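(* Let $\Sigma$ be a sofic approximation to $G$. If $G$-systems $(X,\mu,T)$ and $(Y,\nu,S)$ satisfy $$\mathrm h^{\mathrm{dq}}_\Sigma(\mu,T)=\mathrm h_\Sigma(\mu,T)\quad\text{and}\quad \underline{\mathrm h}_\Sigma(\nu,S)=\mathrm h_\Sigma(\nu,S),$$ or the same with the roles of the two systems exchanged, then $$\mathrm h_\Sigma(\mu\times\nu,T\times S)=\mathrm h_\Sigma(\mu,T)+\mathrm h_\Sigma(\nu,S).$$
   Context: $G$ is a countable discrete sofic group. A sofic approximation $\Sigma=(\sigma_n)_{n\ge1}$ to $G$ is a sequence of nonempty finite sets $V_n$ and maps $\sigma_n:G\to\mathrm{Sym}(V_n)$, $g\mapsto\sigma_n^g$ (not necessarily homomorphisms), such that for all $g,h\in G$ the proportion of $v\in V_n$ with $\sigma_n^g(\sigma_n^h(v))=\sigma_n^{gh}(v)$ tends to $1$, and for all $g\ne e$ the proportion of $v\in V_n$ with $\sigma_n^g(v)\neq v$ tends to $1$. A $G$-system $(X,\mu,T)$ is a standard probability space with a measurable $\mu$-preserving action $T$ of $G$. A metric $G$-process $(\mathcal{X}^G,\mu,S,d)$ consists of a standard measurable space $\mathcal{X}$, a compact metric $d$ on $\mathcal X$ whose Borel $\sigma$-algebra is that of $\mathcal X$, the right-shift action $S^g((x_h)_{h})=(x_{hg})_{h}$, and an $S$-invariant probability measure $\mu$ on $\mathcal{X}^G$. $\mathcal{X}^G$ has the product topology from $d$, and $\mathrm{Prob}(\mathcal X^G)$ the resulting weak$^\ast$ topology.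 For a finite set $V$, a map $\sigma:G\to\mathrm{Sym}(V)$, $\mathbf{x}\in\mathcal{X}^V$, $v\in V$: $\Pi^\sigma_v(\mathbf{x})=(x_{\sigma^g(v)})_{g\in G}\in\mathcal{X}^G$; $P^\sigma_{\mathbf x}=\frac1{|V|}\sum_{v}\delta_{\Pi^\sigma_v(\mathbf x)}$; $\Omega(\mathcal O,\sigma)=\{\mathbf x\in\mathcal X^V: P^\sigma_{\mathbf x}\in\mathcal O\}$ for $\mathcal{O}\subseteq\mathrm{Prob}(\mathcal X^G)$; $d^{(V)}(\mathbf x,\mathbf x')=\frac1{|V|}\sum_v d(x_v,x'_v)$. For a metric space $(Y,d_Y)$, $\mathrm{cov}_\delta(Z,d_Y)$ is the minimum cardinality of a $\delta$-dense subset of $Z\subseteq Y$ (with $\log 0=-\infty$), and for a Borel probability $\nu$ on $Y$, $\mathrm{cov}_{\varepsilon,\delta}(\nu,d_Y)=\min\{|F|: F\subseteq Y,\ \nu(B_\delta(F))>1-\varepsilon\}$, with $B_\delta(F)$ the $\delta$-neighbourhood of $F$. Sofic entropy and lower sofic entropy of a metric $G$-process: $$\mathrm h_\Sigma(\mu)=\sup_{\delta>0}\inf_{\mathcal O}\limsup_{n\to\infty}\tfrac1{|V_n|}\log\mathrm{cov}_\delta(\Omega(\mathcal O,\sigma_n),d^{(V_n)}),$$ and $\underline{\mathrm h}_\Sigma(\mu)$ is defined identically with $\liminf$ in place of $\limsup$; $\mathcal O$ ranges over weak$^\ast$ neighbourhoods of $\mu$. A sequence $\mu_i\in\mathrm{Prob}(\mathcal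 X^{V_{n_i}})$ quenched converges to $\mu$ over $(\sigma_{n_i})_{i\ge1}$ if for every weak$^\ast$ neighbourhood $\mathcal O$ of $\mu$ the proportion of $v\in V_{n_i}$ with $(\Pi^{\sigma_{n_i}}_v)_\ast\mu_i\in\mathcal O$ tends to $1$ and $\mu_i(\Omega(\mathcal O,\sigma_{n_i}))\to1$. It doubly-quenched converges to $\mu$ if $\mu_i\times\mu_i\in\mathrm{Prob}((\mathcal X\times\mathcal X)^{V_{n_i}})$ quenched converges to $\mu\times\mu$ (on $(\mathcal X\times\mathcal X)^G$, with the average of the two copies of $d$). Then $$\mathrm h^{\mathrm{dq}}_\Sigma(\mu)=\sup\Big\{\sup_{\delta,\varepsilon>0}\limsup_{i\to\infty}\tfrac1{|V_{n_i}|}\log\mathrm{cov}_{\varepsilon,\delta}(\mu_i,d^{(V_{n_i})})\Big\},$$ the outer supremum being over all subsequences $n_i\uparrow\infty$ and all sequences $(\mu_i)$ doubly-quenched converging to $\mu$ over $(\sigma_{n_i})_{i\ge1}$ (and $\sup\emptyset=-\infty$). These quantities do not depend on $d$ and are isomorphism invariants of the underlying system. Every $G$-system is isomorphic to a $G$-process (via $x\mapsto(T^hx)_{h\in G}\in X^G$), and the quantities for $(X,\mu,T)$ are defined as those of any isomorphic metric $G$-process. A sum with a term equal to $-\infty$ is interpreted as $-\infty$. *)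

theory Defs
  imports "HOL-Probability.Probability"
begin

section \<open>Standard Borel spaces and G-systems\<close>

(* The group G is a type of class {group_add, countable}.  The class group_add is not
   commutative; the product g h of G is written g + h and its identity 0. *)

definition borel_of :: "'a topology \<Rightarrow> 'a measure" where
  "borel_of \<tau> = sigma (topspace \<tau>) {U. openin \<tau> U}"

definition standard_borel :: "'a measure \<Rightarrow> bool" where
  "standard_borel M \<longleftrightarrow>
     (\<exists>\<tau>. completely_metrizable_space \<tau> \<and> second_countable \<tau> \<and> sets M = sets (borel_of \<tau>))"

definition G_system :: "'a measure \<Rightarrow> ('g::{group_add,countable} \<Rightarrow> 'a \<Rightarrow> 'a) \<Rightarrow> bool" where
  "G_system M T \<longleftrightarrow>
     prob_space M \<and> standard_borel M \<and>
     (\<forall>g. T g \<in> measurable M M \<and> distr M M (T g) = M) \<and>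
     (\<forall>x\<in>space M. T 0 x = x) \<and>
     (\<forall>g h. \<forall>x\<in>space M. T (g + h) x = T g (T h x))"

definition product_action ::
    "('g \<Rightarrow> 'a \<Rightarrow> 'a) \<Rightarrow> ('g \<Rightarrow> 'b \<Rightarrow> 'b) \<Rightarrow> 'g \<Rightarrow> 'a \<times> 'b \<Rightarrow> 'a \<times> 'b" where
  "product_action T S g = map_prod (T g) (S g)"

definition isomorphic_systems ::
    "'a measure \<Rightarrow> ('g \<Rightarrow> 'a \<Rightarrow> 'a) \<Rightarrow> 'b measure \<Rightarrow> ('g \<Rightarrow> 'b \<Rightarrow> 'b) \<Rightarrow> bool" where
  "isomorphic_systems M T N S \<longleftrightarrow>
     (\<exists>\<phi> \<psi>. \<phi> \<in> measurable M N \<and> \<psi> \<in> measurable N M \<and>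
        distr M N \<phi> = N \<and> distr N M \<psi> = M \<and>
        (AE x in M. \<psi> (\<phi> x) = x) \<and> (AE y in N. \<phi> (\<psi> y) = y) \<and>
        (\<forall>g. AE x in M. \<phi> (T g x) = S g (\<phi> x)))"


section \<open>Metric processes\<close>

(* An alphabet is a carrier X with a metric d.  Its measurable structure is the Borel
   sigma-algebra of d, so it is standard as soon as d is compact. *)

abbreviation metric_top :: "'a set \<Rightarrow> ('a \<Rightarrow> 'a \<Rightarrow> real) \<Rightarrow> 'a topology" where
  "metric_top X d \<equiv> Metric_space.mtopology X d"

definition config_algebra ::
    "'i set \<Rightarrow> 'a set \<Rightarrow> ('a \<Rightarrow> 'a \<Rightarrow> real) \<Rightarrow> ('i \<Rightarrow> 'a) measure" where
  "config_algebra I X d = PiM I (\<lambda>_. borel_of (metric_top X d))"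

definition Prob ::
    "'i set \<Rightarrow> 'a set \<Rightarrow> ('a \<Rightarrow> 'a \<Rightarrow> real) \<Rightarrow> ('i \<Rightarrow> 'a) measure set" where
  "Prob I X d = {m. prob_space m \<and> sets m = sets (config_algebra I X d)}"

definition shift :: "'g::group_add \<Rightarrow> ('g \<Rightarrow> 'a) \<Rightarrow> ('g \<Rightarrow> 'a)" where
  "shift g x = (\<lambda>h. x (h + g))"

definition metric_process ::
    "'a set \<Rightarrow> ('a \<Rightarrow> 'a \<Rightarrow> real) \<Rightarrow> ('g::{group_add,countable} \<Rightarrow> 'a) measure \<Rightarrow> bool" where
  "metric_process X d \<mu> \<longleftrightarrow>
     Metric_space X d \<and> compact_space (metric_top X d) \<and>
     \<mu> \<in> Prob UNIV X d \<and> (\<forall>g. distr \<mu> \<mu> (shift g) = \<mu>)"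

definition weak_star ::
    "'a set \<Rightarrow> ('a \<Rightarrow> 'a \<Rightarrow> real) \<Rightarrow> ('g \<Rightarrow> 'a) measure topology" where
  "weak_star X d = topology_generated_by
     {{m \<in> Prob UNIV X d. (\<integral>x. f x \<partial>m) \<in> U} | f U.
        continuous_map (product_topology (\<lambda>_. metric_top X d) UNIV) euclideanreal f \<and> open U}"

(* Open neighbourhoods suffice, as they form a base; they keep the events Omega(O, sigma)
   below measurable. *)
definition nbhds ::
    "'a set \<Rightarrow> ('a \<Rightarrow> 'a \<Rightarrow> real) \<Rightarrow> ('g \<Rightarrow> 'a) measure \<Rightarrow> ('g \<Rightarrow> 'a) measure set set" where
  "nbhds X d \<mu> = {\<O>. openin (weak_star X d) \<O> \<and> \<mu> \<in> \<O>}"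


section \<open>Sofic approximations and model spaces\<close>

definition sofic_approximation ::
    "(nat \<Rightarrow> 'v set) \<Rightarrow> (nat \<Rightarrow> 'g::{group_add,countable} \<Rightarrow> 'v \<Rightarrow> 'v) \<Rightarrow> bool" where
  "sofic_approximation V \<sigma> \<longleftrightarrow>
     (\<forall>n. finite (V n) \<and> V n \<noteq> {}) \<and>
     (\<forall>n g. bij_betw (\<sigma> n g) (V n) (V n)) \<and>
     (\<forall>g h. (\<lambda>n. real (card {v \<in> V n. \<sigma> n g (\<sigma> n h v) = \<sigma> n (g + h) v}) / real (card (V n)))
              \<longlonglongrightarrow> 1) \<and>
     (\<forall>g. g \<noteq> 0 \<longrightarrow>
        (\<lambda>n. real (card {v \<in> V n. \<sigma> n g v \<noteq> v}) / real (card (V n))) \<longlonglongrightarrow> 1)"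

definition pullback_name :: "('g \<Rightarrow> 'v \<Rightarrow> 'v) \<Rightarrow> 'v \<Rightarrow> ('v \<Rightarrow> 'a) \<Rightarrow> ('g \<Rightarrow> 'a)" where
  "pullback_name s v x = (\<lambda>g. x (s g v))"

(* The image of the uniform distribution on V under v \<mapsto> \<Pi>_v(x), i.e. the
   average of the point masses at the \<Pi>_v(x). *)
definition empirical_dist ::
    "'a set \<Rightarrow> ('a \<Rightarrow> 'a \<Rightarrow> real) \<Rightarrow> 'v set \<Rightarrow> ('g \<Rightarrow> 'v \<Rightarrow> 'v) \<Rightarrow> ('v \<Rightarrow> 'a)
      \<Rightarrow> ('g \<Rightarrow> 'a) measure" where
  "empirical_dist X d V s x =
     distr (uniform_count_measure V) (config_algebra UNIV X d) (\<lambda>v. pullback_name s v x)"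

definition good_models ::
    "'a set \<Rightarrow> ('a \<Rightarrow> 'a \<Rightarrow> real) \<Rightarrow> 'v set \<Rightarrow> ('g \<Rightarrow> 'v \<Rightarrow> 'v) \<Rightarrow> ('g \<Rightarrow> 'a) measure set
      \<Rightarrow> ('v \<Rightarrow> 'a) set" where
  "good_models X d V s \<O> = {x \<in> PiE V (\<lambda>_. X). empirical_dist X d V s x \<in> \<O>}"

definition hamming_dist ::
    "'v set \<Rightarrow> ('a \<Rightarrow> 'a \<Rightarrow> real) \<Rightarrow> ('v \<Rightarrow> 'a) \<Rightarrow> ('v \<Rightarrow> 'a) \<Rightarrow> real" where
  "hamming_dist V d x x' = (\<Sum>v\<in>V. d (x v) (x' v)) / real (card V)"


section \<open>Covering numbers\<close>

(* Both minima are over finite sets.  They are attained in every use below: the spaces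
   (PiE V X, hamming_dist V d) are compact, the measures are probabilities and \<epsilon> > 0. *)

definition cov :: "real \<Rightarrow> 'y set \<Rightarrow> ('y \<Rightarrow> 'y \<Rightarrow> real) \<Rightarrow> nat" where
  "cov \<delta> Z dY =
     (LEAST k. \<exists>F. finite F \<and> card F = k \<and> F \<subseteq> Z \<and> (\<forall>z\<in>Z. \<exists>y\<in>F. dY z y < \<delta>))"

definition cov_measure :: "real \<Rightarrow> real \<Rightarrow> 'y measure \<Rightarrow> ('y \<Rightarrow> 'y \<Rightarrow> real) \<Rightarrow> nat" where
  "cov_measure \<epsilon> \<delta> \<nu> dY =
     (LEAST k. \<exists>F. finite F \<and> card F = k \<and> F \<subseteq> space \<nu> \<and>
        measure \<nu> {z \<in> space \<nu>. \<exists>y\<in>F. dY z y < \<delta>} > 1 - \<epsilon>)"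

definition log_card :: "nat \<Rightarrow> ereal" where
  "log_card k = (if k = 0 then -\<infinity> else ereal (ln (real k)))"


section \<open>Sofic entropies of metric processes\<close>

definition process_sofic_entropy ::
    "(nat \<Rightarrow> 'v set) \<Rightarrow> (nat \<Rightarrow> 'g \<Rightarrow> 'v \<Rightarrow> 'v) \<Rightarrow> 'a set \<Rightarrow> ('a \<Rightarrow> 'a \<Rightarrow> real)
      \<Rightarrow> ('g \<Rightarrow> 'a) measure \<Rightarrow> ereal" where
  "process_sofic_entropy V \<sigma> X d \<mu> =
     (SUP \<delta>\<in>{0<..}. INF \<O>\<in>nbhds X d \<mu>.
        limsup (\<lambda>n. log_card (cov \<delta> (good_models X d (V n) (\<sigma> n) \<O>) (hamming_dist (V n) d))
                     / ereal (real (card (V n)))))"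

definition process_lower_sofic_entropy ::
    "(nat \<Rightarrow> 'v set) \<Rightarrow> (nat \<Rightarrow> 'g \<Rightarrow> 'v \<Rightarrow> 'v) \<Rightarrow> 'a set \<Rightarrow> ('a \<Rightarrow> 'a \<Rightarrow> real)
      \<Rightarrow> ('g \<Rightarrow> 'a) measure \<Rightarrow> ereal" where
  "process_lower_sofic_entropy V \<sigma> X d \<mu> =
     (SUP \<delta>\<in>{0<..}. INF \<O>\<in>nbhds X d \<mu>.
        liminf (\<lambda>n. log_card (cov \<delta> (good_models X d (V n) (\<sigma> n) \<O>) (hamming_dist (V n) d))
                     / ereal (real (card (V n)))))"

definition quenched_converges ::
    "(nat \<Rightarrow> 'v set) \<Rightarrow> (nat \<Rightarrow> 'g \<Rightarrow> 'v \<Rightarrow> 'v) \<Rightarrow> 'a set \<Rightarrow> ('a \<Rightarrow> 'a \<Rightarrow> real)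
      \<Rightarrow> (nat \<Rightarrow> ('v \<Rightarrow> 'a) measure) \<Rightarrow> ('g \<Rightarrow> 'a) measure \<Rightarrow> bool" where
  "quenched_converges V \<sigma> X d m \<mu> \<longleftrightarrow>
     (\<forall>i. m i \<in> Prob (V i) X d) \<and>
     (\<forall>\<O>\<in>nbhds X d \<mu>.
        (\<lambda>i. real (card {v \<in> V i.
                distr (m i) (config_algebra UNIV X d) (pullback_name (\<sigma> i) v) \<in> \<O>})
              / real (card (V i))) \<longlonglongrightarrow> 1 \<and>
        (\<lambda>i. measure (m i) (good_models X d (V i) (\<sigma> i) \<O>)) \<longlonglongrightarrow> 1)"

definition pair_dist :: "('a \<Rightarrow> 'a \<Rightarrow> real) \<Rightarrow> 'a \<times> 'a \<Rightarrow> 'a \<times> 'a \<Rightarrow> real" where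
  "pair_dist d p q = (d (fst p) (fst q) + d (snd p) (snd q)) / 2"

(* The product m \<times> m, transported along X^I \<times> X^I = (X \<times> X)^I. *)
definition square_measure ::
    "'i set \<Rightarrow> 'a set \<Rightarrow> ('a \<Rightarrow> 'a \<Rightarrow> real) \<Rightarrow> ('i \<Rightarrow> 'a) measure \<Rightarrow> ('i \<Rightarrow> 'a \<times> 'a) measure" where
  "square_measure I X d m =
     distr (m \<Otimes>\<^sub>M m) (config_algebra I (X \<times> X) (pair_dist d)) (\<lambda>(x, y). \<lambda>i\<in>I. (x i, y i))"

definition doubly_quenched_converges ::
    "(nat \<Rightarrow> 'v set) \<Rightarrow> (nat \<Rightarrow> 'g \<Rightarrow> 'v \<Rightarrow> 'v) \<Rightarrow> 'a set \<Rightarrow> ('a \<Rightarrow> 'a \<Rightarrow> real)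
      \<Rightarrow> (nat \<Rightarrow> ('v \<Rightarrow> 'a) measure) \<Rightarrow> ('g \<Rightarrow> 'a) measure \<Rightarrow> bool" where
  "doubly_quenched_converges V \<sigma> X d m \<mu> \<longleftrightarrow>
     (\<forall>i. m i \<in> Prob (V i) X d) \<and>
     quenched_converges V \<sigma> (X \<times> X) (pair_dist d)
       (\<lambda>i. square_measure (V i) X d (m i)) (square_measure UNIV X d \<mu>)"

definition process_dq_entropy ::
    "(nat \<Rightarrow> 'v set) \<Rightarrow> (nat \<Rightarrow> 'g \<Rightarrow> 'v \<Rightarrow> 'v) \<Rightarrow> 'a set \<Rightarrow> ('a \<Rightarrow> 'a \<Rightarrow> real)
      \<Rightarrow> ('g \<Rightarrow> 'a) measure \<Rightarrow> ereal" where
  "process_dq_entropy V \<sigma> X d \<mu> =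
     (SUP (r, m) \<in> {(r, m). strict_mono r \<and>
                       doubly_quenched_converges (V \<circ> r) (\<sigma> \<circ> r) X d m \<mu>}.
      SUP (\<delta>, \<epsilon>) \<in> {0<..} \<times> {0<..}.
        limsup (\<lambda>i. log_card (cov_measure \<epsilon> \<delta> (m i) (hamming_dist (V (r i)) d))
                     / ereal (real (card (V (r i))))))"


section \<open>Sofic entropies of G-systems\<close>

(* Every G-system (X, \<mu>, T) is isomorphic to a metric process with alphabet X, via
   x \<mapsto> (T^h x)_h and any compact metric on X generating its sigma-algebra, and the
   entropies are isomorphism invariant.  So an arbitrary isomorphic process may be chosen,
   and nothing is lost by taking its alphabet inside the type of X. *)
definition process_of ::
    "'a measure \<Rightarrow> ('g::{group_add,countable} \<Rightarrow> 'a \<Rightarrow> 'a)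
      \<Rightarrow> 'a set \<times> ('a \<Rightarrow> 'a \<Rightarrow> real) \<times> ('g \<Rightarrow> 'a) measure" where
  "process_of M T =
     (SOME (X, d, \<mu>). metric_process X d \<mu> \<and> isomorphic_systems M T \<mu> shift)"

definition sofic_entropy ::
    "(nat \<Rightarrow> 'v set) \<Rightarrow> (nat \<Rightarrow> 'g::{group_add,countable} \<Rightarrow> 'v \<Rightarrow> 'v)
      \<Rightarrow> 'a measure \<Rightarrow> ('g \<Rightarrow> 'a \<Rightarrow> 'a) \<Rightarrow> ereal" where
  "sofic_entropy V \<sigma> M T = (case process_of M T of (X, d, \<mu>) \<Rightarrow> process_sofic_entropy V \<sigma> X d \<mu>)"

definition lower_sofic_entropy ::
    "(nat \<Rightarrow> 'v set) \<Rightarrow> (nat \<Rightarrow> 'g::{group_add,countable} \<Rightarrow> 'v \<Rightarrow> 'v)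
      \<Rightarrow> 'a measure \<Rightarrow> ('g \<Rightarrow> 'a \<Rightarrow> 'a) \<Rightarrow> ereal" where
  "lower_sofic_entropy V \<sigma> M T =
     (case process_of M T of (X, d, \<mu>) \<Rightarrow> process_lower_sofic_entropy V \<sigma> X d \<mu>)"

definition dq_entropy ::
    "(nat \<Rightarrow> 'v set) \<Rightarrow> (nat \<Rightarrow> 'g::{group_add,countable} \<Rightarrow> 'v \<Rightarrow> 'v)
      \<Rightarrow> 'a measure \<Rightarrow> ('g \<Rightarrow> 'a \<Rightarrow> 'a) \<Rightarrow> ereal" where
  "dq_entropy V \<sigma> M T = (case process_of M T of (X, d, \<mu>) \<Rightarrow> process_dq_entropy V \<sigma> X d \<mu>)"

(* In type ereal, -\<infinity> + \<infinity> = \<infinity>. *)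
definition entropy_sum :: "ereal \<Rightarrow> ereal \<Rightarrow> ereal" where
  "entropy_sum a b = (if a = -\<infinity> \<or> b = -\<infinity> then -\<infinity> else a + b)"

end

theory Submission
  imports Defs
begin

text \<open>Both sides of the identity concern processes picked by an arbitrary choice: \<open>process_of\<close> selects some
metric process isomorphic to the given system. Once such processes are known to exist
(\<open>process_exists\<close>) and sofic entropy is known to agree on isomorphic ones
(\<open>sofic_entropy_isomorphism_invariant\<close>), the process chosen for the product system may be replaced by the
product of the two processes chosen for the factors, and additivity becomes a statement about that one
product process (\<open>product_process_additive\<close>). Invariance is applied to the product system; the doubly
quenched and the lower entropy are evaluated on the very processes that were chosen.

\<^bold>\<open>Upper bound.\<close> The coordinates of a good model of the product process are good models of the factors, so a
cover for each factor gives a cover for the product whose size is the product of the two sizes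
(\<open>sofic_entropy_subadditive\<close>).

\<^bold>\<open>Lower bound.\<close> A pair of good models need not be a good model of the product process, because the two
may be correlated. Doubly quenched convergence prevents this. Let \<open>m\<close> be a measure on models from a doubly
quenched convergent sequence, let \<open>f\<close> be a test function with mean zero for \<open>\<mu>\<close>, and write \<open>f_v(x)\<close> for the
value of \<open>f\<close> at the name that the model \<open>x\<close> shows at \<open>v\<close>. The average of \<open>f_v(x) f_v(x')\<close> over \<open>v\<close> is small
for most pairs \<open>(x, x')\<close> under \<open>m \<times> m\<close>, and its second moment is exactly the average over \<open>(v, w)\<close> of
\<open>c(v, w)\<^sup>2\<close>, where \<open>c(v, w)\<close> is the expectation of \<open>f_v f_w\<close> under \<open>m\<close>. Hence most correlations \<open>c(v, w)\<close> are
small, and so, for \<^emph>\<open>every\<close> bounded choice of weights \<open>g_v\<close>, the average of \<open>g_v f_v(x)\<close> over \<open>v\<close> is small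
for \<open>m\<close>-most \<open>x\<close>, with estimates that depend only on the bound for the weights
(\<open>weighted_average_small\<close>, \<open>doubly_quenched_decorrelates\<close>). The values \<open>u_v(y)\<close> of a test function at a model
\<open>y\<close> of the second process are such weights. Therefore, for every good \<open>y\<close>, most \<open>x\<close> make the pair
\<open>(x, y)\<close> a good model of the product (\<open>doubly_quenched_pairs\<close>). Counting such pairs above a separated set of
models \<open>y\<close> shows that covering numbers are supermultiplicative (\<open>cov_product_lower\<close>). The measures \<open>m\<close> live
along a subsequence on which the upper entropy of the second process need not be attained; this is why the
lower entropy occurs, and \<open>sofic_entropy_superadditive\<close> follows.

\<^bold>\<open>Invariance.\<close> An isomorphism between processes is only measurable. Its zeroth coordinate is approximated
in the mean by finitely many continuous functions, and these turn a good model of one process into a good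
model of the other, symbol by symbol (\<open>model_lifting\<close>). Since the inverse map is approximated in the same
way, models with close images are themselves close, which compares the covering numbers
(\<open>sofic_entropy_le_of_embedding\<close>).

\<^bold>\<open>Existence.\<close> A probability measure on a Polish space is carried, up to a null set, by countably many
disjoint compact sets. Shrunk towards a common point, these form a compact metric space
with the same Borel sets, which serves as the alphabet.

All continuity arguments are reduced to one concrete algebra of functions on configurations,
\<open>dist_algebra\<close>, which is dense by Stone-Weierstrass (\<open>tests_approx\<close>).\<close>

section \<open>Compact metric alphabets\<close>

definition compact_metric :: "'a set \<Rightarrow> ('a \<Rightarrow> 'a \<Rightarrow> real) \<Rightarrow> bool" where
  "compact_metric X d \<longleftrightarrow> Metric_space X d \<and> compact_space (metric_top X d)"

abbreviation configs :: "'a set \<Rightarrow> ('a \<Rightarrow> 'a \<Rightarrow> real) \<Rightarrow> ('g \<Rightarrow> 'a) topology" where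
  "configs X d \<equiv> product_topology (\<lambda>_. metric_top X d) UNIV"

lemma compact_metric_space: "compact_metric X d \<Longrightarrow> Metric_space X d"
  by (simp add: compact_metric_def)

lemma compact_metric_nonneg: "compact_metric X d \<Longrightarrow> 0 \<le> d x y"
  by (meson Metric_space.nonneg compact_metric_space)

lemma compact_metric_commute: "compact_metric X d \<Longrightarrow> d x y = d y x"
  by (meson Metric_space.commute compact_metric_space)

lemma compact_metric_triangle:
  "compact_metric X d \<Longrightarrow> x \<in> X \<Longrightarrow> y \<in> X \<Longrightarrow> z \<in> X \<Longrightarrow> d x z \<le> d x y + d y z"
  by (meson Metric_space.triangle compact_metric_space)

lemma compact_metric_zero: "compact_metric X d \<Longrightarrow> x \<in> X \<Longrightarrow> y \<in> X \<Longrightarrow> d x y = 0 \<longleftrightarrow> x = y"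
  by (meson Metric_space.zero compact_metric_space)

lemma compact_metric_abs_diff:
  assumes "compact_metric X d" "x \<in> X" "y \<in> X" "q \<in> X"
  shows "\<bar>d x q - d y q\<bar> \<le> d x y"
  using compact_metric_triangle[OF assms(1), of x y q] compact_metric_triangle[OF assms(1), of y x q]
    compact_metric_commute[OF assms(1), of x y] assms by linarith

lemma topspace_metric_top: "Metric_space X d \<Longrightarrow> topspace (metric_top X d) = X"
  by (rule Metric_space.topspace_mtopology)

lemma space_borel_of [simp]: "space (borel_of \<tau>) = topspace \<tau>"
  by (simp add: borel_of_def space_measure_of_conv)

lemma sets_borel_of: "sets (borel_of \<tau>) = sigma_sets (topspace \<tau>) {U. openin \<tau> U}"
  unfolding borel_of_def by (rule sets_measure_of) (auto dest: openin_subset)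

lemma openin_borel_of: "openin \<tau> U \<Longrightarrow> U \<in> sets (borel_of \<tau>)"
  by (auto simp: sets_borel_of)

lemma closedin_borel_of: "closedin \<tau> U \<Longrightarrow> U \<in> sets (borel_of \<tau>)"
proof -
  assume "closedin \<tau> U"
  then have "topspace \<tau> - (topspace \<tau> - U) = U" "topspace \<tau> - U \<in> sets (borel_of \<tau>)"
    by (auto simp: closedin_def intro!: openin_borel_of)
  then show ?thesis
    by (metis sets.compl_sets space_borel_of)
qed

lemma measurable_borel_of_I:
  assumes "f \<in> space M \<rightarrow> topspace \<tau>" "\<And>U. openin \<tau> U \<Longrightarrow> f -` U \<inter> space M \<in> sets M"
  shows "f \<in> measurable M (borel_of \<tau>)"
  unfolding borel_of_def using assms
  by (intro measurable_measure_of) (auto dest: openin_subset)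

lemma space_config: "Metric_space X d \<Longrightarrow> space (config_algebra I X d) = PiE I (\<lambda>_. X)"
  by (simp add: config_algebra_def space_PiM topspace_metric_top)

lemma finite_net:
  assumes "compact_metric X d" "0 < e"
  obtains F where "finite F" "F \<subseteq> X" "\<And>x. x \<in> X \<Longrightarrow> \<exists>q\<in>F. d x q < e"
proof -
  interpret Metric_space X d using assms compact_metric_space by blast
  have "mtotally_bounded X"
    using assms compact_space_eq_mcomplete_mtotally_bounded by (auto simp: compact_metric_def)
  then obtain K where K: "finite K" "K \<subseteq> X" "X \<subseteq> (\<Union>x\<in>K. mball x e)"
    using assms(2) unfolding mtotally_bounded_def by meson
  show thesis
  proof
    fix x assume "x \<in> X"
    then obtain q where "q \<in> K" "x \<in> mball q e" using K(3) by auto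
    then have "d x q < e" using commute[of x q] by simp
    then show "\<exists>q\<in>K. d x q < e" using \<open>q \<in> K\<close> by blast
  qed (fact K(1) K(2))+
qed

lemma countable_dense:
  assumes "compact_metric X d"
  obtains Q where "countable Q" "Q \<subseteq> X" "\<And>x e. x \<in> X \<Longrightarrow> 0 < e \<Longrightarrow> \<exists>q\<in>Q. d x q < e"
proof -
  have "\<forall>n. \<exists>F. finite F \<and> F \<subseteq> X \<and> (\<forall>x\<in>X. \<exists>q\<in>F. d x q < 1 / real (Suc n))"
  proof
    fix n
    have "(0::real) < 1 / real (Suc n)" by simp
    then show "\<exists>F. finite F \<and> F \<subseteq> X \<and> (\<forall>x\<in>X. \<exists>q\<in>F. d x q < 1 / real (Suc n))"
      using finite_net[OF assms] by metis
  qed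
  then obtain F where F: "\<And>n. finite (F n)" "\<And>n. F n \<subseteq> X"
    "\<And>n x. x \<in> X \<Longrightarrow> \<exists>q\<in>F n. d x q < 1 / real (Suc n)"
    by metis
  show thesis
  proof
    show "countable (\<Union>n. F n)" using F(1) by (simp add: countable_finite)
    show "(\<Union>n. F n) \<subseteq> X" using F(2) by auto
    fix x e assume "x \<in> X" "(0::real) < e"
    then obtain n where "1 / real (Suc n) < e" using nat_approx_posE by metis
    then show "\<exists>q\<in>(\<Union>n. F n). d x q < e" using F(3)[OF \<open>x \<in> X\<close>, of n] by force
  qed
qed

lemma bounded_metric:
  assumes "compact_metric X d"
  obtains C where "0 < C" "\<And>x y. x \<in> X \<Longrightarrow> y \<in> X \<Longrightarrow> d x y \<le> C"
proof -
  obtain F where F: "finite F" "F \<subseteq> X" "\<And>x. x \<in> X \<Longrightarrow> \<exists>q\<in>F. d x q < 1"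
    using finite_net[OF assms, of 1] by auto
  define B where "B = (\<Sum>p\<in>F. \<Sum>q\<in>F. d p q)"
  have nn: "0 \<le> d x y" for x y by (rule compact_metric_nonneg[OF assms])
  have B: "d p q \<le> B" if "p \<in> F" "q \<in> F" for p q
  proof -
    have "d p q \<le> (\<Sum>q\<in>F. d p q)" by (rule member_le_sum) (use that F nn in auto)
    also have "\<dots> \<le> B" unfolding B_def by (rule member_le_sum) (use that F nn in \<open>auto intro: sum_nonneg\<close>)
    finally show ?thesis .
  qed
  show thesis
  proof
    show "0 < B + 2" unfolding B_def using nn by (simp add: sum_nonneg add_nonneg_pos)
    fix x y assume xy: "x \<in> X" "y \<in> X"
    obtain p q where pq: "p \<in> F" "d x p < 1" "q \<in> F" "d y q < 1" using F(3) xy by meson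
    have "d x y \<le> d x p + d p y" "d p y \<le> d p q + d q y"
      using compact_metric_triangle[OF assms] xy pq F(2) by blast+
    then show "d x y \<le> B + 2"
      using B[OF pq(1,3)] pq(2,4) compact_metric_commute[OF assms, of q y] by linarith
  qed
qed

text \<open>Every open set is a countable union of balls with centres in a countable dense set, so measurability of the
distances to fixed points is enough. This avoids identifying Borel algebras of products or of glued spaces.\<close>

lemma measurable_into_metric:
  assumes cm: "compact_metric X d" and f: "f \<in> space M \<rightarrow> X"
    and meas: "\<And>q. q \<in> X \<Longrightarrow> (\<lambda>w. d (f w) q) \<in> borel_measurable M"
  shows "f \<in> measurable M (borel_of (metric_top X d))"
proof (rule measurable_borel_of_I)
  interpret Metric_space X d using cm compact_metric_space by blast
  show "f \<in> space M \<rightarrow> topspace mtopology" using f by simp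
  fix U assume U: "openin mtopology U"
  obtain Q where Q: "countable Q" "Q \<subseteq> X" "\<And>x e. x \<in> X \<Longrightarrow> 0 < e \<Longrightarrow> \<exists>q\<in>Q. d x q < e"
    using countable_dense[OF cm] by blast
  define J where "J = {(q, n). q \<in> Q \<and> mball q (1 / real (Suc n)) \<subseteq> U}"
  have "U = (\<Union>(q,n)\<in>J. mball q (1 / real (Suc n)))"
  proof
    show "U \<subseteq> (\<Union>(q,n)\<in>J. mball q (1 / real (Suc n)))"
    proof
      fix x assume x: "x \<in> U"
      then have xX: "x \<in> X" using U by (auto simp: openin_mtopology)
      obtain r where r: "0 < r" "mball x r \<subseteq> U" using U x by (auto simp: openin_mtopology)
      obtain n where n: "1 / real (Suc n) < r / 2" using nat_approx_posE[of "r/2"] r by auto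
      obtain q where q: "q \<in> Q" "d x q < 1 / real (Suc n)" using Q(3)[OF xX, of "1 / real (Suc n)"] by auto
      have qX: "q \<in> X" using q Q by auto
      have "mball q (1 / real (Suc n)) \<subseteq> mball x r"
      proof
        fix z assume z: "z \<in> mball q (1 / real (Suc n))"
        then have "d x z \<le> d x q + d q z" using triangle xX qX by auto
        then show "z \<in> mball x r" using z q n xX by auto
      qed
      then have "(q, n) \<in> J" using r q by (auto simp: J_def)
      moreover have "x \<in> mball q (1 / real (Suc n))" using q qX xX commute by auto
      ultimately show "x \<in> (\<Union>(q,n)\<in>J. mball q (1 / real (Suc n)))" by blast
    qed
  qed (auto simp: J_def)
  then have Ueq: "x \<in> U \<longleftrightarrow> (\<exists>(q,n)\<in>J. x \<in> mball q (1 / real (Suc n)))" for x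
    by blast
  have "f -` U \<inter> space M = (\<Union>(q,n)\<in>J. {w\<in>space M. d (f w) q < 1 / real (Suc n)})"
  proof (intro set_eqI)
    fix w
    show "w \<in> f -` U \<inter> space M \<longleftrightarrow> w \<in> (\<Union>(q,n)\<in>J. {w\<in>space M. d (f w) q < 1 / real (Suc n)})"
      using Ueq[of "f w"] f Q(2) by (auto simp: J_def commute[of "f w"])
  qed
  moreover have "countable J"
    by (rule countable_subset[of _ "Q \<times> UNIV"]) (use Q in \<open>auto simp: J_def\<close>)
  moreover have "{w\<in>space M. d (f w) q < 1 / real (Suc n)} \<in> sets M" if "(q,n) \<in> J" for q n
  proof -
    have [measurable]: "(\<lambda>w. d (f w) q) \<in> borel_measurable M" using that Q meas by (auto simp: J_def)
    show ?thesis by measurable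
  qed
  ultimately show "f -` U \<inter> space M \<in> sets M"
    by (auto intro!: sets.countable_UN')
qed

lemma continuous_map_lipschitz:
  assumes m: "Metric_space X d"
    and L: "\<And>x y. x \<in> X \<Longrightarrow> y \<in> X \<Longrightarrow> \<bar>f x - f y\<bar> \<le> L * d x y"
  shows "continuous_map (metric_top X d) euclideanreal f"
proof -
  interpret Metric_space X d by (rule m)
  have "continuous_map mtopology Met_TC.mtopology f"
    unfolding metric_continuous_map[OF Met_TC.Metric_space_axioms]
  proof (intro conjI ballI allI impI)
    fix a and \<epsilon> :: real assume a: "a \<in> X" and e: "0 < \<epsilon>"
    show "\<exists>\<delta>>0. \<forall>x. x \<in> X \<and> d a x < \<delta> \<longrightarrow> dist (f a) (f x) < \<epsilon>"
    proof (intro exI[of _ "\<epsilon> / (\<bar>L\<bar> + 1)"] conjI allI impI)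
      show "0 < \<epsilon> / (\<bar>L\<bar> + 1)" using e by simp
      fix x assume x: "x \<in> X \<and> d a x < \<epsilon> / (\<bar>L\<bar> + 1)"
      have "\<bar>f a - f x\<bar> \<le> L * d a x" using L a x by auto
      also have "\<dots> \<le> (\<bar>L\<bar> + 1) * d a x" by (intro mult_right_mono) auto
      also have "\<dots> < \<epsilon>" using x by (simp add: pos_less_divide_eq mult.commute)
      finally show "dist (f a) (f x) < \<epsilon>" by (simp add: dist_real_def)
    qed
  qed auto
  then show ?thesis by simp
qed

lemma continuous_map_dist:
  assumes "compact_metric X d" "q \<in> X"
  shows "continuous_map (metric_top X d) euclideanreal (\<lambda>x. d x q)"
proof (rule continuous_map_lipschitz[where L = 1])
  show "Metric_space X d" by (rule compact_metric_space[OF assms(1)])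
  fix x y assume "x \<in> X" "y \<in> X"
  then show "\<bar>d x q - d y q\<bar> \<le> 1 * d x y"
    using compact_metric_abs_diff[OF assms(1) _ _ assms(2), of x y] by simp
qed

lemma topspace_configs: "Metric_space X d \<Longrightarrow> topspace (configs X d :: ('g \<Rightarrow> 'a) topology) = {x. \<forall>g. x g \<in> X}"
  by (simp add: topspace_metric_top PiE_def Pi_def extensional_def)

lemma space_config_UNIV:
  "Metric_space X d \<Longrightarrow> space (config_algebra UNIV X d :: ('g \<Rightarrow> 'a) measure) = {x. \<forall>g. x g \<in> X}"
  by (simp add: space_config PiE_def Pi_def extensional_def)

section \<open>The algebra generated by the distance functions\<close>

text \<open>The functions obtained from coordinate distances by ring operations. Working with them in place of
arbitrary continuous functions gives measurability, boundedness and a Lipschitz bound in finitely many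
coordinates by induction, and lets one function be substituted into another.\<close>

inductive_set dist_algebra :: "'a set \<Rightarrow> ('a \<Rightarrow> 'a \<Rightarrow> real) \<Rightarrow> (('g \<Rightarrow> 'a) \<Rightarrow> real) set"
  for X :: "'a set" and d :: "'a \<Rightarrow> 'a \<Rightarrow> real" where
  const: "(\<lambda>_. c) \<in> dist_algebra X d"
| coord: "q \<in> X \<Longrightarrow> (\<lambda>x. d (x g) q) \<in> dist_algebra X d"
| add: "f \<in> dist_algebra X d \<Longrightarrow> h \<in> dist_algebra X d \<Longrightarrow> (\<lambda>x. f x + h x) \<in> dist_algebra X d"
| mult: "f \<in> dist_algebra X d \<Longrightarrow> h \<in> dist_algebra X d \<Longrightarrow> (\<lambda>x. f x * h x) \<in> dist_algebra X d"

abbreviation tests :: "'a set \<Rightarrow> ('a \<Rightarrow> 'a \<Rightarrow> real) \<Rightarrow> (('g \<Rightarrow> 'a) \<Rightarrow> real) set" where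
  "tests X d \<equiv> {f. continuous_map (configs X d) euclideanreal f}"

lemma dist_algebra_tests:
  assumes "compact_metric X d" "f \<in> dist_algebra X d"
  shows "f \<in> tests X d"
  using assms(2)
proof induction
  case (coord q g)
  show ?case
    using continuous_map_compose[OF continuous_map_product_projection[OF UNIV_I, of "\<lambda>_. metric_top X d" g]
        continuous_map_dist[OF assms(1) coord]]
    by (simp add: o_def)
qed (auto intro: continuous_intros)

lemma dist_algebra_bounded:
  assumes "compact_metric X d" "f \<in> dist_algebra X d"
  obtains B where "0 < B" "\<And>x. (\<And>g. x g \<in> X) \<Longrightarrow> \<bar>f x\<bar> \<le> B"
proof -
  have "\<exists>B>0. \<forall>x. (\<forall>g. x g \<in> X) \<longrightarrow> \<bar>f x\<bar> \<le> B"
    using assms(2)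
  proof induction
    case (const c)
    show ?case by (intro exI[of _ "\<bar>c\<bar> + 1"]) auto
  next
    case (coord q g)
    obtain C where "0 < C" "\<And>x y. x \<in> X \<Longrightarrow> y \<in> X \<Longrightarrow> d x y \<le> C"
      using bounded_metric[OF assms(1)] by blast
    then show ?case using coord compact_metric_nonneg[OF assms(1)] by (intro exI[of _ C]) auto
  next
    case (add f h)
    then obtain B C where "0 < B" "0 < C" "\<forall>x. (\<forall>g. x g \<in> X) \<longrightarrow> \<bar>f x\<bar> \<le> B" "\<forall>x. (\<forall>g. x g \<in> X) \<longrightarrow> \<bar>h x\<bar> \<le> C"
      by blast
    then show ?case by (intro exI[of _ "B + C"]) (smt (verit))
  next
    case (mult f h)
    then obtain B C where "0 < B" "0 < C" "\<forall>x. (\<forall>g. x g \<in> X) \<longrightarrow> \<bar>f x\<bar> \<le> B" "\<forall>x. (\<forall>g. x g \<in> X) \<longrightarrow> \<bar>h x\<bar> \<le> C"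
      by blast
    then show ?case by (intro exI[of _ "B * C"]) (auto simp: abs_mult intro!: mult_mono)
  qed
  then show thesis using that by blast
qed

text \<open>Dependence on finitely many coordinates is what makes Hamming-close models have close
averages, and what makes only finitely many of the sofic relations matter.\<close>

lemma dist_algebra_lipschitz:
  fixes f :: "('g \<Rightarrow> 'a) \<Rightarrow> real"
  assumes "compact_metric X d" "f \<in> dist_algebra X d"
  obtains L F where "0 < L" "finite F"
    "\<And>x y. (\<And>g. x g \<in> X) \<Longrightarrow> (\<And>g. y g \<in> X) \<Longrightarrow> \<bar>f x - f y\<bar> \<le> L * (\<Sum>g\<in>F. d (x g) (y g))"
proof -
  have nn: "0 \<le> d x y" for x y by (rule compact_metric_nonneg[OF assms(1)])
  have "\<exists>L>0. \<exists>F. finite F \<and> (\<forall>x y :: 'g \<Rightarrow> 'a. (\<forall>g. x g \<in> X) \<longrightarrow> (\<forall>g. y g \<in> X) \<longrightarrow> \<bar>f x - f y\<bar> \<le> L * (\<Sum>g\<in>F. d (x g) (y g)))"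
    using assms(2)
  proof induction
    case (const c)
    show ?case by (intro exI[of _ 1] conjI exI[of _ "{}"]) auto
  next
    case (coord q g)
    show ?case
      by (intro exI[of _ 1] conjI exI[of _ "{g}"])
        (use compact_metric_abs_diff[OF assms(1)] coord in auto)
  next
    case (add f h)
    from add.IH(1) obtain L F where 1: "0 < L" "finite F"
      "\<forall>x y. (\<forall>g. x g \<in> X) \<longrightarrow> (\<forall>g. y g \<in> X) \<longrightarrow> \<bar>f x - f y\<bar> \<le> L * (\<Sum>g\<in>F. d (x g) (y g))"
      by (elim exE conjE)
    from add.IH(2) obtain L' F' where 2: "0 < L'" "finite F'"
      "\<forall>x y. (\<forall>g. x g \<in> X) \<longrightarrow> (\<forall>g. y g \<in> X) \<longrightarrow> \<bar>h x - h y\<bar> \<le> L' * (\<Sum>g\<in>F'. d (x g) (y g))"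
      by (elim exE conjE)
    note * = 1(1,2) 2(1,2) 1(3)[THEN spec, THEN spec, THEN mp, THEN mp] 2(3)[THEN spec, THEN spec, THEN mp, THEN mp]
    show ?case
    proof (intro exI[of _ "L + L'"] conjI exI[of _ "F \<union> F'"] allI impI)
      fix x y :: "'g \<Rightarrow> 'a" assume xy: "\<forall>g. x g \<in> X" "\<forall>g. y g \<in> X"
      have "(\<Sum>g\<in>F. d (x g) (y g)) \<le> (\<Sum>g\<in>F\<union>F'. d (x g) (y g))" "(\<Sum>g\<in>F'. d (x g) (y g)) \<le> (\<Sum>g\<in>F\<union>F'. d (x g) (y g))"
        using * nn by (auto intro!: sum_mono2)
      then have "L * (\<Sum>g\<in>F. d (x g) (y g)) \<le> L * (\<Sum>g\<in>F\<union>F'. d (x g) (y g))"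
         "L' * (\<Sum>g\<in>F'. d (x g) (y g)) \<le> L' * (\<Sum>g\<in>F\<union>F'. d (x g) (y g))" using * by auto
      then show "\<bar>f x + h x - (f y + h y)\<bar> \<le> (L + L') * (\<Sum>g\<in>F\<union>F'. d (x g) (y g))"
        using *(5)[OF xy] *(6)[OF xy] by (simp add: distrib_right)
    qed (use * in auto)
  next
    case (mult f h)
    from mult.IH(1) obtain L F where 1: "0 < L" "finite F"
      "\<forall>x y. (\<forall>g. x g \<in> X) \<longrightarrow> (\<forall>g. y g \<in> X) \<longrightarrow> \<bar>f x - f y\<bar> \<le> L * (\<Sum>g\<in>F. d (x g) (y g))"
      by (elim exE conjE)
    from mult.IH(2) obtain L' F' where 2: "0 < L'" "finite F'"
      "\<forall>x y. (\<forall>g. x g \<in> X) \<longrightarrow> (\<forall>g. y g \<in> X) \<longrightarrow> \<bar>h x - h y\<bar> \<le> L' * (\<Sum>g\<in>F'. d (x g) (y g))"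
      by (elim exE conjE)
    note * = 1(1,2) 2(1,2) 1(3)[THEN spec, THEN spec, THEN mp, THEN mp] 2(3)[THEN spec, THEN spec, THEN mp, THEN mp]
    obtain B where B: "0 < B" "\<And>x. (\<And>g. x g \<in> X) \<Longrightarrow> \<bar>f x\<bar> \<le> B" 
      using dist_algebra_bounded[OF assms(1) mult(1)] by blast
    obtain C where C: "0 < C" "\<And>x. (\<And>g. x g \<in> X) \<Longrightarrow> \<bar>h x\<bar> \<le> C" 
      using dist_algebra_bounded[OF assms(1) mult(2)] by blast
    show ?case
    proof (intro exI[of _ "C * L + B * L'"] conjI exI[of _ "F \<union> F'"] allI impI)
      show "0 < C * L + B * L'" using * B C by (simp add: add_pos_pos)
      fix x y :: "'g \<Rightarrow> 'a" assume xy: "\<forall>g. x g \<in> X" "\<forall>g. y g \<in> X"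
      let ?S = "\<Sum>g\<in>F\<union>F'. d (x g) (y g)"
      have "(\<Sum>g\<in>F. d (x g) (y g)) \<le> ?S" "(\<Sum>g\<in>F'. d (x g) (y g)) \<le> ?S"
        using * nn by (auto intro!: sum_mono2)
      then have 1: "L * (\<Sum>g\<in>F. d (x g) (y g)) \<le> L * ?S" "L' * (\<Sum>g\<in>F'. d (x g) (y g)) \<le> L' * ?S" using * by auto
      have "f x * h x - f y * h y = (f x - f y) * h x + f y * (h x - h y)" by (simp add: algebra_simps)
      then have "\<bar>f x * h x - f y * h y\<bar> \<le> \<bar>f x - f y\<bar> * \<bar>h x\<bar> + \<bar>f y\<bar> * \<bar>h x - h y\<bar>"
        by (metis abs_mult abs_triangle_ineq)
      also have "\<dots> \<le> (L * ?S) * C + B * (L' * ?S)"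
        using *(5)[OF xy] *(6)[OF xy] 1 B(1) C(1) B(2)[of y] C(2)[of x] xy
        by (intro add_mono mult_mono) auto
      finally show "\<bar>f x * h x - f y * h y\<bar> \<le> (C * L + B * L') * ?S" by (simp add: algebra_simps)
    qed (use * in auto)
  qed
  then show thesis using that by (elim exE conjE) blast
qed

lemma measurable_config_coord:
  "(\<lambda>x. x i) \<in> measurable (config_algebra I X d) (borel_of (metric_top X d))" if "i \<in> I"
  unfolding config_algebra_def by (rule measurable_component_singleton[OF that])

lemma continuous_map_measurable_borel_of:
  assumes "continuous_map \<tau> euclideanreal f"
  shows "f \<in> borel_measurable (borel_of \<tau>)"
proof (rule borel_measurableI)
  fix S :: "real set" assume "open S"
  then have "openin \<tau> {x \<in> topspace \<tau>. f x \<in> S}"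
    using assms by (simp add: continuous_map_def)
  moreover have "f -` S \<inter> space (borel_of \<tau>) = {x \<in> topspace \<tau>. f x \<in> S}" by auto
  ultimately show "f -` S \<inter> space (borel_of \<tau>) \<in> sets (borel_of \<tau>)" by (simp add: openin_borel_of)
qed

lemma dist_algebra_measurable:
  assumes "compact_metric X d" "f \<in> dist_algebra X d"
  shows "f \<in> borel_measurable (config_algebra UNIV X d)"
  using assms(2)
proof induction
  case (coord q g)
  show ?case
    by (rule measurable_compose[OF measurable_config_coord
          continuous_map_measurable_borel_of[OF continuous_map_dist[OF assms(1) coord]]]) simp
qed auto

text \<open>Stone-Weierstrass concerns compact subsets of a topological type, while the configurations over \<open>X\<close>
carry an abstract topology. The distances to a countable dense subset of \<open>X\<close> embed them as a compact
set of real families indexed by \<open>'g \<times> nat\<close>, on which the coordinate functions separate points and correspond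
to generators of the algebra.\<close>

theorem tests_approx:
  fixes f :: "('g::countable \<Rightarrow> 'a) \<Rightarrow> real"
  assumes cm: "compact_metric X d" and f: "f \<in> tests X d" and e: "0 < e"
  obtains h where "h \<in> dist_algebra X d" "\<And>x. (\<And>g. x g \<in> X) \<Longrightarrow> \<bar>f x - h x\<bar> < e"
proof (cases "X = {}")
  case True
  then show thesis using that[OF dist_algebra.const] by simp
next
  case False
  obtain Q0 where Q0: "countable Q0" "Q0 \<subseteq> X" "\<And>x e. x \<in> X \<Longrightarrow> 0 < e \<Longrightarrow> \<exists>q\<in>Q0. d x q < e"
    using countable_dense[OF cm] by blast
  have "Q0 \<noteq> {}" using Q0(3) False by (metis all_not_in_conv zero_less_one)
  then obtain Q :: "nat \<Rightarrow> 'a" where Q: "range Q = Q0" using range_from_nat_into[OF _ Q0(1)] by blast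
  have QX: "Q n \<in> X" for n using Q Q0 by auto
  define E :: "('g \<Rightarrow> 'a) \<Rightarrow> ('g \<times> nat \<Rightarrow> real)" where "E x = (\<lambda>(g,n). d (x g) (Q n))" for x
  let ?K = "configs X d :: ('g \<Rightarrow> 'a) topology"
  have K: "topspace ?K = {x. \<forall>g. x g \<in> X}" by (rule topspace_configs[OF compact_metric_space[OF cm]])
  have cK: "compact_space ?K" using cm by (auto simp: compact_space_product_topology compact_metric_def)
  have contE: "continuous_map ?K euclidean E"
    unfolding euclidean_product_topology[symmetric] continuous_map_componentwise_UNIV
  proof
    fix k :: "'g \<times> nat"
    obtain g n where k: "k = (g,n)" by force
    have "(\<lambda>x. d (x g) (Q n)) \<in> tests X d" by (rule dist_algebra_tests[OF cm dist_algebra.coord[OF QX]])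
    then show "continuous_map ?K euclidean (\<lambda>x. E x k)" by (simp add: E_def k)
  qed
  have cE: "compact (E ` C)" if "closedin ?K C" for C
    using image_compactin[OF closedin_compact_space[OF cK that] contE] by simp
  define S where "S = E ` topspace ?K"
  have cS: "compact S" unfolding S_def by (rule cE) (rule closedin_topspace)
  have inj: "inj_on E (topspace ?K)"
  proof (rule inj_onI, rule ext)
    fix x y g assume xy: "x \<in> topspace ?K" "y \<in> topspace ?K" "E x = E y"
    have eq: "d (x g) (Q n) = d (y g) (Q n)" for n
      using fun_cong[OF xy(3), of "(g,n)"] by (simp add: E_def)
    have X: "x g \<in> X" "y g \<in> X" using xy K by auto
    have "d (x g) (y g) \<le> r" if "0 < r" for r
    proof -
      obtain n where "d (x g) (Q n) < r/2" using Q0(3)[OF X(1), of "r/2"] \<open>0<r\<close> Q by auto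
      moreover have "d (x g) (y g) \<le> d (x g) (Q n) + d (Q n) (y g)"
        using compact_metric_triangle[OF cm X(1) QX X(2)] .
      ultimately show ?thesis using eq[of n] compact_metric_commute[OF cm, of "Q n" "y g"] by linarith
    qed
    then have "d (x g) (y g) \<le> 0" by (metis dense not_le)
    then show "x g = y g" using compact_metric_zero[OF cm X] compact_metric_nonneg[OF cm, of "x g" "y g"] by simp
  qed
  define f' where "f' z = f (inv_into (topspace ?K) E z)" for z
  have f'E: "f' (E x) = f x" if "x \<in> topspace ?K" for x
    using that inj by (simp add: f'_def)
  have contf': "continuous_on S f'"
    unfolding continuous_on_closed_vimage[OF compact_imp_closed[OF cS]]
  proof (intro allI impI)
    fix B :: "real set" assume "closed B"
    then have "closedin ?K {x \<in> topspace ?K. f x \<in> B}"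
      using f by (intro closedin_continuous_map_preimage) auto
    from compact_imp_closed[OF cE[OF this]] 
    have "closed (E ` {x \<in> topspace ?K. f x \<in> B})" .
    also have "E ` {x \<in> topspace ?K. f x \<in> B} = f' -` B \<inter> S"
      using f'E by (auto simp: S_def)
    finally show "closed (f' -` B \<inter> S)" .
  qed
  define P where "P h \<longleftrightarrow> continuous_on S h \<and> (\<exists>k\<in>dist_algebra X d. \<forall>x\<in>topspace ?K. h (E x) = k x)" for h
  have "\<exists>h. P h \<and> (\<forall>z\<in>S. \<bar>f' z - h z\<bar> < e)"
  proof (rule Stone_Weierstrass_HOL[OF cS _ _ _ _ _ contf' e])
    show "P (\<lambda>x. c)" for c unfolding P_def
      by (intro conjI bexI[OF _ dist_algebra.const[of c]] continuous_on_const ballI refl)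
    show "continuous_on S h" if "P h" for h using that by (simp add: P_def)
    show "P (\<lambda>x. h x + k x)" if hk: "P h \<and> P k" for h k
    proof -
      obtain h' k' where "h' \<in> dist_algebra X d" "k' \<in> dist_algebra X d"
        "\<forall>x\<in>topspace ?K. h (E x) = h' x" "\<forall>x\<in>topspace ?K. k (E x) = k' x"
        using hk unfolding P_def by meson
      then show ?thesis using that unfolding P_def
        by (intro conjI bexI[OF _ dist_algebra.add[of h' X d k']] continuous_on_add ballI) simp_all
    qed
    show "P (\<lambda>x. h x * k x)" if hk: "P h \<and> P k" for h k
    proof -
      obtain h' k' where "h' \<in> dist_algebra X d" "k' \<in> dist_algebra X d"
        "\<forall>x\<in>topspace ?K. h (E x) = h' x" "\<forall>x\<in>topspace ?K. k (E x) = k' x"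
        using hk unfolding P_def by meson
      then show ?thesis using that unfolding P_def
        by (intro conjI bexI[OF _ dist_algebra.mult[of h' X d k']] continuous_on_mult ballI) simp_all
    qed
    show "\<exists>h. P h \<and> h x \<noteq> h y" if xy: "x \<in> S \<and> y \<in> S \<and> x \<noteq> y" for x y
    proof -
      obtain p where "x p \<noteq> y p" using xy by (auto simp: fun_eq_iff)
      then obtain g n where gn: "x (g,n) \<noteq> y (g,n)" by (cases p) auto
      have "P (\<lambda>z. z (g,n))" unfolding P_def
        by (intro conjI bexI[OF _ dist_algebra.coord[OF QX, of d g n]] ballI
            continuous_on_product_then_coordinatewise[where f = "\<lambda>z. z"] continuous_on_id) (simp add: E_def)
      then show ?thesis using gn by blast
    qed
  qed
  then obtain h k where h: "\<forall>z\<in>S. \<bar>f' z - h z\<bar> < e" "k\<in>dist_algebra X d" "\<forall>x\<in>topspace ?K. h (E x) = k x"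
    unfolding P_def by meson
  show thesis
  proof (rule that[OF h(2)])
    fix x :: "'g \<Rightarrow> 'a" assume "\<And>g. x g \<in> X"
    then have x: "x \<in> topspace ?K" using K by auto
    then have "E x \<in> S" by (simp add: S_def)
    with h(1) have "\<bar>f' (E x) - h (E x)\<bar> < e" by blast
    then show "\<bar>f x - k x\<bar> < e" using h(3) x f'E[OF x] by auto
  qed
qed

section \<open>Test functions, weak neighbourhoods and empirical distributions\<close>

lemma ProbD:
  assumes "\<mu> \<in> Prob I X d" "Metric_space X d"
  shows "prob_space \<mu>" "sets \<mu> = sets (config_algebra I X d)" "space \<mu> = PiE I (\<lambda>_. X)"
proof -
  show "prob_space \<mu>" and s: "sets \<mu> = sets (config_algebra I X d)" using assms(1) by (auto simp: Prob_def)
  show "space \<mu> = PiE I (\<lambda>_. X)" using sets_eq_imp_space_eq[OF s] space_config[OF assms(2), of I] by simp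
qed

lemma space_Prob_UNIV:
  assumes "\<mu> \<in> Prob UNIV X d" "Metric_space X d"
  shows "x \<in> space \<mu> \<longleftrightarrow> (\<forall>g. x g \<in> X)"
  using ProbD(3)[OF assms] by (auto simp: PiE_def)

text \<open>The configuration space is given the product of the Borel algebras, for which continuity does not by itself
yield measurability; uniform approximation from the algebra does.\<close>

lemma tests_measurable:
  fixes f :: "('g::countable \<Rightarrow> 'a) \<Rightarrow> real"
  assumes cm: "compact_metric X d" and f: "f \<in> tests X d"
  shows "f \<in> borel_measurable (config_algebra UNIV X d)"
proof -
  have "\<exists>h. h \<in> dist_algebra X d \<and> (\<forall>x. (\<forall>g. x g \<in> X) \<longrightarrow> \<bar>f x - h x\<bar> < 1 / real (Suc n))" for n
  proof -
    obtain h where "h \<in> dist_algebra X d" "\<And>x. (\<And>g. x g \<in> X) \<Longrightarrow> \<bar>f x - h x\<bar> < 1 / real (Suc n)"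
      using tests_approx[OF cm f, of "1 / real (Suc n)"] by auto
    then show ?thesis by blast
  qed
  then obtain h where h: "\<And>n. h n \<in> dist_algebra X d"
    "\<And>n x. (\<forall>g. x g \<in> X) \<longrightarrow> \<bar>f x - h n x\<bar> < 1 / real (Suc n)"
    by metis
  show ?thesis
  proof (rule borel_measurable_LIMSEQ_real)
    show "h n \<in> borel_measurable (config_algebra UNIV X d)" for n by (rule dist_algebra_measurable[OF cm h(1)])
    fix x :: "'g \<Rightarrow> 'a" assume "x \<in> space (config_algebra UNIV X d)"
    then have x: "\<forall>g. x g \<in> X" by (simp add: space_config_UNIV[OF compact_metric_space[OF cm]])
    show "(\<lambda>n. h n x) \<longlonglongrightarrow> f x"
    proof (rule LIM_zero_cancel, rule Lim_null_comparison)
      show "(\<lambda>n. 1 / real (Suc n)) \<longlonglongrightarrow> 0" using LIMSEQ_inverse_real_of_nat by (simp add: inverse_eq_divide)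
      show "\<forall>\<^sub>F n in sequentially. norm (h n x - f x) \<le> 1 / real (Suc n)"
        using h(2)[of x] x by (auto intro!: always_eventually less_imp_le simp: abs_minus_commute)
    qed
  qed
qed

lemma tests_bounded:
  fixes f :: "('g::countable \<Rightarrow> 'a) \<Rightarrow> real"
  assumes cm: "compact_metric X d" and f: "f \<in> tests X d"
  obtains B where "0 < B" "\<And>x. (\<And>g. x g \<in> X) \<Longrightarrow> \<bar>f x\<bar> \<le> B"
proof -
  obtain h where h: "h \<in> dist_algebra X d" "\<And>x. (\<And>g. x g \<in> X) \<Longrightarrow> \<bar>f x - h x\<bar> < 1"
    using tests_approx[OF cm f, of 1] by auto
  obtain B where B: "0 < B" "\<And>x. (\<And>g. x g \<in> X) \<Longrightarrow> \<bar>h x\<bar> \<le> B"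
    using dist_algebra_bounded[OF cm h(1)] by blast
  show thesis
  proof (rule that[of "B + 1"])
    fix x :: "'g \<Rightarrow> 'a" assume x: "\<And>g. x g \<in> X"
    show "\<bar>f x\<bar> \<le> B + 1" using h(2)[of x] B(2)[of x] x by fastforce
  qed (use B in simp)
qed

lemma tests_integrable:
  fixes f :: "('g::countable \<Rightarrow> 'a) \<Rightarrow> real"
  assumes cm: "compact_metric X d" and f: "f \<in> tests X d" and mu: "\<mu> \<in> Prob UNIV X d"
  shows "integrable \<mu> f"
proof -
  note ms = compact_metric_space[OF cm]
  interpret prob_space \<mu> by (rule ProbD(1)[OF mu ms])
  obtain B where B: "0 < B" "\<And>x. (\<And>g. x g \<in> X) \<Longrightarrow> \<bar>f x\<bar> \<le> B"
    using tests_bounded[OF cm f] by blast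
  show ?thesis
  proof (rule integrable_const_bound)
    show "AE x in \<mu>. norm (f x) \<le> B" using B(2) by (intro AE_I2) (simp add: space_Prob_UNIV[OF mu ms])
    show "f \<in> borel_measurable \<mu>"
      using tests_measurable[OF cm f] by (simp cong: measurable_cong_sets add: ProbD(2)[OF mu ms])
  qed
qed

definition ave :: "'v set \<Rightarrow> ('v \<Rightarrow> real) \<Rightarrow> real" where
  "ave V f = (\<Sum>v\<in>V. f v) / real (card V)"

definition model_frame :: "'v set \<Rightarrow> ('g \<Rightarrow> 'v \<Rightarrow> 'v) \<Rightarrow> bool" where
  "model_frame V s \<longleftrightarrow> finite V \<and> V \<noteq> {} \<and> (\<forall>g. bij_betw (s g) V V)"

lemma model_frameD:
  assumes "model_frame V s"
  shows "finite V" "V \<noteq> {}" "0 < card V" "bij_betw (s g) V V" "v \<in> V \<Longrightarrow> s g v \<in> V"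
  using assms by (auto simp: model_frame_def card_gt_0_iff bij_betw_def)

lemma sofic_model_frame: "sofic_approximation V \<sigma> \<Longrightarrow> model_frame (V n) (\<sigma> n)"
  by (auto simp: sofic_approximation_def model_frame_def)

lemma ave_mono: "(\<And>v. v \<in> V \<Longrightarrow> f v \<le> h v) \<Longrightarrow> ave V f \<le> ave V h"
  by (auto simp: ave_def intro!: divide_right_mono sum_mono)

lemma ave_add: "ave V (\<lambda>v. f v + h v) = ave V f + ave V h"
  by (simp add: ave_def sum.distrib add_divide_distrib)

lemma ave_diff: "ave V (\<lambda>v. f v - h v) = ave V f - ave V h"
  by (simp add: ave_def sum_subtractf diff_divide_distrib)

lemma ave_cmult: "ave V (\<lambda>v. c * f v) = c * ave V f"
  by (simp add: ave_def sum_distrib_left[symmetric])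

lemma ave_sum: "ave V (\<lambda>v. \<Sum>i\<in>I. f i v) = (\<Sum>i\<in>I. ave V (f i))"
  by (simp add: ave_def sum_divide_distrib sum.swap[of _ V])

lemma ave_const: "finite V \<Longrightarrow> V \<noteq> {} \<Longrightarrow> ave V (\<lambda>v. c) = c"
  by (simp add: ave_def)

lemma ave_abs: "\<bar>ave V f\<bar> \<le> ave V (\<lambda>v. \<bar>f v\<bar>)"
  by (simp add: ave_def abs_divide divide_right_mono)

lemma ave_nonneg: "(\<And>v. v \<in> V \<Longrightarrow> 0 \<le> f v) \<Longrightarrow> 0 \<le> ave V f"
  by (auto simp: ave_def intro!: divide_nonneg_nonneg sum_nonneg)

lemma ave_cong: "(\<And>v. v \<in> V \<Longrightarrow> f v = h v) \<Longrightarrow> ave V f = ave V h"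
  by (simp add: ave_def)

text \<open>Each permutation \<open>\<sigma> g\<close> of the vertices leaves averages unchanged; this replaces shift invariance on the
side of the models.\<close>

lemma ave_bij: "bij_betw p V V \<Longrightarrow> ave V (\<lambda>v. f (p v)) = ave V f"
  by (simp add: ave_def sum.reindex_bij_betw)

lemma pullback_name_in:
  assumes "model_frame V s" "x \<in> PiE V (\<lambda>_. X)" "v \<in> V"
  shows "pullback_name s v x g \<in> X"
  using assms model_frameD(5)[OF assms(1,3), of g] by (auto simp: pullback_name_def)

lemma pullback_name_measurable:
  assumes "model_frame V s" "v \<in> V"
  shows "pullback_name s v \<in> measurable (config_algebra V X d) (config_algebra UNIV X d)"
  unfolding pullback_name_def
proof -
  have "(\<lambda>x. \<lambda>g\<in>UNIV. x (s g v)) \<in> measurable (config_algebra V X d) (config_algebra UNIV X d)"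
    unfolding config_algebra_def
    by (intro measurable_restrict measurable_component_singleton model_frameD(5)[OF assms])
  then show "(\<lambda>x g. x (s g v)) \<in> measurable (config_algebra V X d) (config_algebra UNIV X d)"
    by (simp add: restrict_def)
qed

lemma empirical_measurable:
  assumes "Metric_space X d" "model_frame V s" "x \<in> PiE V (\<lambda>_. X)"
  shows "(\<lambda>v. pullback_name s v x) \<in> measurable (uniform_count_measure V) (config_algebra UNIV X d)"
  using pullback_name_in[OF assms(2,3)]
  by (auto simp: measurable_def space_uniform_count_measure sets_uniform_count_measure space_config_UNIV[OF assms(1)])

lemma empirical_Prob:
  assumes "Metric_space X d" "model_frame V s" "x \<in> PiE V (\<lambda>_. X)"
  shows "empirical_dist X d V s x \<in> Prob UNIV X d"
proof -
  interpret prob_space "uniform_count_measure V"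
    by (rule prob_space_uniform_count_measure) (use model_frameD[OF assms(2)] in auto)
  show ?thesis unfolding Prob_def empirical_dist_def
    using prob_space_distr[OF empirical_measurable[OF assms]] by simp
qed

lemma empirical_integral:
  fixes f :: "('g::countable \<Rightarrow> 'a) \<Rightarrow> real"
  assumes cm: "compact_metric X d" and "model_frame V s" "x \<in> PiE V (\<lambda>_. X)" "f \<in> tests X d"
  shows "(\<integral>z. f z \<partial>empirical_dist X d V s x) = ave V (\<lambda>v. f (pullback_name s v x))"
proof -
  have "(\<integral>z. f z \<partial>empirical_dist X d V s x) = (\<integral>v. f (pullback_name s v x) \<partial>uniform_count_measure V)"
    unfolding empirical_dist_def
    by (rule integral_distr[OF empirical_measurable tests_measurable])
      (use assms compact_metric_space[OF cm] in auto)
  also have "\<dots> = ave V (\<lambda>v. f (pullback_name s v x))"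
    unfolding ave_def by (rule integral_uniform_count_measure[OF model_frameD(1)[OF assms(2)]])
  finally show ?thesis .
qed

definition basic_nbhd ::
  "'a set \<Rightarrow> ('a \<Rightarrow> 'a \<Rightarrow> real) \<Rightarrow> ('g \<Rightarrow> 'a) measure \<Rightarrow> (('g \<Rightarrow> 'a) \<Rightarrow> real) set \<Rightarrow> real \<Rightarrow> ('g \<Rightarrow> 'a) measure set" where
  "basic_nbhd X d \<mu> Fs \<epsilon> = {m \<in> Prob UNIV X d. \<forall>f\<in>Fs. \<bar>(\<integral>x. f x \<partial>m) - (\<integral>x. f x \<partial>\<mu>)\<bar> < \<epsilon>}"

lemma nbhds_Int: "A \<in> nbhds X d \<mu> \<Longrightarrow> B \<in> nbhds X d \<mu> \<Longrightarrow> A \<inter> B \<in> nbhds X d \<mu>"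
  by (auto simp: nbhds_def)

lemma basic_nbhd_nbhds:
  assumes mu: "\<mu> \<in> Prob UNIV X d" and "finite Fs" "Fs \<subseteq> tests X d" "0 < \<epsilon>"
  shows "basic_nbhd X d \<mu> Fs \<epsilon> \<in> nbhds X d \<mu>"
  using assms(2,3)
proof induction
  case empty
  have "openin (weak_star X d) {m \<in> Prob UNIV X d. (\<integral>x. (\<lambda>_. 0) x \<partial>m) \<in> (UNIV::real set)}"
    unfolding weak_star_def
    by (rule topology_generated_by_Basis, rule CollectI, rule exI[of _ "\<lambda>_. 0"], rule exI[of _ UNIV]) simp
  then show ?case using mu by (simp add: nbhds_def basic_nbhd_def)
next
  case (insert f Fs)
  let ?U = "{(\<integral>x. f x \<partial>\<mu>) - \<epsilon><..<(\<integral>x. f x \<partial>\<mu>) + \<epsilon>}"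
  have "openin (weak_star X d) {m \<in> Prob UNIV X d. (\<integral>x. f x \<partial>m) \<in> ?U}"
    unfolding weak_star_def
    by (rule topology_generated_by_Basis) (use insert in \<open>auto intro!: exI[of _ f] exI[of _ ?U]\<close>)
  then have "{m \<in> Prob UNIV X d. (\<integral>x. f x \<partial>m) \<in> ?U} \<in> nbhds X d \<mu>"
    using mu assms(4) by (simp add: nbhds_def)
  with insert have "{m \<in> Prob UNIV X d. (\<integral>x. f x \<partial>m) \<in> ?U} \<inter> basic_nbhd X d \<mu> Fs \<epsilon> \<in> nbhds X d \<mu>"
    by (intro nbhds_Int) auto
  also have "{m \<in> Prob UNIV X d. (\<integral>x. f x \<partial>m) \<in> ?U} \<inter> basic_nbhd X d \<mu> Fs \<epsilon> = basic_nbhd X d \<mu> (insert f Fs) \<epsilon>"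
    by (auto simp: basic_nbhd_def abs_less_iff)
  finally show ?case .
qed

lemma nbhds_basic_tests:
  fixes \<mu> :: "('g::countable \<Rightarrow> 'a) measure"
  assumes mu: "\<mu> \<in> Prob UNIV X d" and O: "\<O> \<in> nbhds X d \<mu>"
  obtains Fs \<epsilon> where "finite Fs" "Fs \<subseteq> tests X d" "0 < \<epsilon>" "basic_nbhd X d \<mu> Fs \<epsilon> \<subseteq> \<O>"
proof -
  let ?B = "{{m \<in> Prob UNIV X d. (\<integral>x. f x \<partial>m) \<in> U} | (f :: ('g \<Rightarrow> 'a) \<Rightarrow> real) U. f \<in> tests X d \<and> open U}"
  have "generate_topology_on ?B \<O>"
    using O unfolding nbhds_def weak_star_def by (auto dest: openin_topology_generated_by)
  moreover have "\<mu> \<in> \<O>" using O by (simp add: nbhds_def)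
  ultimately have "\<exists>Fs \<epsilon>. finite Fs \<and> Fs \<subseteq> tests X d \<and> 0 < \<epsilon> \<and> basic_nbhd X d \<mu> Fs \<epsilon> \<subseteq> \<O>"
  proof induction
    case Empty then show ?case by simp
  next
    case (Int a b)
    then obtain Fs \<epsilon> Fs' \<epsilon>' where *: "finite Fs" "Fs \<subseteq> tests X d" "0 < \<epsilon>" "basic_nbhd X d \<mu> Fs \<epsilon> \<subseteq> a"
      "finite Fs'" "Fs' \<subseteq> tests X d" "0 < \<epsilon>'" "basic_nbhd X d \<mu> Fs' \<epsilon>' \<subseteq> b"
      by (meson IntE)
    have "basic_nbhd X d \<mu> (Fs \<union> Fs') (min \<epsilon> \<epsilon>') \<subseteq> basic_nbhd X d \<mu> Fs \<epsilon> \<inter> basic_nbhd X d \<mu> Fs' \<epsilon>'"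
      by (auto simp: basic_nbhd_def)
    then show ?case using *
      by (intro exI[of _ "Fs \<union> Fs'"] exI[of _ "min \<epsilon> \<epsilon>'"]) auto
  next
    case (UN K)
    then obtain k where k: "k \<in> K" "\<mu> \<in> k" by blast
    from UN.IH[OF k] obtain Fs \<epsilon> where "finite Fs" "Fs \<subseteq> tests X d" "0 < \<epsilon>" "basic_nbhd X d \<mu> Fs \<epsilon> \<subseteq> k"
      by (elim exE conjE)
    then show ?case using k by (intro exI[of _ Fs] exI[of _ \<epsilon>]) auto
  next
    case (Basis s)
    then obtain f :: "('g \<Rightarrow> 'a) \<Rightarrow> real" and U where fU: "s = {m \<in> Prob UNIV X d. (\<integral>x. f x \<partial>m) \<in> U}" "f \<in> tests X d" "open U"
      by blast
    then have "(\<integral>x. f x \<partial>\<mu>) \<in> U" using Basis by auto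
    then obtain e where e: "0 < e" "ball (\<integral>x. f x \<partial>\<mu>) e \<subseteq> U" using fU(3) open_contains_ball by blast
    have "basic_nbhd X d \<mu> {f} e \<subseteq> s"
      using e(2) fU(1) by (auto simp: basic_nbhd_def dist_real_def subset_iff abs_minus_commute)
    then show ?case using e fU by (intro exI[of _ "{f}"] exI[of _ e]) auto
  qed
  then show thesis using that by (elim exE conjE)
qed

lemma integral_close:
  fixes f h :: "('g::countable \<Rightarrow> 'a) \<Rightarrow> real"
  assumes cm: "compact_metric X d" and m: "m \<in> Prob UNIV X d"
    and f: "f \<in> tests X d" and h: "h \<in> tests X d"
    and fh: "\<And>x. (\<And>g. x g \<in> X) \<Longrightarrow> \<bar>f x - h x\<bar> \<le> e"
  shows "\<bar>(\<integral>x. f x \<partial>m) - (\<integral>x. h x \<partial>m)\<bar> \<le> e"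
proof -
  note ms = compact_metric_space[OF cm]
  interpret prob_space m by (rule ProbD(1)[OF m ms])
  note int = tests_integrable[OF cm f m] tests_integrable[OF cm h m]
  have "\<bar>(\<integral>x. f x \<partial>m) - (\<integral>x. h x \<partial>m)\<bar> = \<bar>\<integral>x. f x - h x \<partial>m\<bar>" using int by simp
  also have "\<dots> \<le> (\<integral>x. \<bar>f x - h x\<bar> \<partial>m)" by (rule integral_abs_bound)
  also have "\<dots> \<le> (\<integral>x. e \<partial>m)"
    using int fh by (intro integral_mono) (auto simp: space_Prob_UNIV[OF m ms])
  finally show ?thesis by (simp add: prob_space)
qed

text \<open>A neighbourhood base built from the algebra alone, so that good models are described by finitely many
averages of explicit functions.\<close>

lemma nbhds_basic_algebra:
  fixes \<mu> :: "('g::countable \<Rightarrow> 'a) measure"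
  assumes cm: "compact_metric X d" and mu: "\<mu> \<in> Prob UNIV X d" and O: "\<O> \<in> nbhds X d \<mu>"
  obtains Fs \<epsilon> where "finite Fs" "Fs \<subseteq> dist_algebra X d" "0 < \<epsilon>" "basic_nbhd X d \<mu> Fs \<epsilon> \<subseteq> \<O>"
proof -
  obtain Fs \<epsilon> where Fs: "finite Fs" "Fs \<subseteq> tests X d" "0 < \<epsilon>" "basic_nbhd X d \<mu> Fs \<epsilon> \<subseteq> \<O>"
    using nbhds_basic_tests[OF mu O] by blast
  have "\<exists>h. h \<in> dist_algebra X d \<and> (\<forall>x. (\<forall>g. x g \<in> X) \<longrightarrow> \<bar>f x - h x\<bar> \<le> \<epsilon> / 3)" if f: "f \<in> Fs" for f
  proof -
    have f': "f \<in> tests X d" using f Fs by blast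
    obtain h where h: "h \<in> dist_algebra X d" "\<And>x. (\<And>g. x g \<in> X) \<Longrightarrow> \<bar>f x - h x\<bar> < \<epsilon> / 3"
      using tests_approx[OF cm f', of "\<epsilon>/3"] Fs(3) by auto
    show ?thesis by (intro exI[of _ h] conjI h(1) allI impI less_imp_le h(2)) auto
  qed
  then obtain h where h: "\<And>f. f \<in> Fs \<Longrightarrow> h f \<in> dist_algebra X d"
    "\<And>f x. f \<in> Fs \<Longrightarrow> (\<forall>g. x g \<in> X) \<Longrightarrow> \<bar>f x - h f x\<bar> \<le> \<epsilon> / 3"
    by metis
  have "basic_nbhd X d \<mu> (h ` Fs) (\<epsilon>/3) \<subseteq> basic_nbhd X d \<mu> Fs \<epsilon>"
    unfolding basic_nbhd_def
  proof (intro subsetI CollectI conjI ballI)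
    fix m f assume m: "m \<in> {m \<in> Prob UNIV X d. \<forall>f\<in>h ` Fs. \<bar>integral\<^sup>L m f - integral\<^sup>L \<mu> f\<bar> < \<epsilon> / 3}" and f: "f \<in> Fs"
    have ft: "f \<in> tests X d" using f Fs by blast
    have ht: "h f \<in> tests X d" by (rule dist_algebra_tests[OF cm h(1)[OF f]])
    have mP: "m \<in> Prob UNIV X d" using m by simp
    have 1: "\<bar>integral\<^sup>L m f - integral\<^sup>L m (h f)\<bar> \<le> \<epsilon>/3" by (rule integral_close[OF cm mP ft ht h(2)[OF f]]) blast
    have 2: "\<bar>integral\<^sup>L \<mu> f - integral\<^sup>L \<mu> (h f)\<bar> \<le> \<epsilon>/3" by (rule integral_close[OF cm mu ft ht h(2)[OF f]]) blast
    have 3: "\<bar>integral\<^sup>L m (h f) - integral\<^sup>L \<mu> (h f)\<bar> < \<epsilon>/3" using m f by auto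
    show "\<bar>integral\<^sup>L m f - integral\<^sup>L \<mu> f\<bar> < \<epsilon>" using 1 2 3 by linarith
  qed auto
  with Fs h show thesis by (intro that[of "h ` Fs" "\<epsilon>/3"]) auto
qed

lemma good_models_mono: "A \<subseteq> B \<Longrightarrow> good_models X d V s A \<subseteq> good_models X d V s B"
  by (auto simp: good_models_def)

lemma good_models_basic:
  fixes \<mu> :: "('g::countable \<Rightarrow> 'a) measure"
  assumes cm: "compact_metric X d" and "model_frame V s" and Fs: "Fs \<subseteq> tests X d"
  shows "good_models X d V s (basic_nbhd X d \<mu> Fs \<epsilon>) =
    {x \<in> PiE V (\<lambda>_. X). \<forall>f\<in>Fs. \<bar>ave V (\<lambda>v. f (pullback_name s v x)) - (\<integral>x. f x \<partial>\<mu>)\<bar> < \<epsilon>}"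
  unfolding good_models_def basic_nbhd_def
  using empirical_Prob[OF compact_metric_space[OF cm] assms(2)] empirical_integral[OF cm assms(2)] Fs
  by (auto simp: subset_iff)

section \<open>Covering numbers for the Hamming distance\<close>

lemma hamming_ave: "hamming_dist V d x y = ave V (\<lambda>v. d (x v) (y v))"
  by (simp add: hamming_dist_def ave_def)

lemma hamming_nonneg: "compact_metric X d \<Longrightarrow> 0 \<le> hamming_dist V d x y"
  by (simp add: hamming_ave ave_nonneg compact_metric_nonneg)

lemma hamming_commute: "compact_metric X d \<Longrightarrow> hamming_dist V d x y = hamming_dist V d y x"
  unfolding hamming_ave by (rule ave_cong) (rule compact_metric_commute)

lemma hamming_triangle:
  assumes "compact_metric X d" "x \<in> PiE V (\<lambda>_. X)" "y \<in> PiE V (\<lambda>_. X)" "z \<in> PiE V (\<lambda>_. X)"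
  shows "hamming_dist V d x z \<le> hamming_dist V d x y + hamming_dist V d y z"
  unfolding hamming_ave ave_add[symmetric]
  by (rule ave_mono, rule compact_metric_triangle[OF assms(1)]) (use assms in auto)

lemma hamming_self:
  assumes "compact_metric X d" "x \<in> PiE V (\<lambda>_. X)"
  shows "hamming_dist V d x x = 0"
proof -
  have "d (x v) (x v) = 0" if "v \<in> V" for v
    using that assms compact_metric_zero[OF assms(1), of "x v" "x v"] by auto
  then show ?thesis by (simp add: hamming_dist_def)
qed

text \<open>The centres of a cover must belong to the covered set itself. A partition into cells of small diameter
gives such a cover, one representative per cell. It also shows that
some finite cover exists, without which the least number in the definition of \<open>cov\<close> would be meaningless.\<close>

lemma cov_le_partition:
  assumes J: "finite J" "c ` W \<subseteq> J" and c: "\<And>w w'. w \<in> W \<Longrightarrow> w' \<in> W \<Longrightarrow> c w = c w' \<Longrightarrow> D w w' < \<delta>"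
  shows "cov \<delta> W D \<le> card J"
    and "\<exists>F. finite F \<and> card F = cov \<delta> W D \<and> F \<subseteq> W \<and> (\<forall>z\<in>W. \<exists>y\<in>F. D z y < \<delta>)"
proof -
  define F where "F = inv_into W c ` (c ` W)"
  have fin: "finite (c ` W)" using J finite_subset by blast
  have F: "finite F" "F \<subseteq> W" "\<forall>z\<in>W. \<exists>y\<in>F. D z y < \<delta>"
  proof -
    show "finite F" using fin by (simp add: F_def)
    show "F \<subseteq> W" by (auto simp: F_def inv_into_into)
    show "\<forall>z\<in>W. \<exists>y\<in>F. D z y < \<delta>"
    proof
      fix z assume z: "z \<in> W"
      let ?y = "inv_into W c (c z)"
      have "?y \<in> W" "c ?y = c z" using z by (auto simp: inv_into_into f_inv_into_f)
      then have "D z ?y < \<delta>" using c[OF z] by simp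
      then show "\<exists>y\<in>F. D z y < \<delta>" using z by (auto simp: F_def)
    qed
  qed
  have "cov \<delta> W D \<le> card F" unfolding cov_def by (rule Least_le) (use F in blast)
  also have "\<dots> \<le> card (c ` W)" unfolding F_def by (rule card_image_le[OF fin])
  also have "\<dots> \<le> card J" using J by (intro card_mono) auto
  finally show "cov \<delta> W D \<le> card J" .
  show "\<exists>F. finite F \<and> card F = cov \<delta> W D \<and> F \<subseteq> W \<and> (\<forall>z\<in>W. \<exists>y\<in>F. D z y < \<delta>)"
    unfolding cov_def by (rule LeastI[of _ "card F"]) (use F in blast)
qed

text \<open>Round every symbol to a point of a finite net of the alphabet; models that round to the same model are close.\<close>

lemma hamming_partition:
  fixes X :: "'a set" and V :: "'v set"
  assumes cm: "compact_metric X d" and V: "finite V" "V \<noteq> {}" and "0 < \<delta>"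
  obtains J :: "('v \<Rightarrow> 'a) set" and c where "finite J" "c ` (PiE V (\<lambda>_. X)) \<subseteq> J"
    "\<And>x y. x \<in> PiE V (\<lambda>_. X) \<Longrightarrow> y \<in> PiE V (\<lambda>_. X) \<Longrightarrow> c x = c y \<Longrightarrow> hamming_dist V d x y < \<delta>"
proof -
  obtain Q where Q: "finite Q" "Q \<subseteq> X" "\<And>x. x \<in> X \<Longrightarrow> \<exists>q\<in>Q. d x q < \<delta> / 2"
    using finite_net[OF cm, of "\<delta>/2"] assms by auto
  obtain p where p: "\<And>x. x \<in> X \<Longrightarrow> p x \<in> Q" "\<And>x. x \<in> X \<Longrightarrow> d x (p x) < \<delta> / 2" using Q(3) by metis
  show thesis
  proof (rule that[of "PiE V (\<lambda>_. Q)" "\<lambda>x. \<lambda>v\<in>V. p (x v)"])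
    show "finite (PiE V (\<lambda>_. Q))" using V Q by (simp add: finite_PiE)
    show "(\<lambda>x. \<lambda>v\<in>V. p (x v)) ` (PiE V (\<lambda>_. X)) \<subseteq> PiE V (\<lambda>_. Q)" by (auto intro!: p(1))
    fix x y assume x: "x \<in> PiE V (\<lambda>_. X)" and y: "y \<in> PiE V (\<lambda>_. X)" and eq: "(\<lambda>v\<in>V. p (x v)) = (\<lambda>v\<in>V. p (y v))"
    have "d (x v) (y v) < \<delta>" if v: "v \<in> V" for v
    proof -
      have X: "x v \<in> X" "y v \<in> X" using x y v by auto
      have e: "p (x v) = p (y v)" using fun_cong[OF eq, of v] v by simp
      have "p (x v) \<in> X" using p(1)[OF X(1)] Q(2) by blast
      then have "d (x v) (y v) \<le> d (x v) (p (x v)) + d (p (x v)) (y v)"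
        using compact_metric_triangle[OF cm] X by blast
      then show ?thesis using p(2)[OF X(1)] p(2)[OF X(2)] e compact_metric_commute[OF cm, of "p (x v)" "y v"] by simp
    qed
    then have "(\<Sum>v\<in>V. d (x v) (y v)) < (\<Sum>v\<in>V. \<delta>)" using V by (intro sum_strict_mono) auto
    then show "hamming_dist V d x y < \<delta>"
      using V by (simp add: hamming_dist_def divide_less_eq card_gt_0_iff mult.commute)
  qed
qed

lemma cov_hamming_attained:
  assumes cm: "compact_metric X d" and V: "finite V" "V \<noteq> {}" and "0 < \<delta>" and Z: "Z \<subseteq> PiE V (\<lambda>_. X)"
  obtains F where "finite F" "card F = cov \<delta> Z (hamming_dist V d)" "F \<subseteq> Z"
    "\<And>z. z \<in> Z \<Longrightarrow> \<exists>y\<in>F. hamming_dist V d z y < \<delta>"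
proof (rule hamming_partition[OF cm V \<open>0 < \<delta>\<close>])
  fix J c assume J: "finite J" "c ` (PiE V (\<lambda>_. X)) \<subseteq> J"
    and c: "\<And>x y. x \<in> PiE V (\<lambda>_. X) \<Longrightarrow> y \<in> PiE V (\<lambda>_. X) \<Longrightarrow> c x = c y \<Longrightarrow> hamming_dist V d x y < \<delta>"
  have "c ` Z \<subseteq> J" using J(2) Z by blast
  moreover have "hamming_dist V d w w' < \<delta>" if "w \<in> Z" "w' \<in> Z" "c w = c w'" for w w'
    by (rule c) (use that Z in auto)
  ultimately obtain F
    where F: "finite F" "card F = cov \<delta> Z (hamming_dist V d)" "F \<subseteq> Z" "\<forall>z\<in>Z. \<exists>y\<in>F. hamming_dist V d z y < \<delta>"
    using cov_le_partition(2)[OF J(1), of c Z "hamming_dist V d" \<delta>] by blast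
  show thesis by (rule that[OF F(1-3)]) (use F(4) in blast)
qed

text \<open>An arbitrary map \<open>\<Phi>\<close>, with no continuity, transports covers backwards as long as closeness of images forces
closeness of points. The factor \<open>2\<close> is the price for keeping centres inside the set: two points assigned to the same
centre are within \<open>2 * \<delta>'\<close> of each other.\<close>

lemma cov_le_cov:
  assumes cm: "compact_metric Y e" and V: "finite V" "V \<noteq> {}" and "0 < \<delta>'" and Z: "Z \<subseteq> PiE V (\<lambda>_. Y)"
    and \<Phi>: "\<And>w. w \<in> W \<Longrightarrow> \<Phi> w \<in> Z"
    and close: "\<And>w w'. w \<in> W \<Longrightarrow> w' \<in> W \<Longrightarrow> hamming_dist V e (\<Phi> w) (\<Phi> w') < 2 * \<delta>' \<Longrightarrow> D w w' < \<delta>"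
  shows "cov \<delta> W D \<le> cov \<delta>' Z (hamming_dist V e)"
proof -
  obtain F where F: "finite F" "card F = cov \<delta>' Z (hamming_dist V e)" "F \<subseteq> Z"
    "\<And>z. z \<in> Z \<Longrightarrow> \<exists>y\<in>F. hamming_dist V e z y < \<delta>'"
    using cov_hamming_attained[OF cm V \<open>0 < \<delta>'\<close> Z] by blast
  have "\<forall>z\<in>Z. \<exists>y. y \<in> F \<and> hamming_dist V e z y < \<delta>'" using F(4) by blast
  from bchoice[OF this] obtain p where p: "\<And>z. z \<in> Z \<Longrightarrow> p z \<in> F"
    "\<And>z. z \<in> Z \<Longrightarrow> hamming_dist V e z (p z) < \<delta>'" by blast
  have "cov \<delta> W D \<le> card F"
  proof (rule cov_le_partition(1)[where c = "\<lambda>w. p (\<Phi> w)"])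
    fix w w' assume w: "w \<in> W" "w' \<in> W" and eq: "p (\<Phi> w) = p (\<Phi> w')"
    have Z': "\<Phi> w \<in> Z" "\<Phi> w' \<in> Z" using w \<Phi> by auto
    then have "p (\<Phi> w) \<in> PiE V (\<lambda>_. Y)" using p(1) F(3) Z by blast
    then have "hamming_dist V e (\<Phi> w) (\<Phi> w') \<le> hamming_dist V e (\<Phi> w) (p (\<Phi> w)) + hamming_dist V e (p (\<Phi> w)) (\<Phi> w')"
      using Z' Z by (intro hamming_triangle[OF cm]) auto
    also have "\<dots> < 2 * \<delta>'"
      using p(2)[OF Z'(1)] p(2)[OF Z'(2)] eq hamming_commute[OF cm, of V "p (\<Phi> w)" "\<Phi> w'"] by simp
    finally show "D w w' < \<delta>" by (rule close[OF w])
  qed (use F p \<Phi> in auto)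
  then show ?thesis using F by simp
qed

section \<open>Density of the algebra in the space of integrable functions\<close>

context
  fixes X :: "'a set" and d :: "'a \<Rightarrow> 'a \<Rightarrow> real" and \<mu> :: "('g::countable \<Rightarrow> 'a) measure"
  assumes cm: "compact_metric X d" and mu: "\<mu> \<in> Prob UNIV X d"
begin

lemma mu_prob: "prob_space \<mu>" and sets_mu: "sets \<mu> = sets (config_algebra UNIV X d)"
  and space_mu: "x \<in> space \<mu> \<longleftrightarrow> (\<forall>g. x g \<in> X)"
  using ProbD[OF mu compact_metric_space[OF cm]] space_Prob_UNIV[OF mu compact_metric_space[OF cm]] by auto

text \<open>The bounds \<open>0 \<le> r \<le> 1\<close> survive complements and unions, and they make the approximants built in \<open>L1_density\<close>
uniformly bounded.\<close>

definition approximable :: "('g \<Rightarrow> 'a) set \<Rightarrow> bool" where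
  "approximable A \<longleftrightarrow> A \<in> sets \<mu> \<and>
     (\<forall>\<epsilon>>0. \<exists>r. r \<in> tests X d \<and> (\<forall>x. 0 \<le> r x \<and> r x \<le> 1) \<and> (\<integral>x. \<bar>r x - indicator A x\<bar> \<partial>\<mu>) < \<epsilon>)"

lemma tests_int: "r \<in> tests X d \<Longrightarrow> integrable \<mu> r"
  by (rule tests_integrable[OF cm _ mu])

lemma approximableD:
  assumes "approximable A" "0 < \<epsilon>"
  obtains r where "r \<in> tests X d" "\<And>x. 0 \<le> r x" "\<And>x. r x \<le> 1" "(\<integral>x. \<bar>r x - indicator A x\<bar> \<partial>\<mu>) < \<epsilon>"
  using assms unfolding approximable_def by meson

lemma indicator_int: "A \<in> sets \<mu> \<Longrightarrow> integrable \<mu> (indicator A :: _ \<Rightarrow> real)"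
proof -
  interpret prob_space \<mu> by (rule mu_prob)
  show "A \<in> sets \<mu> \<Longrightarrow> integrable \<mu> (indicator A :: _ \<Rightarrow> real)"
    by (rule integrable_real_indicator) (simp_all add: emeasure_eq_measure)
qed

lemma approximable_compl:
  assumes A: "approximable A" shows "approximable (space \<mu> - A)"
  unfolding approximable_def
proof (intro conjI allI impI)
  show "space \<mu> - A \<in> sets \<mu>" using A by (auto simp: approximable_def)
  fix \<epsilon> :: real assume "0 < \<epsilon>"
  from approximableD[OF A this] obtain r where r: "r \<in> tests X d" "\<And>x. 0 \<le> r x" "\<And>x. r x \<le> 1"
    "(\<integral>x. \<bar>r x - indicator A x\<bar> \<partial>\<mu>) < \<epsilon>" by blast
  have "(\<integral>x. \<bar>(1 - r x) - indicator (space \<mu> - A) x\<bar> \<partial>\<mu>) = (\<integral>x. \<bar>r x - indicator A x\<bar> \<partial>\<mu>)"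
    by (intro Bochner_Integration.integral_cong) (auto simp: indicator_def)
  moreover have "(\<lambda>x. 1 - r x) \<in> tests X d" using r(1) by (auto intro: continuous_intros)
  ultimately show "\<exists>r. r \<in> tests X d \<and> (\<forall>x. 0 \<le> r x \<and> r x \<le> 1) \<and> (\<integral>x. \<bar>r x - indicator (space \<mu> - A) x\<bar> \<partial>\<mu>) < \<epsilon>"
    using r by (intro exI[of _ "\<lambda>x. 1 - r x"]) auto
qed

lemma approximable_Un:
  assumes A: "approximable A" and B: "approximable B" shows "approximable (A \<union> B)"
  unfolding approximable_def
proof (intro conjI allI impI)
  show AB: "A \<union> B \<in> sets \<mu>" using A B by (auto simp: approximable_def)
  have AB': "A \<in> sets \<mu>" "B \<in> sets \<mu>" using A B by (auto simp: approximable_def)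
  fix \<epsilon> :: real assume "0 < \<epsilon>"
  then have e: "0 < \<epsilon>/2" by simp
  from approximableD[OF A e] obtain r where r: "r \<in> tests X d" "\<And>x. 0 \<le> r x" "\<And>x. r x \<le> 1"
    "(\<integral>x. \<bar>r x - indicator A x\<bar> \<partial>\<mu>) < \<epsilon>/2" by blast
  from approximableD[OF B e] obtain s where s: "s \<in> tests X d" "\<And>x. 0 \<le> s x" "\<And>x. s x \<le> 1"
    "(\<integral>x. \<bar>s x - indicator B x\<bar> \<partial>\<mu>) < \<epsilon>/2" by blast
  have rs: "(\<lambda>x. max (r x) (s x)) \<in> tests X d" using r(1) s(1) by (auto intro: continuous_map_real_max)
  note int = tests_int[OF rs] tests_int[OF r(1)] tests_int[OF s(1)] indicator_int[OF AB] indicator_int[OF AB'(1)] indicator_int[OF AB'(2)]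
  have "(\<integral>x. \<bar>max (r x) (s x) - indicator (A \<union> B) x\<bar> \<partial>\<mu>) \<le> (\<integral>x. \<bar>r x - indicator A x\<bar> + \<bar>s x - indicator B x\<bar> \<partial>\<mu>)"
  proof (rule integral_mono)
    fix x
    show "\<bar>max (r x) (s x) - indicator (A \<union> B) x\<bar> \<le> \<bar>r x - indicator A x\<bar> + \<bar>s x - indicator B x\<bar>"
      using r(2,3)[of x] s(2,3)[of x] by (auto simp: indicator_def max_def abs_if)
  qed (use int in \<open>auto intro!: integrable_abs Bochner_Integration.integrable_diff Bochner_Integration.integrable_add\<close>)
  also have "\<dots> = (\<integral>x. \<bar>r x - indicator A x\<bar> \<partial>\<mu>) + (\<integral>x. \<bar>s x - indicator B x\<bar> \<partial>\<mu>)"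
    using int by (intro Bochner_Integration.integral_add) auto
  also have "\<dots> < \<epsilon>" using r s by simp
  finally show "\<exists>r. r \<in> tests X d \<and> (\<forall>x. 0 \<le> r x \<and> r x \<le> 1) \<and> (\<integral>x. \<bar>r x - indicator (A \<union> B) x\<bar> \<partial>\<mu>) < \<epsilon>"
    using rs r s by (intro exI[of _ "\<lambda>x. max (r x) (s x)"]) (auto simp: max_def)
qed

lemma approximable_limit:
  assumes A: "\<And>n::nat. approximable (A n)" and B: "B \<in> sets \<mu>"
    and lim: "\<And>x. x \<in> space \<mu> \<Longrightarrow> (\<lambda>n. indicator (A n) x :: real) \<longlonglongrightarrow> indicator B x"
  shows "approximable B"
  unfolding approximable_def
proof (intro conjI allI impI B)
  interpret prob_space \<mu> by (rule mu_prob)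
  have An: "A n \<in> sets \<mu>" for n using A by (auto simp: approximable_def)
  fix \<epsilon> :: real assume e: "0 < \<epsilon>"
  have "(\<lambda>n. (\<integral>x. \<bar>indicator (A n) x - indicator B x :: real\<bar> \<partial>\<mu>)) \<longlonglongrightarrow> (\<integral>x. 0 \<partial>\<mu>)"
  proof (rule integral_dominated_convergence[where w = "\<lambda>_. 1"])
    show "AE x in \<mu>. (\<lambda>n. \<bar>indicator (A n) x - indicator B x\<bar> :: real) \<longlonglongrightarrow> 0"
    proof (rule AE_I2)
      fix x assume "x \<in> space \<mu>"
      from tendsto_diff[OF lim[OF this] tendsto_const[of "indicator B x"]]
      show "(\<lambda>n. \<bar>indicator (A n) x - indicator B x\<bar> :: real) \<longlonglongrightarrow> 0"
        using tendsto_rabs_zero by fastforce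
    qed
    show "AE x in \<mu>. norm \<bar>indicator (A n) x - indicator B x :: real\<bar> \<le> 1" for n
      by (auto simp: indicator_def)
  qed (use An B in auto)
  then have "\<forall>\<^sub>F n in sequentially. (\<integral>x. \<bar>indicator (A n) x - indicator B x :: real\<bar> \<partial>\<mu>) < \<epsilon>/2"
    using e by (intro order_tendstoD(2)[where y = "\<integral>x. 0 \<partial>\<mu>"]) auto
  then obtain n where n: "(\<integral>x. \<bar>indicator (A n) x - indicator B x\<bar> \<partial>\<mu>) < \<epsilon>/2" by (auto simp: eventually_sequentially)
  from approximableD[OF A, of "\<epsilon>/2" n] e obtain r where r: "r \<in> tests X d" "\<And>x. 0 \<le> r x" "\<And>x. r x \<le> 1"
    "(\<integral>x. \<bar>r x - indicator (A n) x\<bar> \<partial>\<mu>) < \<epsilon>/2" by auto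
  note int = tests_int[OF r(1)] indicator_int[OF An[of n]] indicator_int[OF B]
  have "(\<integral>x. \<bar>r x - indicator B x\<bar> \<partial>\<mu>) \<le> (\<integral>x. \<bar>r x - indicator (A n) x\<bar> + \<bar>indicator (A n) x - indicator B x\<bar> \<partial>\<mu>)"
    using int by (intro integral_mono) auto
  also have "\<dots> = (\<integral>x. \<bar>r x - indicator (A n) x\<bar> \<partial>\<mu>) + (\<integral>x. \<bar>indicator (A n) x - indicator B x\<bar> \<partial>\<mu>)"
    using int by (intro Bochner_Integration.integral_add) auto
  also have "\<dots> < \<epsilon>" using r n by simp
  finally show "\<exists>r. r \<in> tests X d \<and> (\<forall>x. 0 \<le> r x \<and> r x \<le> 1) \<and> (\<integral>x. \<bar>r x - indicator B x\<bar> \<partial>\<mu>) < \<epsilon>"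
    using r by (intro exI[of _ r]) auto
qed

lemma approximable_UN:
  assumes A: "range (A :: nat \<Rightarrow> _) \<subseteq> Collect approximable" shows "approximable (\<Union>n. A n)"
proof (rule approximable_limit)
  show "approximable (\<Union>k\<in>{..n}. A k)" for n :: nat
  proof (induction n)
    case 0 then show ?case using A by auto
  next
    case (Suc n)
    have "(\<Union>k\<in>{..Suc n}. A k) = (\<Union>k\<in>{..n}. A k) \<union> A (Suc n)" by (auto simp: atMost_Suc)
    moreover have "approximable (A (Suc n))" using A by blast
    ultimately show ?case using approximable_Un[OF Suc] by simp
  qed
  show "(\<Union>n. A n) \<in> sets \<mu>" using A by (intro sets.countable_UN) (auto simp: approximable_def)
  fix x
  have "(\<lambda>n. indicator (\<Union>k\<in>{..n}. A k) x :: real) \<longlonglongrightarrow> indicator (\<Union>n. \<Union>k\<in>{..n}. A k) x"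
    by (rule LIMSEQ_indicator_incseq) (fastforce simp: incseq_def)
  moreover have "(\<Union>n. \<Union>k\<in>{..n}. A k) = (\<Union>n. A n)" by auto
  ultimately show "(\<lambda>n. indicator (\<Union>k\<in>{..n}. A k) x :: real) \<longlonglongrightarrow> indicator (\<Union>n. A n) x" by simp
qed

text \<open>Steep continuous ramps converge pointwise to the indicator of an open ball.\<close>

lemma approximable_ball:
  assumes q: "q \<in> X" shows "approximable {x \<in> space \<mu>. d (x g) q < a}"
  unfolding approximable_def
proof (intro conjI allI impI)
  interpret prob_space \<mu> by (rule mu_prob)
  have dm: "(\<lambda>x. d (x g) q) \<in> borel_measurable \<mu>"
    using dist_algebra_measurable[OF cm dist_algebra.coord[OF q]] by (simp cong: measurable_cong_sets add: sets_mu)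
  show B: "{x \<in> space \<mu>. d (x g) q < a} \<in> sets \<mu>" (is "?B \<in> _") using dm by measurable
  fix \<epsilon> :: real assume e: "0 < \<epsilon>"
  define r where "r n x = min 1 (max 0 (real n * (a - d (x g) q)))" for n and x :: "'g \<Rightarrow> 'a"
  have r: "r n \<in> tests X d" for n
  proof -
    have "(\<lambda>x. d (x g) q) \<in> tests X d" by (rule dist_algebra_tests[OF cm dist_algebra.coord[OF q]])
    then show ?thesis unfolding r_def
      by (auto intro!: continuous_map_real_min continuous_map_real_max continuous_intros)
  qed
  have rm: "r n \<in> borel_measurable \<mu>" for n using tests_int[OF r] by auto
  have "(\<lambda>n. (\<integral>x. \<bar>r n x - indicator ?B x\<bar> \<partial>\<mu>)) \<longlonglongrightarrow> (\<integral>x. 0 \<partial>\<mu>)"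
  proof (rule integral_dominated_convergence[where w = "\<lambda>_. 1"])
    show "AE x in \<mu>. (\<lambda>n. \<bar>r n x - indicator ?B x\<bar>) \<longlonglongrightarrow> 0"
    proof (rule AE_I2)
      fix x assume x: "x \<in> space \<mu>"
      have "\<forall>\<^sub>F n in sequentially. \<bar>r n x - indicator ?B x\<bar> = 0"
      proof (cases "d (x g) q < a")
        case True
        obtain N :: nat where N: "1 / (a - d (x g) q) < real N" using reals_Archimedean2 by blast
        have "\<bar>r n x - indicator ?B x\<bar> = 0" if "N \<le> n" for n
        proof -
          have "1 / (a - d (x g) q) < real n" using N that by linarith
          then have "1 < real n * (a - d (x g) q)" using True by (simp add: pos_divide_less_eq)
          then show ?thesis using x True by (simp add: r_def)
        qed
        then show ?thesis by (auto simp: eventually_sequentially)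
      next
        case False
        then have "real n * (a - d (x g) q) \<le> 0" for n by (simp add: mult_nonneg_nonpos)
        then show ?thesis using False by (simp add: r_def)
      qed
      then show "(\<lambda>n. \<bar>r n x - indicator ?B x\<bar>) \<longlonglongrightarrow> 0" by (rule tendsto_eventually)
    qed
    show "AE x in \<mu>. norm \<bar>r n x - indicator ?B x\<bar> \<le> 1" for n
      by (auto simp: indicator_def r_def)
  qed (use rm B in auto)
  then have "\<forall>\<^sub>F n in sequentially. (\<integral>x. \<bar>r n x - indicator ?B x\<bar> \<partial>\<mu>) < \<epsilon>"
    using e by (intro order_tendstoD(2)[where y = "\<integral>x. 0 \<partial>\<mu>"]) auto
  then obtain n where n: "(\<integral>x. \<bar>r n x - indicator ?B x\<bar> \<partial>\<mu>) < \<epsilon>" by (auto simp: eventually_sequentially)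
  then show "\<exists>r. r \<in> tests X d \<and> (\<forall>x. 0 \<le> r x \<and> r x \<le> 1) \<and> (\<integral>x. \<bar>r x - indicator ?B x\<bar> \<partial>\<mu>) < \<epsilon>"
    using r by (intro exI[of _ "r n"]) (auto simp: r_def)
qed

text \<open>The approximable sets form a sigma-algebra for which every coordinate is measurable, because of the balls;
hence it contains the product algebra.\<close>

lemma approximable_sets: 
  assumes "A \<in> sets \<mu>" shows "approximable A"
proof -
  interpret prob_space \<mu> by (rule mu_prob)
  let ?N = "sigma (space \<mu>) (Collect approximable)"
  have sub: "Collect approximable \<subseteq> Pow (space \<mu>)"
    unfolding approximable_def using sets.sets_into_space by blast
  have sa: "sigma_algebra (space \<mu>) (Collect approximable)"
  proof (rule sigma_algebra_iff2[THEN iffD2], intro conjI ballI allI impI)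
    show "Collect approximable \<subseteq> Pow (space \<mu>)" by (rule sub)
    show "{} \<in> Collect approximable"
      by (auto simp: approximable_def intro!: exI[of _ "\<lambda>_. 0"])
  qed (use approximable_compl approximable_UN in auto)
  then have sN: "sets ?N = Collect approximable" by (rule sigma_algebra.sets_measure_of_eq)
  have spN: "space ?N = space \<mu>" by (rule space_measure_of[OF sub])
  have coord: "(\<lambda>x. x g) \<in> measurable ?N (borel_of (metric_top X d))" for g
  proof (rule measurable_into_metric[OF cm])
    show "(\<lambda>x. x g) \<in> space ?N \<rightarrow> X" using space_mu spN by auto
    fix q assume "q \<in> X"
    then have "approximable {x \<in> space \<mu>. d (x g) q < a}" for a by (rule approximable_ball)
    then show "(\<lambda>x. d (x g) q) \<in> borel_measurable ?N"
      unfolding borel_measurable_iff_less spN sN by simp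
  qed
  have "(\<lambda>x. \<lambda>g\<in>UNIV. x g) \<in> measurable ?N (config_algebra UNIV X d)"
    unfolding config_algebra_def by (intro measurable_restrict coord)
  then have id: "(\<lambda>x. x) \<in> measurable ?N (config_algebra UNIV X d)" by (simp add: restrict_def)
  have "(\<lambda>x. x) -` A \<inter> space ?N \<in> sets ?N"
    by (rule measurable_sets[OF id]) (use assms sets_mu in simp)
  then have "A \<inter> space \<mu> \<in> Collect approximable" using spN sN by simp
  moreover have "A \<inter> space \<mu> = A" using sets.sets_into_space[OF assms] by blast
  ultimately show ?thesis by simp
qed

text \<open>A bounded function is cut into \<open>n\<close> horizontal layers of height \<open>C / n\<close>; each layer is a set, approximated by a
test function. The uniform bound on the approximant is kept because \<open>algebra_substitution\<close> multiplies approximants.\<close>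

theorem L1_density:
  assumes u: "u \<in> borel_measurable \<mu>" and C: "0 < C" "\<And>x. x \<in> space \<mu> \<Longrightarrow> 0 \<le> u x \<and> u x \<le> C" and \<epsilon>: "0 < \<epsilon>"
  obtains r where "r \<in> dist_algebra X d" "(\<integral>x. \<bar>r x - u x\<bar> \<partial>\<mu>) < \<epsilon>" "\<And>x. \<forall>g. x g \<in> X \<Longrightarrow> \<bar>r x\<bar> \<le> C + 1"
proof -
  interpret prob_space \<mu> by (rule mu_prob)
  obtain n :: nat where n0: "3 * C / \<epsilon> < real n" using reals_Archimedean2 by blast
  have n: "0 < real n" using n0 C(1) \<epsilon> by (smt (verit) divide_pos_pos mult_pos_pos)
  have nC: "C / real n < \<epsilon> / 3" using n0 n \<epsilon> by (simp add: field_simps)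
  define A where "A k = {x \<in> space \<mu>. real k * C / real n \<le> u x}" for k :: nat
  have A: "A k \<in> sets \<mu>" for k unfolding A_def using u by measurable
  have e3: "0 < \<epsilon> / (3 * C)" using \<epsilon> C by simp
  have "\<forall>k. \<exists>r. r \<in> tests X d \<and> (\<forall>x. 0 \<le> r x \<and> r x \<le> 1) \<and> (\<integral>x. \<bar>r x - indicator (A k) x\<bar> \<partial>\<mu>) < \<epsilon> / (3 * C)"
    using approximable_sets[OF A] e3 unfolding approximable_def by meson
  from choice[OF this] obtain r where r0: "\<forall>k. r k \<in> tests X d \<and> (\<forall>x. 0 \<le> r k x \<and> r k x \<le> 1) \<and>
    (\<integral>x. \<bar>r k x - indicator (A k) x\<bar> \<partial>\<mu>) < \<epsilon> / (3 * C)" ..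
  have r: "\<And>k. r k \<in> tests X d" "\<And>k x. 0 \<le> r k x" "\<And>k x. r k x \<le> 1"
    "\<And>k. (\<integral>x. \<bar>r k x - indicator (A k) x\<bar> \<partial>\<mu>) < \<epsilon> / (3 * C)"
    using r0 by blast+
  define s where "s x = (\<Sum>k\<in>{1..n}. (C / real n) * r k x)" for x
  define u' where "u' x = (\<Sum>k\<in>{1..n}. (C / real n) * indicator (A k) x)" for x
  have s: "s \<in> tests X d" unfolding s_def using r(1) by (auto intro!: continuous_intros)
  have sb: "0 \<le> s x \<and> s x \<le> C" for x
  proof
    show "0 \<le> s x" unfolding s_def using r(2) C n by (intro sum_nonneg mult_nonneg_nonneg) auto
    have "s x \<le> (\<Sum>k\<in>{1..n}. (C / real n) * 1)"
      unfolding s_def using r(3) C n by (intro sum_mono mult_left_mono) auto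
    then show "s x \<le> C" using n by simp
  qed
  have u'u: "\<bar>u' x - u x\<bar> \<le> C / real n" if x: "x \<in> space \<mu>" for x
  proof -
    define t where "t = u x * real n / C"
    have t: "0 \<le> t" using C(1) C(2)[OF x] n by (simp add: t_def)
    have "u x * real n \<le> C * real n" using C(2)[OF x] n by (intro mult_right_mono) auto
    then have t2: "t \<le> real n" using C(1) by (simp add: t_def pos_divide_le_eq mult.commute)
    have mem: "x \<in> A k \<longleftrightarrow> real k \<le> t" for k
      using x C(1) n by (simp add: A_def t_def field_simps)
    have "{k \<in> {1..n}. x \<in> A k} = {1..nat \<lfloor>t\<rfloor>}"
    proof -
      have "real k \<le> t \<longleftrightarrow> k \<le> nat \<lfloor>t\<rfloor>" for k :: nat using t by (simp add: le_nat_iff le_floor_iff)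
      note iff = this
      have le: "nat \<lfloor>t\<rfloor> \<le> n" using t t2 by linarith
      show ?thesis
      proof (rule set_eqI)
        fix k show "k \<in> {k \<in> {1..n}. x \<in> A k} \<longleftrightarrow> k \<in> {1..nat \<lfloor>t\<rfloor>}"
          unfolding mem mem_Collect_eq atLeastAtMost_iff iff using le by linarith
      qed
    qed
    then have "u' x = (C / real n) * real (nat \<lfloor>t\<rfloor>)"
      unfolding u'_def sum_distrib_left[symmetric]
      by (simp add: indicator_def of_bool_def sum.If_cases Int_def)
    moreover have "u x = (C / real n) * t" using C n by (simp add: t_def)
    ultimately have "u' x - u x = (C / real n) * (real (nat \<lfloor>t\<rfloor>) - t)"
      by (simp only: right_diff_distrib)
    then have "\<bar>u' x - u x\<bar> = (C / real n) * \<bar>real (nat \<lfloor>t\<rfloor>) - t\<bar>"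
      using divide_pos_pos[OF C(1) n] by (simp only: abs_mult abs_of_pos)
    also have "\<dots> \<le> (C / real n) * 1"
    proof (rule mult_left_mono)
      show "\<bar>real (nat \<lfloor>t\<rfloor>) - t\<bar> \<le> 1" using t by linarith
      show "0 \<le> C / real n" using C n by simp
    qed
    finally show ?thesis by simp
  qed
  have iA: "integrable \<mu> (\<lambda>x. indicator (A k) x :: real)" for k by (rule indicator_int[OF A])
  have iu': "integrable \<mu> u'" unfolding u'_def using iA by (intro Bochner_Integration.integrable_sum integrable_mult_right) auto
  have iu: "integrable \<mu> u" by (rule integrable_const_bound[where B = C]) (use C u in auto)
  obtain h where h: "h \<in> dist_algebra X d" "\<And>x. (\<And>g. x g \<in> X) \<Longrightarrow> \<bar>s x - h x\<bar> < min 1 (\<epsilon>/3)"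
    using tests_approx[OF cm s, of "min 1 (\<epsilon>/3)"] \<epsilon> by auto
  have h2: "\<bar>s x - h x\<bar> < min 1 (\<epsilon>/3)" if "\<forall>g. x g \<in> X" for x using h(2)[of x] that by blast
  have ih: "integrable \<mu> h" by (rule tests_int[OF dist_algebra_tests[OF cm h(1)]])
  note int = iu iu' ih tests_int[OF s] iA tests_int[OF r(1)]
  have su': "(\<integral>x. \<bar>s x - u' x\<bar> \<partial>\<mu>) \<le> \<epsilon>/3"
  proof -
    have "(\<integral>x. \<bar>s x - u' x\<bar> \<partial>\<mu>) \<le> (\<integral>x. (\<Sum>k\<in>{1..n}. (C / real n) * \<bar>r k x - indicator (A k) x\<bar>) \<partial>\<mu>)"
    proof (rule integral_mono)
      show "integrable \<mu> (\<lambda>x. \<Sum>k\<in>{1..n}. (C / real n) * \<bar>r k x - indicator (A k) x\<bar>)"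
        using int by (intro Bochner_Integration.integrable_sum integrable_mult_right) auto
      fix x
      have "\<bar>s x - u' x\<bar> = \<bar>\<Sum>k\<in>{1..n}. (C / real n) * (r k x - indicator (A k) x)\<bar>"
        by (simp add: s_def u'_def sum_subtractf right_diff_distrib)
      also have "\<dots> \<le> (\<Sum>k\<in>{1..n}. \<bar>(C / real n) * (r k x - indicator (A k) x)\<bar>)" by (rule sum_abs)
      finally show "\<bar>s x - u' x\<bar> \<le> (\<Sum>k\<in>{1..n}. (C / real n) * \<bar>r k x - indicator (A k) x\<bar>)"
        using C n by (simp add: abs_mult)
    qed (use int in auto)
    also have "\<dots> = (\<Sum>k\<in>{1..n}. (C / real n) * (\<integral>x. \<bar>r k x - indicator (A k) x\<bar> \<partial>\<mu>))"
      using int by (subst Bochner_Integration.integral_sum) auto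
    also have "\<dots> \<le> (\<Sum>k\<in>{1..n}. (C / real n) * (\<epsilon> / (3 * C)))"
      using C n by (intro sum_mono mult_left_mono less_imp_le[OF r(4)]) auto
    also have "\<dots> = \<epsilon>/3" using C n by simp
    finally show ?thesis .
  qed
  have "(\<integral>x. \<bar>h x - u x\<bar> \<partial>\<mu>) \<le> (\<integral>x. (\<epsilon>/3 + \<bar>s x - u' x\<bar>) + C / real n \<partial>\<mu>)"
  proof (rule integral_mono)
    fix x assume x: "x \<in> space \<mu>"
    have "\<forall>g. x g \<in> X" using x space_mu by simp
    from h2[OF this] have "\<bar>h x - s x\<bar> \<le> \<epsilon>/3" by (simp add: abs_minus_commute)
    then show "\<bar>h x - u x\<bar> \<le> (\<epsilon>/3 + \<bar>s x - u' x\<bar>) + C / real n" using u'u[OF x] by linarith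
  qed (use int in auto)
  also have "\<dots> = \<epsilon>/3 + (\<integral>x. \<bar>s x - u' x\<bar> \<partial>\<mu>) + C / real n"
    using int by (simp add: prob_space)
  also have "\<dots> < \<epsilon>" using su' nC by linarith
  finally have "(\<integral>x. \<bar>h x - u x\<bar> \<partial>\<mu>) < \<epsilon>" .
  then show thesis
  proof (rule that[OF h(1)])
    fix x :: "'g \<Rightarrow> 'a" assume "\<forall>g. x g \<in> X"
    from h2[OF this] have "\<bar>s x - h x\<bar> < 1" by simp
    then show "\<bar>h x\<bar> \<le> C + 1" using sb[of x] by linarith
  qed
qed

end

section \<open>Product processes\<close>

text \<open>The normalisation matches \<open>pair_dist\<close>, so that the square of a process is its product with itself.\<close>

definition avg_dist :: "('a \<Rightarrow> 'a \<Rightarrow> real) \<Rightarrow> ('b \<Rightarrow> 'b \<Rightarrow> real) \<Rightarrow> 'a \<times> 'b \<Rightarrow> 'a \<times> 'b \<Rightarrow> real" where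
  "avg_dist d e p q = (d (fst p) (fst q) + e (snd p) (snd q)) / 2"

lemma pair_dist_avg: "pair_dist d = avg_dist d d"
  by (intro ext) (simp add: pair_dist_def avg_dist_def)

definition product_process ::
  "'a set \<Rightarrow> ('a \<Rightarrow> 'a \<Rightarrow> real) \<Rightarrow> ('g \<Rightarrow> 'a) measure \<Rightarrow> 'b set \<Rightarrow> ('b \<Rightarrow> 'b \<Rightarrow> real) \<Rightarrow> ('g \<Rightarrow> 'b) measure
    \<Rightarrow> ('g \<Rightarrow> 'a \<times> 'b) measure" where
  "product_process X d \<mu> Y e \<nu> =
     distr (\<mu> \<Otimes>\<^sub>M \<nu>) (config_algebra UNIV (X \<times> Y) (avg_dist d e)) (\<lambda>(x, y). \<lambda>i. (x i, y i))"

lemma tests_mult: "f \<in> tests Z D \<Longrightarrow> h \<in> tests Z D \<Longrightarrow> (\<lambda>z. f z * h z) \<in> tests Z D"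
  by (auto intro: continuous_intros)

context
  fixes X :: "'a set" and d and Y :: "'b set" and e
  assumes cmX: "compact_metric X d" and cmY: "compact_metric Y e"
begin

lemma metric_avg: "Metric_space (X \<times> Y) (avg_dist d e)"
proof
  interpret A: Metric_space X d by (rule compact_metric_space[OF cmX])
  interpret B: Metric_space Y e by (rule compact_metric_space[OF cmY])
  show "0 \<le> avg_dist d e p q" for p q by (simp add: avg_dist_def)
  show "avg_dist d e p q = avg_dist d e q p" for p q
    by (simp add: avg_dist_def A.commute[of "fst p"] B.commute[of "snd p"])
  show "avg_dist d e p q = 0 \<longleftrightarrow> p = q" if "p \<in> X \<times> Y" "q \<in> X \<times> Y" for p q
    using that A.nonneg[of "fst p" "fst q"] B.nonneg[of "snd p" "snd q"]
      A.zero[of "fst p" "fst q"] B.zero[of "snd p" "snd q"]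
    unfolding avg_dist_def prod_eq_iff by (auto simp: mem_Times_iff add_nonneg_eq_0_iff)
  show "avg_dist d e p r \<le> avg_dist d e p q + avg_dist d e q r"
    if "p \<in> X \<times> Y" "q \<in> X \<times> Y" "r \<in> X \<times> Y" for p q r
  proof -
    have "d (fst p) (fst r) \<le> d (fst p) (fst q) + d (fst q) (fst r)" using that by (intro A.triangle) auto
    moreover have "e (snd p) (snd r) \<le> e (snd p) (snd q) + e (snd q) (snd r)" using that by (intro B.triangle) auto
    ultimately have "d (fst p) (fst r) + e (snd p) (snd r) \<le>
      (d (fst p) (fst q) + e (snd p) (snd q)) + (d (fst q) (fst r) + e (snd q) (snd r))" by linarith
    then show ?thesis unfolding avg_dist_def add_divide_distrib[symmetric] by (rule divide_right_mono) simp
  qed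
qed

text \<open>The identity from the product topology to the metric topology is continuous, and images of compact sets are compact.\<close>

lemma compact_avg: "compact_metric (X \<times> Y) (avg_dist d e)"
proof -
  interpret A: Metric_space X d by (rule compact_metric_space[OF cmX])
  interpret B: Metric_space Y e by (rule compact_metric_space[OF cmY])
  interpret P: Metric_space "X \<times> Y" "avg_dist d e" by (rule metric_avg)
  have "continuous_map (prod_topology A.mtopology B.mtopology) P.mtopology (\<lambda>p. p)"
    unfolding P.continuous_map_to_metric
  proof (intro ballI allI impI)
    fix p and \<epsilon> :: real assume p: "p \<in> topspace (prod_topology A.mtopology B.mtopology)" and \<epsilon>: "0 < \<epsilon>"
    let ?U = "A.mball (fst p) \<epsilon> \<times> B.mball (snd p) \<epsilon>"
    have "openin (prod_topology A.mtopology B.mtopology) ?U" by (simp add: openin_prod_Times_iff)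
    moreover have "p \<in> ?U" using p \<epsilon> by (auto simp: mem_Times_iff)
    moreover have "q \<in> P.mball p \<epsilon>" if "q \<in> ?U" for q
      using that by (auto simp: mem_Times_iff avg_dist_def)
    ultimately show "\<exists>U. openin (prod_topology A.mtopology B.mtopology) U \<and> p \<in> U \<and> (\<forall>q\<in>U. q \<in> P.mball p \<epsilon>)" by blast
  qed
  moreover have "compactin (prod_topology A.mtopology B.mtopology) (X \<times> Y)"
    using cmX cmY compact_space_prod_topology[of A.mtopology B.mtopology] by (auto simp: compact_metric_def compact_space_def)
  ultimately have "compactin P.mtopology ((\<lambda>p. p) ` (X \<times> Y))" by (rule image_compactin[rotated])
  then show ?thesis using metric_avg by (simp add: compact_metric_def compact_space_def)
qed

text \<open>Distances in the product alphabet are sums of coordinate distances, so \<open>measurable_into_metric\<close> applies.\<close>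

lemma config_product_coord:
  assumes "i \<in> I"
  shows "(\<lambda>p. (fst p i, snd p i)) \<in> measurable (config_algebra I X d \<Otimes>\<^sub>M config_algebra I Y e)
     (borel_of (metric_top (X \<times> Y) (avg_dist d e)))"
proof (rule measurable_into_metric[OF compact_avg])
  have fm: "(\<lambda>p. fst p i) \<in> measurable (config_algebra I X d \<Otimes>\<^sub>M config_algebra I Y e) (borel_of (metric_top X d))"
    by (rule measurable_compose[OF measurable_fst measurable_config_coord[OF assms]])
  have sm: "(\<lambda>p. snd p i) \<in> measurable (config_algebra I X d \<Otimes>\<^sub>M config_algebra I Y e) (borel_of (metric_top Y e))"
    by (rule measurable_compose[OF measurable_snd measurable_config_coord[OF assms]])
  show "(\<lambda>p. (fst p i, snd p i)) \<in> space (config_algebra I X d \<Otimes>\<^sub>M config_algebra I Y e) \<rightarrow> X \<times> Y"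
    using measurable_space[OF fm] measurable_space[OF sm]
    by (auto simp: topspace_metric_top compact_metric_space cmX cmY)
  fix q assume q: "q \<in> X \<times> Y"
  have "(\<lambda>p. d (fst p i) (fst q)) \<in> borel_measurable (config_algebra I X d \<Otimes>\<^sub>M config_algebra I Y e)"
    by (rule measurable_compose[OF fm continuous_map_measurable_borel_of[OF continuous_map_dist[OF cmX]]]) (use q in auto)
  moreover have "(\<lambda>p. e (snd p i) (snd q)) \<in> borel_measurable (config_algebra I X d \<Otimes>\<^sub>M config_algebra I Y e)"
    by (rule measurable_compose[OF sm continuous_map_measurable_borel_of[OF continuous_map_dist[OF cmY]]]) (use q in auto)
  ultimately show "(\<lambda>p. avg_dist d e (fst p i, snd p i) q) \<in> borel_measurable (config_algebra I X d \<Otimes>\<^sub>M config_algebra I Y e)"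
    unfolding avg_dist_def by simp
qed

lemma config_product_measurable:
  "(\<lambda>(x, y). \<lambda>i\<in>I. (x i, y i)) \<in> measurable (config_algebra I X d \<Otimes>\<^sub>M config_algebra I Y e)
     (config_algebra I (X \<times> Y) (avg_dist d e))"
proof -
  have "(\<lambda>p. \<lambda>i\<in>I. (fst p i, snd p i)) \<in> measurable (config_algebra I X d \<Otimes>\<^sub>M config_algebra I Y e)
     (config_algebra I (X \<times> Y) (avg_dist d e))"
    unfolding config_algebra_def[of I "X \<times> Y"]
    by (intro measurable_restrict config_product_coord)
  then show ?thesis by (simp add: case_prod_beta')
qed

lemma continuous_fst_avg: "continuous_map (metric_top (X \<times> Y) (avg_dist d e)) (metric_top X d) fst"
proof -
  interpret P: Metric_space "X \<times> Y" "avg_dist d e" by (rule metric_avg)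
  show ?thesis unfolding P.metric_continuous_map[OF compact_metric_space[OF cmX]]
  proof (intro conjI ballI allI impI)
    fix p and \<epsilon> :: real assume "p \<in> X \<times> Y" "0 < \<epsilon>"
    show "\<exists>\<delta>>0. \<forall>q. q \<in> X \<times> Y \<and> avg_dist d e p q < \<delta> \<longrightarrow> d (fst p) (fst q) < \<epsilon>"
    proof (intro exI[of _ "\<epsilon>/2"] conjI allI impI)
      fix q assume "q \<in> X \<times> Y \<and> avg_dist d e p q < \<epsilon>/2"
      then show "d (fst p) (fst q) < \<epsilon>"
        using compact_metric_nonneg[OF cmY, of "snd p" "snd q"] by (simp add: avg_dist_def)
    qed (use \<open>0 < \<epsilon>\<close> in simp)
  qed auto
qed

lemma continuous_snd_avg: "continuous_map (metric_top (X \<times> Y) (avg_dist d e)) (metric_top Y e) snd"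
proof -
  interpret P: Metric_space "X \<times> Y" "avg_dist d e" by (rule metric_avg)
  show ?thesis unfolding P.metric_continuous_map[OF compact_metric_space[OF cmY]]
  proof (intro conjI ballI allI impI)
    fix p and \<epsilon> :: real assume "p \<in> X \<times> Y" "0 < \<epsilon>"
    show "\<exists>\<delta>>0. \<forall>q. q \<in> X \<times> Y \<and> avg_dist d e p q < \<delta> \<longrightarrow> e (snd p) (snd q) < \<epsilon>"
    proof (intro exI[of _ "\<epsilon>/2"] conjI allI impI)
      fix q assume "q \<in> X \<times> Y \<and> avg_dist d e p q < \<epsilon>/2"
      then show "e (snd p) (snd q) < \<epsilon>"
        using compact_metric_nonneg[OF cmX, of "fst p" "fst q"] by (simp add: avg_dist_def)
    qed (use \<open>0 < \<epsilon>\<close> in simp)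
  qed auto
qed

lemma tests_fst:
  assumes "f \<in> tests X d" shows "(\<lambda>z. f (\<lambda>g. fst (z g))) \<in> tests (X \<times> Y) (avg_dist d e)"
proof -
  have "continuous_map (configs (X \<times> Y) (avg_dist d e)) (configs X d) (\<lambda>z g. fst (z g))"
    unfolding continuous_map_componentwise_UNIV
  proof
    fix g
    show "continuous_map (configs (X \<times> Y) (avg_dist d e)) (metric_top X d) (\<lambda>z. fst (z g))"
      using continuous_map_compose[OF continuous_map_product_projection[OF UNIV_I, of "\<lambda>_. metric_top (X \<times> Y) (avg_dist d e)" g] continuous_fst_avg]
      by (simp add: o_def)
  qed
  from continuous_map_compose[OF this, of euclideanreal f] assms show ?thesis by (simp add: o_def)
qed

lemma tests_snd:
  assumes "f \<in> tests Y e" shows "(\<lambda>z. f (\<lambda>g. snd (z g))) \<in> tests (X \<times> Y) (avg_dist d e)"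
proof -
  have "continuous_map (configs (X \<times> Y) (avg_dist d e)) (configs Y e) (\<lambda>z g. snd (z g))"
    unfolding continuous_map_componentwise_UNIV
  proof
    fix g
    show "continuous_map (configs (X \<times> Y) (avg_dist d e)) (metric_top Y e) (\<lambda>z. snd (z g))"
      using continuous_map_compose[OF continuous_map_product_projection[OF UNIV_I, of "\<lambda>_. metric_top (X \<times> Y) (avg_dist d e)" g] continuous_snd_avg]
      by (simp add: o_def)
  qed
  from continuous_map_compose[OF this, of euclideanreal f] assms show ?thesis by (simp add: o_def)
qed

context
  fixes \<mu> :: "('g::countable \<Rightarrow> 'a) measure" and \<nu> :: "('g \<Rightarrow> 'b) measure"
  assumes mu: "\<mu> \<in> Prob UNIV X d" and nu: "\<nu> \<in> Prob UNIV Y e"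
begin

lemma pairing_measurable:
  "(\<lambda>(x, y). \<lambda>i. (x i, y i)) \<in> measurable (\<mu> \<Otimes>\<^sub>M \<nu>) (config_algebra UNIV (X \<times> Y) (avg_dist d e))"
proof -
  have "sets \<mu> = sets (config_algebra UNIV X d)" "sets \<nu> = sets (config_algebra UNIV Y e)"
    using ProbD(2)[OF mu compact_metric_space[OF cmX]] ProbD(2)[OF nu compact_metric_space[OF cmY]] by auto
  then have s: "sets (\<mu> \<Otimes>\<^sub>M \<nu>) = sets (config_algebra UNIV X d \<Otimes>\<^sub>M config_algebra UNIV Y e)" by (rule sets_pair_measure_cong)
  have "(\<lambda>(x, y). \<lambda>i\<in>UNIV. (x i, y i)) \<in> measurable (\<mu> \<Otimes>\<^sub>M \<nu>) (config_algebra UNIV (X \<times> Y) (avg_dist d e))"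
    using config_product_measurable[of UNIV] measurable_cong_sets[OF s refl] by blast
  then show ?thesis by (simp add: restrict_def)
qed

lemma product_process_Prob: "product_process X d \<mu> Y e \<nu> \<in> Prob UNIV (X \<times> Y) (avg_dist d e)"
proof -
  interpret A: prob_space \<mu> by (rule ProbD(1)[OF mu compact_metric_space[OF cmX]])
  interpret B: prob_space \<nu> by (rule ProbD(1)[OF nu compact_metric_space[OF cmY]])
  interpret P: pair_prob_space \<mu> \<nu> ..
  show ?thesis unfolding Prob_def product_process_def
    using P.prob_space_distr[OF pairing_measurable] by simp
qed

text \<open>Independence of the two factors, in the form used for averages along models: integrals of tensors are products.\<close>

lemma integral_product_tensor:
  assumes f: "f \<in> tests X d" and u: "u \<in> tests Y e"
  shows "(\<integral>z. f (\<lambda>g. fst (z g)) * u (\<lambda>g. snd (z g)) \<partial>product_process X d \<mu> Y e \<nu>)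
    = (\<integral>x. f x \<partial>\<mu>) * (\<integral>y. u y \<partial>\<nu>)"
proof -
  interpret A: prob_space \<mu> by (rule ProbD(1)[OF mu compact_metric_space[OF cmX]])
  interpret B: prob_space \<nu> by (rule ProbD(1)[OF nu compact_metric_space[OF cmY]])
  interpret P: pair_prob_space \<mu> \<nu> ..
  have fu: "(\<lambda>z. f (\<lambda>g. fst (z g)) * u (\<lambda>g. snd (z g))) \<in> borel_measurable (config_algebra UNIV (X \<times> Y) (avg_dist d e))"
    by (rule tests_measurable[OF compact_avg tests_mult[OF tests_fst[OF f] tests_snd[OF u]]])
  have fi: "integrable \<mu> f" by (rule tests_integrable[OF cmX f mu])
  have ui: "integrable \<nu> u" by (rule tests_integrable[OF cmY u nu])
  obtain Bf where Bf: "0 < Bf" "\<And>x. (\<And>g. x g \<in> X) \<Longrightarrow> \<bar>f x\<bar> \<le> Bf" using tests_bounded[OF cmX f] by blast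
  obtain Bu where Bu: "0 < Bu" "\<And>x. (\<And>g. x g \<in> Y) \<Longrightarrow> \<bar>u x\<bar> \<le> Bu" using tests_bounded[OF cmY u] by blast
  have "(\<integral>z. f (\<lambda>g. fst (z g)) * u (\<lambda>g. snd (z g)) \<partial>product_process X d \<mu> Y e \<nu>)
     = (\<integral>p. f (fst p) * u (snd p) \<partial>(\<mu> \<Otimes>\<^sub>M \<nu>))"
    unfolding product_process_def
    by (subst integral_distr[OF pairing_measurable fu]) (simp add: case_prod_beta')
  also have "\<dots> = (\<integral>x. (\<integral>y. f x * u y \<partial>\<nu>) \<partial>\<mu>)"
  proof -
    have "integrable (\<mu> \<Otimes>\<^sub>M \<nu>) (\<lambda>p. f (fst p) * u (snd p))"
    proof (rule P.integrable_const_bound)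
      show "AE p in \<mu> \<Otimes>\<^sub>M \<nu>. norm (f (fst p) * u (snd p)) \<le> Bf * Bu"
      proof (rule AE_I2)
        fix p assume "p \<in> space (\<mu> \<Otimes>\<^sub>M \<nu>)"
        then have "\<forall>g. fst p g \<in> X" "\<forall>g. snd p g \<in> Y"
          using space_Prob_UNIV[OF mu compact_metric_space[OF cmX], of "fst p"]
            space_Prob_UNIV[OF nu compact_metric_space[OF cmY], of "snd p"]
          by (auto simp: space_pair_measure)
        then have "\<bar>f (fst p)\<bar> \<le> Bf" "\<bar>u (snd p)\<bar> \<le> Bu" using Bf(2)[of "fst p"] Bu(2)[of "snd p"] by blast+
        then show "norm (f (fst p) * u (snd p)) \<le> Bf * Bu"
          using Bf(1) by (auto simp: abs_mult intro!: mult_mono)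
      qed
      show "(\<lambda>p. f (fst p) * u (snd p)) \<in> borel_measurable (\<mu> \<Otimes>\<^sub>M \<nu>)"
        using fi ui by (intro borel_measurable_times measurable_compose[OF measurable_fst] measurable_compose[OF measurable_snd]) auto
    qed
    from P.integral_fst'[OF this] show ?thesis by simp
  qed
  also have "\<dots> = (\<integral>x. f x \<partial>\<mu>) * (\<integral>y. u y \<partial>\<nu>)" by simp
  finally show ?thesis .
qed

lemma integral_product_fst:
  assumes f: "f \<in> tests X d"
  shows "(\<integral>z. f (\<lambda>g. fst (z g)) \<partial>product_process X d \<mu> Y e \<nu>) = (\<integral>x. f x \<partial>\<mu>)"
  using integral_product_tensor[OF f, of "\<lambda>_. 1"] prob_space.prob_space[OF ProbD(1)[OF nu compact_metric_space[OF cmY]]]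
  by simp

lemma integral_product_snd:
  assumes u: "u \<in> tests Y e"
  shows "(\<integral>z. u (\<lambda>g. snd (z g)) \<partial>product_process X d \<mu> Y e \<nu>) = (\<integral>y. u y \<partial>\<nu>)"
  using integral_product_tensor[OF _ u, of "\<lambda>_. 1"] prob_space.prob_space[OF ProbD(1)[OF mu compact_metric_space[OF cmX]]]
  by simp

end
end

section \<open>Entropy rates\<close>

definition rate :: "'a set \<Rightarrow> ('a \<Rightarrow> 'a \<Rightarrow> real) \<Rightarrow> 'v set \<Rightarrow> ('g \<Rightarrow> 'v \<Rightarrow> 'v) \<Rightarrow> real \<Rightarrow> ('g \<Rightarrow> 'a) measure set \<Rightarrow> ereal" where
  "rate X d V s \<delta> \<O> = log_card (cov \<delta> (good_models X d V s \<O>) (hamming_dist V d)) / ereal (real (card V))"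

lemma process_sofic_entropy_rate:
  "process_sofic_entropy V \<sigma> X d \<mu> =
     (SUP \<delta>\<in>{0<..}. INF \<O>\<in>nbhds X d \<mu>. limsup (\<lambda>n. rate X d (V n) (\<sigma> n) \<delta> \<O>))"
  by (simp add: process_sofic_entropy_def rate_def)

lemma process_lower_sofic_entropy_rate:
  "process_lower_sofic_entropy V \<sigma> X d \<mu> =
     (SUP \<delta>\<in>{0<..}. INF \<O>\<in>nbhds X d \<mu>. liminf (\<lambda>n. rate X d (V n) (\<sigma> n) \<delta> \<O>))"
  by (simp add: process_lower_sofic_entropy_def rate_def)

lemma log_card_mono: "k \<le> l \<Longrightarrow> log_card k \<le> log_card l"
  by (auto simp: log_card_def)

lemma log_card_mult: "log_card (k * l) = log_card k + log_card l"
  by (auto simp: log_card_def ln_mult)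

lemma log_card_cases: "log_card k = -\<infinity> \<and> k = 0 \<or> (\<exists>r\<ge>0. log_card k = ereal r \<and> r = ln (real k) \<and> 0 < k)"
  by (auto simp: log_card_def)

lemma rate_mono:
  assumes "cov \<delta> (good_models X d V s \<O>) (hamming_dist V d) \<le> cov \<delta>' (good_models Y e V s' \<O>') (hamming_dist V e)"
    and "0 < card V" 
  shows "rate X d V s \<delta> \<O> \<le> rate Y e V s' \<delta>' \<O>'"
  unfolding rate_def using log_card_mono[OF assms(1)] assms(2) by (auto intro: ereal_divide_right_mono)

lemma log_card_divide_add:
  assumes "0 < c" shows "log_card (k * l) / ereal c = log_card k / ereal c + log_card l / ereal c"
  using assms log_card_cases[of k] log_card_cases[of l] unfolding log_card_mult
  by (auto simp: add_divide_distrib)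

text \<open>A covering number \<open>k \<ge> 1\<close> has \<open>ln k \<ge> 0\<close>. So an entropy that is negative comes from empty sets of
models and is already \<open>-\<infinity>\<close>.\<close>

lemma log_card_divide_less:
  assumes "0 < c" shows "log_card k / ereal c < 0 \<longleftrightarrow> k = 0"
proof (cases "k = 0")
  case False
  then have "0 \<le> ln (real k)" by (intro ln_ge_zero) simp
  then have "0 \<le> ln (real k) / c" using assms by (intro divide_nonneg_pos)
  moreover have "log_card k / ereal c = ereal (ln (real k) / c)" using False assms by (simp add: log_card_def)
  ultimately show ?thesis using False by (simp add: not_less)
qed (use assms in \<open>simp add: log_card_def\<close>)

lemma log_card_divide_fin:
  assumes "0 < c" shows "log_card k / ereal c \<noteq> \<infinity>"
  using assms log_card_cases[of k] by auto

lemma log_card_divide_gt: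
  assumes "0 < c" shows "ereal a < log_card k / ereal c \<longleftrightarrow> 0 < k \<and> a * c < ln (real k)"
  using assms log_card_cases[of k] by (auto simp: pos_less_divide_eq)

lemma log_card_divide_ge:
  assumes "0 < c" shows "ereal a \<le> log_card k / ereal c \<longleftrightarrow> 0 < k \<and> a * c \<le> ln (real k)"
  using assms log_card_cases[of k] by (auto simp: pos_le_divide_eq)

section \<open>Subadditivity\<close>

text \<open>Label a model of the product by the pair of centres nearest to its two coordinates. Two models with the same
label are within \<open>\<delta>\<close> in each coordinate, hence in the average.\<close>

lemma cov_product:
  assumes cmX: "compact_metric X d" and cmY: "compact_metric Y e" and V: "finite V" "V \<noteq> {}" and \<delta>: "0 < \<delta>"
    and W1: "W1 \<subseteq> PiE V (\<lambda>_. X)" and W2: "W2 \<subseteq> PiE V (\<lambda>_. Y)"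
    and W: "\<And>z. z \<in> W \<Longrightarrow> (\<lambda>v\<in>V. fst (z v)) \<in> W1" "\<And>z. z \<in> W \<Longrightarrow> (\<lambda>v\<in>V. snd (z v)) \<in> W2"
  shows "cov \<delta> W (hamming_dist V (avg_dist d e)) \<le> cov (\<delta>/2) W1 (hamming_dist V d) * cov (\<delta>/2) W2 (hamming_dist V e)"
proof -
  have \<delta>2: "0 < \<delta>/2" using \<delta> by simp
  obtain F where F: "finite F" "card F = cov (\<delta>/2) W1 (hamming_dist V d)" "F \<subseteq> W1"
    "\<And>z. z \<in> W1 \<Longrightarrow> \<exists>y\<in>F. hamming_dist V d z y < \<delta>/2"
    using cov_hamming_attained[OF cmX V \<delta>2 W1] by blast
  obtain H where H: "finite H" "card H = cov (\<delta>/2) W2 (hamming_dist V e)" "H \<subseteq> W2"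
    "\<And>z. z \<in> W2 \<Longrightarrow> \<exists>y\<in>H. hamming_dist V e z y < \<delta>/2"
    using cov_hamming_attained[OF cmY V \<delta>2 W2] by blast
  have "\<forall>z\<in>W1. \<exists>y. y \<in> F \<and> hamming_dist V d z y < \<delta>/2" using F(4) by blast
  from bchoice[OF this] obtain p where p: "\<And>z. z \<in> W1 \<Longrightarrow> p z \<in> F"
    "\<And>z. z \<in> W1 \<Longrightarrow> hamming_dist V d z (p z) < \<delta>/2" by blast
  have "\<forall>z\<in>W2. \<exists>y. y \<in> H \<and> hamming_dist V e z y < \<delta>/2" using H(4) by blast
  from bchoice[OF this] obtain q where q: "\<And>z. z \<in> W2 \<Longrightarrow> q z \<in> H"
    "\<And>z. z \<in> W2 \<Longrightarrow> hamming_dist V e z (q z) < \<delta>/2" by blast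
  let ?a = "\<lambda>z. \<lambda>v\<in>V. fst (z v)" and ?b = "\<lambda>z. \<lambda>v\<in>V. snd (z v)"
  have "cov \<delta> W (hamming_dist V (avg_dist d e)) \<le> card (F \<times> H)"
  proof (rule cov_le_partition(1)[where c = "\<lambda>z. (p (?a z), q (?b z))"])
    show "(\<lambda>z. (p (?a z), q (?b z))) ` W \<subseteq> F \<times> H" using W p(1) q(1) by auto
    fix w w' assume w: "w \<in> W" "w' \<in> W" and "(p (?a w), q (?b w)) = (p (?a w'), q (?b w'))"
    then have eq: "p (?a w) = p (?a w')" "q (?b w) = q (?b w')" by auto
    have pF: "p (?a w) \<in> PiE V (\<lambda>_. X)" using p(1)[OF W(1)[OF w(1)]] F(3) W1 by blast
    have qH: "q (?b w) \<in> PiE V (\<lambda>_. Y)" using q(1)[OF W(2)[OF w(1)]] H(3) W2 by blast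
    have 1: "hamming_dist V d (?a w) (?a w') \<le> hamming_dist V d (?a w) (p (?a w)) + hamming_dist V d (p (?a w)) (?a w')"
      by (rule hamming_triangle[OF cmX _ pF]) (use W(1)[OF w(1)] W(1)[OF w(2)] W1 in blast)+
    have 2: "hamming_dist V e (?b w) (?b w') \<le> hamming_dist V e (?b w) (q (?b w)) + hamming_dist V e (q (?b w)) (?b w')"
      by (rule hamming_triangle[OF cmY _ qH]) (use W(2)[OF w(1)] W(2)[OF w(2)] W2 in blast)+
    have 3: "hamming_dist V d (?a w) (?a w') < \<delta>"
      using 1 p(2)[OF W(1)[OF w(1)]] p(2)[OF W(1)[OF w(2)]] eq(1) hamming_commute[OF cmX, of V "p (?a w)" "?a w'"] by simp
    have 4: "hamming_dist V e (?b w) (?b w') < \<delta>"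
      using 2 q(2)[OF W(2)[OF w(1)]] q(2)[OF W(2)[OF w(2)]] eq(2) hamming_commute[OF cmY, of V "q (?b w)" "?b w'"] by simp
    have "hamming_dist V (avg_dist d e) w w' = (hamming_dist V d (?a w) (?a w') + hamming_dist V e (?b w) (?b w')) / 2"
      by (simp add: hamming_dist_def avg_dist_def sum.distrib sum_divide_distrib[symmetric] add_divide_distrib)
    then show "hamming_dist V (avg_dist d e) w w' < \<delta>" using 3 4 by simp
  qed (use F H in auto)
  then show ?thesis using F H by (simp add: card_cartesian_product)
qed

text \<open>A test function of one coordinate is also a test function of the pair, with the same integral.\<close>

lemma good_models_product_marginals:
  fixes \<mu> :: "('g::countable \<Rightarrow> 'a) measure" and \<nu> :: "('g \<Rightarrow> 'b) measure"
  assumes cmX: "compact_metric X d" and cmY: "compact_metric Y e"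
    and mu: "\<mu> \<in> Prob UNIV X d" and nu: "\<nu> \<in> Prob UNIV Y e"
    and O1: "\<O>1 \<in> nbhds X d \<mu>" and O2: "\<O>2 \<in> nbhds Y e \<nu>"
  obtains \<O> where "\<O> \<in> nbhds (X \<times> Y) (avg_dist d e) (product_process X d \<mu> Y e \<nu>)"
    "\<And>(V :: 'v set) s z. model_frame V s \<Longrightarrow> z \<in> good_models (X \<times> Y) (avg_dist d e) V s \<O> \<Longrightarrow>
       (\<lambda>v\<in>V. fst (z v)) \<in> good_models X d V s \<O>1 \<and> (\<lambda>v\<in>V. snd (z v)) \<in> good_models Y e V s \<O>2"
proof -
  let ?Z = "X \<times> Y" and ?D = "avg_dist d e" and ?\<zeta> = "product_process X d \<mu> Y e \<nu>"
  obtain Fs \<epsilon> where F: "finite Fs" "Fs \<subseteq> tests X d" "0 < \<epsilon>" "basic_nbhd X d \<mu> Fs \<epsilon> \<subseteq> \<O>1"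
    using nbhds_basic_tests[OF mu O1] by blast
  obtain Us \<epsilon>' where U: "finite Us" "Us \<subseteq> tests Y e" "0 < \<epsilon>'" "basic_nbhd Y e \<nu> Us \<epsilon>' \<subseteq> \<O>2"
    using nbhds_basic_tests[OF nu O2] by blast
  define A where "A = (\<lambda>f z. f (\<lambda>g::'g. fst (z g :: 'a \<times> 'b)) :: real) ` Fs"
  define B where "B = (\<lambda>f z. f (\<lambda>g::'g. snd (z g :: 'a \<times> 'b)) :: real) ` Us"
  have A: "A \<subseteq> tests ?Z ?D" unfolding A_def using F(2) tests_fst[OF cmX cmY] by blast
  have B: "B \<subseteq> tests ?Z ?D" unfolding B_def using U(2) tests_snd[OF cmX cmY] by blast
  note cmZ = compact_avg[OF cmX cmY]
  note zP = product_process_Prob[OF cmX cmY mu nu]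
  show thesis
  proof (rule that[of "basic_nbhd ?Z ?D ?\<zeta> A \<epsilon> \<inter> basic_nbhd ?Z ?D ?\<zeta> B \<epsilon>'"])
    show "basic_nbhd ?Z ?D ?\<zeta> A \<epsilon> \<inter> basic_nbhd ?Z ?D ?\<zeta> B \<epsilon>' \<in> nbhds ?Z ?D ?\<zeta>"
      using F U A B unfolding A_def B_def by (intro nbhds_Int basic_nbhd_nbhds zP) auto
    fix V :: "'v set" and s z assume fr: "model_frame V s"
      and z: "z \<in> good_models ?Z ?D V s (basic_nbhd ?Z ?D ?\<zeta> A \<epsilon> \<inter> basic_nbhd ?Z ?D ?\<zeta> B \<epsilon>')"
    have zA: "z \<in> good_models ?Z ?D V s (basic_nbhd ?Z ?D ?\<zeta> A \<epsilon>)" and zB: "z \<in> good_models ?Z ?D V s (basic_nbhd ?Z ?D ?\<zeta> B \<epsilon>')"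
      using z by (auto simp: good_models_def)
    have zE: "z \<in> PiE V (\<lambda>_. ?Z)" using z by (auto simp: good_models_def)
    have pf: "pullback_name s v (\<lambda>v\<in>V. fst (z v)) = (\<lambda>g. fst (pullback_name s v z g))"
      and ps: "pullback_name s v (\<lambda>v\<in>V. snd (z v)) = (\<lambda>g. snd (pullback_name s v z g))" if "v \<in> V" for v
      using model_frameD(5)[OF fr that] by (auto simp: pullback_name_def)
    have "(\<lambda>v\<in>V. fst (z v)) \<in> good_models X d V s (basic_nbhd X d \<mu> Fs \<epsilon>)"
      unfolding good_models_basic[OF cmX fr F(2)]
    proof (intro CollectI conjI ballI)
      show "(\<lambda>v\<in>V. fst (z v)) \<in> PiE V (\<lambda>_. X)" using zE by (auto simp: restrict_PiE_iff PiE_iff mem_Times_iff)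
      fix f assume f: "f \<in> Fs"
      have "(\<lambda>z. f (\<lambda>g. fst (z g))) \<in> A" using f by (auto simp: A_def)
      then have "\<bar>ave V (\<lambda>v. f (\<lambda>g. fst (pullback_name s v z g))) - (\<integral>z. f (\<lambda>g. fst (z g)) \<partial>?\<zeta>)\<bar> < \<epsilon>"
        using zA[unfolded good_models_basic[OF cmZ fr A], THEN CollectD, THEN conjunct2] by (rule bspec[rotated])
      moreover have "(\<integral>z. f (\<lambda>g. fst (z g)) \<partial>?\<zeta>) = (\<integral>x. f x \<partial>\<mu>)"
        using integral_product_fst[OF cmX cmY mu nu] f F(2) by blast
      moreover have "ave V (\<lambda>v. f (pullback_name s v (\<lambda>v\<in>V. fst (z v)))) = ave V (\<lambda>v. f (\<lambda>g. fst (pullback_name s v z g)))"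
        by (rule ave_cong) (simp add: pf)
      ultimately show "\<bar>ave V (\<lambda>v. f (pullback_name s v (\<lambda>v\<in>V. fst (z v)))) - (\<integral>x. f x \<partial>\<mu>)\<bar> < \<epsilon>" by simp
    qed
    moreover have "(\<lambda>v\<in>V. snd (z v)) \<in> good_models Y e V s (basic_nbhd Y e \<nu> Us \<epsilon>')"
      unfolding good_models_basic[OF cmY fr U(2)]
    proof (intro CollectI conjI ballI)
      show "(\<lambda>v\<in>V. snd (z v)) \<in> PiE V (\<lambda>_. Y)" using zE by (auto simp: restrict_PiE_iff PiE_iff mem_Times_iff)
      fix f assume f: "f \<in> Us"
      have "(\<lambda>z. f (\<lambda>g. snd (z g))) \<in> B" using f by (auto simp: B_def)
      then have "\<bar>ave V (\<lambda>v. f (\<lambda>g. snd (pullback_name s v z g))) - (\<integral>z. f (\<lambda>g. snd (z g)) \<partial>?\<zeta>)\<bar> < \<epsilon>'"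
        using zB[unfolded good_models_basic[OF cmZ fr B], THEN CollectD, THEN conjunct2] by (rule bspec[rotated])
      moreover have "(\<integral>z. f (\<lambda>g. snd (z g)) \<partial>?\<zeta>) = (\<integral>x. f x \<partial>\<nu>)"
        using integral_product_snd[OF cmX cmY mu nu] f U(2) by blast
      moreover have "ave V (\<lambda>v. f (pullback_name s v (\<lambda>v\<in>V. snd (z v)))) = ave V (\<lambda>v. f (\<lambda>g. snd (pullback_name s v z g)))"
        by (rule ave_cong) (simp add: ps)
      ultimately show "\<bar>ave V (\<lambda>v. f (pullback_name s v (\<lambda>v\<in>V. snd (z v)))) - (\<integral>x. f x \<partial>\<nu>)\<bar> < \<epsilon>'" by simp
    qed
    ultimately show "(\<lambda>v\<in>V. fst (z v)) \<in> good_models X d V s \<O>1 \<and> (\<lambda>v\<in>V. snd (z v)) \<in> good_models Y e V s \<O>2"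
      using good_models_mono[OF F(4)] good_models_mono[OF U(4)] by blast
  qed
qed

text \<open>Covering numbers multiply and the upper limit of a sum is at most the sum of the upper limits. The
value \<open>-\<infinity>\<close> needs its own case, since \<open>-\<infinity> + \<infinity> = \<infinity>\<close> for extended reals: there one factor has no good
models at all for large \<open>n\<close>, and then neither has the product.\<close>

theorem sofic_entropy_subadditive:
  fixes \<mu> :: "('g::{group_add,countable} \<Rightarrow> 'a) measure" and \<nu> :: "('g \<Rightarrow> 'b) measure"
  assumes sof: "sofic_approximation V \<sigma>" and cmX: "compact_metric X d" and cmY: "compact_metric Y e"
    and mu: "\<mu> \<in> Prob UNIV X d" and nu: "\<nu> \<in> Prob UNIV Y e"
  shows "process_sofic_entropy V \<sigma> (X \<times> Y) (avg_dist d e) (product_process X d \<mu> Y e \<nu>)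
    \<le> entropy_sum (process_sofic_entropy V \<sigma> X d \<mu>) (process_sofic_entropy V \<sigma> Y e \<nu>)" (is "?h \<le> entropy_sum ?a ?b")
proof -
  let ?Z = "X \<times> Y" and ?D = "avg_dist d e" and ?\<zeta> = "product_process X d \<mu> Y e \<nu>"
  note fr = sofic_model_frame[OF sof]
  note V = model_frameD(1,2)[OF fr]
  have main: "\<exists>\<O>\<in>nbhds ?Z ?D ?\<zeta>. \<forall>n. rate ?Z ?D (V n) (\<sigma> n) \<delta> \<O> \<le> rate X d (V n) (\<sigma> n) (\<delta>/2) \<O>1 + rate Y e (V n) (\<sigma> n) (\<delta>/2) \<O>2"
    if \<delta>: "0 < \<delta>" and O1: "\<O>1 \<in> nbhds X d \<mu>" and O2: "\<O>2 \<in> nbhds Y e \<nu>" for \<delta> \<O>1 \<O>2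
  proof -
    obtain \<O> where O: "\<O> \<in> nbhds ?Z ?D ?\<zeta>"
      "\<And>(V :: 'c set) s z. model_frame V s \<Longrightarrow> z \<in> good_models ?Z ?D V s \<O> \<Longrightarrow>
       (\<lambda>v\<in>V. fst (z v)) \<in> good_models X d V s \<O>1 \<and> (\<lambda>v\<in>V. snd (z v)) \<in> good_models Y e V s \<O>2"
      using good_models_product_marginals[OF cmX cmY mu nu O1 O2, where ?'v = 'c] by blast
    show ?thesis
    proof (intro bexI[OF _ O(1)] allI)
      fix n
      let ?k = "cov (\<delta>/2) (good_models X d (V n) (\<sigma> n) \<O>1) (hamming_dist (V n) d)"
      let ?l = "cov (\<delta>/2) (good_models Y e (V n) (\<sigma> n) \<O>2) (hamming_dist (V n) e)"
      have "cov \<delta> (good_models ?Z ?D (V n) (\<sigma> n) \<O>) (hamming_dist (V n) ?D) \<le> ?k * ?l"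
        by (rule cov_product[OF cmX cmY V \<delta>]) (use O(2)[OF fr] in \<open>auto simp: good_models_def\<close>)
      then have "rate ?Z ?D (V n) (\<sigma> n) \<delta> \<O> \<le> log_card (?k * ?l) / ereal (real (card (V n)))"
        unfolding rate_def using model_frameD(3)[OF fr, of n] by (intro ereal_divide_right_mono log_card_mono) auto
      also have "\<dots> = rate X d (V n) (\<sigma> n) (\<delta>/2) \<O>1 + rate Y e (V n) (\<sigma> n) (\<delta>/2) \<O>2"
        unfolding rate_def using model_frameD(3)[OF fr, of n] by (intro log_card_divide_add) auto
      finally show "rate ?Z ?D (V n) (\<sigma> n) \<delta> \<O> \<le> rate X d (V n) (\<sigma> n) (\<delta>/2) \<O>1 + rate Y e (V n) (\<sigma> n) (\<delta>/2) \<O>2" .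
    qed
  qed
  have pick: "\<exists>\<O>\<in>nbhds Z' D' m. limsup (\<lambda>n. rate Z' D' (V n) (\<sigma> n) \<delta> \<O>) < c"
    if "process_sofic_entropy V \<sigma> Z' D' m < c" "0 < \<delta>" for Z' D' m c \<delta>
  proof -
    have "(INF \<O>\<in>nbhds Z' D' m. limsup (\<lambda>n. rate Z' D' (V n) (\<sigma> n) \<delta> \<O>)) \<le> process_sofic_entropy V \<sigma> Z' D' m"
      unfolding process_sofic_entropy_rate using that(2) by (intro SUP_upper) auto
    also note that(1)
    finally show ?thesis by (simp only: INF_less_iff)
  qed
  have rate_fin: "rate Z' D' (V n) (\<sigma> n) \<delta> \<O> \<noteq> \<infinity>" for Z' D' n \<delta> and \<O> :: "('g \<Rightarrow> _) measure set"
    unfolding rate_def using model_frameD(3)[OF fr, of n] by (intro log_card_divide_fin) auto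
  have rate_neg: "rate Z' D' (V n) (\<sigma> n) \<delta> \<O> = -\<infinity>" if "rate Z' D' (V n) (\<sigma> n) \<delta> \<O> < 0"
    for Z' D' n \<delta> and \<O> :: "('g \<Rightarrow> _) measure set"
    using that model_frameD(3)[OF fr, of n] unfolding rate_def by (subst (asm) log_card_divide_less) (auto simp: log_card_def)
  have h_le: "?h \<le> c" if *: "\<And>\<delta>. 0 < \<delta> \<Longrightarrow> \<exists>\<O>\<in>nbhds ?Z ?D ?\<zeta>. limsup (\<lambda>n. rate ?Z ?D (V n) (\<sigma> n) \<delta> \<O>) \<le> c" for c
    unfolding process_sofic_entropy_rate
  proof (rule SUP_least)
    fix \<delta> :: real assume "\<delta> \<in> {0<..}"
    then obtain \<O> where "\<O>\<in>nbhds ?Z ?D ?\<zeta>" "limsup (\<lambda>n. rate ?Z ?D (V n) (\<sigma> n) \<delta> \<O>) \<le> c" using *[of \<delta>] by auto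
    then show "(INF \<O>\<in>nbhds ?Z ?D ?\<zeta>. limsup (\<lambda>n. rate ?Z ?D (V n) (\<sigma> n) \<delta> \<O>)) \<le> c" by (rule INF_lower2)
  qed
  have univ1: "basic_nbhd X d \<mu> {} 1 \<in> nbhds X d \<mu>"
    by (rule basic_nbhd_nbhds[OF mu]) auto
  have univ2: "basic_nbhd Y e \<nu> {} 1 \<in> nbhds Y e \<nu>"
    by (rule basic_nbhd_nbhds[OF nu]) auto
  show ?thesis
  proof (cases "?a = -\<infinity> \<or> ?b = -\<infinity>")
    case True
    have "?h \<le> -\<infinity>"
    proof (rule h_le)
      fix \<delta> :: real assume \<delta>: "0 < \<delta>"
      then have \<delta>2: "0 < \<delta>/2" by simp
      show "\<exists>\<O>\<in>nbhds ?Z ?D ?\<zeta>. limsup (\<lambda>n. rate ?Z ?D (V n) (\<sigma> n) \<delta> \<O>) \<le> -\<infinity>"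
      proof (cases "?a = -\<infinity>")
        case True
        then obtain \<O>1 where O1: "\<O>1 \<in> nbhds X d \<mu>" "limsup (\<lambda>n. rate X d (V n) (\<sigma> n) (\<delta>/2) \<O>1) < 0"
          using pick[OF _ \<delta>2, of X d \<mu> 0] by auto
        obtain \<O> where O: "\<O> \<in> nbhds ?Z ?D ?\<zeta>" "\<And>n. rate ?Z ?D (V n) (\<sigma> n) \<delta> \<O> \<le>
            rate X d (V n) (\<sigma> n) (\<delta>/2) \<O>1 + rate Y e (V n) (\<sigma> n) (\<delta>/2) (basic_nbhd Y e \<nu> {} 1)"
          using main[OF \<delta> O1(1) univ2] by blast
        have "\<forall>\<^sub>F n in sequentially. rate ?Z ?D (V n) (\<sigma> n) \<delta> \<O> \<le> -\<infinity>"
          using Limsup_lessD[OF O1(2)]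
        proof eventually_elim
          case (elim n)
          then show ?case using O(2)[of n] rate_neg[OF elim] rate_fin[of Y e n "\<delta>/2" "basic_nbhd Y e \<nu> {} 1"]
            by (cases "rate Y e (V n) (\<sigma> n) (\<delta>/2) (basic_nbhd Y e \<nu> {} 1)") auto
        qed
        then show ?thesis by (intro bexI[OF _ O(1)] Limsup_bounded)
      next
        case False
        then have "?b = -\<infinity>" using \<open>?a = -\<infinity> \<or> ?b = -\<infinity>\<close> by simp
        then obtain \<O>2 where O2: "\<O>2 \<in> nbhds Y e \<nu>" "limsup (\<lambda>n. rate Y e (V n) (\<sigma> n) (\<delta>/2) \<O>2) < 0"
          using pick[OF _ \<delta>2, of Y e \<nu> 0] by auto
        obtain \<O> where O: "\<O> \<in> nbhds ?Z ?D ?\<zeta>" "\<And>n. rate ?Z ?D (V n) (\<sigma> n) \<delta> \<O> \<le>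
            rate X d (V n) (\<sigma> n) (\<delta>/2) (basic_nbhd X d \<mu> {} 1) + rate Y e (V n) (\<sigma> n) (\<delta>/2) \<O>2"
          using main[OF \<delta> univ1 O2(1)] by blast
        have "\<forall>\<^sub>F n in sequentially. rate ?Z ?D (V n) (\<sigma> n) \<delta> \<O> \<le> -\<infinity>"
          using Limsup_lessD[OF O2(2)]
        proof eventually_elim
          case (elim n)
          then show ?case using O(2)[of n] rate_neg[OF elim] rate_fin[of X d n "\<delta>/2" "basic_nbhd X d \<mu> {} 1"]
            by (cases "rate X d (V n) (\<sigma> n) (\<delta>/2) (basic_nbhd X d \<mu> {} 1)") auto
        qed
        then show ?thesis by (intro bexI[OF _ O(1)] Limsup_bounded)
      qed
    qed
    then show ?thesis by simp
  next
    case False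
    show ?thesis
    proof (cases "?a = \<infinity> \<or> ?b = \<infinity>")
      case True
      then show ?thesis using False by (auto simp: entropy_sum_def)
    next
      case False2: False
      then obtain a b where ab: "?a = ereal a" "?b = ereal b" using False by (cases ?a; cases ?b) auto
      have "?h \<le> ereal (a + b) + ereal \<eta>" if \<eta>: "0 < \<eta>" for \<eta>
      proof (rule h_le)
        fix \<delta> :: real assume \<delta>: "0 < \<delta>"
        then have \<delta>2: "0 < \<delta>/2" by simp
        obtain \<O>1 where O1: "\<O>1 \<in> nbhds X d \<mu>" "limsup (\<lambda>n. rate X d (V n) (\<sigma> n) (\<delta>/2) \<O>1) < ereal (a + \<eta>/2)"
          using pick[OF _ \<delta>2, of X d \<mu> "ereal (a + \<eta>/2)"] ab \<eta> by auto
        obtain \<O>2 where O2: "\<O>2 \<in> nbhds Y e \<nu>" "limsup (\<lambda>n. rate Y e (V n) (\<sigma> n) (\<delta>/2) \<O>2) < ereal (b + \<eta>/2)"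
          using pick[OF _ \<delta>2, of Y e \<nu> "ereal (b + \<eta>/2)"] ab \<eta> by auto
        obtain \<O> where O: "\<O> \<in> nbhds ?Z ?D ?\<zeta>" "\<And>n. rate ?Z ?D (V n) (\<sigma> n) \<delta> \<O> \<le>
            rate X d (V n) (\<sigma> n) (\<delta>/2) \<O>1 + rate Y e (V n) (\<sigma> n) (\<delta>/2) \<O>2"
          using main[OF \<delta> O1(1) O2(1)] by blast
        have "limsup (\<lambda>n. rate ?Z ?D (V n) (\<sigma> n) \<delta> \<O>) \<le>
          limsup (\<lambda>n. rate X d (V n) (\<sigma> n) (\<delta>/2) \<O>1 + rate Y e (V n) (\<sigma> n) (\<delta>/2) \<O>2)"
          by (intro Limsup_mono always_eventually allI O(2))
        also have "\<dots> \<le> limsup (\<lambda>n. rate X d (V n) (\<sigma> n) (\<delta>/2) \<O>1) + limsup (\<lambda>n. rate Y e (V n) (\<sigma> n) (\<delta>/2) \<O>2)"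
          by (rule ereal_limsup_add_mono)
        also have "\<dots> \<le> ereal (a + \<eta>/2) + ereal (b + \<eta>/2)"
          using O1(2) O2(2) by (intro add_mono) auto
        also have "\<dots> = ereal (a + b) + ereal \<eta>" by simp
        finally show "\<exists>\<O>\<in>nbhds ?Z ?D ?\<zeta>. limsup (\<lambda>n. rate ?Z ?D (V n) (\<sigma> n) \<delta> \<O>) \<le> ereal (a + b) + ereal \<eta>"
          using O(1) by blast
      qed
      then have "?h \<le> ereal (a + b)" by (rule ereal_le_epsilon2)
      then show ?thesis using ab by (simp add: entropy_sum_def)
    qed
  qed
qed

section \<open>Correlations under doubly quenched convergence\<close>

lemma ave_power2: "(ave V a)\<^sup>2 = (\<Sum>v\<in>V. \<Sum>w\<in>V. a v * a w) / (real (card V))\<^sup>2"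
  by (simp add: ave_def power_divide power2_eq_square sum_product)

context prob_space
begin

context
  fixes V :: "'v set" and \<phi> :: "'v \<Rightarrow> 'a \<Rightarrow> real" and C :: real
  assumes V: "finite V" "V \<noteq> {}"
    and \<phi>[measurable]: "\<And>v. v \<in> V \<Longrightarrow> \<phi> v \<in> borel_measurable M"
    and C: "0 < C" "\<And>v x. v \<in> V \<Longrightarrow> x \<in> space M \<Longrightarrow> \<bar>\<phi> v x\<bar> \<le> C"
begin

lemma integrable_correlation: "v \<in> V \<Longrightarrow> w \<in> V \<Longrightarrow> integrable M (\<lambda>x. \<phi> v x * \<phi> w x)"
proof (rule integrable_const_bound[where B = "C * C"])
  assume v: "v \<in> V" "w \<in> V"
  then show "AE x in M. norm (\<phi> v x * \<phi> w x) \<le> C * C"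
    using C by (intro AE_I2) (auto simp: abs_mult intro!: mult_mono)
  show "(\<lambda>x. \<phi> v x * \<phi> w x) \<in> borel_measurable M" using v by measurable
qed

text \<open>Together with \<open>expectation_pair_square\<close> this is the key computation. The quantity to be bounded is a quadratic form in the
correlations, with the weights as coefficients. The pair average, which doubly quenched convergence controls,
has as its second moment the average of their squares.\<close>

lemma expectation_weighted_square:
  "expectation (\<lambda>x. (ave V (\<lambda>v. g v * \<phi> v x))\<^sup>2)
    = (\<Sum>v\<in>V. \<Sum>w\<in>V. g v * g w * expectation (\<lambda>x. \<phi> v x * \<phi> w x)) / (real (card V))\<^sup>2"
proof -
  have "expectation (\<lambda>x. (ave V (\<lambda>v. g v * \<phi> v x))\<^sup>2) =
     expectation (\<lambda>x. (\<Sum>v\<in>V. \<Sum>w\<in>V. (g v * g w) * (\<phi> v x * \<phi> w x)) / (real (card V))\<^sup>2)"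
    unfolding ave_power2 by (simp add: mult_ac)
  also have "\<dots> = (\<Sum>v\<in>V. \<Sum>w\<in>V. expectation (\<lambda>x. (g v * g w) * (\<phi> v x * \<phi> w x))) / (real (card V))\<^sup>2"
    using integrable_correlation by (simp add: Bochner_Integration.integral_sum)
  finally show ?thesis by simp
qed

text \<open>Squaring and applying Fubini gives the correlation of \<open>v\<close> and \<open>w\<close> once from each factor of \<open>M \<Otimes>\<^sub>M M\<close>.\<close>

lemma expectation_pair_square:
  "(\<integral>p. (ave V (\<lambda>v. \<phi> v (fst p) * \<phi> v (snd p)))\<^sup>2 \<partial>(M \<Otimes>\<^sub>M M))
    = (\<Sum>v\<in>V. \<Sum>w\<in>V. (expectation (\<lambda>x. \<phi> v x * \<phi> w x))\<^sup>2) / (real (card V))\<^sup>2"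
proof -
  interpret P: pair_prob_space M M ..
  let ?h = "\<lambda>v w p. (\<phi> v (fst p) * \<phi> w (fst p)) * (\<phi> v (snd p) * \<phi> w (snd p))"
  have int: "integrable (M \<Otimes>\<^sub>M M) (?h v w)" if v: "v \<in> V" "w \<in> V" for v w
  proof (rule P.integrable_const_bound[where B = "(C * C) * (C * C)"])
    show "AE p in M \<Otimes>\<^sub>M M. norm (?h v w p) \<le> (C * C) * (C * C)"
      using C v by (intro AE_I2) (auto simp: abs_mult space_pair_measure intro!: mult_mono)
    show "?h v w \<in> borel_measurable (M \<Otimes>\<^sub>M M)" using v by measurable
  qed
  have val: "(\<integral>p. ?h v w p \<partial>(M \<Otimes>\<^sub>M M)) = (expectation (\<lambda>x. \<phi> v x * \<phi> w x))\<^sup>2" if v: "v \<in> V" "w \<in> V" for v w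
    using P.integral_fst'[OF int[OF v]] by (simp add: power2_eq_square)
  have "(\<integral>p. (ave V (\<lambda>v. \<phi> v (fst p) * \<phi> v (snd p)))\<^sup>2 \<partial>(M \<Otimes>\<^sub>M M)) =
     (\<integral>p. (\<Sum>v\<in>V. \<Sum>w\<in>V. ?h v w p) / (real (card V))\<^sup>2 \<partial>(M \<Otimes>\<^sub>M M))"
    unfolding ave_power2 by (simp add: mult_ac)
  also have "\<dots> = (\<Sum>v\<in>V. \<Sum>w\<in>V. (\<integral>p. ?h v w p \<partial>(M \<Otimes>\<^sub>M M))) / (real (card V))\<^sup>2"
    using int by (simp add: Bochner_Integration.integral_sum)
  finally show ?thesis using val by simp
qed

text \<open>The pair average is at most \<open>\<tau>\<close> off a set of measure \<open>\<theta>\<close>, where it is at most \<open>C\<^sup>2\<close>; so the mean square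
of the correlations is at most \<open>\<tau>\<^sup>2 + C^4 * \<theta>\<close>. The inequality \<open>\<bar>c\<bar> \<le> \<tau> + c\<^sup>2 / \<tau>\<close> turns this into a bound on
their mean absolute value, and Markov's inequality for the square of the weighted average concludes. The bound depends
on the weights only through \<open>B\<close>.\<close>

lemma weighted_average_small:
  assumes \<tau>: "0 < \<tau>" and \<theta>: "0 \<le> \<theta>" and B: "\<And>v. v \<in> V \<Longrightarrow> \<bar>g v\<bar> \<le> B" and \<kappa>: "0 < \<kappa>"
    and conc: "measure (M \<Otimes>\<^sub>M M) {p \<in> space (M \<Otimes>\<^sub>M M). \<bar>ave V (\<lambda>v. \<phi> v (fst p) * \<phi> v (snd p))\<bar> < \<tau>} \<ge> 1 - \<theta>"
  shows "prob {x \<in> space M. \<kappa> \<le> \<bar>ave V (\<lambda>v. g v * \<phi> v x)\<bar>} \<le> B\<^sup>2 * (2 * \<tau> + C^4 * \<theta> / \<tau>) / \<kappa>\<^sup>2"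
proof -
  interpret P: pair_prob_space M M ..
  define c where "c v w = expectation (\<lambda>x. \<phi> v x * \<phi> w x)" for v w
  define A where "A p = ave V (\<lambda>v. \<phi> v (fst p) * \<phi> v (snd p))" for p
  define N where "N = (real (card V))\<^sup>2"
  have N: "0 < N" using V by (simp add: N_def card_gt_0_iff)
  have Am[measurable]: "A \<in> borel_measurable (M \<Otimes>\<^sub>M M)" unfolding A_def ave_def by measurable
  have AC: "\<bar>A p\<bar> \<le> C\<^sup>2" if p: "p \<in> space (M \<Otimes>\<^sub>M M)" for p
  proof -
    have "\<bar>A p\<bar> \<le> ave V (\<lambda>v. \<bar>\<phi> v (fst p) * \<phi> v (snd p)\<bar>)" unfolding A_def by (rule ave_abs)
    also have "\<dots> \<le> ave V (\<lambda>v. C\<^sup>2)"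
      using p C by (intro ave_mono) (auto simp: abs_mult power2_eq_square space_pair_measure intro!: mult_mono)
    finally show ?thesis using V by (simp add: ave_const)
  qed
  have A4: "(A p)\<^sup>2 \<le> C^4" if p: "p \<in> space (M \<Otimes>\<^sub>M M)" for p
    using power_mono[OF AC[OF p] abs_ge_zero, of 2] by (simp add: power_mult[symmetric])
  let ?G = "{p \<in> space (M \<Otimes>\<^sub>M M). \<bar>A p\<bar> < \<tau>}"
  have G: "?G \<in> sets (M \<Otimes>\<^sub>M M)" by measurable
  have "(\<integral>p. (A p)\<^sup>2 \<partial>(M \<Otimes>\<^sub>M M)) \<le> (\<integral>p. \<tau>\<^sup>2 + C^4 * indicator (space (M \<Otimes>\<^sub>M M) - ?G) p \<partial>(M \<Otimes>\<^sub>M M))"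
  proof (rule integral_mono)
    show "integrable (M \<Otimes>\<^sub>M M) (\<lambda>p. (A p)\<^sup>2)"
    proof (rule P.integrable_const_bound[where B = "C^4"])
      show "AE p in M \<Otimes>\<^sub>M M. norm ((A p)\<^sup>2) \<le> C^4"
        using A4 by (intro AE_I2) simp
    qed measurable
    show "integrable (M \<Otimes>\<^sub>M M) (\<lambda>p. \<tau>\<^sup>2 + C^4 * indicator (space (M \<Otimes>\<^sub>M M) - ?G) p)"
      using G by (intro Bochner_Integration.integrable_add integrable_mult_right integrable_real_indicator)
        (auto simp: P.emeasure_eq_measure)
    fix p assume p: "p \<in> space (M \<Otimes>\<^sub>M M)"
    show "(A p)\<^sup>2 \<le> \<tau>\<^sup>2 + C^4 * indicator (space (M \<Otimes>\<^sub>M M) - ?G) p"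
    proof (cases "p \<in> ?G")
      case True
      then have "\<bar>A p\<bar> \<le> \<bar>\<tau>\<bar>" using \<tau> by auto
      then have "(A p)\<^sup>2 \<le> \<tau>\<^sup>2" by (simp add: abs_le_square_iff)
      then show ?thesis using True by simp
    next
      case False
      then show ?thesis using A4[OF p] p by (simp add: add_increasing)
    qed
  qed
  also have "\<dots> = \<tau>\<^sup>2 + C^4 * (1 - P.prob ?G)"
    using G by (simp add: P.prob_compl[symmetric] P.prob_space integrable_real_indicator P.emeasure_eq_measure)
  also have "\<dots> \<le> \<tau>\<^sup>2 + C^4 * \<theta>"
    using conc C unfolding A_def by (intro add_left_mono mult_left_mono) auto
  finally have sq: "(\<Sum>v\<in>V. \<Sum>w\<in>V. (c v w)\<^sup>2) / N \<le> \<tau>\<^sup>2 + C^4 * \<theta>"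
    unfolding A_def expectation_pair_square N_def c_def .
  have "expectation (\<lambda>x. (ave V (\<lambda>v. g v * \<phi> v x))\<^sup>2) = (\<Sum>v\<in>V. \<Sum>w\<in>V. g v * g w * c v w) / N"
    unfolding expectation_weighted_square N_def c_def ..
  also have "\<dots> \<le> (\<Sum>v\<in>V. \<Sum>w\<in>V. B\<^sup>2 * (\<tau> + (c v w)\<^sup>2 / \<tau>)) / N"
  proof (intro divide_right_mono sum_mono)
    fix v w assume v: "v \<in> V" "w \<in> V"
    have "0 \<le> B" using B[OF v(1)] by linarith
    \<comment> \<open>the inequality between arithmetic and geometric means gives the bound on \<open>\<bar>c\<bar>\<close> by \<open>c\<^sup>2\<close>\<close>
    have "0 \<le> (\<bar>c v w\<bar> - \<tau>)\<^sup>2" by simp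
    then have "2 * (\<bar>c v w\<bar> * \<tau>) \<le> \<tau>\<^sup>2 + (c v w)\<^sup>2" by (simp add: power2_diff)
    moreover have "0 \<le> \<bar>c v w\<bar> * \<tau>" using \<tau> by simp
    ultimately have "\<bar>c v w\<bar> * \<tau> \<le> \<tau>\<^sup>2 + (c v w)\<^sup>2" by linarith
    then have cb: "\<bar>c v w\<bar> \<le> \<tau> + (c v w)\<^sup>2 / \<tau>" using \<tau> by (simp add: field_simps power2_eq_square)
    have "g v * g w * c v w \<le> \<bar>g v\<bar> * \<bar>g w\<bar> * \<bar>c v w\<bar>" by (metis abs_ge_self abs_mult)
    also have "\<dots> \<le> (B * B) * (\<tau> + (c v w)\<^sup>2 / \<tau>)"
      using B[OF v(1)] B[OF v(2)] cb \<open>0 \<le> B\<close> by (intro mult_mono) auto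
    finally show "g v * g w * c v w \<le> B\<^sup>2 * (\<tau> + (c v w)\<^sup>2 / \<tau>)" by (simp add: power2_eq_square)
  qed (use N in simp)
  also have "\<dots> = B\<^sup>2 * (\<tau> + ((\<Sum>v\<in>V. \<Sum>w\<in>V. (c v w)\<^sup>2) / N) / \<tau>)"
  proof -
    have "(\<Sum>v\<in>V. \<Sum>w\<in>V. B\<^sup>2 * (\<tau> + (c v w)\<^sup>2 / \<tau>)) = B\<^sup>2 * (N * \<tau> + (\<Sum>v\<in>V. \<Sum>w\<in>V. (c v w)\<^sup>2) / \<tau>)"
      by (simp add: sum_distrib_left[symmetric] sum.distrib sum_divide_distrib[symmetric] N_def power2_eq_square)
    then show ?thesis using N \<tau> by (simp add: field_simps)
  qed
  also have "\<dots> \<le> B\<^sup>2 * (\<tau> + (\<tau>\<^sup>2 + C^4 * \<theta>) / \<tau>)"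
    using sq \<tau> by (intro mult_left_mono add_left_mono divide_right_mono) auto
  also have "\<dots> = B\<^sup>2 * (2 * \<tau> + C^4 * \<theta> / \<tau>)" using \<tau> by (simp add: field_simps power2_eq_square)
  finally have E: "expectation (\<lambda>x. (ave V (\<lambda>v. g v * \<phi> v x))\<^sup>2) \<le> B\<^sup>2 * (2 * \<tau> + C^4 * \<theta> / \<tau>)" .
  have am: "(\<lambda>x. ave V (\<lambda>v. g v * \<phi> v x)) \<in> borel_measurable M" unfolding ave_def by measurable
  have "prob {x \<in> space M. \<kappa>\<^sup>2 \<le> (ave V (\<lambda>v. g v * \<phi> v x))\<^sup>2} \<le> expectation (\<lambda>x. (ave V (\<lambda>v. g v * \<phi> v x))\<^sup>2) / \<kappa>\<^sup>2"
  proof (rule integral_Markov_inequality_measure[where A = "{}"])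
    show "integrable M (\<lambda>x. (ave V (\<lambda>v. g v * \<phi> v x))\<^sup>2)"
    proof -
      have "integrable M (\<lambda>x. (\<Sum>v\<in>V. \<Sum>w\<in>V. (g v * g w) * (\<phi> v x * \<phi> w x)) / (real (card V))\<^sup>2)"
        using integrable_correlation by (intro Bochner_Integration.integrable_divide Bochner_Integration.integrable_sum integrable_mult_right) auto
      then show ?thesis unfolding ave_power2 by (simp add: mult_ac)
    qed
  qed (use \<kappa> in auto)
  also have "{x \<in> space M. \<kappa>\<^sup>2 \<le> (ave V (\<lambda>v. g v * \<phi> v x))\<^sup>2} = {x \<in> space M. \<kappa> \<le> \<bar>ave V (\<lambda>v. g v * \<phi> v x)\<bar>}"
    using \<kappa> by (auto simp: abs_le_square_iff[symmetric])
  also have "expectation (\<lambda>x. (ave V (\<lambda>v. g v * \<phi> v x))\<^sup>2) / \<kappa>\<^sup>2 \<le> B\<^sup>2 * (2 * \<tau> + C^4 * \<theta> / \<tau>) / \<kappa>\<^sup>2"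
    using E by (intro divide_right_mono) auto
  finally show ?thesis .
qed

end
end

lemma good_models_sets:
  fixes \<mu> :: "('g::countable \<Rightarrow> 'a) measure"
  assumes cm: "compact_metric X d" and fr: "model_frame V s" and Fs: "finite Fs" "Fs \<subseteq> tests X d"
  shows "good_models X d V s (basic_nbhd X d \<mu> Fs \<epsilon>) \<in> sets (config_algebra V X d)"
proof -
  let ?M = "config_algebra V X d"
  have sp: "space ?M = PiE V (\<lambda>_. X)" by (rule space_config[OF compact_metric_space[OF cm]])
  have "{x \<in> space ?M. \<bar>ave V (\<lambda>v. f (pullback_name s v x)) - (\<integral>x. f x \<partial>\<mu>)\<bar> < \<epsilon>} \<in> sets ?M" if f: "f \<in> Fs" for f
  proof -
    have "(\<lambda>x. f (pullback_name s v x)) \<in> borel_measurable ?M" if "v \<in> V" for v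
      by (rule measurable_compose[OF pullback_name_measurable[OF fr that] tests_measurable[OF cm]]) (use f Fs in auto)
    then have [measurable]: "(\<lambda>x. ave V (\<lambda>v. f (pullback_name s v x))) \<in> borel_measurable ?M"
      unfolding ave_def by (intro borel_measurable_divide borel_measurable_sum) auto
    show ?thesis by measurable
  qed
  then have "{x \<in> space ?M. \<forall>f\<in>Fs. \<bar>ave V (\<lambda>v. f (pullback_name s v x)) - (\<integral>x. f x \<partial>\<mu>)\<bar> < \<epsilon>} \<in> sets ?M"
    by (intro sets.sets_Collect_finite_All Fs(1))
  then show ?thesis unfolding good_models_basic[OF cm fr Fs(2)] sp .
qed

text \<open>The test function \<open>(x, x') \<mapsto> f0(x) f0(x')\<close>, with \<open>f0\<close> the centred version of \<open>f\<close>, has integral \<open>0\<close> for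
\<open>\<mu> \<times> \<mu>\<close>; its averages over good models of the square are the pair averages of \<open>weighted_average_small\<close>.
The weights are quantified after \<open>i\<close>, because later they depend on a model \<open>y\<close> over the same vertex set.\<close>

lemma doubly_quenched_decorrelates:
  fixes \<mu> :: "('g::countable \<Rightarrow> 'a) measure"
  assumes cm: "compact_metric X d" and fr: "\<And>i. model_frame (V i) (\<sigma> i)" and mu: "\<mu> \<in> Prob UNIV X d"
    and dq: "doubly_quenched_converges V \<sigma> X d m \<mu>"
    and f: "f \<in> tests X d" and B: "0 < B" and \<kappa>: "0 < \<kappa>" and \<eta>: "0 < \<eta>"
  shows "\<forall>\<^sub>F i in sequentially. \<forall>g. (\<forall>v\<in>V i. \<bar>g v\<bar> \<le> B) \<longrightarrow>
    measure (m i) {x \<in> space (m i). \<kappa> \<le> \<bar>ave (V i) (\<lambda>v. g v * (f (pullback_name (\<sigma> i) v x) - (\<integral>x. f x \<partial>\<mu>)))\<bar>} \<le> \<eta>"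
proof -
  note ms = compact_metric_space[OF cm]
  let ?D = "avg_dist d d" and ?Z = "X \<times> X"
  note cmZ = compact_avg[OF cm cm]
  define f0 where "f0 x = f x - (\<integral>x. f x \<partial>\<mu>)" for x
  have f0: "f0 \<in> tests X d" unfolding f0_def using f by (auto intro: continuous_intros)
  have f0_int: "(\<integral>x. f0 x \<partial>\<mu>) = 0"
  proof -
    interpret prob_space \<mu> by (rule ProbD(1)[OF mu ms])
    show ?thesis unfolding f0_def using tests_integrable[OF cm f mu] by (simp add: prob_space)
  qed
  obtain C where C: "0 < C" "\<And>x. (\<And>g. x g \<in> X) \<Longrightarrow> \<bar>f0 x\<bar> \<le> C" using tests_bounded[OF cm f0] by blast
  define \<tau> where "\<tau> = \<eta> * \<kappa>\<^sup>2 / (3 * B\<^sup>2)"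
  \<comment> \<open>with these values the bound of \<open>weighted_average_small\<close> is exactly \<open>\<eta>\<close>\<close>
  define \<theta> where "\<theta> = \<tau>\<^sup>2 / C^4"
  have \<tau>: "0 < \<tau>" using \<eta> \<kappa> B by (simp add: \<tau>_def)
  have \<theta>: "0 < \<theta>" using \<tau> C by (simp add: \<theta>_def)
  define F where "F z = f0 (\<lambda>g. fst (z g)) * f0 (\<lambda>g. snd (z g))" for z
  have F: "F \<in> tests ?Z ?D" unfolding F_def by (rule tests_mult[OF tests_fst[OF cm cm f0] tests_snd[OF cm cm f0]])
  have sq: "square_measure UNIV X d \<mu> = product_process X d \<mu> X d \<mu>"
    by (simp add: square_measure_def product_process_def pair_dist_avg restrict_def)
  have F_int: "(\<integral>z. F z \<partial>product_process X d \<mu> X d \<mu>) = 0"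
    unfolding F_def integral_product_tensor[OF cm cm mu mu f0 f0] f0_int by simp
  let ?O = "basic_nbhd ?Z ?D (product_process X d \<mu> X d \<mu>) {F} \<tau>"
  have "?O \<in> nbhds ?Z ?D (product_process X d \<mu> X d \<mu>)"
    by (rule basic_nbhd_nbhds[OF product_process_Prob[OF cm cm mu mu]]) (use F \<tau> in auto)
  then have lim: "(\<lambda>i. measure (square_measure (V i) X d (m i)) (good_models ?Z ?D (V i) (\<sigma> i) ?O)) \<longlonglongrightarrow> 1"
    using dq unfolding doubly_quenched_converges_def quenched_converges_def sq pair_dist_avg by blast
  have mP: "m i \<in> Prob (V i) X d" for i using dq by (simp add: doubly_quenched_converges_def)
  have "\<forall>\<^sub>F i in sequentially. measure (square_measure (V i) X d (m i)) (good_models ?Z ?D (V i) (\<sigma> i) ?O) > 1 - \<theta>"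
    using order_tendstoD(1)[OF lim, of "1 - \<theta>"] \<theta> by simp
  then show ?thesis
  proof eventually_elim
    case (elim i)
    interpret M: prob_space "m i" by (rule ProbD(1)[OF mP ms])
    interpret P: pair_prob_space "m i" "m i" ..
    note V = model_frameD(1,2)[OF fr[of i]]
    have spm: "space (m i) = PiE (V i) (\<lambda>_. X)" by (rule ProbD(3)[OF mP ms])
    have sm: "sets (m i) = sets (config_algebra (V i) X d)" by (rule ProbD(2)[OF mP ms])
    define \<phi> where "\<phi> v x = f0 (pullback_name (\<sigma> i) v x)" for v x
    have \<phi>m: "\<phi> v \<in> borel_measurable (m i)" if "v \<in> V i" for v
      unfolding \<phi>_def using measurable_compose[OF pullback_name_measurable[OF fr that] tests_measurable[OF cm f0]]
      by (simp cong: measurable_cong_sets add: sm)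
    have \<phi>C: "\<bar>\<phi> v x\<bar> \<le> C" if "v \<in> V i" "x \<in> space (m i)" for v x
      unfolding \<phi>_def by (intro C(2) pullback_name_in[OF fr]) (use that spm in auto)
    have pm: "(\<lambda>(x, y). \<lambda>v\<in>V i. (x v, y v)) \<in> measurable (m i \<Otimes>\<^sub>M m i) (config_algebra (V i) ?Z ?D)"
      using config_product_measurable[OF cm cm, of "V i"] measurable_cong_sets[OF sets_pair_measure_cong[OF sm sm] refl] by blast
    let ?G = "good_models ?Z ?D (V i) (\<sigma> i) ?O"
    have G: "?G \<in> sets (config_algebra (V i) ?Z ?D)" by (rule good_models_sets[OF cmZ fr]) (use F in auto)
    have "1 - \<theta> \<le> measure (square_measure (V i) X d (m i)) ?G" using elim by simp
    also have "\<dots> = P.prob ((\<lambda>(x, y). \<lambda>v\<in>V i. (x v, y v)) -` ?G \<inter> space (m i \<Otimes>\<^sub>M m i))"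
      unfolding square_measure_def pair_dist_avg by (rule measure_distr[OF pm G])
    also have "\<dots> \<le> P.prob {p \<in> space (m i \<Otimes>\<^sub>M m i). \<bar>ave (V i) (\<lambda>v. \<phi> v (fst p) * \<phi> v (snd p))\<bar> < \<tau>}"
    proof (rule P.finite_measure_mono)
      have [measurable]: "(\<lambda>p. ave (V i) (\<lambda>v. \<phi> v (fst p) * \<phi> v (snd p))) \<in> borel_measurable (m i \<Otimes>\<^sub>M m i)"
        unfolding ave_def using \<phi>m
        by (intro borel_measurable_divide borel_measurable_sum borel_measurable_times
            measurable_compose[OF measurable_fst] measurable_compose[OF measurable_snd]) auto
      show "{p \<in> space (m i \<Otimes>\<^sub>M m i). \<bar>ave (V i) (\<lambda>v. \<phi> v (fst p) * \<phi> v (snd p))\<bar> < \<tau>} \<in> sets (m i \<Otimes>\<^sub>M m i)" by measurable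
      show "(\<lambda>(x, y). \<lambda>v\<in>V i. (x v, y v)) -` ?G \<inter> space (m i \<Otimes>\<^sub>M m i) \<subseteq>
        {p \<in> space (m i \<Otimes>\<^sub>M m i). \<bar>ave (V i) (\<lambda>v. \<phi> v (fst p) * \<phi> v (snd p))\<bar> < \<tau>}"
      proof
        fix p assume p: "p \<in> (\<lambda>(x, y). \<lambda>v\<in>V i. (x v, y v)) -` ?G \<inter> space (m i \<Otimes>\<^sub>M m i)"
        have "(\<lambda>v\<in>V i. (fst p v, snd p v)) \<in> ?G" using p by (simp add: case_prod_beta')
        then have "\<bar>ave (V i) (\<lambda>v. F (pullback_name (\<sigma> i) v (\<lambda>v\<in>V i. (fst p v, snd p v)))) - 0\<bar> < \<tau>"
          unfolding good_models_basic[OF cmZ fr, of "{F}", simplified, OF F[simplified]] F_int by simp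
        moreover have "ave (V i) (\<lambda>v. F (pullback_name (\<sigma> i) v (\<lambda>v\<in>V i. (fst p v, snd p v)))) =
           ave (V i) (\<lambda>v. \<phi> v (fst p) * \<phi> v (snd p))"
          by (rule ave_cong) (use model_frameD(5)[OF fr] in \<open>simp add: F_def \<phi>_def pullback_name_def\<close>)
        ultimately show "p \<in> {p \<in> space (m i \<Otimes>\<^sub>M m i). \<bar>ave (V i) (\<lambda>v. \<phi> v (fst p) * \<phi> v (snd p))\<bar> < \<tau>}"
          using p by simp
      qed
    qed
    finally have conc: "1 - \<theta> \<le> P.prob {p \<in> space (m i \<Otimes>\<^sub>M m i). \<bar>ave (V i) (\<lambda>v. \<phi> v (fst p) * \<phi> v (snd p))\<bar> < \<tau>}" .
    have const: "B\<^sup>2 * (2 * \<tau> + C^4 * \<theta> / \<tau>) / \<kappa>\<^sup>2 = \<eta>"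
    proof -
      have "C^4 * \<theta> / \<tau> = \<tau>" using C \<tau> by (simp add: \<theta>_def power2_eq_square)
      then show ?thesis using B \<kappa> by (simp add: \<tau>_def)
    qed
    show ?case
    proof (intro allI impI)
      fix g assume "\<forall>v\<in>V i. \<bar>g v\<bar> \<le> B"
      then have "M.prob {x \<in> space (m i). \<kappa> \<le> \<bar>ave (V i) (\<lambda>v. g v * \<phi> v x)\<bar>} \<le> B\<^sup>2 * (2 * \<tau> + C^4 * \<theta> / \<tau>) / \<kappa>\<^sup>2"
        using M.weighted_average_small[OF V \<phi>m C(1) \<phi>C \<tau> less_imp_le[OF \<theta>] _ \<kappa> conc, of g B] by blast
      then show "M.prob {x \<in> space (m i). \<kappa> \<le> \<bar>ave (V i) (\<lambda>v. g v * (f (pullback_name (\<sigma> i) v x) - (\<integral>x. f x \<partial>\<mu>)))\<bar>} \<le> \<eta>"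
        unfolding const \<phi>_def f0_def .
    qed
  qed
qed

section \<open>Counting pairs of models\<close>

lemma hamming_avg:
  "hamming_dist V (avg_dist d e) z w =
    (hamming_dist V d (\<lambda>v\<in>V. fst (z v)) (\<lambda>v\<in>V. fst (w v)) + hamming_dist V e (\<lambda>v\<in>V. snd (z v)) (\<lambda>v\<in>V. snd (w v))) / 2"
  by (simp add: hamming_dist_def avg_dist_def sum.distrib sum_divide_distrib[symmetric] add_divide_distrib)

text \<open>A separated set of greatest cardinality is also a cover.\<close>

lemma separated_set:
  assumes cm: "compact_metric Y e" and V: "finite V" "V \<noteq> {}" and \<delta>: "0 < \<delta>" and Z: "Z \<subseteq> PiE V (\<lambda>_. Y)"
  obtains S where "finite S" "S \<subseteq> Z" "\<And>x y. x \<in> S \<Longrightarrow> y \<in> S \<Longrightarrow> x \<noteq> y \<Longrightarrow> \<delta> \<le> hamming_dist V e x y"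
    "cov \<delta> Z (hamming_dist V e) \<le> card S"
proof (rule hamming_partition[OF cm V \<delta>])
  fix J c assume J: "finite J" "c ` (PiE V (\<lambda>_. Y)) \<subseteq> J"
    and c: "\<And>x y. x \<in> PiE V (\<lambda>_. Y) \<Longrightarrow> y \<in> PiE V (\<lambda>_. Y) \<Longrightarrow> c x = c y \<Longrightarrow> hamming_dist V e x y < \<delta>"
  define sep where "sep S \<longleftrightarrow> finite S \<and> S \<subseteq> Z \<and> (\<forall>x\<in>S. \<forall>y\<in>S. x \<noteq> y \<longrightarrow> \<delta> \<le> hamming_dist V e x y)" for S
  have bound: "card S < Suc (card J)" if S: "sep S" for S
  proof -
    have "inj_on c S"
    proof (rule inj_onI, rule ccontr)
      fix x y assume xy: "x \<in> S" "y \<in> S" "c x = c y" "x \<noteq> y"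
      then have "hamming_dist V e x y < \<delta>" using S Z by (intro c) (auto simp: sep_def)
      moreover have "\<delta> \<le> hamming_dist V e x y" using xy S by (auto simp: sep_def)
      ultimately show False by simp
    qed
    moreover have "c ` S \<subseteq> J" using S Z J(2) unfolding sep_def by (meson image_mono order_trans)
    ultimately show ?thesis using card_inj_on_le[OF _ _ J(1)] by (simp add: less_Suc_eq_le)
  qed
  have "sep {}" by (simp add: sep_def)
  then have "\<exists>S. sep S \<and> (\<forall>T. sep T \<longrightarrow> card T \<le> card S)"
    by (rule ex_has_greatest_nat[where b = "Suc (card J)"]) (use bound in blast)
  then obtain S where S: "sep S" "\<And>T. sep T \<Longrightarrow> card T \<le> card S" by blast
  have dense: "\<exists>y\<in>S. hamming_dist V e z y < \<delta>" if z: "z \<in> Z" for z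
  proof (rule ccontr)
    assume "\<not> ?thesis"
    then have far: "\<And>y. y \<in> S \<Longrightarrow> \<delta> \<le> hamming_dist V e z y" by (simp add: not_less)
    have "z \<notin> S" using far[of z] hamming_self[OF cm, of z V] z Z \<delta> by auto
    moreover have "sep (insert z S)"
      using S(1) z far hamming_commute[OF cm, of V] unfolding sep_def by auto
    ultimately show False using S(2)[of "insert z S"] S(1) by (simp add: sep_def)
  qed
  show thesis
  proof (rule that[of S])
    show "cov \<delta> Z (hamming_dist V e) \<le> card S"
      unfolding cov_def by (rule Least_le) (use S(1) dense in \<open>auto simp: sep_def\<close>)
  qed (use S(1) in \<open>auto simp: sep_def\<close>)
qed

text \<open>Fix a cover \<open>F\<close> of the pairs and a \<open>\<delta>2\<close>-separated set of models \<open>y\<close>. The centres in \<open>F\<close> whose second coordinate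
is close to a given \<open>y\<close> have first coordinates covering \<open>E y\<close>, hence a large part of \<open>m\<close>, so there are at least
\<open>cov_measure \<epsilon> \<delta>1 m\<close> of them. For different \<open>y\<close> these families of centres are disjoint.\<close>

lemma cov_product_lower:
  assumes cmX: "compact_metric X d" and cmY: "compact_metric Y e" and V: "finite V" "V \<noteq> {}"
    and \<delta>: "0 < \<delta>" "2 * \<delta> \<le> \<delta>1" "4 * \<delta> \<le> \<delta>2"
    and m: "m \<in> Prob V X d" and Z: "Z \<subseteq> PiE V (\<lambda>_. Y)" and W: "W \<subseteq> PiE V (\<lambda>_. X \<times> Y)"
    and E: "\<And>y. y \<in> Z \<Longrightarrow> E y \<in> sets m" "\<And>y. y \<in> Z \<Longrightarrow> 1 - \<epsilon> < measure m (E y)"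
      "\<And>x y. y \<in> Z \<Longrightarrow> x \<in> E y \<Longrightarrow> (\<lambda>v\<in>V. (x v, y v)) \<in> W"
  shows "cov_measure \<epsilon> \<delta>1 m (hamming_dist V d) * cov \<delta>2 Z (hamming_dist V e) \<le> cov \<delta> W (hamming_dist V (avg_dist d e))"
proof -
  note msX = compact_metric_space[OF cmX]
  interpret prob_space m by (rule ProbD(1)[OF m msX])
  have spm: "space m = PiE V (\<lambda>_. X)" by (rule ProbD(3)[OF m msX])
  have \<delta>2: "0 < \<delta>2" using \<delta> by simp
  obtain S where S: "finite S" "S \<subseteq> Z" "\<And>x y. x \<in> S \<Longrightarrow> y \<in> S \<Longrightarrow> x \<noteq> y \<Longrightarrow> \<delta>2 \<le> hamming_dist V e x y"
    "cov \<delta>2 Z (hamming_dist V e) \<le> card S"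
    using separated_set[OF cmY V \<delta>2 Z] by blast
  obtain F where F: "finite F" "card F = cov \<delta> W (hamming_dist V (avg_dist d e))" "F \<subseteq> W"
    "\<And>z. z \<in> W \<Longrightarrow> \<exists>y\<in>F. hamming_dist V (avg_dist d e) z y < \<delta>"
    using cov_hamming_attained[OF compact_avg[OF cmX cmY] V \<delta>(1) W] by blast
  let ?a = "\<lambda>z. \<lambda>v\<in>V. fst (z v)" and ?b = "\<lambda>z. \<lambda>v\<in>V. snd (z v)"
  have FE: "z \<in> PiE V (\<lambda>_. X \<times> Y)" if "z \<in> F" for z using that F(3) W by blast
  have aX: "?a z \<in> PiE V (\<lambda>_. X)" "?b z \<in> PiE V (\<lambda>_. Y)" if "z \<in> F" for z
    using FE[OF that] by (auto simp: restrict_PiE_iff PiE_iff mem_Times_iff)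
  \<comment> \<open>the metric on pairs is an average, so closeness in one coordinate costs a factor \<open>2\<close>\<close>
  define G where "G y = {f \<in> F. hamming_dist V e y (?b f) < 2 * \<delta>}" for y
  have Gf: "finite (G y)" for y using F(1) by (simp add: G_def)
  have le: "cov_measure \<epsilon> \<delta>1 m (hamming_dist V d) \<le> card (G y)" if y: "y \<in> S" for y
  proof -
    have yZ: "y \<in> Z" using y S(2) by blast
    let ?H = "?a ` G y"
    have H: "?H \<subseteq> space m" using aX(1) unfolding spm G_def by blast
    have hm: "(\<lambda>x. hamming_dist V d x h) \<in> borel_measurable m" if h: "h \<in> PiE V (\<lambda>_. X)" for h
    proof -
      have "(\<lambda>x. d (x v) (h v)) \<in> borel_measurable m" if v: "v \<in> V" for v
      proof -
        have "(\<lambda>x. d (x v) (h v)) \<in> borel_measurable (config_algebra V X d)"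
          by (rule measurable_compose[OF measurable_config_coord[OF v]
               continuous_map_measurable_borel_of[OF continuous_map_dist[OF cmX]]]) (use h v in auto)
        then show ?thesis by (simp cong: measurable_cong_sets add: ProbD(2)[OF m msX])
      qed
      then show ?thesis unfolding hamming_dist_def by (intro borel_measurable_divide borel_measurable_sum) auto
    qed
    have "1 - \<epsilon> < prob (E y)" by (rule E(2)[OF yZ])
    also have "\<dots> \<le> prob {x \<in> space m. \<exists>h\<in>?H. hamming_dist V d x h < \<delta>1}"
    proof (rule finite_measure_mono)
      have "{x \<in> space m. \<exists>h\<in>?H. hamming_dist V d x h < \<delta>1} = (\<Union>h\<in>?H. {x \<in> space m. hamming_dist V d x h < \<delta>1})" by auto
      also have "\<dots> \<in> sets m"
      proof (rule sets.finite_UN)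
        show "finite ?H" using Gf by simp
        fix h assume "h \<in> ?H"
        then have [measurable]: "(\<lambda>x. hamming_dist V d x h) \<in> borel_measurable m" using hm H spm by blast
        show "{x \<in> space m. hamming_dist V d x h < \<delta>1} \<in> sets m" by measurable
      qed
      finally show "{x \<in> space m. \<exists>h\<in>?H. hamming_dist V d x h < \<delta>1} \<in> sets m" .
      show "E y \<subseteq> {x \<in> space m. \<exists>h\<in>?H. hamming_dist V d x h < \<delta>1}"
      proof
        fix x assume x: "x \<in> E y"
        have xs: "x \<in> space m" using x sets.sets_into_space[OF E(1)[OF yZ]] by blast
        have w: "(\<lambda>v\<in>V. (x v, y v)) \<in> W" by (rule E(3)[OF yZ x])
        from F(4)[OF w] obtain z where z: "z \<in> F" "hamming_dist V (avg_dist d e) (\<lambda>v\<in>V. (x v, y v)) z < \<delta>" by blast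
        have "hamming_dist V (avg_dist d e) (\<lambda>v\<in>V. (x v, y v)) z = (hamming_dist V d x (?a z) + hamming_dist V e y (?b z)) / 2"
          unfolding hamming_avg by (simp add: hamming_dist_def)
        then have "hamming_dist V d x (?a z) < 2 * \<delta>" "hamming_dist V e y (?b z) < 2 * \<delta>"
          using z(2) hamming_nonneg[OF cmX, of V x "?a z"] hamming_nonneg[OF cmY, of V y "?b z"] by auto
        then have "?a z \<in> ?H" "hamming_dist V d x (?a z) < \<delta>1" using z(1) \<delta> by (auto simp: G_def)
        then show "x \<in> {x \<in> space m. \<exists>h\<in>?H. hamming_dist V d x h < \<delta>1}" using xs by blast
      qed
    qed
    finally have "cov_measure \<epsilon> \<delta>1 m (hamming_dist V d) \<le> card ?H"
      unfolding cov_measure_def using H Gf[of y] by (intro Least_le exI[of _ ?H]) auto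
    also have "\<dots> \<le> card (G y)" by (rule card_image_le[OF Gf])
    finally show ?thesis .
  qed
  have disj: "G y \<inter> G y' = {}" if y: "y \<in> S" "y' \<in> S" "y \<noteq> y'" for y y'
  proof (rule ccontr)
    assume "G y \<inter> G y' \<noteq> {}"
    then obtain f where f: "f \<in> F" "hamming_dist V e y (?b f) < 2 * \<delta>" "hamming_dist V e y' (?b f) < 2 * \<delta>"
      by (auto simp: G_def)
    have "hamming_dist V e y y' \<le> hamming_dist V e y (?b f) + hamming_dist V e (?b f) y'"
      by (rule hamming_triangle[OF cmY _ aX(2)[OF f(1)]]) (use y S(2) Z in auto)
    then have "hamming_dist V e y y' < \<delta>2"
      using f(2,3) hamming_commute[OF cmY, of V "?b f" y'] \<delta>(3) by linarith
    then show False using S(3)[OF y] by simp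
  qed
  have "cov_measure \<epsilon> \<delta>1 m (hamming_dist V d) * cov \<delta>2 Z (hamming_dist V e) \<le> cov_measure \<epsilon> \<delta>1 m (hamming_dist V d) * card S"
    using S(4) by simp
  also have "\<dots> = (\<Sum>y\<in>S. cov_measure \<epsilon> \<delta>1 m (hamming_dist V d))" by simp
  also have "\<dots> \<le> (\<Sum>y\<in>S. card (G y))" by (rule sum_mono) (rule le)
  also have "\<dots> = card (\<Union>y\<in>S. G y)"
    using S(1) Gf disj by (intro card_UN_disjoint[symmetric]) auto
  also have "\<dots> \<le> card F" by (rule card_mono[OF F(1)]) (auto simp: G_def)
  finally show ?thesis using F(2) by simp
qed

section \<open>Superadditivity\<close>

text \<open>Lists are used for finite sums of tensors \<open>f \<otimes> u\<close> so that the product of two such sums is again one of them.\<close>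

definition tensor_sum :: "((('g \<Rightarrow> 'a) \<Rightarrow> real) \<times> (('g \<Rightarrow> 'b) \<Rightarrow> real)) list \<Rightarrow> ('g \<Rightarrow> 'a \<times> 'b) \<Rightarrow> real" where
  "tensor_sum L z = (\<Sum>p\<leftarrow>L. fst p (\<lambda>g. fst (z g)) * snd p (\<lambda>g. snd (z g)))"

lemma tensor_sum_simps [simp]:
  "tensor_sum [] z = 0"
  "tensor_sum (p # L) z = fst p (\<lambda>g. fst (z g)) * snd p (\<lambda>g. snd (z g)) + tensor_sum L z"
  by (simp_all add: tensor_sum_def)

lemma tensor_sum_append: "tensor_sum (L @ L') z = tensor_sum L z + tensor_sum L' z"
  by (induction L) auto

text \<open>The averaged metric makes each generator over the product alphabet a sum of two functions, each depending
on one coordinate only. Thus correlations of tensors decide whether a pair of models is good.\<close>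

lemma dist_algebra_tensor:
  assumes "F \<in> dist_algebra (X \<times> Y) (avg_dist d e)"
  shows "\<exists>L. set L \<subseteq> dist_algebra X d \<times> dist_algebra Y e \<and> F = tensor_sum L"
  using assms
proof induction
  case (const c)
  show ?case
    by (intro exI[of _ "[(\<lambda>_. c, \<lambda>_. 1)]"]) (auto intro!: dist_algebra.const)
next
  case (coord q g)
  have "(\<lambda>x. (1/2) * d (x g) (fst q)) \<in> dist_algebra X d"
    by (rule dist_algebra.mult[OF dist_algebra.const dist_algebra.coord]) (use coord in auto)
  moreover have "(\<lambda>x. e (x g) (snd q)) \<in> dist_algebra Y e"
    by (rule dist_algebra.coord) (use coord in auto)
  ultimately show ?case
    by (intro exI[of _ "[(\<lambda>x. (1/2) * d (x g) (fst q), \<lambda>_. 1), (\<lambda>_. 1/2, \<lambda>x. e (x g) (snd q))]"])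
      (auto intro!: dist_algebra.const simp: avg_dist_def fun_eq_iff add_divide_distrib)
next
  case (add F H)
  then obtain L L' where "set L \<subseteq> dist_algebra X d \<times> dist_algebra Y e" "F = tensor_sum L"
    "set L' \<subseteq> dist_algebra X d \<times> dist_algebra Y e" "H = tensor_sum L'" by blast
  then show ?case by (intro exI[of _ "L @ L'"]) (auto simp: tensor_sum_append)
next
  case (mult F H)
  then obtain L L' where L: "set L \<subseteq> dist_algebra X d \<times> dist_algebra Y e" "F = tensor_sum L"
    "set L' \<subseteq> dist_algebra X d \<times> dist_algebra Y e" "H = tensor_sum L'" by blast
  let ?m = "\<lambda>p q. (\<lambda>x. fst p x * fst q x, \<lambda>y. snd p y * snd q y)"
  have 1: "tensor_sum (map (?m p) K) z = fst p (\<lambda>g. fst (z g)) * snd p (\<lambda>g. snd (z g)) * tensor_sum K z" for p K z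
    by (induction K) (auto simp: algebra_simps)
  have 2: "tensor_sum (concat (map (\<lambda>p. map (?m p) K) K')) z = tensor_sum K' z * tensor_sum K z" for K K' z
    by (induction K') (auto simp: tensor_sum_append 1 algebra_simps)
  have "set (concat (map (\<lambda>p. map (?m p) L') L)) \<subseteq> dist_algebra X d \<times> dist_algebra Y e"
  proof
    fix r assume "r \<in> set (concat (map (\<lambda>p. map (?m p) L') L))"
    then obtain p q where pq: "p \<in> set L" "q \<in> set L'" "r = ?m p q" by auto
    then have "p \<in> dist_algebra X d \<times> dist_algebra Y e" "q \<in> dist_algebra X d \<times> dist_algebra Y e" using L by blast+
    then show "r \<in> dist_algebra X d \<times> dist_algebra Y e" 
      unfolding pq(3) by (auto intro!: dist_algebra.mult simp: mem_Times_iff)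
  qed
  then show ?case unfolding L(2,4)
    by (intro exI[of _ "concat (map (\<lambda>p. map (?m p) L') L)"] conjI) (simp_all add: 2 fun_eq_iff)
qed

lemma tensor_deviation:
  fixes \<mu> :: "('g::countable \<Rightarrow> 'a) measure" and \<nu> :: "('g \<Rightarrow> 'b) measure"
  assumes cmX: "compact_metric X d" and cmY: "compact_metric Y e"
    and mu: "\<mu> \<in> Prob UNIV X d" and nu: "\<nu> \<in> Prob UNIV Y e" and fr: "model_frame V s"
    and L: "set L \<subseteq> tests X d \<times> tests Y e"
    and small: "\<And>f u. (f, u) \<in> set L \<Longrightarrow>
      \<bar>ave V (\<lambda>v. f (pullback_name s v x) * u (pullback_name s v y)) - (\<integral>x. f x \<partial>\<mu>) * (\<integral>y. u y \<partial>\<nu>)\<bar> \<le> c"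
  shows "\<bar>ave V (\<lambda>v. tensor_sum L (pullback_name s v (\<lambda>v\<in>V. (x v, y v)))) - (\<integral>z. tensor_sum L z \<partial>product_process X d \<mu> Y e \<nu>)\<bar>
    \<le> real (length L) * c"
    and "tensor_sum L \<in> tests (X \<times> Y) (avg_dist d e)"
proof -
  have *: "\<bar>ave V (\<lambda>v. tensor_sum L (pullback_name s v (\<lambda>v\<in>V. (x v, y v)))) - (\<integral>z. tensor_sum L z \<partial>product_process X d \<mu> Y e \<nu>)\<bar>
    \<le> real (length L) * c \<and> tensor_sum L \<in> tests (X \<times> Y) (avg_dist d e)"
    using L small
  proof (induction L)
    case Nil
    show ?case by (simp add: ave_def)
  next
    case (Cons p L)
    obtain f u where p: "p = (f, u)" by force
    let ?h = "\<lambda>z. f (\<lambda>g. fst (z g)) * u (\<lambda>g. snd (z g))"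
    have f: "f \<in> tests X d" and u: "u \<in> tests Y e" using Cons.prems(1) by (auto simp: p)
    have IH: "\<bar>ave V (\<lambda>v. tensor_sum L (pullback_name s v (\<lambda>v\<in>V. (x v, y v)))) - (\<integral>z. tensor_sum L z \<partial>product_process X d \<mu> Y e \<nu>)\<bar>
      \<le> real (length L) * c" and t: "tensor_sum L \<in> tests (X \<times> Y) (avg_dist d e)"
    proof -
      have "set L \<subseteq> tests X d \<times> tests Y e" using Cons.prems(1) by simp
      moreover have "\<And>f u. (f, u) \<in> set L \<Longrightarrow>
        \<bar>ave V (\<lambda>v. f (pullback_name s v x) * u (pullback_name s v y)) - (\<integral>x. f x \<partial>\<mu>) * (\<integral>y. u y \<partial>\<nu>)\<bar> \<le> c"
        by (rule Cons.prems(2)) simp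
      ultimately show "\<bar>ave V (\<lambda>v. tensor_sum L (pullback_name s v (\<lambda>v\<in>V. (x v, y v)))) - (\<integral>z. tensor_sum L z \<partial>product_process X d \<mu> Y e \<nu>)\<bar>
        \<le> real (length L) * c" "tensor_sum L \<in> tests (X \<times> Y) (avg_dist d e)"
        using Cons.IH by blast+
    qed
    have h: "?h \<in> tests (X \<times> Y) (avg_dist d e)"
      by (rule tests_mult[OF tests_fst[OF cmX cmY f] tests_snd[OF cmX cmY u]])
    have ts: "tensor_sum (p # L) = (\<lambda>z. ?h z + tensor_sum L z)" by (auto simp: p)
    have zP: "product_process X d \<mu> Y e \<nu> \<in> Prob UNIV (X \<times> Y) (avg_dist d e)"
      by (rule product_process_Prob[OF cmX cmY mu nu])
    note int = tests_integrable[OF compact_avg[OF cmX cmY] h zP] tests_integrable[OF compact_avg[OF cmX cmY] t zP]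
    have I: "(\<integral>z. tensor_sum (p # L) z \<partial>product_process X d \<mu> Y e \<nu>) =
       (\<integral>x. f x \<partial>\<mu>) * (\<integral>y. u y \<partial>\<nu>) + (\<integral>z. tensor_sum L z \<partial>product_process X d \<mu> Y e \<nu>)"
      unfolding ts using int integral_product_tensor[OF cmX cmY mu nu f u] by simp
    have A: "ave V (\<lambda>v. tensor_sum (p # L) (pullback_name s v (\<lambda>v\<in>V. (x v, y v)))) =
       ave V (\<lambda>v. f (pullback_name s v x) * u (pullback_name s v y)) + ave V (\<lambda>v. tensor_sum L (pullback_name s v (\<lambda>v\<in>V. (x v, y v))))"
      unfolding ave_add[symmetric]
      by (rule ave_cong) (use model_frameD(5)[OF fr] in \<open>simp add: p pullback_name_def\<close>)
    have "\<bar>ave V (\<lambda>v. f (pullback_name s v x) * u (pullback_name s v y)) - (\<integral>x. f x \<partial>\<mu>) * (\<integral>y. u y \<partial>\<nu>)\<bar> \<le> c"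
      by (rule Cons.prems(2)) (simp add: p)
    then have "\<bar>ave V (\<lambda>v. tensor_sum (p # L) (pullback_name s v (\<lambda>v\<in>V. (x v, y v)))) - (\<integral>z. tensor_sum (p # L) z \<partial>product_process X d \<mu> Y e \<nu>)\<bar>
      \<le> real (length (p # L)) * c"
      unfolding I A using IH by (simp add: algebra_simps)
    moreover have "tensor_sum (p # L) \<in> tests (X \<times> Y) (avg_dist d e)"
      unfolding ts using h t by (auto intro: continuous_intros)
    ultimately show ?case by blast
  qed
  show "\<bar>ave V (\<lambda>v. tensor_sum L (pullback_name s v (\<lambda>v\<in>V. (x v, y v)))) - (\<integral>z. tensor_sum L z \<partial>product_process X d \<mu> Y e \<nu>)\<bar>
    \<le> real (length L) * c" "tensor_sum L \<in> tests (X \<times> Y) (avg_dist d e)" using * by blast+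
qed

text \<open>For a tensor \<open>f \<otimes> u\<close> the average along \<open>(x, y)\<close> splits into the average of \<open>u_v(y) (f_v(x) - \<integral> f)\<close>, which is
small for most \<open>x\<close> by decorrelation with weights \<open>u_v(y)\<close>, and \<open>\<integral> f\<close> times the average of \<open>u_v(y)\<close>, which is
right because \<open>y\<close> is good. Only finitely many tensors are involved, so the exceptional sets of \<open>x\<close> can be united.\<close>

lemma doubly_quenched_pairs:
  fixes \<mu> :: "('g::countable \<Rightarrow> 'a) measure" and \<nu> :: "('g \<Rightarrow> 'b) measure"
  assumes cmX: "compact_metric X d" and cmY: "compact_metric Y e" and fr: "\<And>i. model_frame (V i) (\<sigma> i)"
    and mu: "\<mu> \<in> Prob UNIV X d" and nu: "\<nu> \<in> Prob UNIV Y e"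
    and dq: "doubly_quenched_converges V \<sigma> X d m \<mu>"
    and O: "\<O> \<in> nbhds (X \<times> Y) (avg_dist d e) (product_process X d \<mu> Y e \<nu>)" and \<epsilon>: "0 < \<epsilon>"
  obtains \<O>' where "\<O>' \<in> nbhds Y e \<nu>"
    "\<forall>\<^sub>F i in sequentially. \<forall>y\<in>good_models Y e (V i) (\<sigma> i) \<O>'. \<exists>E\<in>sets (m i). 1 - \<epsilon> < measure (m i) E \<and>
       (\<forall>x\<in>E. (\<lambda>v\<in>V i. (x v, y v)) \<in> good_models (X \<times> Y) (avg_dist d e) (V i) (\<sigma> i) \<O>)"
proof -
  let ?Z = "X \<times> Y" and ?D = "avg_dist d e" and ?\<zeta> = "product_process X d \<mu> Y e \<nu>"
  note msX = compact_metric_space[OF cmX]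
  note cmZ = compact_avg[OF cmX cmY]
  note zP = product_process_Prob[OF cmX cmY mu nu]
  obtain Fs \<kappa> where Fs: "finite Fs" "Fs \<subseteq> dist_algebra ?Z ?D" "0 < \<kappa>" "basic_nbhd ?Z ?D ?\<zeta> Fs \<kappa> \<subseteq> \<O>"
    using nbhds_basic_algebra[OF cmZ zP O] by blast
  have "\<forall>F\<in>Fs. \<exists>L. set L \<subseteq> dist_algebra X d \<times> dist_algebra Y e \<and> F = tensor_sum L"
    using dist_algebra_tensor Fs(2) by blast
  from bchoice[OF this] obtain LL where LL: "\<And>F. F \<in> Fs \<Longrightarrow> set (LL F) \<subseteq> dist_algebra X d \<times> dist_algebra Y e"
    "\<And>F. F \<in> Fs \<Longrightarrow> F = tensor_sum (LL F)" by blast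
  define P where "P = (\<Union>F\<in>Fs. set (LL F))"
  have P: "finite P" "P \<subseteq> tests X d \<times> tests Y e"
  proof -
    show "finite P" using Fs(1) by (simp add: P_def)
    have "P \<subseteq> dist_algebra X d \<times> dist_algebra Y e" using LL(1) unfolding P_def by blast
    also have "dist_algebra X d \<times> dist_algebra Y e \<subseteq> tests X d \<times> tests Y e"
      by (intro Sigma_mono subsetI dist_algebra_tests cmX cmY)
    finally show "P \<subseteq> tests X d \<times> tests Y e" .
  qed
  have fP: "fst p \<in> tests X d" "snd p \<in> tests Y e" if "p \<in> P" for p using P(2) that by auto
  define K where "K = 1 + (\<Sum>F\<in>Fs. real (length (LL F)))"
  have K: "real (length (LL F)) < K" if "F \<in> Fs" for F
    unfolding K_def using member_le_sum[OF that _ Fs(1), of "\<lambda>F. real (length (LL F))"] by auto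
  have K0: "0 < K" unfolding K_def by (simp add: add_pos_nonneg sum_nonneg)
  define \<kappa>1 where "\<kappa>1 = \<kappa> / K"
  have \<kappa>1: "0 < \<kappa>1" using Fs(3) K0 by (simp add: \<kappa>1_def)
  define A where "A = 1 + (\<Sum>p\<in>P. \<bar>\<integral>x. fst p x \<partial>\<mu>\<bar>)"
  have A: "\<bar>\<integral>x. fst p x \<partial>\<mu>\<bar> \<le> A" if "p \<in> P" for p
    unfolding A_def using member_le_sum[OF that _ P(1), of "\<lambda>p. \<bar>\<integral>x. fst p x \<partial>\<mu>\<bar>"] by auto
  have A0: "0 < A" unfolding A_def by (simp add: add_pos_nonneg sum_nonneg)
  have "\<forall>p\<in>P. \<exists>B>0. \<forall>y. (\<forall>g. y g \<in> Y) \<longrightarrow> \<bar>snd p y\<bar> \<le> B"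
  proof
    fix p assume p: "p \<in> P"
    show "\<exists>B>0. \<forall>y. (\<forall>g. y g \<in> Y) \<longrightarrow> \<bar>snd p y\<bar> \<le> B"
    proof (rule tests_bounded[OF cmY fP(2)[OF p]])
      fix B :: real assume "0 < B" and B: "\<And>x. (\<And>g. x g \<in> Y) \<Longrightarrow> \<bar>snd p x\<bar> \<le> B"
      have "\<bar>snd p y\<bar> \<le> B" if "\<forall>g. y g \<in> Y" for y by (rule B) (use that in blast)
      then show ?thesis using \<open>0 < B\<close> by (intro exI[of _ B]) simp
    qed
  qed
  from bchoice[OF this] obtain B where B: "\<And>p. p \<in> P \<Longrightarrow> 0 < B p"
    "\<And>p y. p \<in> P \<Longrightarrow> (\<forall>g. y g \<in> Y) \<Longrightarrow> \<bar>snd p y\<bar> \<le> B p" by blast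
  define \<eta> where "\<eta> = \<epsilon> / (2 * (1 + real (card P)))"
  have \<eta>: "0 < \<eta>" using \<epsilon> by (simp add: \<eta>_def)
  \<comment> \<open>the error in the average of \<open>u\<close> along \<open>y\<close> is multiplied by the integral of \<open>f\<close>, at most \<open>A\<close>\<close>
  let ?O = "basic_nbhd Y e \<nu> (snd ` P) (\<kappa>1 / (2 * A))"
  have sP: "snd ` P \<subseteq> tests Y e" using P(2) by auto
  have mP: "m i \<in> Prob (V i) X d" for i using dq by (simp add: doubly_quenched_converges_def)
  show thesis
  proof (rule that[of ?O])
    show "?O \<in> nbhds Y e \<nu>"
      by (rule basic_nbhd_nbhds[OF nu _ sP]) (use P \<kappa>1 A0 in auto)
    have "\<forall>\<^sub>F i in sequentially. \<forall>p\<in>P. \<forall>g. (\<forall>v\<in>V i. \<bar>g v\<bar> \<le> B p) \<longrightarrow>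
      measure (m i) {x \<in> space (m i). \<kappa>1/2 \<le> \<bar>ave (V i) (\<lambda>v. g v * (fst p (pullback_name (\<sigma> i) v x) - (\<integral>x. fst p x \<partial>\<mu>)))\<bar>} \<le> \<eta>"
      by (intro eventually_ball_finite P(1) ballI doubly_quenched_decorrelates[OF cmX fr mu dq fP(1)] B(1) \<eta>) (use \<kappa>1 in auto)
    then show "\<forall>\<^sub>F i in sequentially. \<forall>y\<in>good_models Y e (V i) (\<sigma> i) ?O. \<exists>E\<in>sets (m i). 1 - \<epsilon> < measure (m i) E \<and>
       (\<forall>x\<in>E. (\<lambda>v\<in>V i. (x v, y v)) \<in> good_models ?Z ?D (V i) (\<sigma> i) \<O>)"
    proof eventually_elim
      case (elim i)
      interpret M: prob_space "m i" by (rule ProbD(1)[OF mP msX])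
      note V = model_frameD(1,2)[OF fr[of i]]
      have spm: "space (m i) = PiE (V i) (\<lambda>_. X)" by (rule ProbD(3)[OF mP msX])
      show ?case
      proof
        fix y assume y: "y \<in> good_models Y e (V i) (\<sigma> i) ?O"
        have yE: "y \<in> PiE (V i) (\<lambda>_. Y)" and yu: "\<And>p. p \<in> P \<Longrightarrow> \<bar>ave (V i) (\<lambda>v. snd p (pullback_name (\<sigma> i) v y)) - (\<integral>y. snd p y \<partial>\<nu>)\<bar> < \<kappa>1 / (2 * A)"
          using y unfolding good_models_basic[OF cmY fr sP] by auto
        define a where "a p x = ave (V i) (\<lambda>v. snd p (pullback_name (\<sigma> i) v y) * (fst p (pullback_name (\<sigma> i) v x) - (\<integral>x. fst p x \<partial>\<mu>)))" for p x
        define Bad where "Bad p = {x \<in> space (m i). \<kappa>1/2 \<le> \<bar>a p x\<bar>}" for p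
        have Bs: "Bad p \<in> sets (m i)" if p: "p \<in> P" for p
        proof -
          have [measurable]: "a p \<in> borel_measurable (m i)"
            unfolding a_def ave_def
          proof (intro borel_measurable_divide borel_measurable_sum borel_measurable_times borel_measurable_diff borel_measurable_const)
            fix v assume v: "v \<in> V i"
            show "(\<lambda>x. fst p (pullback_name (\<sigma> i) v x)) \<in> borel_measurable (m i)"
              using measurable_compose[OF pullback_name_measurable[OF fr v] tests_measurable[OF cmX fP(1)[OF p]]]
              by (simp cong: measurable_cong_sets add: ProbD(2)[OF mP msX])
          qed
          show ?thesis unfolding Bad_def by measurable
        qed
        have Bm: "M.prob (Bad p) \<le> \<eta>" if p: "p \<in> P" for p
        proof -
          have "\<forall>v\<in>V i. \<bar>snd p (pullback_name (\<sigma> i) v y)\<bar> \<le> B p"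
            by (intro ballI B(2)[OF p] allI pullback_name_in[OF fr yE])
          then show ?thesis unfolding Bad_def a_def
            using elim[THEN bspec[OF _ p], THEN spec, of "\<lambda>v. snd p (pullback_name (\<sigma> i) v y)"] by (rule rev_mp)
        qed
        let ?E = "space (m i) - (\<Union>p\<in>P. Bad p)"
        have UB: "(\<Union>p\<in>P. Bad p) \<in> sets (m i)" using P(1) Bs by blast
        have "M.prob (\<Union>p\<in>P. Bad p) \<le> (\<Sum>p\<in>P. M.prob (Bad p))"
          by (rule M.finite_measure_subadditive_finite[OF P(1)]) (use Bs in auto)
        also have "\<dots> \<le> (\<Sum>p\<in>P. \<eta>)" by (rule sum_mono) (rule Bm)
        also have "\<dots> = real (card P) * \<eta>" by simp
        also have "\<dots> < \<epsilon>"
        proof -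
          have "real (card P) * \<eta> \<le> (1 + real (card P)) * \<eta>" using \<eta> by (intro mult_right_mono) auto
          also have "\<dots> = \<epsilon> / 2" using \<epsilon> by (simp add: \<eta>_def field_simps)
          finally show ?thesis using \<epsilon> by simp
        qed
        finally have E1: "1 - \<epsilon> < M.prob ?E" using M.prob_compl[OF UB] by simp
        show "\<exists>E\<in>sets (m i). 1 - \<epsilon> < measure (m i) E \<and>
           (\<forall>x\<in>E. (\<lambda>v\<in>V i. (x v, y v)) \<in> good_models ?Z ?D (V i) (\<sigma> i) \<O>)"
        proof (intro bexI[of _ ?E] conjI ballI E1)
          show "?E \<in> sets (m i)" using UB by blast
          fix x assume x: "x \<in> ?E"
          have xE: "x \<in> PiE (V i) (\<lambda>_. X)" using x spm by auto
          have dev: "\<bar>ave (V i) (\<lambda>v. f (pullback_name (\<sigma> i) v x) * u (pullback_name (\<sigma> i) v y)) - (\<integral>x. f x \<partial>\<mu>) * (\<integral>y. u y \<partial>\<nu>)\<bar> \<le> \<kappa>1"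
            if fu: "(f, u) \<in> P" for f u
          proof -
            let ?I = "\<integral>x. f x \<partial>\<mu>"
            let ?J = "ave (V i) (\<lambda>v. u (pullback_name (\<sigma> i) v y))"
            have 1: "\<bar>a (f, u) x\<bar> < \<kappa>1/2" using x fu by (auto simp: Bad_def not_le)
            have "a (f, u) x = ave (V i) (\<lambda>v. f (pullback_name (\<sigma> i) v x) * u (pullback_name (\<sigma> i) v y) - ?I * u (pullback_name (\<sigma> i) v y))"
              unfolding a_def by (rule ave_cong) (simp add: algebra_simps)
            then have 2: "a (f, u) x = ave (V i) (\<lambda>v. f (pullback_name (\<sigma> i) v x) * u (pullback_name (\<sigma> i) v y)) - ?I * ?J"
              by (simp add: ave_diff ave_cmult)
            have "\<bar>?I * ?J - ?I * (\<integral>y. u y \<partial>\<nu>)\<bar> = \<bar>?I\<bar> * \<bar>?J - (\<integral>y. u y \<partial>\<nu>)\<bar>"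
              by (simp add: abs_mult right_diff_distrib[symmetric])
            also have "\<dots> \<le> A * (\<kappa>1 / (2 * A))"
              using A[OF fu] yu[OF fu] A0 by (intro mult_mono) auto
            also have "\<dots> = \<kappa>1/2" using A0 by simp
            finally show ?thesis using 1 2 by linarith
          qed
          have "(\<lambda>v\<in>V i. (x v, y v)) \<in> good_models ?Z ?D (V i) (\<sigma> i) (basic_nbhd ?Z ?D ?\<zeta> Fs \<kappa>)"
          proof -
            have FT: "Fs \<subseteq> tests ?Z ?D" using Fs(2) dist_algebra_tests[OF cmZ] by blast
            show ?thesis unfolding good_models_basic[OF cmZ fr FT]
            proof (intro CollectI conjI ballI)
              show "(\<lambda>v\<in>V i. (x v, y v)) \<in> PiE (V i) (\<lambda>_. ?Z)" using xE yE by (auto simp: restrict_PiE_iff)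
              fix F assume F: "F \<in> Fs"
              have sub: "set (LL F) \<subseteq> P" using F by (auto simp: P_def)
              have LT: "set (LL F) \<subseteq> tests X d \<times> tests Y e" using sub P(2) by blast
              have "\<bar>ave (V i) (\<lambda>v. tensor_sum (LL F) (pullback_name (\<sigma> i) v (\<lambda>v\<in>V i. (x v, y v)))) - (\<integral>z. tensor_sum (LL F) z \<partial>?\<zeta>)\<bar>
                 \<le> real (length (LL F)) * \<kappa>1"
                by (rule tensor_deviation(1)[OF cmX cmY mu nu fr LT]) (use dev sub in blast)
              also have "\<dots> < K * \<kappa>1" using K[OF F] \<kappa>1 by (rule mult_strict_right_mono)
              also have "\<dots> = \<kappa>" using K0 by (simp add: \<kappa>1_def)
              finally show "\<bar>ave (V i) (\<lambda>v. F (pullback_name (\<sigma> i) v (\<lambda>v\<in>V i. (x v, y v)))) - (\<integral>z. F z \<partial>?\<zeta>)\<bar> < \<kappa>"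
                unfolding LL(2)[OF F, symmetric] .
            qed
          qed
          then show "(\<lambda>v\<in>V i. (x v, y v)) \<in> good_models ?Z ?D (V i) (\<sigma> i) \<O>"
            using good_models_mono[OF Fs(4)] by blast
        qed
      qed
    qed
  qed
qed

text \<open>Suppose the product had smaller entropy. Then for large \<open>i\<close> along the subsequence of the doubly quenched
measures the covering numbers of the product are too small, while those of the second process are large
for all large \<open>i\<close> because its lower entropy exceeds \<open>b\<close>. By \<open>cov_product_lower\<close> the covering numbers of the
measures are then small for all large \<open>i\<close>, contrary to the choice of the measures.\<close>

theorem sofic_entropy_superadditive:
  fixes \<mu> :: "('g::{group_add,countable} \<Rightarrow> 'a) measure" and \<nu> :: "('g \<Rightarrow> 'b) measure"
  assumes sof: "sofic_approximation V \<sigma>" and cmX: "compact_metric X d" and cmY: "compact_metric Y e"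
    and mu: "\<mu> \<in> Prob UNIV X d" and nu: "\<nu> \<in> Prob UNIV Y e"
    and a: "ereal a < process_dq_entropy V \<sigma> X d \<mu>" and b: "ereal b < process_lower_sofic_entropy V \<sigma> Y e \<nu>"
  shows "ereal (a + b) \<le> process_sofic_entropy V \<sigma> (X \<times> Y) (avg_dist d e) (product_process X d \<mu> Y e \<nu>)"
proof -
  let ?Z = "X \<times> Y" and ?D = "avg_dist d e" and ?\<zeta> = "product_process X d \<mu> Y e \<nu>"
  note fr = sofic_model_frame[OF sof]
  from a obtain r m \<delta>1 \<epsilon> where r: "strict_mono r" and dq: "doubly_quenched_converges (V \<circ> r) (\<sigma> \<circ> r) X d m \<mu>"
    and \<delta>1: "0 < \<delta>1" and \<epsilon>: "0 < \<epsilon>"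
    and lima: "ereal a < limsup (\<lambda>i. log_card (cov_measure \<epsilon> \<delta>1 (m i) (hamming_dist (V (r i)) d)) / ereal (real (card (V (r i)))))"
    unfolding process_dq_entropy_def less_SUP_iff case_prod_beta by (auto simp: less_SUP_iff)
  from b obtain \<delta>2 where \<delta>2: "0 < \<delta>2"
    and limb: "ereal b < (INF \<O>\<in>nbhds Y e \<nu>. liminf (\<lambda>n. rate Y e (V n) (\<sigma> n) \<delta>2 \<O>))"
    unfolding process_lower_sofic_entropy_rate less_SUP_iff by auto
  define \<delta> where "\<delta> = min (\<delta>1/2) (\<delta>2/4)"
  have \<delta>: "0 < \<delta>" "2 * \<delta> \<le> \<delta>1" "4 * \<delta> \<le> \<delta>2" using \<delta>1 \<delta>2 by (auto simp: \<delta>_def)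
  have "ereal (a + b) \<le> (INF \<O>\<in>nbhds ?Z ?D ?\<zeta>. limsup (\<lambda>n. rate ?Z ?D (V n) (\<sigma> n) \<delta> \<O>))"
  proof (rule INF_greatest)
    fix \<O> assume O: "\<O> \<in> nbhds ?Z ?D ?\<zeta>"
    have frr: "model_frame ((V \<circ> r) i) ((\<sigma> \<circ> r) i)" for i using fr by simp
    obtain \<O>' where O': "\<O>' \<in> nbhds Y e \<nu>" and ev:
      "\<forall>\<^sub>F i in sequentially. \<forall>y\<in>good_models Y e ((V \<circ> r) i) ((\<sigma> \<circ> r) i) \<O>'. \<exists>E\<in>sets (m i). 1 - \<epsilon> < measure (m i) E \<and>
       (\<forall>x\<in>E. (\<lambda>v\<in>(V \<circ> r) i. (x v, y v)) \<in> good_models ?Z ?D ((V \<circ> r) i) ((\<sigma> \<circ> r) i) \<O>)"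
      using doubly_quenched_pairs[OF cmX cmY frr mu nu dq O \<epsilon>] by blast
    have "ereal b < liminf (\<lambda>n. rate Y e (V n) (\<sigma> n) \<delta>2 \<O>')"
      using limb O' by (meson INF_lower less_le_trans)
    then have "\<forall>\<^sub>F n in sequentially. ereal b < rate Y e (V n) (\<sigma> n) \<delta>2 \<O>'" by (rule less_LiminfD)
    then have evb: "\<forall>\<^sub>F i in sequentially. ereal b < rate Y e (V (r i)) (\<sigma> (r i)) \<delta>2 \<O>'"
      by (rule eventually_subseq[OF r])
    show "ereal (a + b) \<le> limsup (\<lambda>n. rate ?Z ?D (V n) (\<sigma> n) \<delta> \<O>)"
    proof (rule ccontr)
      assume "\<not> ?thesis"
      then have "limsup (\<lambda>n. rate ?Z ?D (V n) (\<sigma> n) \<delta> \<O>) < ereal (a + b)" by simp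
      then have "\<forall>\<^sub>F n in sequentially. rate ?Z ?D (V n) (\<sigma> n) \<delta> \<O> < ereal (a + b)" by (rule Limsup_lessD)
      then have evz: "\<forall>\<^sub>F i in sequentially. rate ?Z ?D (V (r i)) (\<sigma> (r i)) \<delta> \<O> < ereal (a + b)"
        by (rule eventually_subseq[OF r])
      have "\<forall>\<^sub>F i in sequentially. log_card (cov_measure \<epsilon> \<delta>1 (m i) (hamming_dist (V (r i)) d)) / ereal (real (card (V (r i)))) \<le> ereal a"
        using ev evb evz
      proof eventually_elim
        case (elim i)
        let ?V = "V (r i)" and ?s = "\<sigma> (r i)"
        let ?c = "real (card ?V)"
        let ?k = "cov_measure \<epsilon> \<delta>1 (m i) (hamming_dist ?V d)"
        let ?l = "cov \<delta>2 (good_models Y e ?V ?s \<O>') (hamming_dist ?V e)"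
        let ?w = "cov \<delta> (good_models ?Z ?D ?V ?s \<O>) (hamming_dist ?V ?D)"
        have c: "0 < ?c" using model_frameD(3)[OF fr] by simp
        have mi: "m i \<in> Prob ?V X d" using dq by (auto simp: doubly_quenched_converges_def)
        have "\<forall>y\<in>good_models Y e ?V ?s \<O>'. \<exists>E. E \<in> sets (m i) \<and> 1 - \<epsilon> < measure (m i) E \<and>
          (\<forall>x\<in>E. (\<lambda>v\<in>?V. (x v, y v)) \<in> good_models ?Z ?D ?V ?s \<O>)" using elim(1) by auto
        from bchoice[OF this] obtain E where E: "\<forall>y\<in>good_models Y e ?V ?s \<O>'. E y \<in> sets (m i) \<and> 1 - \<epsilon> < measure (m i) (E y) \<and>
          (\<forall>x\<in>E y. (\<lambda>v\<in>?V. (x v, y v)) \<in> good_models ?Z ?D ?V ?s \<O>)" ..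
        have le: "?k * ?l \<le> ?w"
          by (rule cov_product_lower[OF cmX cmY model_frameD(1,2)[OF fr] \<delta> mi, where E = E])
            (use E in \<open>auto simp: good_models_def\<close>)
        show ?case
        proof (rule ccontr)
          assume "\<not> ?thesis"
          then have "ereal a < log_card ?k / ereal ?c" by simp
          then have k: "0 < ?k" "a * ?c < ln (real ?k)" by (simp_all add: log_card_divide_gt[OF c])
          have l: "0 < ?l" "b * ?c < ln (real ?l)" using elim(2) by (simp_all add: rate_def log_card_divide_gt[OF c])
          have kl: "0 < ?k * ?l" using k(1) l(1) by simp
          then have w: "0 < ?w" using le by linarith
          have "(a + b) * ?c \<le> ln (real (?k * ?l))" using k l by (simp add: ln_mult distrib_right)
          also have "\<dots> \<le> ln (real ?w)"
            by (rule ln_le_cancel_iff[THEN iffD2]) (use kl w le in \<open>simp_all del: of_nat_mult\<close>)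
          finally have "ereal (a + b) \<le> rate ?Z ?D ?V ?s \<delta> \<O>"
            unfolding rate_def log_card_divide_ge[OF c] using w by blast
          then show False using elim(3) by simp
        qed
      qed
      then have "limsup (\<lambda>i. log_card (cov_measure \<epsilon> \<delta>1 (m i) (hamming_dist (V (r i)) d)) / ereal (real (card (V (r i))))) \<le> ereal a"
        by (rule Limsup_bounded)
      then show False using lima by simp
    qed
  qed
  also have "\<dots> \<le> process_sofic_entropy V \<sigma> ?Z ?D ?\<zeta>"
    unfolding process_sofic_entropy_rate using \<delta>(1) by (intro SUP_upper) auto
  finally show ?thesis .
qed

section \<open>Lifting models along equivariant maps\<close>

lemma dist_algebra_shift:
  "f \<in> dist_algebra X d \<Longrightarrow> (\<lambda>x. f (shift g x)) \<in> dist_algebra X d"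
proof (induction rule: dist_algebra.induct)
  case (coord q h)
  then show ?case unfolding shift_def by (rule dist_algebra.coord)
qed (auto intro: dist_algebra.intros)

lemma shift_in: "(\<forall>g. x g \<in> X) \<Longrightarrow> (\<forall>g. shift h x g \<in> X)"
  by (simp add: shift_def)

lemma shift_measurable: "shift g \<in> measurable (config_algebra UNIV X d) (config_algebra UNIV X d)"
proof -
  have "(\<lambda>x. \<lambda>h\<in>UNIV. x (h + g)) \<in> measurable (config_algebra UNIV X d) (config_algebra UNIV X d)"
    unfolding config_algebra_def by (intro measurable_restrict measurable_component_singleton) auto
  then show ?thesis by (simp add: shift_def[abs_def] restrict_def)
qed

text \<open>
The constants \<open>P\<close>, \<open>F\<close>, \<open>L\<close> and \<open>B\<close> depend on \<open>u\<close> and \<open>C\<close> only and are fixed before the functions \<open>r\<close> are chosen. In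
\<open>model_lifting\<close> they determine how well the \<open>r p\<close> have to approximate. The estimate is for arbitrary \<open>x\<close> and \<open>y\<close>, unrelated to
each other; it is used both with \<open>y\<close> a name along a lifted model and with \<open>y\<close> the image of \<open>x\<close>.
\<close>

definition substitution_bound ::
  "'a set \<Rightarrow> ('a \<Rightarrow> 'a \<Rightarrow> real) \<Rightarrow> 'b set \<Rightarrow> ('b \<Rightarrow> 'b \<Rightarrow> real) \<Rightarrow> real \<Rightarrow> (('g::group_add \<Rightarrow> 'b) \<Rightarrow> real)
    \<Rightarrow> 'b set \<Rightarrow> 'g set \<Rightarrow> real \<Rightarrow> real \<Rightarrow> bool" where
  "substitution_bound X d Y e C u P F L B \<longleftrightarrow> finite P \<and> P \<subseteq> Y \<and> finite F \<and> 0 < L \<and> 0 < B \<and>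
    (\<forall>r. (\<forall>p\<in>P. r p \<in> dist_algebra X d \<and> (\<forall>x. (\<forall>g. x g \<in> X) \<longrightarrow> \<bar>r p x\<bar> \<le> C)) \<longrightarrow>
      (\<exists>w\<in>dist_algebra X d. \<forall>x. (\<forall>g. x g \<in> X) \<longrightarrow> \<bar>w x\<bar> \<le> B \<and>
        (\<forall>y. (\<forall>g. y g \<in> Y) \<longrightarrow> \<bar>u y - w x\<bar> \<le> L * (\<Sum>p\<in>P. \<Sum>g\<in>F. \<bar>e (y g) p - r p (shift g x)\<bar>))))"

lemma substitution_bound_pos:
  assumes "substitution_bound X d Y e C u P F L B"
  shows "finite P" "P \<subseteq> Y" "finite F" "0 < L" "0 < B"
  using assms by (simp_all add: substitution_bound_def)

lemma substitution_boundD: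
  assumes "substitution_bound X d Y e C u P F L B"
    and "\<forall>p\<in>P. r p \<in> dist_algebra X d \<and> (\<forall>x. (\<forall>g. x g \<in> X) \<longrightarrow> \<bar>r p x\<bar> \<le> C)"
  shows "\<exists>w\<in>dist_algebra X d. (\<forall>x. (\<forall>g. x g \<in> X) \<longrightarrow> \<bar>w x\<bar> \<le> B) \<and>
    (\<forall>x y. (\<forall>g. x g \<in> X) \<longrightarrow> (\<forall>g. y g \<in> Y) \<longrightarrow> \<bar>u y - w x\<bar> \<le> L * (\<Sum>p\<in>P. \<Sum>g\<in>F. \<bar>e (y g) p - r p (shift g x)\<bar>))"
proof -
  from assms(1)[unfolded substitution_bound_def, THEN conjunct2, THEN conjunct2, THEN conjunct2, THEN conjunct2,
      THEN conjunct2, THEN spec, THEN mp, OF assms(2)]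
  obtain w where w: "w\<in>dist_algebra X d" "\<forall>x. (\<forall>g. x g \<in> X) \<longrightarrow> \<bar>w x\<bar> \<le> B \<and>
        (\<forall>y. (\<forall>g. y g \<in> Y) \<longrightarrow> \<bar>u y - w x\<bar> \<le> L * (\<Sum>p\<in>P. \<Sum>g\<in>F. \<bar>e (y g) p - r p (shift g x)\<bar>))"
    by (elim bexE)
  show ?thesis by (rule bexI[OF _ w(1)]) (simp add: w(2))
qed

text \<open>An element \<open>u\<close> of the algebra is a polynomial in the distances \<open>e (y g) p\<close>. Replacing each of them by \<open>r p (shift g x)\<close>
gives the function \<open>w\<close>; the error is Lipschitz in the errors made in each distance, as all factors are bounded.\<close>

lemma algebra_substitution:
  fixes u :: "('g::group_add \<Rightarrow> 'b) \<Rightarrow> real" and X :: "'a set"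
  assumes cmY: "compact_metric Y e" and u: "u \<in> dist_algebra Y e" and C: "0 < C"
  shows "\<exists>P F L B. substitution_bound X d Y e C u P F L B"
proof -
  have mono: "(\<Sum>p\<in>P. \<Sum>g\<in>F. \<bar>e (y g) p - r p (shift g x)\<bar>) \<le> (\<Sum>p\<in>P \<union> P'. \<Sum>g\<in>F \<union> F'. \<bar>e (y g) p - r p (shift g x)\<bar>)"
    if "finite P" "finite F" "finite P'" "finite F'" for P P' :: "'b set" and F F' :: "'g set" and x :: "'g \<Rightarrow> 'a" and y r
  proof -
    have "(\<Sum>p\<in>P. \<Sum>g\<in>F. \<bar>e (y g) p - r p (shift g x)\<bar>) \<le> (\<Sum>p\<in>P. \<Sum>g\<in>F \<union> F'. \<bar>e (y g) p - r p (shift g x)\<bar>)"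
      by (intro sum_mono sum_mono2) (use that in auto)
    also have "\<dots> \<le> (\<Sum>p\<in>P \<union> P'. \<Sum>g\<in>F \<union> F'. \<bar>e (y g) p - r p (shift g x)\<bar>)"
      by (intro sum_mono2) (use that in \<open>auto intro: sum_nonneg\<close>)
    finally show ?thesis .
  qed
  show ?thesis
    using u
  proof induction
    case (const c)
    show ?case
      unfolding substitution_bound_def
      by (rule exI[of _ "{}"], rule exI[of _ "{}"], rule exI[of _ 1], rule exI[of _ "\<bar>c\<bar> + 1"])
        (auto intro!: bexI[OF _ dist_algebra.const[of c]])
  next
    case (coord q g)
    show ?case
    proof (rule exI[of _ "{q}"], rule exI[of _ "{g}"], rule exI[of _ "1::real"], rule exI[of _ C], unfold substitution_bound_def, intro conjI allI impI)
      fix r assume r: "\<forall>p\<in>{q}. r p \<in> dist_algebra X d \<and> (\<forall>x::'g \<Rightarrow> 'a. (\<forall>g. x g \<in> X) \<longrightarrow> \<bar>r p x\<bar> \<le> C)"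
      show "\<exists>w\<in>dist_algebra X d. \<forall>x. (\<forall>g::'g. x g \<in> X) \<longrightarrow> \<bar>w x\<bar> \<le> C \<and>
        (\<forall>y. (\<forall>g. y g \<in> Y) \<longrightarrow> \<bar>e (y g) q - w x\<bar> \<le> 1 * (\<Sum>p\<in>{q}. \<Sum>g\<in>{g}. \<bar>e (y g) p - r p (shift g x)\<bar>))"
      proof (intro bexI[of _ "\<lambda>x. r q (shift g x)"] allI impI conjI)
        show "(\<lambda>x. r q (shift g x)) \<in> dist_algebra X d" using r by (intro dist_algebra_shift) auto
        fix x :: "'g \<Rightarrow> 'a" assume "\<forall>g. x g \<in> X"
        then show "\<bar>r q (shift g x)\<bar> \<le> C" using r shift_in[of x X g] by blast
      qed auto
    qed (use coord C in auto)
  next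
    case (add u1 u2)
    from add.IH(1) obtain P1 F1 L1 B1 where S1: "substitution_bound X d Y e C u1 P1 F1 L1 B1" by (elim exE)
    from add.IH(2) obtain P2 F2 L2 B2 where S2: "substitution_bound X d Y e C u2 P2 F2 L2 B2" by (elim exE)
    note pos = substitution_bound_pos[OF S1] substitution_bound_pos[OF S2]
    show ?case
    proof (rule exI[of _ "P1 \<union> P2"], rule exI[of _ "F1 \<union> F2"], rule exI[of _ "L1 + L2"], rule exI[of _ "B1 + B2"],
        unfold substitution_bound_def, intro conjI allI impI)
      fix r assume r: "\<forall>p\<in>P1 \<union> P2. r p \<in> dist_algebra X d \<and> (\<forall>x::'g \<Rightarrow> 'a. (\<forall>g. x g \<in> X) \<longrightarrow> \<bar>r p x\<bar> \<le> C)"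
      let ?T = "\<lambda>x y. \<Sum>p\<in>P1 \<union> P2. \<Sum>g\<in>F1 \<union> F2. \<bar>e (y g) p - r p (shift g x)\<bar>"
      have r1: "\<forall>p\<in>P1. r p \<in> dist_algebra X d \<and> (\<forall>x::'g \<Rightarrow> 'a. (\<forall>g. x g \<in> X) \<longrightarrow> \<bar>r p x\<bar> \<le> C)"
        by (rule ballI, rule bspec[OF r]) simp
      from substitution_boundD[OF S1 r1]
      obtain w1 where w1: "w1 \<in> dist_algebra X d" "\<forall>x. (\<forall>g. x g \<in> X) \<longrightarrow> \<bar>w1 x\<bar> \<le> B1"
        "\<forall>x y. (\<forall>g. x g \<in> X) \<longrightarrow> (\<forall>g. y g \<in> Y) \<longrightarrow> \<bar>u1 y - w1 x\<bar> \<le> L1 * (\<Sum>p\<in>P1. \<Sum>g\<in>F1. \<bar>e (y g) p - r p (shift g x)\<bar>)"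
        by (elim bexE conjE)
      have r2: "\<forall>p\<in>P2. r p \<in> dist_algebra X d \<and> (\<forall>x::'g \<Rightarrow> 'a. (\<forall>g. x g \<in> X) \<longrightarrow> \<bar>r p x\<bar> \<le> C)"
        by (rule ballI, rule bspec[OF r]) simp
      from substitution_boundD[OF S2 r2]
      obtain w2 where w2: "w2 \<in> dist_algebra X d" "\<forall>x. (\<forall>g. x g \<in> X) \<longrightarrow> \<bar>w2 x\<bar> \<le> B2"
        "\<forall>x y. (\<forall>g. x g \<in> X) \<longrightarrow> (\<forall>g. y g \<in> Y) \<longrightarrow> \<bar>u2 y - w2 x\<bar> \<le> L2 * (\<Sum>p\<in>P2. \<Sum>g\<in>F2. \<bar>e (y g) p - r p (shift g x)\<bar>)"
        by (elim bexE conjE)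
      have T: "\<bar>u1 y - w1 x\<bar> \<le> L1 * ?T x y" "\<bar>u2 y - w2 x\<bar> \<le> L2 * ?T x y"
        if "\<forall>g. x g \<in> X" "\<forall>g. y g \<in> Y" for x y
        using order_trans[OF w1(3)[THEN spec, THEN spec, THEN mp, THEN mp, OF that]
            mult_left_mono[OF mono[OF pos(1,3,6,8), of y r x] less_imp_le[OF pos(4)]]]
          order_trans[OF w2(3)[THEN spec, THEN spec, THEN mp, THEN mp, OF that]
            mult_left_mono[OF mono[OF pos(6,8,1,3), of y r x] less_imp_le[OF pos(9)]]]
        by (simp_all only: Un_commute)
      show "\<exists>w\<in>dist_algebra X d. \<forall>x. (\<forall>g::'g. x g \<in> X) \<longrightarrow> \<bar>w x\<bar> \<le> B1 + B2 \<and>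
        (\<forall>y. (\<forall>g. y g \<in> Y) \<longrightarrow> \<bar>u1 y + u2 y - w x\<bar> \<le> (L1 + L2) * ?T x y)"
      proof (intro bexI[OF _ dist_algebra.add[OF w1(1) w2(1)]] allI impI conjI)
        fix x :: "'g \<Rightarrow> 'a" assume x: "\<forall>g. x g \<in> X"
        show "\<bar>w1 x + w2 x\<bar> \<le> B1 + B2" using w1(2)[THEN spec, THEN mp, OF x] w2(2)[THEN spec, THEN mp, OF x] by linarith
        fix y :: "'g \<Rightarrow> 'b" assume y: "\<forall>g. y g \<in> Y"
        show "\<bar>u1 y + u2 y - (w1 x + w2 x)\<bar> \<le> (L1 + L2) * ?T x y" unfolding distrib_right using T[OF x y] by linarith
      qed
    qed (use pos in auto)
  next
    case (mult u1 u2)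
    from mult.IH(1) obtain P1 F1 L1 B1 where S1: "substitution_bound X d Y e C u1 P1 F1 L1 B1" by (elim exE)
    from mult.IH(2) obtain P2 F2 L2 B2 where S2: "substitution_bound X d Y e C u2 P2 F2 L2 B2" by (elim exE)
    note pos = substitution_bound_pos[OF S1] substitution_bound_pos[OF S2]
    obtain A where A: "0 < A" "\<And>y. (\<And>g. y g \<in> Y) \<Longrightarrow> \<bar>u2 y\<bar> \<le> A"
      using dist_algebra_bounded[OF cmY mult.hyps(2)] by blast
    show ?case
    proof (rule exI[of _ "P1 \<union> P2"], rule exI[of _ "F1 \<union> F2"], rule exI[of _ "L1 * A + B1 * L2"], rule exI[of _ "B1 * B2"],
        unfold substitution_bound_def, intro conjI allI impI)
      fix r assume r: "\<forall>p\<in>P1 \<union> P2. r p \<in> dist_algebra X d \<and> (\<forall>x::'g \<Rightarrow> 'a. (\<forall>g. x g \<in> X) \<longrightarrow> \<bar>r p x\<bar> \<le> C)"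
      let ?T = "\<lambda>x y. \<Sum>p\<in>P1 \<union> P2. \<Sum>g\<in>F1 \<union> F2. \<bar>e (y g) p - r p (shift g x)\<bar>"
      have r1: "\<forall>p\<in>P1. r p \<in> dist_algebra X d \<and> (\<forall>x::'g \<Rightarrow> 'a. (\<forall>g. x g \<in> X) \<longrightarrow> \<bar>r p x\<bar> \<le> C)"
        by (rule ballI, rule bspec[OF r]) simp
      from substitution_boundD[OF S1 r1]
      obtain w1 where w1: "w1 \<in> dist_algebra X d" "\<forall>x. (\<forall>g. x g \<in> X) \<longrightarrow> \<bar>w1 x\<bar> \<le> B1"
        "\<forall>x y. (\<forall>g. x g \<in> X) \<longrightarrow> (\<forall>g. y g \<in> Y) \<longrightarrow> \<bar>u1 y - w1 x\<bar> \<le> L1 * (\<Sum>p\<in>P1. \<Sum>g\<in>F1. \<bar>e (y g) p - r p (shift g x)\<bar>)"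
        by (elim bexE conjE)
      have r2: "\<forall>p\<in>P2. r p \<in> dist_algebra X d \<and> (\<forall>x::'g \<Rightarrow> 'a. (\<forall>g. x g \<in> X) \<longrightarrow> \<bar>r p x\<bar> \<le> C)"
        by (rule ballI, rule bspec[OF r]) simp
      from substitution_boundD[OF S2 r2]
      obtain w2 where w2: "w2 \<in> dist_algebra X d" "\<forall>x. (\<forall>g. x g \<in> X) \<longrightarrow> \<bar>w2 x\<bar> \<le> B2"
        "\<forall>x y. (\<forall>g. x g \<in> X) \<longrightarrow> (\<forall>g. y g \<in> Y) \<longrightarrow> \<bar>u2 y - w2 x\<bar> \<le> L2 * (\<Sum>p\<in>P2. \<Sum>g\<in>F2. \<bar>e (y g) p - r p (shift g x)\<bar>)"
        by (elim bexE conjE)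
      have T: "\<bar>u1 y - w1 x\<bar> \<le> L1 * ?T x y" "\<bar>u2 y - w2 x\<bar> \<le> L2 * ?T x y"
        if "\<forall>g. x g \<in> X" "\<forall>g. y g \<in> Y" for x y
        using order_trans[OF w1(3)[THEN spec, THEN spec, THEN mp, THEN mp, OF that]
            mult_left_mono[OF mono[OF pos(1,3,6,8), of y r x] less_imp_le[OF pos(4)]]]
          order_trans[OF w2(3)[THEN spec, THEN spec, THEN mp, THEN mp, OF that]
            mult_left_mono[OF mono[OF pos(6,8,1,3), of y r x] less_imp_le[OF pos(9)]]]
        by (simp_all only: Un_commute)
      show "\<exists>w\<in>dist_algebra X d. \<forall>x. (\<forall>g::'g. x g \<in> X) \<longrightarrow> \<bar>w x\<bar> \<le> B1 * B2 \<and>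
        (\<forall>y. (\<forall>g. y g \<in> Y) \<longrightarrow> \<bar>u1 y * u2 y - w x\<bar> \<le> (L1 * A + B1 * L2) * ?T x y)"
      proof (intro bexI[OF _ dist_algebra.mult[OF w1(1) w2(1)]] allI impI conjI)
        fix x :: "'g \<Rightarrow> 'a" assume x: "\<forall>g. x g \<in> X"
        show "\<bar>w1 x * w2 x\<bar> \<le> B1 * B2" unfolding abs_mult using w1(2)[THEN spec, THEN mp, OF x] w2(2)[THEN spec, THEN mp, OF x] pos by (intro mult_mono) auto
        fix y :: "'g \<Rightarrow> 'b" assume y: "\<forall>g. y g \<in> Y"
        have T0: "0 \<le> ?T x y" by (intro sum_nonneg) auto
        have "u1 y * u2 y - w1 x * w2 x = (u1 y - w1 x) * u2 y + w1 x * (u2 y - w2 x)" by (simp add: algebra_simps)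
        then have "\<bar>u1 y * u2 y - w1 x * w2 x\<bar> \<le> \<bar>u1 y - w1 x\<bar> * \<bar>u2 y\<bar> + \<bar>w1 x\<bar> * \<bar>u2 y - w2 x\<bar>"
          by (metis abs_mult abs_triangle_ineq)
        also have "\<dots> \<le> (L1 * ?T x y) * A + B1 * (L2 * ?T x y)"
          using T[OF x y] w1(2)[THEN spec, THEN mp, OF x] A(2)[of y] y pos T0 by (intro add_mono mult_mono) auto
        also have "\<dots> = (L1 * A + B1 * L2) * ?T x y" by (simp add: algebra_simps)
        finally show "\<bar>u1 y * u2 y - w1 x * w2 x\<bar> \<le> (L1 * A + B1 * L2) * ?T x y" .
      qed
    qed (use pos A in \<open>auto simp: add_pos_pos\<close>)
  qed
qed

text \<open>Names along a model are nearly equivariant: the name at \<open>\<sigma> g v\<close> and the shifted name at \<open>v\<close> agree in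
coordinate \<open>h\<close> whenever \<open>\<sigma> h (\<sigma> g v) = \<sigma> (h + g) v\<close>. A function of finitely many coordinates sees finitely many \<open>h\<close>,
and on the few exceptional \<open>v\<close> the error is bounded. The estimate is uniform in \<open>x\<close>.\<close>

lemma sofic_shift_error:
  fixes f :: "('g::{group_add,countable} \<Rightarrow> 'a) \<Rightarrow> real"
  assumes sof: "sofic_approximation V \<sigma>" and cm: "compact_metric X d" and f: "f \<in> dist_algebra X d" and \<epsilon>: "0 < \<epsilon>"
  shows "\<forall>\<^sub>F n in sequentially. \<forall>x\<in>PiE (V n) (\<lambda>_. X).
    ave (V n) (\<lambda>v. \<bar>f (pullback_name (\<sigma> n) (\<sigma> n g v) x) - f (shift g (pullback_name (\<sigma> n) v x))\<bar>) \<le> \<epsilon>"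
proof -
  note fr = sofic_model_frame[OF sof]
  obtain L F where LF: "0 < L" "finite F"
    "\<And>x y. (\<And>g. x g \<in> X) \<Longrightarrow> (\<And>g. y g \<in> X) \<Longrightarrow> \<bar>f x - f y\<bar> \<le> L * (\<Sum>g\<in>F. d (x g) (y g))"
    by (rule dist_algebra_lipschitz[OF cm f]) blast
  obtain C where C: "0 < C" "\<And>x y. x \<in> X \<Longrightarrow> y \<in> X \<Longrightarrow> d x y \<le> C" using bounded_metric[OF cm] by blast
  define bad where "bad n h v = (if \<sigma> n h (\<sigma> n g v) = \<sigma> n (h + g) v then 0 else 1 :: real)" for n h v
  have badlim: "(\<lambda>n. ave (V n) (bad n h)) \<longlonglongrightarrow> 0" for h
  proof -
    have "ave (V n) (bad n h) = 1 - real (card {v \<in> V n. \<sigma> n h (\<sigma> n g v) = \<sigma> n (h + g) v}) / real (card (V n))" for n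
    proof -
      note V = model_frameD(1-3)[OF fr[of n]]
      have "bad n h v = 1 - (if \<sigma> n h (\<sigma> n g v) = \<sigma> n (h + g) v then 1 else 0)" for v by (simp add: bad_def)
      then have "ave (V n) (bad n h) = ave (V n) (\<lambda>v. 1 - (if \<sigma> n h (\<sigma> n g v) = \<sigma> n (h + g) v then 1 else 0))"
        by (intro ave_cong)
      also have "\<dots> = 1 - ave (V n) (\<lambda>v. if \<sigma> n h (\<sigma> n g v) = \<sigma> n (h + g) v then 1 else 0)"
        unfolding ave_diff using V by (simp add: ave_const)
      also have "ave (V n) (\<lambda>v. if \<sigma> n h (\<sigma> n g v) = \<sigma> n (h + g) v then 1 else 0)
        = real (card {v \<in> V n. \<sigma> n h (\<sigma> n g v) = \<sigma> n (h + g) v}) / real (card (V n))"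
        using V(1) unfolding ave_def by (simp add: sum.If_cases Int_def)
      finally show ?thesis .
    qed
    moreover have "(\<lambda>n. 1 - real (card {v \<in> V n. \<sigma> n h (\<sigma> n g v) = \<sigma> n (h + g) v}) / real (card (V n))) \<longlonglongrightarrow> 1 - 1"
      using sof unfolding sofic_approximation_def by (intro tendsto_diff tendsto_const) blast
    ultimately show ?thesis by simp
  qed
  have "(\<lambda>n. L * (\<Sum>h\<in>F. C * ave (V n) (bad n h))) \<longlonglongrightarrow> L * (\<Sum>h\<in>F. C * 0)"
    by (intro tendsto_intros badlim)
  then have "\<forall>\<^sub>F n in sequentially. L * (\<Sum>h\<in>F. C * ave (V n) (bad n h)) < \<epsilon>"
    using \<epsilon> by (intro order_tendstoD(2)) auto
  then show ?thesis
  proof eventually_elim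
    case (elim n)
    show ?case
    proof
      fix x assume x: "x \<in> PiE (V n) (\<lambda>_. X)"
      have "ave (V n) (\<lambda>v. \<bar>f (pullback_name (\<sigma> n) (\<sigma> n g v) x) - f (shift g (pullback_name (\<sigma> n) v x))\<bar>)
        \<le> ave (V n) (\<lambda>v. L * (\<Sum>h\<in>F. C * bad n h v))"
      proof (rule ave_mono)
        fix v assume v: "v \<in> V n"
        have xin: "x w \<in> X" if "w \<in> V n" for w using x that by auto
        have gv: "\<sigma> n g v \<in> V n" by (rule model_frameD(5)[OF fr v])
        have "\<bar>f (pullback_name (\<sigma> n) (\<sigma> n g v) x) - f (shift g (pullback_name (\<sigma> n) v x))\<bar>
          \<le> L * (\<Sum>h\<in>F. d (pullback_name (\<sigma> n) (\<sigma> n g v) x h) (shift g (pullback_name (\<sigma> n) v x) h))"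
          by (rule LF(3)) (use pullback_name_in[OF fr x gv] pullback_name_in[OF fr x v] in \<open>auto simp: shift_def\<close>)
        also have "\<dots> \<le> L * (\<Sum>h\<in>F. C * bad n h v)"
        proof (intro mult_left_mono sum_mono)
          fix h
          have in1: "\<sigma> n h (\<sigma> n g v) \<in> V n" "\<sigma> n (h + g) v \<in> V n" using model_frameD(5)[OF fr] gv v by blast+
          show "d (pullback_name (\<sigma> n) (\<sigma> n g v) x h) (shift g (pullback_name (\<sigma> n) v x) h) \<le> C * bad n h v"
          proof (cases "\<sigma> n h (\<sigma> n g v) = \<sigma> n (h + g) v")
            case True
            then show ?thesis using compact_metric_zero[OF cm xin[OF in1(2)] xin[OF in1(2)]]
              by (simp add: pullback_name_def shift_def bad_def)
          next
            case False
            then show ?thesis using C(2)[OF xin[OF in1(1)] xin[OF in1(2)]]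
              by (simp add: pullback_name_def shift_def bad_def)
          qed
        qed (use LF in auto)
        finally show "\<bar>f (pullback_name (\<sigma> n) (\<sigma> n g v) x) - f (shift g (pullback_name (\<sigma> n) v x))\<bar> \<le> L * (\<Sum>h\<in>F. C * bad n h v)" .
      qed
      also have "\<dots> = L * (\<Sum>h\<in>F. C * ave (V n) (bad n h))" by (simp add: ave_cmult ave_sum)
      also have "\<dots> \<le> \<epsilon>" using elim by simp
      finally show "ave (V n) (\<lambda>v. \<bar>f (pullback_name (\<sigma> n) (\<sigma> n g v) x) - f (shift g (pullback_name (\<sigma> n) v x))\<bar>) \<le> \<epsilon>" .
    qed
  qed
qed

lemma tests_Min:
  assumes "finite J" "J \<noteq> {}" "\<And>j. j \<in> J \<Longrightarrow> h j \<in> tests X d"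
  shows "(\<lambda>z. Min ((\<lambda>j. h j z) ` J)) \<in> tests X d"
  using assms
proof (induction rule: finite_ne_induct)
  case (insert j J)
  then have "(\<lambda>z. min (h j z) (Min ((\<lambda>j. h j z) ` J))) \<in> tests X d"
    by (auto intro: continuous_map_real_min)
  moreover have "Min ((\<lambda>j. h j z) ` insert j J) = min (h j z) (Min ((\<lambda>j. h j z) ` J))" for z
    using insert by simp
  ultimately show ?case by simp
qed auto

text \<open>The functions \<open>r p\<close> approximate the distances \<open>e (\<phi> x) p\<close> in the mean. At a vertex \<open>v\<close> the lifted model \<open>y\<close> takes the
point \<open>j\<close> of a finite net whose distances to all \<open>p\<close> agree best with the values \<open>r p\<close> at the name of \<open>x\<close> at \<open>v\<close>. The
remaining discrepancy \<open>D\<close> is a minimum of finitely many test functions and hence a test function itself. Its integral is small,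
as the net point nearest to \<open>\<phi> x\<close> is a competitor, so its average along every good model is small as well. Through
\<open>algebra_substitution\<close> and \<open>sofic_shift_error\<close> this controls the averages of all \<open>u\<close> in \<open>U\<close> along \<open>y\<close>.

The functions \<open>w u\<close> link both sides: near \<open>u\<close> along the models, and near \<open>u\<close> composed with the factor map
in the mean for \<open>\<mu>\<close>.\<close>

lemma model_lifting:
  fixes \<mu> :: "('g::{group_add,countable} \<Rightarrow> 'a) measure" and Y :: "'b set"
  assumes sof: "sofic_approximation V \<sigma>" and cmX: "compact_metric X d" and cmY: "compact_metric Y e"
    and mu: "\<mu> \<in> Prob UNIV X d" and inv: "\<And>g. distr \<mu> \<mu> (shift g) = \<mu>"
    and \<phi>: "\<phi> \<in> measurable \<mu> (borel_of (metric_top Y e))"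
    and U: "finite U" "U \<subseteq> dist_algebra Y e" and \<kappa>: "0 < \<kappa>"
  obtains w \<O> where "\<O> \<in> nbhds X d \<mu>" "\<And>u. u \<in> U \<Longrightarrow> w u \<in> dist_algebra X d"
    "\<And>u. u \<in> U \<Longrightarrow> (\<integral>x. \<bar>w u x - u (\<lambda>g. \<phi> (shift g x))\<bar> \<partial>\<mu>) < \<kappa>"
    "\<forall>\<^sub>F n in sequentially. \<forall>x\<in>good_models X d (V n) (\<sigma> n) \<O>. \<exists>y\<in>PiE (V n) (\<lambda>_. Y). \<forall>u\<in>U.
       ave (V n) (\<lambda>v. \<bar>u (pullback_name (\<sigma> n) v y) - w u (pullback_name (\<sigma> n) v x)\<bar>) < \<kappa>"
proof -
  note msX = compact_metric_space[OF cmX] and msY = compact_metric_space[OF cmY]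
  note fr = sofic_model_frame[OF sof]
  interpret prob_space \<mu> by (rule ProbD(1)[OF mu msX])
  note sets_mu = ProbD(2)[OF mu msX] and sp = space_Prob_UNIV[OF mu msX]
  have shm: "shift g \<in> measurable \<mu> \<mu>" for g
    using shift_measurable[of g X d] measurable_cong_sets[OF sets_mu sets_mu] by blast
  have \<phi>Y: "\<phi> x \<in> Y" if "x \<in> space \<mu>" for x
    using measurable_space[OF \<phi> that] by (simp add: topspace_metric_top[OF msY])
  obtain D0 where D0: "0 < D0" "\<And>x y. x \<in> Y \<Longrightarrow> y \<in> Y \<Longrightarrow> e x y \<le> D0" using bounded_metric[OF cmY] by blast
  define C where "C = D0 + 1"
  have C: "0 < C" using D0 by (simp add: C_def)
  have "\<forall>u\<in>U. \<exists>t. substitution_bound X d Y e C u (fst t) (fst (snd t)) (fst (snd (snd t))) (snd (snd (snd t)))"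
  proof
    fix u assume "u \<in> U"
    then have "u \<in> dist_algebra Y e" using U(2) by blast
    from algebra_substitution[OF cmY this C, of X d] obtain P F L B where "substitution_bound X d Y e C u P F L B"
      by (elim exE)
    then show "\<exists>t. substitution_bound X d Y e C u (fst t) (fst (snd t)) (fst (snd (snd t))) (snd (snd (snd t)))"
      by (intro exI[of _ "(P, F, L, B)"]) simp
  qed
  from bchoice[OF this] obtain t where
    t: "\<forall>u\<in>U. substitution_bound X d Y e C u (fst (t u)) (fst (snd (t u))) (fst (snd (snd (t u)))) (snd (snd (snd (t u))))" ..
  define P where "P u = fst (t u)" for u
  define F where "F u = fst (snd (t u))" for u
  define L where "L u = fst (snd (snd (t u)))" for u
  define B where "B u = snd (snd (snd (t u)))" for u
  have S: "substitution_bound X d Y e C u (P u) (F u) (L u) (B u)" if "u \<in> U" for u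
    using t that unfolding P_def F_def L_def B_def by (rule bspec)
  note fin = substitution_bound_pos[OF S]
  define PP where "PP = (\<Union>u\<in>U. P u)"
  define FF where "FF = (\<Union>u\<in>U. F u)"
  have PP: "finite PP" "PP \<subseteq> Y" "finite FF" using U(1) fin by (auto simp: PP_def FF_def)
  define K where "K = 1 + (\<Sum>u\<in>U. L u * (real (card (P u)) * real (card (F u))))"
  have Kn: "0 \<le> L u * (real (card (P u)) * real (card (F u)))" if "u \<in> U" for u
    using fin(4)[OF that] by simp
  have K: "L u * (real (card (P u)) * real (card (F u))) < K" if "u \<in> U" for u
  proof -
    have "L u * (real (card (P u)) * real (card (F u))) \<le> (\<Sum>u\<in>U. L u * (real (card (P u)) * real (card (F u))))"
      by (rule member_le_sum[OF that _ U(1)]) (use Kn in auto)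
    then show ?thesis unfolding K_def by linarith
  qed
  have "0 \<le> (\<Sum>u\<in>U. L u * (real (card (P u)) * real (card (F u))))"
    by (rule sum_nonneg) (rule Kn)
  then have K0: "0 < K" by (simp add: K_def)
  define N where "N = real (card PP)"
  \<comment> \<open>\<open>2 * N * \<eta>\<close> bounds the integral of \<open>D\<close>; one \<open>\<eta>\<close> is lost to the neighbourhood, one to the sofic error, and one is slack\<close>
  define \<eta> where "\<eta> = \<kappa> / (K * (2 * N + 3))"
  have N0: "0 \<le> N" by (simp add: N_def)
  have den: "0 < K * (2 * N + 3)" using K0 N0 by (intro mult_pos_pos) auto
  have \<eta>: "0 < \<eta>" using \<kappa> den by (simp add: \<eta>_def)
  have K\<eta>: "K * ((2 * N + 3) * \<eta>) = \<kappa>" using den by (simp add: \<eta>_def field_simps)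
  have edist: "(\<lambda>x. e (\<phi> x) p) \<in> borel_measurable \<mu>" if "p \<in> Y" for p
    by (rule measurable_compose[OF \<phi> continuous_map_measurable_borel_of[OF continuous_map_dist[OF cmY that]]])
  have "\<forall>p\<in>PP. \<exists>r. r \<in> dist_algebra X d \<and> (\<integral>x. \<bar>r x - e (\<phi> x) p\<bar> \<partial>\<mu>) < \<eta> \<and> (\<forall>x. (\<forall>g. x g \<in> X) \<longrightarrow> \<bar>r x\<bar> \<le> C)"
  proof
    fix p assume "p \<in> PP"
    then have p: "p \<in> Y" using PP by blast
    show "\<exists>r. r \<in> dist_algebra X d \<and> (\<integral>x. \<bar>r x - e (\<phi> x) p\<bar> \<partial>\<mu>) < \<eta> \<and> (\<forall>x. (\<forall>g. x g \<in> X) \<longrightarrow> \<bar>r x\<bar> \<le> C)"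
    proof (rule L1_density[OF cmX mu edist[OF p] D0(1) _ \<eta>])
      show "0 \<le> e (\<phi> x) p \<and> e (\<phi> x) p \<le> D0" if "x \<in> space \<mu>" for x
        using D0(2)[OF \<phi>Y[OF that] p] compact_metric_nonneg[OF cmY] by simp
      fix r assume "r \<in> dist_algebra X d" "(\<integral>x. \<bar>r x - e (\<phi> x) p\<bar> \<partial>\<mu>) < \<eta>"
        "\<And>x. \<forall>g. x g \<in> X \<Longrightarrow> \<bar>r x\<bar> \<le> D0 + 1"
      then show ?thesis unfolding C_def by (intro exI[of _ r] conjI allI impI)
    qed
  qed
  from bchoice[OF this] obtain r where r0: "\<forall>p\<in>PP. r p \<in> dist_algebra X d \<and> (\<integral>x. \<bar>r p x - e (\<phi> x) p\<bar> \<partial>\<mu>) < \<eta> \<and>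
    (\<forall>x. (\<forall>g. x g \<in> X) \<longrightarrow> \<bar>r p x\<bar> \<le> C)" ..
  have r: "r p \<in> dist_algebra X d" "(\<integral>x. \<bar>r p x - e (\<phi> x) p\<bar> \<partial>\<mu>) < \<eta>" if "p \<in> PP" for p
    using r0 that by blast+
  have rt: "r p \<in> tests X d" if "p \<in> PP" for p by (rule dist_algebra_tests[OF cmX r(1)[OF that]])
  have "\<forall>u\<in>U. \<exists>w. w \<in> dist_algebra X d \<and> (\<forall>x y. (\<forall>g::'g. x g \<in> X) \<longrightarrow> (\<forall>g. y g \<in> Y) \<longrightarrow>
        \<bar>u y - w x\<bar> \<le> L u * (\<Sum>p\<in>P u. \<Sum>g\<in>F u. \<bar>e (y g) p - r p (shift g x)\<bar>))"
  proof
    fix u assume u: "u \<in> U"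
    have "\<forall>p\<in>P u. r p \<in> dist_algebra X d \<and> (\<forall>x. (\<forall>g. x g \<in> X) \<longrightarrow> \<bar>r p x\<bar> \<le> C)"
      using r0 u unfolding PP_def by blast
    from substitution_boundD[OF S[OF u] this]
    show "\<exists>w. w \<in> dist_algebra X d \<and> (\<forall>x y. (\<forall>g::'g. x g \<in> X) \<longrightarrow> (\<forall>g. y g \<in> Y) \<longrightarrow>
        \<bar>u y - w x\<bar> \<le> L u * (\<Sum>p\<in>P u. \<Sum>g\<in>F u. \<bar>e (y g) p - r p (shift g x)\<bar>))"
      by (elim bexE conjE) (intro exI conjI)
  qed
  from bchoice[OF this] obtain w where w0: "\<forall>u\<in>U. w u \<in> dist_algebra X d \<and> (\<forall>x y. (\<forall>g::'g. x g \<in> X) \<longrightarrow> (\<forall>g. y g \<in> Y) \<longrightarrow>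
        \<bar>u y - w u x\<bar> \<le> L u * (\<Sum>p\<in>P u. \<Sum>g\<in>F u. \<bar>e (y g) p - r p (shift g x)\<bar>))" ..
  have w: "w u \<in> dist_algebra X d" if "u \<in> U" for u using w0 that by blast
  have wu: "\<bar>u y - w u x\<bar> \<le> L u * (\<Sum>p\<in>P u. \<Sum>g\<in>F u. \<bar>e (y g) p - r p (shift g x)\<bar>)"
    if "u \<in> U" "\<And>g. x g \<in> X" "\<And>g. y g \<in> Y" for u x y
    using w0[THEN bspec, OF that(1), THEN conjunct2, THEN spec, THEN spec, of x y] that(2,3) by simp
  have eint: "integrable \<mu> (\<lambda>x. e (\<phi> x) p)" if p: "p \<in> Y" for p
    by (rule integrable_const_bound[where B = D0])
      (use D0(2)[OF \<phi>Y p] compact_metric_nonneg[OF cmY] edist[OF p] in \<open>auto intro!: AE_I2\<close>)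
  have rint: "integrable \<mu> (r p)" if "p \<in> PP" for p by (rule tests_integrable[OF cmX rt[OF that] mu])
  have reint: "integrable \<mu> (\<lambda>x. \<bar>e (\<phi> x) p - r p x\<bar>)" if "p \<in> PP" for p
    using eint[OF subsetD[OF PP(2) that]] rint[OF that] by auto
  have reint_le: "(\<integral>x. \<bar>e (\<phi> x) p - r p x\<bar> \<partial>\<mu>) < \<eta>" if "p \<in> PP" for p
    using r(2)[OF that] by (simp add: abs_minus_commute)
  obtain x0 where "x0 \<in> space \<mu>" using not_empty by blast
  then have Yne: "Y \<noteq> {}" using \<phi>Y by blast
  obtain J where J: "finite J" "J \<subseteq> Y" "\<And>y. y \<in> Y \<Longrightarrow> \<exists>j\<in>J. e y j < \<eta>" using finite_net[OF cmY \<eta>] by blast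
  have Jne: "J \<noteq> {}" using J(3) Yne by blast
  define \<Delta> where "\<Delta> j z = (\<Sum>p\<in>PP. \<bar>e j p - r p z\<bar>)" for j z
  define D where "D z = Min ((\<lambda>j. \<Delta> j z) ` J)" for z
  have \<Delta>t: "\<Delta> j \<in> tests X d" for j unfolding \<Delta>_def using rt PP(1) by (auto intro!: continuous_intros)
  have Dt: "D \<in> tests X d" unfolding D_def by (rule tests_Min[OF J(1) Jne \<Delta>t])
  have Dint: "(\<integral>x. D x \<partial>\<mu>) \<le> 2 * N * \<eta>"
  proof -
    have "(\<integral>x. D x \<partial>\<mu>) \<le> (\<integral>x. (\<Sum>p\<in>PP. \<eta> + \<bar>e (\<phi> x) p - r p x\<bar>) \<partial>\<mu>)"
    proof (rule integral_mono)
      show "integrable \<mu> D" by (rule tests_integrable[OF cmX Dt mu])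
      show "integrable \<mu> (\<lambda>x. \<Sum>p\<in>PP. \<eta> + \<bar>e (\<phi> x) p - r p x\<bar>)"
        using reint by (intro Bochner_Integration.integrable_sum Bochner_Integration.integrable_add) auto
      fix x assume x: "x \<in> space \<mu>"
      from J(3)[OF \<phi>Y[OF x]] obtain j where j: "j \<in> J" "e (\<phi> x) j < \<eta>" by blast
      have "D x \<le> \<Delta> j x" unfolding D_def using J(1) j(1) by (intro Min_le) auto
      also have "\<dots> \<le> (\<Sum>p\<in>PP. \<eta> + \<bar>e (\<phi> x) p - r p x\<bar>)"
        unfolding \<Delta>_def
      proof (rule sum_mono)
        fix p assume "p \<in> PP"
        then have "\<bar>e (\<phi> x) p - e j p\<bar> \<le> e (\<phi> x) j"
          using compact_metric_abs_diff[OF cmY \<phi>Y[OF x], of j p] j(1) J(2) PP(2) by blast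
        then show "\<bar>e j p - r p x\<bar> \<le> \<eta> + \<bar>e (\<phi> x) p - r p x\<bar>" using j(2) by linarith
      qed
      finally show "D x \<le> (\<Sum>p\<in>PP. \<eta> + \<bar>e (\<phi> x) p - r p x\<bar>)" .
    qed
    also have "\<dots> = (\<Sum>p\<in>PP. \<eta> + (\<integral>x. \<bar>e (\<phi> x) p - r p x\<bar> \<partial>\<mu>))"
    proof -
      have "(\<integral>x. (\<Sum>p\<in>PP. \<eta> + \<bar>e (\<phi> x) p - r p x\<bar>) \<partial>\<mu>) = (\<Sum>p\<in>PP. (\<integral>x. \<eta> + \<bar>e (\<phi> x) p - r p x\<bar> \<partial>\<mu>))"
        using reint by (intro Bochner_Integration.integral_sum Bochner_Integration.integrable_add) auto
      also have "\<dots> = (\<Sum>p\<in>PP. \<eta> + (\<integral>x. \<bar>e (\<phi> x) p - r p x\<bar> \<partial>\<mu>))"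
        using reint by (intro sum.cong refl) (simp add: prob_space)
      finally show ?thesis .
    qed
    also have "\<dots> \<le> (\<Sum>p\<in>PP. \<eta> + \<eta>)" using reint_le by (intro sum_mono add_left_mono) (auto intro: less_imp_le)
    finally show ?thesis by (simp add: N_def)
  qed
  have "\<forall>p\<in>PP. \<forall>g\<in>FF. \<forall>\<^sub>F n in sequentially. \<forall>x\<in>PiE (V n) (\<lambda>_. X).
    ave (V n) (\<lambda>v. \<bar>r p (pullback_name (\<sigma> n) (\<sigma> n g v) x) - r p (shift g (pullback_name (\<sigma> n) v x))\<bar>) \<le> \<eta>"
    by (intro ballI sofic_shift_error[OF sof cmX r(1) \<eta>])
  then have sofev: "\<forall>\<^sub>F n in sequentially. \<forall>p\<in>PP. \<forall>g\<in>FF. \<forall>x\<in>PiE (V n) (\<lambda>_. X).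
    ave (V n) (\<lambda>v. \<bar>r p (pullback_name (\<sigma> n) (\<sigma> n g v) x) - r p (shift g (pullback_name (\<sigma> n) v x))\<bar>) \<le> \<eta>"
    by (intro eventually_ball_finite PP ballI) blast
  have \<phi>'m: "(\<lambda>x g. \<phi> (shift g x)) \<in> measurable \<mu> (config_algebra UNIV Y e)"
  proof -
    have "(\<lambda>x. \<lambda>g\<in>UNIV. \<phi> (shift g x)) \<in> measurable \<mu> (config_algebra UNIV Y e)"
      unfolding config_algebra_def by (intro measurable_restrict measurable_compose[OF shm \<phi>])
    then show ?thesis by (simp add: restrict_def)
  qed
  show thesis
  proof (rule that[of "basic_nbhd X d \<mu> {D} \<eta>" w])
    show "basic_nbhd X d \<mu> {D} \<eta> \<in> nbhds X d \<mu>" by (rule basic_nbhd_nbhds[OF mu]) (use Dt \<eta> in auto)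
    show "w u \<in> dist_algebra X d" if "u \<in> U" for u by (rule w[OF that])
    show "(\<integral>x. \<bar>w u x - u (\<lambda>g. \<phi> (shift g x))\<bar> \<partial>\<mu>) < \<kappa>" if u: "u \<in> U" for u
    proof -
      have Psub: "p \<in> PP" if "p \<in> P u" for p using that u by (auto simp: PP_def)
      have shint: "integrable \<mu> (\<lambda>x. \<bar>e (\<phi> (shift g x)) p - r p (shift g x)\<bar>)"
        and shval: "(\<integral>x. \<bar>e (\<phi> (shift g x)) p - r p (shift g x)\<bar> \<partial>\<mu>) = (\<integral>x. \<bar>e (\<phi> x) p - r p x\<bar> \<partial>\<mu>)" if p: "p \<in> PP" for g p
      proof -
        have m: "(\<lambda>x. \<bar>e (\<phi> x) p - r p x\<bar>) \<in> borel_measurable \<mu>" using reint[OF p] by auto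
        have "integrable (distr \<mu> \<mu> (shift g)) (\<lambda>x. \<bar>e (\<phi> x) p - r p x\<bar>)" unfolding inv by (rule reint[OF p])
        then show "integrable \<mu> (\<lambda>x. \<bar>e (\<phi> (shift g x)) p - r p (shift g x)\<bar>)" using integrable_distr_eq[OF shm m] by simp
        show "(\<integral>x. \<bar>e (\<phi> (shift g x)) p - r p (shift g x)\<bar> \<partial>\<mu>) = (\<integral>x. \<bar>e (\<phi> x) p - r p x\<bar> \<partial>\<mu>)"
          using integral_distr[OF shm m] unfolding inv by simp
      qed
      have ud: "u \<in> dist_algebra Y e" using u U by blast
      have um: "(\<lambda>x. u (\<lambda>g. \<phi> (shift g x))) \<in> borel_measurable \<mu>"
        by (rule measurable_compose[OF \<phi>'m dist_algebra_measurable[OF cmY ud]])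
      have \<phi>'Y: "\<phi> (shift g x) \<in> Y" if "x \<in> space \<mu>" for x g
        using \<phi>Y measurable_space[OF shm that] by blast
      obtain Bu where Bu: "0 < Bu" "\<And>y. (\<And>g. y g \<in> Y) \<Longrightarrow> \<bar>u y\<bar> \<le> Bu" using dist_algebra_bounded[OF cmY ud] by blast
      have ui: "integrable \<mu> (\<lambda>x. u (\<lambda>g. \<phi> (shift g x)))"
        by (rule integrable_const_bound[where B = Bu]) (use um in \<open>auto intro!: AE_I2 Bu(2) \<phi>'Y\<close>)
      have wi: "integrable \<mu> (w u)" by (rule tests_integrable[OF cmX dist_algebra_tests[OF cmX w[OF u]] mu])
      have "(\<integral>x. \<bar>w u x - u (\<lambda>g. \<phi> (shift g x))\<bar> \<partial>\<mu>) \<le>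
        (\<integral>x. L u * (\<Sum>p\<in>P u. \<Sum>g\<in>F u. \<bar>e (\<phi> (shift g x)) p - r p (shift g x)\<bar>) \<partial>\<mu>)"
      proof (rule integral_mono)
        show "integrable \<mu> (\<lambda>x. L u * (\<Sum>p\<in>P u. \<Sum>g\<in>F u. \<bar>e (\<phi> (shift g x)) p - r p (shift g x)\<bar>))"
          using shint[OF Psub] by (intro integrable_mult_right Bochner_Integration.integrable_sum)
        fix x assume x: "x \<in> space \<mu>"
        have "\<bar>u (\<lambda>g. \<phi> (shift g x)) - w u x\<bar> \<le> L u * (\<Sum>p\<in>P u. \<Sum>g\<in>F u. \<bar>e (\<phi> (shift g x)) p - r p (shift g x)\<bar>)"
          by (rule wu[OF u]) (use x sp \<phi>'Y in auto)
        then show "\<bar>w u x - u (\<lambda>g. \<phi> (shift g x))\<bar> \<le> L u * (\<Sum>p\<in>P u. \<Sum>g\<in>F u. \<bar>e (\<phi> (shift g x)) p - r p (shift g x)\<bar>)"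
          by (simp add: abs_minus_commute)
      qed (use ui wi in auto)
      also have "\<dots> = L u * (\<Sum>p\<in>P u. \<Sum>g\<in>F u. (\<integral>x. \<bar>e (\<phi> x) p - r p x\<bar> \<partial>\<mu>))"
        using shint[OF Psub] shval[OF Psub] by (simp add: Bochner_Integration.integral_sum Bochner_Integration.integrable_sum)
      also have "\<dots> \<le> L u * (\<Sum>p\<in>P u. \<Sum>g\<in>F u. \<eta>)"
        using fin(4)[OF u] reint_le[OF Psub] by (intro mult_left_mono sum_mono) (auto intro: less_imp_le)
      also have "\<dots> = (L u * (real (card (P u)) * real (card (F u)))) * \<eta>" by simp
      also have "\<dots> < K * \<eta>" using K[OF u] \<eta> by (rule mult_strict_right_mono)
      also have "\<dots> \<le> K * ((2 * N + 3) * \<eta>)" using K0 \<eta> N0 by (intro mult_left_mono) auto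
      finally show ?thesis unfolding K\<eta> .
    qed
    show "\<forall>\<^sub>F n in sequentially. \<forall>x\<in>good_models X d (V n) (\<sigma> n) (basic_nbhd X d \<mu> {D} \<eta>). \<exists>y\<in>PiE (V n) (\<lambda>_. Y). \<forall>u\<in>U.
       ave (V n) (\<lambda>v. \<bar>u (pullback_name (\<sigma> n) v y) - w u (pullback_name (\<sigma> n) v x)\<bar>) < \<kappa>"
      using sofev
    proof eventually_elim
      case (elim n)
      note Vn = model_frameD(1,2)[OF fr[of n]]
      show ?case
      proof
        fix x assume x: "x \<in> good_models X d (V n) (\<sigma> n) (basic_nbhd X d \<mu> {D} \<eta>)"
        have xE: "x \<in> PiE (V n) (\<lambda>_. X)" using x by (simp add: good_models_def)
        have "{D} \<subseteq> tests X d" using Dt by simp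
        from x[unfolded good_models_basic[OF cmX fr this]]
        have "\<bar>ave (V n) (\<lambda>v. D (pullback_name (\<sigma> n) v x)) - (\<integral>x. D x \<partial>\<mu>)\<bar> < \<eta>" by simp
        then have Dave: "ave (V n) (\<lambda>v. D (pullback_name (\<sigma> n) v x)) \<le> (2 * N + 1) * \<eta>"
          using Dint by (simp add: algebra_simps)
        have "\<forall>v. \<exists>j. j \<in> J \<and> \<Delta> j (pullback_name (\<sigma> n) v x) = D (pullback_name (\<sigma> n) v x)"
        proof
          fix v
          have "D (pullback_name (\<sigma> n) v x) \<in> (\<lambda>j. \<Delta> j (pullback_name (\<sigma> n) v x)) ` J"
            unfolding D_def using J(1) Jne by (intro Min_in) auto
          then show "\<exists>j. j \<in> J \<and> \<Delta> j (pullback_name (\<sigma> n) v x) = D (pullback_name (\<sigma> n) v x)" by auto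
        qed
        from choice[OF this] obtain y0 where y0: "\<forall>v. y0 v \<in> J \<and> \<Delta> (y0 v) (pullback_name (\<sigma> n) v x) = D (pullback_name (\<sigma> n) v x)" ..
        define y where "y = restrict y0 (V n)"
        have yE: "y \<in> PiE (V n) (\<lambda>_. Y)" using y0 J(2) by (auto simp: y_def)
        have yr: "ave (V n) (\<lambda>v. \<bar>e (y v) p - r p (pullback_name (\<sigma> n) v x)\<bar>) \<le> (2 * N + 1) * \<eta>" if p: "p \<in> PP" for p
        proof -
          have "ave (V n) (\<lambda>v. \<bar>e (y v) p - r p (pullback_name (\<sigma> n) v x)\<bar>) \<le> ave (V n) (\<lambda>v. D (pullback_name (\<sigma> n) v x))"
          proof (rule ave_mono)
            fix v assume v: "v \<in> V n"
            have "\<bar>e (y0 v) p - r p (pullback_name (\<sigma> n) v x)\<bar> \<le> \<Delta> (y0 v) (pullback_name (\<sigma> n) v x)"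
              unfolding \<Delta>_def by (rule member_le_sum[OF p _ PP(1)]) auto
            then show "\<bar>e (y v) p - r p (pullback_name (\<sigma> n) v x)\<bar> \<le> D (pullback_name (\<sigma> n) v x)"
              using y0 v by (simp add: y_def)
          qed
          then show ?thesis using Dave by linarith
        qed
        show "\<exists>y\<in>PiE (V n) (\<lambda>_. Y). \<forall>u\<in>U. ave (V n) (\<lambda>v. \<bar>u (pullback_name (\<sigma> n) v y) - w u (pullback_name (\<sigma> n) v x)\<bar>) < \<kappa>"
        proof (intro bexI[OF _ yE] ballI)
          fix u assume u: "u \<in> U"
          let ?A = "\<lambda>p g v. \<bar>e (y (\<sigma> n g v)) p - r p (pullback_name (\<sigma> n) (\<sigma> n g v) x)\<bar>"
          let ?B = "\<lambda>p g v. \<bar>r p (pullback_name (\<sigma> n) (\<sigma> n g v) x) - r p (shift g (pullback_name (\<sigma> n) v x))\<bar>"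
          have "ave (V n) (\<lambda>v. \<bar>u (pullback_name (\<sigma> n) v y) - w u (pullback_name (\<sigma> n) v x)\<bar>)
            \<le> ave (V n) (\<lambda>v. L u * (\<Sum>p\<in>P u. \<Sum>g\<in>F u. ?A p g v + ?B p g v))"
          proof (rule ave_mono)
            fix v assume v: "v \<in> V n"
            have "\<bar>u (pullback_name (\<sigma> n) v y) - w u (pullback_name (\<sigma> n) v x)\<bar> \<le>
              L u * (\<Sum>p\<in>P u. \<Sum>g\<in>F u. \<bar>e (pullback_name (\<sigma> n) v y g) p - r p (shift g (pullback_name (\<sigma> n) v x))\<bar>)"
              by (rule wu[OF u pullback_name_in[OF fr xE v] pullback_name_in[OF fr yE v]])
            also have "\<dots> \<le> L u * (\<Sum>p\<in>P u. \<Sum>g\<in>F u. ?A p g v + ?B p g v)"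
              using fin(4)[OF u] by (intro mult_left_mono sum_mono) (auto simp: pullback_name_def)
            finally show "\<bar>u (pullback_name (\<sigma> n) v y) - w u (pullback_name (\<sigma> n) v x)\<bar> \<le> L u * (\<Sum>p\<in>P u. \<Sum>g\<in>F u. ?A p g v + ?B p g v)" .
          qed
          also have "\<dots> = L u * (\<Sum>p\<in>P u. \<Sum>g\<in>F u. ave (V n) (?A p g) + ave (V n) (?B p g))"
            by (simp add: ave_cmult ave_sum ave_add)
          also have "\<dots> \<le> L u * (\<Sum>p\<in>P u. \<Sum>g\<in>F u. (2 * N + 2) * \<eta>)"
          proof (intro mult_left_mono sum_mono)
            fix p g assume p: "p \<in> P u" and g: "g \<in> F u"
            have p': "p \<in> PP" "g \<in> FF" using p g u by (auto simp: PP_def FF_def)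
            have "ave (V n) (?A p g) = ave (V n) (\<lambda>v. \<bar>e (y v) p - r p (pullback_name (\<sigma> n) v x)\<bar>)"
              by (rule ave_bij[OF model_frameD(4)[OF fr]])
            then have "ave (V n) (?A p g) \<le> (2 * N + 1) * \<eta>" using yr[OF p'(1)] by simp
            moreover have "ave (V n) (?B p g) \<le> \<eta>" using elim p' xE by blast
            ultimately show "ave (V n) (?A p g) + ave (V n) (?B p g) \<le> (2 * N + 2) * \<eta>" by (simp add: algebra_simps)
          qed (use fin(4)[OF u] in auto)
          also have "\<dots> = (L u * (real (card (P u)) * real (card (F u)))) * ((2 * N + 2) * \<eta>)" by simp
          also have "\<dots> < K * ((2 * N + 2) * \<eta>)" using K[OF u] \<eta> N0 by (intro mult_strict_right_mono mult_pos_pos) auto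
          also have "\<dots> \<le> K * ((2 * N + 3) * \<eta>)" using K0 \<eta> by (intro mult_left_mono mult_right_mono) auto
          finally show "ave (V n) (\<lambda>v. \<bar>u (pullback_name (\<sigma> n) v y) - w u (pullback_name (\<sigma> n) v x)\<bar>) < \<kappa>"
            unfolding K\<eta> .
        qed
      qed
    qed
  qed
qed

section \<open>Invariance under isomorphism\<close>

lemma metric_processD:
  assumes "metric_process X d \<mu>"
  shows "compact_metric X d" "\<mu> \<in> Prob UNIV X d" "distr \<mu> \<mu> (shift g) = \<mu>"
  using assms by (auto simp: metric_process_def compact_metric_def)

text \<open>Good models \<open>x\<close> are lifted to models \<open>y\<close> for the second process by \<open>model_lifting\<close>. To recover \<open>x\<close> from \<open>y\<close>
up to \<open>\<delta>\<close>, approximate the distances \<open>d (\<psi> y 0) q\<close>, for \<open>q\<close> in a finite net of \<open>X\<close>, by functions \<open>\<rho> q\<close> in the algebra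
over \<open>Y\<close>. Their values along \<open>y\<close> nearly give the distances from the symbols of \<open>x\<close> to the net. As
the \<open>\<rho> q\<close> are Lipschitz, close models \<open>y\<close> come from close models \<open>x\<close>, and covers can be pulled back by \<open>cov_le_cov\<close>.

The statement asks for an almost sure left inverse, so that both inequalities between isomorphic processes are instances.\<close>

theorem sofic_entropy_le_of_embedding:
  fixes \<mu> :: "('g::{group_add,countable} \<Rightarrow> 'a) measure" and \<nu> :: "('g \<Rightarrow> 'b) measure"
  assumes sof: "sofic_approximation V \<sigma>" and mpX: "metric_process X d \<mu>" and mpY: "metric_process Y e \<nu>"
    and \<phi>: "\<phi> \<in> measurable \<mu> \<nu>" "distr \<mu> \<nu> \<phi> = \<nu>" and \<psi>: "\<psi> \<in> measurable \<nu> \<mu>"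
    and inverse: "AE x in \<mu>. \<psi> (\<phi> x) = x" and equi: "\<And>g. AE x in \<mu>. \<phi> (shift g x) = shift g (\<phi> x)"
  shows "process_sofic_entropy V \<sigma> X d \<mu> \<le> process_sofic_entropy V \<sigma> Y e \<nu>"
  unfolding process_sofic_entropy_rate[of V \<sigma> X d]
proof (rule SUP_least)
  fix \<delta> :: real assume "\<delta> \<in> {0<..}"
  then have \<delta>: "0 < \<delta>" by simp
  note cmX = metric_processD(1)[OF mpX] and mu = metric_processD(2)[OF mpX] and inv = metric_processD(3)[OF mpX]
  note cmY = metric_processD(1)[OF mpY] and nu = metric_processD(2)[OF mpY]
  note msX = compact_metric_space[OF cmX] and msY = compact_metric_space[OF cmY]
  note fr = sofic_model_frame[OF sof]
  interpret M: prob_space \<mu> by (rule ProbD(1)[OF mu msX])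
  interpret N: prob_space \<nu> by (rule ProbD(1)[OF nu msY])
  note sets_mu = ProbD(2)[OF mu msX] and sets_nu = ProbD(2)[OF nu msY]
  have coordX: "(\<lambda>x. x 0) \<in> measurable \<mu> (borel_of (metric_top X d))"
    using measurable_config_coord[OF UNIV_I, of 0 X d] measurable_cong_sets[OF sets_mu refl] by blast
  have coordY: "(\<lambda>x. x 0) \<in> measurable \<nu> (borel_of (metric_top Y e))"
    using measurable_config_coord[OF UNIV_I, of 0 Y e] measurable_cong_sets[OF sets_nu refl] by blast
  define \<phi>0 where "\<phi>0 x = \<phi> x 0" for x
  have \<phi>0: "\<phi>0 \<in> measurable \<mu> (borel_of (metric_top Y e))"
    unfolding \<phi>0_def by (rule measurable_compose[OF \<phi>(1) coordY])
  have "AE x in \<mu>. \<forall>g. \<phi> (shift g x) = shift g (\<phi> x)" by (rule AE_all_countable[THEN iffD2]) (rule allI, rule equi)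
  then have \<phi>0eq: "AE x in \<mu>. (\<lambda>g. \<phi>0 (shift g x)) = \<phi> x"
  proof (rule AE_mp, intro AE_I2 impI)
    fix x assume "\<forall>g. \<phi> (shift g x) = shift g (\<phi> x)"
    then show "(\<lambda>g. \<phi>0 (shift g x)) = \<phi> x" by (auto simp: \<phi>0_def shift_def)
  qed
  obtain Q where Q: "finite Q" "Q \<subseteq> X" "\<And>x. x \<in> X \<Longrightarrow> \<exists>q\<in>Q. d x q < \<delta>/8" using finite_net[OF cmX, of "\<delta>/8"] \<delta> by auto
  define K where "K = real (card Q)"
  define \<gamma> where "\<gamma> = \<delta> / (18 * (K + 1))"
  have K0: "0 \<le> K" by (simp add: K_def)
  have \<gamma>: "0 < \<gamma>" using \<delta> K0 by (simp add: \<gamma>_def)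
  have K\<gamma>: "K * (9 * \<gamma>) < \<delta>/2"
  proof -
    have "18 * ((K + 1) * \<gamma>) = \<delta>" using K0 by (simp add: \<gamma>_def field_simps)
    then have "18 * (K * \<gamma>) + 18 * \<gamma> = \<delta>" by (simp add: algebra_simps)
    then show ?thesis using \<gamma> by (simp add: algebra_simps)
  qed
  obtain C where C: "0 < C" "\<And>x y. x \<in> X \<Longrightarrow> y \<in> X \<Longrightarrow> d x y \<le> C" using bounded_metric[OF cmX] by blast
  define t where "t q y = d (\<psi> y 0) q" for q y
  have tm: "t q \<in> borel_measurable \<nu>" if "q \<in> X" for q
    unfolding t_def by (rule measurable_compose[OF measurable_compose[OF \<psi> coordX]
      continuous_map_measurable_borel_of[OF continuous_map_dist[OF cmX that]]])
  have tb: "0 \<le> t q y \<and> t q y \<le> C" if "q \<in> X" "y \<in> space \<nu>" for q y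
    unfolding t_def using C(2)[OF _ that(1)] measurable_space[OF \<psi> that(2)] compact_metric_nonneg[OF cmX]
    by (simp add: space_Prob_UNIV[OF mu msX])
  have "\<forall>q\<in>Q. \<exists>r. r \<in> dist_algebra Y e \<and> (\<integral>y. \<bar>r y - t q y\<bar> \<partial>\<nu>) < \<gamma>"
  proof
    fix q assume "q \<in> Q"
    then have q: "q \<in> X" using Q(2) by blast
    show "\<exists>r. r \<in> dist_algebra Y e \<and> (\<integral>y. \<bar>r y - t q y\<bar> \<partial>\<nu>) < \<gamma>"
      by (rule L1_density[OF cmY nu tm[OF q] C(1) tb[OF q] \<gamma>]) blast+
  qed
  from bchoice[OF this] obtain \<rho> where \<rho>: "\<And>q. q \<in> Q \<Longrightarrow> \<rho> q \<in> dist_algebra Y e"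
    "\<And>q. q \<in> Q \<Longrightarrow> (\<integral>y. \<bar>\<rho> q y - t q y\<bar> \<partial>\<nu>) < \<gamma>" by blast
  have "\<forall>q\<in>Q. \<exists>c. 0 < c \<and> (\<forall>(W::'c set) s y y'. model_frame W s \<longrightarrow> y \<in> PiE W (\<lambda>_. Y) \<longrightarrow> y' \<in> PiE W (\<lambda>_. Y) \<longrightarrow>
    ave W (\<lambda>v. \<bar>\<rho> q (pullback_name s v y) - \<rho> q (pullback_name s v y')\<bar>) \<le> c * hamming_dist W e y y')"
  proof
    fix q assume q: "q \<in> Q"
    obtain L F where LF: "0 < L" "finite F"
      "\<And>x y. (\<And>g. x g \<in> Y) \<Longrightarrow> (\<And>g. y g \<in> Y) \<Longrightarrow> \<bar>\<rho> q x - \<rho> q y\<bar> \<le> L * (\<Sum>g\<in>F. e (x g) (y g))"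
      by (rule dist_algebra_lipschitz[OF cmY \<rho>(1)[OF q]]) blast
    have "ave W (\<lambda>v. \<bar>\<rho> q (pullback_name s v y) - \<rho> q (pullback_name s v y')\<bar>) \<le> (L * real (card F) + 1) * hamming_dist W e y y'"
      if W: "model_frame W s" and y: "y \<in> PiE W (\<lambda>_. Y)" "y' \<in> PiE W (\<lambda>_. Y)" for W :: "'c set" and s y y'
    proof -
      have "ave W (\<lambda>v. \<bar>\<rho> q (pullback_name s v y) - \<rho> q (pullback_name s v y')\<bar>) \<le>
        ave W (\<lambda>v. L * (\<Sum>g\<in>F. e (pullback_name s v y g) (pullback_name s v y' g)))"
        by (intro ave_mono LF(3) pullback_name_in[OF W y(1)] pullback_name_in[OF W y(2)])
      also have "\<dots> = L * (\<Sum>g\<in>F. ave W (\<lambda>v. e (y (s g v)) (y' (s g v))))"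
        by (simp add: ave_cmult ave_sum pullback_name_def)
      also have "\<dots> = L * (\<Sum>g\<in>F. hamming_dist W e y y')"
        unfolding hamming_ave using ave_bij[OF model_frameD(4)[OF W], of "\<lambda>v. e (y v) (y' v)"] by simp
      also have "\<dots> \<le> (L * real (card F) + 1) * hamming_dist W e y y'"
        using hamming_nonneg[OF cmY, of W y y'] by (simp add: distrib_right)
      finally show ?thesis .
    qed
    moreover have "0 < L * real (card F) + 1" using LF(1) by (simp add: add_nonneg_pos)
    ultimately show "\<exists>c. 0 < c \<and> (\<forall>(W::'c set) s y y'. model_frame W s \<longrightarrow> y \<in> PiE W (\<lambda>_. Y) \<longrightarrow> y' \<in> PiE W (\<lambda>_. Y) \<longrightarrow>
      ave W (\<lambda>v. \<bar>\<rho> q (pullback_name s v y) - \<rho> q (pullback_name s v y')\<bar>) \<le> c * hamming_dist W e y y')"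
      by (intro exI[of _ "L * real (card F) + 1"] conjI allI impI)
  qed
  from bchoice[OF this] obtain c where c: "\<forall>q\<in>Q. 0 < c q \<and> (\<forall>(W::'c set) s y y'. model_frame W s \<longrightarrow> y \<in> PiE W (\<lambda>_. Y) \<longrightarrow> y' \<in> PiE W (\<lambda>_. Y) \<longrightarrow>
    ave W (\<lambda>v. \<bar>\<rho> q (pullback_name s v y) - \<rho> q (pullback_name s v y')\<bar>) \<le> c q * hamming_dist W e y y')" ..
  define A where "A = 1 + (\<Sum>q\<in>Q. c q)"
  have csum: "0 \<le> (\<Sum>q\<in>Q. c q)" by (rule sum_nonneg) (use c in \<open>auto intro: less_imp_le\<close>)
  have A0: "0 < A" using csum by (simp add: A_def)
  have cA: "c q \<le> A" if "q \<in> Q" for q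
    using member_le_sum[OF that _ Q(1), of c] c by (fastforce simp: A_def intro: less_imp_le)
  \<comment> \<open>\<open>\<delta>'\<close> must not depend on the neighbourhood \<open>\<O>'\<close>; it is determined by the functions \<open>\<rho> q\<close> alone\<close>
  define \<delta>' where "\<delta>' = \<gamma> / (2 * A)"
  have \<delta>': "0 < \<delta>'" using \<gamma> A0 by (simp add: \<delta>'_def)
  have \<rho>close: "ave W (\<lambda>v. \<bar>\<rho> q (pullback_name s v y) - \<rho> q (pullback_name s v y')\<bar>) \<le> \<gamma>"
    if "q \<in> Q" "model_frame W s" "y \<in> PiE W (\<lambda>_. Y)" "y' \<in> PiE W (\<lambda>_. Y)" "hamming_dist W e y y' < 2 * \<delta>'"
    for q and W :: "'c set" and s y y'
  proof -
    have "ave W (\<lambda>v. \<bar>\<rho> q (pullback_name s v y) - \<rho> q (pullback_name s v y')\<bar>) \<le> c q * hamming_dist W e y y'"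
      using c[THEN bspec, OF that(1), THEN conjunct2] that(2-4) by simp
    also have "\<dots> \<le> A * (2 * \<delta>')"
      using cA[OF that(1)] that(5) hamming_nonneg[OF cmY, of W y y'] A0 by (intro mult_mono) auto
    also have "\<dots> = \<gamma>" using A0 by (simp add: \<delta>'_def)
    finally show ?thesis .
  qed
  have "(INF \<O>\<in>nbhds X d \<mu>. limsup (\<lambda>n. rate X d (V n) (\<sigma> n) \<delta> \<O>))
     \<le> (INF \<O>\<in>nbhds Y e \<nu>. limsup (\<lambda>n. rate Y e (V n) (\<sigma> n) \<delta>' \<O>))"
  proof (rule INF_greatest)
    fix \<O>' assume O': "\<O>' \<in> nbhds Y e \<nu>"
    obtain Us \<epsilon> where U: "finite Us" "Us \<subseteq> dist_algebra Y e" "0 < \<epsilon>" "basic_nbhd Y e \<nu> Us \<epsilon> \<subseteq> \<O>'"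
      using nbhds_basic_algebra[OF cmY nu O'] by blast
    define \<kappa> where "\<kappa> = min \<gamma> (\<epsilon>/3)"
    have \<kappa>: "0 < \<kappa>" "\<kappa> \<le> \<gamma>" "\<kappa> \<le> \<epsilon>/3" using \<gamma> U(3) by (auto simp: \<kappa>_def)
    let ?U = "Us \<union> \<rho> ` Q"
    have Uf: "finite ?U" "?U \<subseteq> dist_algebra Y e" using U Q(1) \<rho>(1) by auto
    show "(INF \<O>\<in>nbhds X d \<mu>. limsup (\<lambda>n. rate X d (V n) (\<sigma> n) \<delta> \<O>)) \<le> limsup (\<lambda>n. rate Y e (V n) (\<sigma> n) \<delta>' \<O>')"
    proof (rule model_lifting[OF sof cmX cmY mu inv \<phi>0 Uf \<kappa>(1)])
      fix w \<O>0 assume O0: "\<O>0 \<in> nbhds X d \<mu>" and w: "\<And>u. u \<in> ?U \<Longrightarrow> w u \<in> dist_algebra X d"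
        and wint0: "\<And>u. u \<in> ?U \<Longrightarrow> (\<integral>x. \<bar>w u x - u (\<lambda>g. \<phi>0 (shift g x))\<bar> \<partial>\<mu>) < \<kappa>"
        and lift: "\<forall>\<^sub>F n in sequentially. \<forall>x\<in>good_models X d (V n) (\<sigma> n) \<O>0. \<exists>y\<in>PiE (V n) (\<lambda>_. Y). \<forall>u\<in>?U.
           ave (V n) (\<lambda>v. \<bar>u (pullback_name (\<sigma> n) v y) - w u (pullback_name (\<sigma> n) v x)\<bar>) < \<kappa>"
      have ud: "u \<in> dist_algebra Y e" if "u \<in> ?U" for u using Uf(2) that by blast
      have uint: "integrable \<nu> u" if "u \<in> ?U" for u
        by (rule tests_integrable[OF cmY dist_algebra_tests[OF cmY ud[OF that]] nu])
      have u\<phi>: "integrable \<mu> (\<lambda>x. u (\<phi> x))" "(\<integral>x. u (\<phi> x) \<partial>\<mu>) = (\<integral>y. u y \<partial>\<nu>)" if u: "u \<in> ?U" for u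
      proof -
        have m: "u \<in> borel_measurable \<nu>" using uint[OF u] by auto
        have "integrable (distr \<mu> \<nu> \<phi>) u" unfolding \<phi>(2) by (rule uint[OF u])
        then show "integrable \<mu> (\<lambda>x. u (\<phi> x))" using integrable_distr_eq[OF \<phi>(1) m] by simp
        show "(\<integral>x. u (\<phi> x) \<partial>\<mu>) = (\<integral>y. u y \<partial>\<nu>)" using integral_distr[OF \<phi>(1) m] unfolding \<phi>(2) by simp
      qed
      have wt: "w u \<in> tests X d" if "u \<in> ?U" for u by (rule dist_algebra_tests[OF cmX w[OF that]])
      have wi: "integrable \<mu> (w u)" if "u \<in> ?U" for u by (rule tests_integrable[OF cmX wt[OF that] mu])
      have wint: "(\<integral>x. \<bar>w u x - u (\<phi> x)\<bar> \<partial>\<mu>) < \<kappa>" if u: "u \<in> ?U" for u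
      proof -
        have um: "(\<lambda>x. u (\<lambda>g. \<phi>0 (shift g x))) \<in> borel_measurable \<mu>"
        proof -
          have "shift g \<in> measurable \<mu> \<mu>" for g
            using shift_measurable[of g X d] measurable_cong_sets[OF sets_mu sets_mu] by blast
          then have "(\<lambda>x. \<lambda>g\<in>UNIV. \<phi>0 (shift g x)) \<in> measurable \<mu> (config_algebra UNIV Y e)"
            unfolding config_algebra_def by (intro measurable_restrict measurable_compose[OF _ \<phi>0])
          then have "(\<lambda>x g. \<phi>0 (shift g x)) \<in> measurable \<mu> (config_algebra UNIV Y e)" by (simp add: restrict_def)
          then show ?thesis by (rule measurable_compose[OF _ dist_algebra_measurable[OF cmY ud[OF u]]])
        qed
        have "(\<integral>x. \<bar>w u x - u (\<phi> x)\<bar> \<partial>\<mu>) = (\<integral>x. \<bar>w u x - u (\<lambda>g. \<phi>0 (shift g x))\<bar> \<partial>\<mu>)"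
        proof (rule integral_cong_AE)
          show "AE x in \<mu>. \<bar>w u x - u (\<phi> x)\<bar> = \<bar>w u x - u (\<lambda>g. \<phi>0 (shift g x))\<bar>" using \<phi>0eq by auto
        qed (use um wi[OF u] u\<phi>(1)[OF u] in auto)
        then show ?thesis using wint0[OF u] by simp
      qed
      define W where "W q x = \<bar>w (\<rho> q) x - d (x 0) q\<bar>" for q and x :: "'g \<Rightarrow> 'a"
      have Wt: "W q \<in> tests X d" if q: "q \<in> Q" for q
      proof -
        have "(\<lambda>x. d (x 0) q) \<in> tests X d" by (rule dist_algebra_tests[OF cmX dist_algebra.coord]) (use q Q in auto)
        then show ?thesis using wt[of "\<rho> q"] q unfolding W_def by (auto intro!: continuous_intros)
      qed
      have Wint: "(\<integral>x. W q x \<partial>\<mu>) \<le> 2 * \<gamma>" if q: "q \<in> Q" for q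
      proof -
        have qX: "q \<in> X" using q Q by blast
        have \<rho>U: "\<rho> q \<in> ?U" using q by blast
        have ti: "integrable \<nu> (t q)"
          by (rule N.integrable_const_bound[where B = C]) (use tb[OF qX] tm[OF qX] in \<open>auto intro!: AE_I2\<close>)
        have ai: "integrable \<nu> (\<lambda>y. \<bar>\<rho> q y - t q y\<bar>)" using ti uint[OF \<rho>U] by auto
        have am: "(\<lambda>y. \<bar>\<rho> q y - t q y\<bar>) \<in> borel_measurable \<nu>" using ai by auto
        have ai2: "integrable \<mu> (\<lambda>x. \<bar>\<rho> q (\<phi> x) - t q (\<phi> x)\<bar>)"
        proof -
          have "integrable (distr \<mu> \<nu> \<phi>) (\<lambda>y. \<bar>\<rho> q y - t q y\<bar>)" unfolding \<phi>(2) by (rule ai)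
          then show ?thesis using integrable_distr_eq[OF \<phi>(1) am] by simp
        qed
        have av: "(\<integral>x. \<bar>\<rho> q (\<phi> x) - t q (\<phi> x)\<bar> \<partial>\<mu>) < \<gamma>"
          using integral_distr[OF \<phi>(1) am] \<rho>(2)[OF q] unfolding \<phi>(2) by simp
        have "(\<integral>x. W q x \<partial>\<mu>) \<le> (\<integral>x. \<bar>w (\<rho> q) x - \<rho> q (\<phi> x)\<bar> + \<bar>\<rho> q (\<phi> x) - t q (\<phi> x)\<bar> \<partial>\<mu>)"
        proof (rule integral_mono_AE)
          show "integrable \<mu> (W q)" by (rule tests_integrable[OF cmX Wt[OF q] mu])
          show "integrable \<mu> (\<lambda>x. \<bar>w (\<rho> q) x - \<rho> q (\<phi> x)\<bar> + \<bar>\<rho> q (\<phi> x) - t q (\<phi> x)\<bar>)"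
            using ai2 wi[OF \<rho>U] u\<phi>(1)[OF \<rho>U] by auto
          show "AE x in \<mu>. W q x \<le> \<bar>w (\<rho> q) x - \<rho> q (\<phi> x)\<bar> + \<bar>\<rho> q (\<phi> x) - t q (\<phi> x)\<bar>"
            using inverse
          proof (rule AE_mp, intro AE_I2 impI)
            fix x assume "\<psi> (\<phi> x) = x"
            then show "W q x \<le> \<bar>w (\<rho> q) x - \<rho> q (\<phi> x)\<bar> + \<bar>\<rho> q (\<phi> x) - t q (\<phi> x)\<bar>"
              by (simp add: W_def t_def)
          qed
        qed
        also have "\<dots> = (\<integral>x. \<bar>w (\<rho> q) x - \<rho> q (\<phi> x)\<bar> \<partial>\<mu>) + (\<integral>x. \<bar>\<rho> q (\<phi> x) - t q (\<phi> x)\<bar> \<partial>\<mu>)"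
          using ai2 wi[OF \<rho>U] u\<phi>(1)[OF \<rho>U] by (intro Bochner_Integration.integral_add) auto
        also have "\<dots> \<le> \<kappa> + \<gamma>" using wint[OF \<rho>U] av by linarith
        finally show ?thesis using \<kappa> by linarith
      qed
      let ?N1 = "basic_nbhd X d \<mu> (w ` Us) (\<epsilon>/3)"
      let ?N2 = "basic_nbhd X d \<mu> (W ` Q) \<gamma>"
      have T1: "w ` Us \<subseteq> tests X d" using wt by blast
      have T2: "W ` Q \<subseteq> tests X d" using Wt by blast
      have N1: "?N1 \<in> nbhds X d \<mu>" by (rule basic_nbhd_nbhds[OF mu _ T1]) (use U in auto)
      have N2: "?N2 \<in> nbhds X d \<mu>" by (rule basic_nbhd_nbhds[OF mu _ T2]) (use Q \<gamma> in auto)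
      define \<O> where "\<O> = \<O>0 \<inter> (?N1 \<inter> ?N2)"
      have O: "\<O> \<in> nbhds X d \<mu>" unfolding \<O>_def by (intro nbhds_Int O0 N1 N2)
      have "\<forall>\<^sub>F n in sequentially. rate X d (V n) (\<sigma> n) \<delta> \<O> \<le> rate Y e (V n) (\<sigma> n) \<delta>' \<O>'"
        using lift
      proof eventually_elim
        case (elim n)
        note Vn = model_frameD(1-3)[OF fr[of n]]
        let ?\<Pi> = "pullback_name (\<sigma> n)"
        have gm: "x \<in> good_models X d (V n) (\<sigma> n) \<O>0" "x \<in> good_models X d (V n) (\<sigma> n) ?N1"
          "x \<in> good_models X d (V n) (\<sigma> n) ?N2" "x \<in> PiE (V n) (\<lambda>_. X)" if "x \<in> good_models X d (V n) (\<sigma> n) \<O>" for x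
          using that by (auto simp: good_models_def \<O>_def)
        have "\<forall>x\<in>good_models X d (V n) (\<sigma> n) \<O>. \<exists>y. y \<in> PiE (V n) (\<lambda>_. Y) \<and> (\<forall>u\<in>?U.
           ave (V n) (\<lambda>v. \<bar>u (?\<Pi> v y) - w u (?\<Pi> v x)\<bar>) < \<kappa>)"
          using elim gm(1) by (simp only: Bex_def) blast
        from bchoice[OF this] obtain \<Phi> where \<Phi>0: "\<forall>x\<in>good_models X d (V n) (\<sigma> n) \<O>. \<Phi> x \<in> PiE (V n) (\<lambda>_. Y) \<and>
          (\<forall>u\<in>?U. ave (V n) (\<lambda>v. \<bar>u (?\<Pi> v (\<Phi> x)) - w u (?\<Pi> v x)\<bar>) < \<kappa>)" ..
        have \<Phi>: "\<Phi> x \<in> PiE (V n) (\<lambda>_. Y)" "\<And>u. u \<in> ?U \<Longrightarrow> ave (V n) (\<lambda>v. \<bar>u (?\<Pi> v (\<Phi> x)) - w u (?\<Pi> v x)\<bar>) < \<kappa>"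
          if "x \<in> good_models X d (V n) (\<sigma> n) \<O>" for x
          using \<Phi>0[THEN bspec, OF that] by simp_all
        have "cov \<delta> (good_models X d (V n) (\<sigma> n) \<O>) (hamming_dist (V n) d)
          \<le> cov \<delta>' (good_models Y e (V n) (\<sigma> n) \<O>') (hamming_dist (V n) e)"
        proof (rule cov_le_cov[OF cmY Vn(1,2) \<delta>', where \<Phi> = \<Phi>])
          show "good_models Y e (V n) (\<sigma> n) \<O>' \<subseteq> PiE (V n) (\<lambda>_. Y)" by (auto simp: good_models_def)
          fix x assume x: "x \<in> good_models X d (V n) (\<sigma> n) \<O>"
          have UT: "Us \<subseteq> tests Y e" using U(2) dist_algebra_tests[OF cmY] by blast
          have "\<Phi> x \<in> good_models Y e (V n) (\<sigma> n) (basic_nbhd Y e \<nu> Us \<epsilon>)"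
            unfolding good_models_basic[OF cmY fr UT]
          proof (intro CollectI conjI ballI \<Phi>(1)[OF x])
            fix u assume u: "u \<in> Us"
            then have u': "u \<in> ?U" by blast
            have 1: "\<bar>ave (V n) (\<lambda>v. u (?\<Pi> v (\<Phi> x))) - ave (V n) (\<lambda>v. w u (?\<Pi> v x))\<bar> < \<epsilon>/3"
              using ave_abs[of "V n" "\<lambda>v. u (?\<Pi> v (\<Phi> x)) - w u (?\<Pi> v x)"] \<Phi>(2)[OF x u'] \<kappa>(3) by (simp add: ave_diff)
            have 2: "\<bar>ave (V n) (\<lambda>v. w u (?\<Pi> v x)) - (\<integral>x. w u x \<partial>\<mu>)\<bar> < \<epsilon>/3"
              using gm(2)[OF x] u unfolding good_models_basic[OF cmX fr T1] by auto
            have "\<bar>(\<integral>x. w u x \<partial>\<mu>) - (\<integral>y. u y \<partial>\<nu>)\<bar> = \<bar>\<integral>x. w u x - u (\<phi> x) \<partial>\<mu>\<bar>"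
              using wi[OF u'] u\<phi>[OF u'] by simp
            also have "\<dots> \<le> (\<integral>x. \<bar>w u x - u (\<phi> x)\<bar> \<partial>\<mu>)" by (rule integral_abs_bound)
            also have "\<dots> < \<epsilon>/3" using wint[OF u'] \<kappa>(3) by simp
            finally show "\<bar>ave (V n) (\<lambda>v. u (?\<Pi> v (\<Phi> x))) - (\<integral>y. u y \<partial>\<nu>)\<bar> < \<epsilon>" using 1 2 by linarith
          qed
          then show "\<Phi> x \<in> good_models Y e (V n) (\<sigma> n) \<O>'" using good_models_mono[OF U(4)] by blast
        next
          fix x x' assume x: "x \<in> good_models X d (V n) (\<sigma> n) \<O>" and x': "x' \<in> good_models X d (V n) (\<sigma> n) \<O>"
            and close: "hamming_dist (V n) e (\<Phi> x) (\<Phi> x') < 2 * \<delta>'"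
          \<comment> \<open>the name at \<open>v\<close> has \<open>x (\<sigma> n 0 v)\<close> at \<open>0\<close>; \<open>\<sigma> n 0\<close> need not be the identity, but it is a bijection\<close>
          let ?x = "\<lambda>v. x (\<sigma> n 0 v)" and ?x' = "\<lambda>v. x' (\<sigma> n 0 v)"
          have xX: "?x v \<in> X" "?x' v \<in> X" if "v \<in> V n" for v
            using model_frameD(5)[OF fr that, of 0] gm(4)[OF x] gm(4)[OF x'] by auto
          have near: "ave (V n) (\<lambda>v. \<bar>d (z (\<sigma> n 0 v)) q - \<rho> q (?\<Pi> v (\<Phi> z))\<bar>) \<le> 4 * \<gamma>"
            if z: "z \<in> good_models X d (V n) (\<sigma> n) \<O>" and q: "q \<in> Q" for z q
          proof -
            have "ave (V n) (\<lambda>v. \<bar>d (z (\<sigma> n 0 v)) q - \<rho> q (?\<Pi> v (\<Phi> z))\<bar>) \<le>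
              ave (V n) (\<lambda>v. W q (?\<Pi> v z) + \<bar>\<rho> q (?\<Pi> v (\<Phi> z)) - w (\<rho> q) (?\<Pi> v z)\<bar>)"
              by (rule ave_mono) (simp add: W_def pullback_name_def)
            also have "\<dots> = ave (V n) (\<lambda>v. W q (?\<Pi> v z)) + ave (V n) (\<lambda>v. \<bar>\<rho> q (?\<Pi> v (\<Phi> z)) - w (\<rho> q) (?\<Pi> v z)\<bar>)"
              by (rule ave_add)
            also have "\<bar>ave (V n) (\<lambda>v. W q (?\<Pi> v z)) - (\<integral>x. W q x \<partial>\<mu>)\<bar> < \<gamma>"
              using gm(3)[OF z] q unfolding good_models_basic[OF cmX fr T2] by auto
            then have "ave (V n) (\<lambda>v. W q (?\<Pi> v z)) + ave (V n) (\<lambda>v. \<bar>\<rho> q (?\<Pi> v (\<Phi> z)) - w (\<rho> q) (?\<Pi> v z)\<bar>) \<le> 4 * \<gamma>"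
              using Wint[OF q] \<Phi>(2)[OF z, of "\<rho> q"] q \<kappa>(2) by auto
            finally show ?thesis .
          qed
          have qdiff: "ave (V n) (\<lambda>v. \<bar>d (?x v) q - d (?x' v) q\<bar>) \<le> 9 * \<gamma>" if q: "q \<in> Q" for q
          proof -
            have "ave (V n) (\<lambda>v. \<bar>d (?x v) q - d (?x' v) q\<bar>) \<le>
              ave (V n) (\<lambda>v. \<bar>d (?x v) q - \<rho> q (?\<Pi> v (\<Phi> x))\<bar> + (\<bar>\<rho> q (?\<Pi> v (\<Phi> x)) - \<rho> q (?\<Pi> v (\<Phi> x'))\<bar>
                + \<bar>d (?x' v) q - \<rho> q (?\<Pi> v (\<Phi> x'))\<bar>))"
              by (rule ave_mono) linarith
            also have "\<dots> \<le> 4 * \<gamma> + (\<gamma> + 4 * \<gamma>)"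
              unfolding ave_add
              by (intro add_mono near[OF x q] near[OF x' q] \<rho>close[OF q fr \<Phi>(1)[OF x] \<Phi>(1)[OF x'] close])
            finally show ?thesis by simp
          qed
          have "hamming_dist (V n) d x x' = ave (V n) (\<lambda>v. d (?x v) (?x' v))"
            unfolding hamming_ave using ave_bij[OF model_frameD(4)[OF fr, of n 0], of "\<lambda>v. d (x v) (x' v)"] by simp
          also have "\<dots> \<le> ave (V n) (\<lambda>v. \<delta>/4 + (\<Sum>q\<in>Q. \<bar>d (?x v) q - d (?x' v) q\<bar>))"
          proof (rule ave_mono)
            fix v assume v: "v \<in> V n"
            obtain q where q: "q \<in> Q" "d (?x v) q < \<delta>/8" using Q(3)[OF xX(1)[OF v]] by blast
            have qX: "q \<in> X" using q Q by blast
            have "\<bar>d (?x v) q - d (?x' v) q\<bar> \<le> (\<Sum>q\<in>Q. \<bar>d (?x v) q - d (?x' v) q\<bar>)"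
              by (rule member_le_sum[OF q(1) _ Q(1)]) auto
            moreover have "d (?x v) (?x' v) \<le> d (?x v) q + d q (?x' v)"
              by (rule compact_metric_triangle[OF cmX xX(1)[OF v] qX xX(2)[OF v]])
            ultimately show "d (?x v) (?x' v) \<le> \<delta>/4 + (\<Sum>q\<in>Q. \<bar>d (?x v) q - d (?x' v) q\<bar>)"
              using q(2) compact_metric_commute[OF cmX, of q "?x' v"] by linarith
          qed
          also have "\<dots> = \<delta>/4 + (\<Sum>q\<in>Q. ave (V n) (\<lambda>v. \<bar>d (?x v) q - d (?x' v) q\<bar>))"
            using Vn by (simp add: ave_add ave_sum ave_const)
          also have "\<dots> \<le> \<delta>/4 + (\<Sum>q\<in>Q. 9 * \<gamma>)" by (intro add_left_mono sum_mono qdiff)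
          also have "\<dots> < \<delta>" using K\<gamma> \<delta> by (simp add: K_def)
          finally show "hamming_dist (V n) d x x' < \<delta>" .
        qed
        then show ?case by (rule rate_mono) (rule Vn(3))
      qed
      then have "limsup (\<lambda>n. rate X d (V n) (\<sigma> n) \<delta> \<O>) \<le> limsup (\<lambda>n. rate Y e (V n) (\<sigma> n) \<delta>' \<O>')" by (rule Limsup_mono)
      then show ?thesis by (rule INF_lower2[OF O])
    qed
  qed
  also have "\<dots> \<le> process_sofic_entropy V \<sigma> Y e \<nu>"
    unfolding process_sofic_entropy_rate using \<delta>' by (intro SUP_upper) auto
  finally show "(INF \<O>\<in>nbhds X d \<mu>. limsup (\<lambda>n. rate X d (V n) (\<sigma> n) \<delta> \<O>)) \<le> process_sofic_entropy V \<sigma> Y e \<nu>" .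
qed

lemma AE_pullback:
  assumes "f \<in> measurable A B" "distr A B f = B" "AE y in B. P y"
  shows "AE x in A. P (f x)"
proof (rule AE_distrD[OF assms(1)])
  show "AE y in distr A B f. P y" unfolding assms(2) by (rule assms(3))
qed

text \<open>Both processes are reached from the common system \<open>(M, T)\<close>; going back along one isomorphism and forth along the other
links them directly. All identities hold almost everywhere and are moved to \<open>\<mu>\<close> with \<open>AE_pullback\<close>.\<close>

lemma isomorphic_processes_link:
  assumes T: "\<And>g. T g \<in> measurable M M" "\<And>g. distr M M (T g) = M"
    and i1: "isomorphic_systems M T \<mu> shift" and i2: "isomorphic_systems M T \<nu> shift"
  obtains \<phi> \<psi> where "\<phi> \<in> measurable \<mu> \<nu>" "distr \<mu> \<nu> \<phi> = \<nu>" "\<psi> \<in> measurable \<nu> \<mu>"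
    "AE x in \<mu>. \<psi> (\<phi> x) = x" "\<And>g. AE x in \<mu>. \<phi> (shift g x) = shift g (\<phi> x)"
proof -
  from i1 obtain \<phi>1 \<psi>1 where 1: "\<phi>1 \<in> measurable M \<mu>" "\<psi>1 \<in> measurable \<mu> M" "distr M \<mu> \<phi>1 = \<mu>" "distr \<mu> M \<psi>1 = M"
    "AE x in M. \<psi>1 (\<phi>1 x) = x" "AE y in \<mu>. \<phi>1 (\<psi>1 y) = y" "\<And>g. AE x in M. \<phi>1 (T g x) = shift g (\<phi>1 x)"
    unfolding isomorphic_systems_def by blast
  from i2 obtain \<phi>2 \<psi>2 where 2: "\<phi>2 \<in> measurable M \<nu>" "\<psi>2 \<in> measurable \<nu> M" "distr M \<nu> \<phi>2 = \<nu>" "distr \<nu> M \<psi>2 = M"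
    "AE x in M. \<psi>2 (\<phi>2 x) = x" "AE y in \<nu>. \<phi>2 (\<psi>2 y) = y" "\<And>g. AE x in M. \<phi>2 (T g x) = shift g (\<phi>2 x)"
    unfolding isomorphic_systems_def by blast
  note pb = AE_pullback[OF 1(2) 1(4)]
  show thesis
  proof (rule that[of "\<lambda>x. \<phi>2 (\<psi>1 x)" "\<lambda>y. \<phi>1 (\<psi>2 y)"])
    show "(\<lambda>x. \<phi>2 (\<psi>1 x)) \<in> measurable \<mu> \<nu>" by (rule measurable_compose[OF 1(2) 2(1)])
    show "(\<lambda>y. \<phi>1 (\<psi>2 y)) \<in> measurable \<nu> \<mu>" by (rule measurable_compose[OF 2(2) 1(1)])
    show "distr \<mu> \<nu> (\<lambda>x. \<phi>2 (\<psi>1 x)) = \<nu>"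
      using distr_distr[OF 2(1) 1(2)] 1(4) 2(3) by (simp add: o_def)
    show "AE x in \<mu>. \<phi>1 (\<psi>2 (\<phi>2 (\<psi>1 x))) = x" using pb[OF 2(5)] 1(6) by eventually_elim simp
    fix g
    have a: "AE x in \<mu>. \<phi>1 (T g (\<psi>1 x)) = shift g (\<phi>1 (\<psi>1 x))" by (rule pb[OF 1(7)])
    have b: "AE x in \<mu>. \<psi>1 (\<phi>1 (T g (\<psi>1 x))) = T g (\<psi>1 x)" by (rule pb[OF AE_pullback[OF T 1(5)]])
    have c: "AE x in \<mu>. \<phi>2 (T g (\<psi>1 x)) = shift g (\<phi>2 (\<psi>1 x))" by (rule pb[OF 2(7)])
    show "AE x in \<mu>. \<phi>2 (\<psi>1 (shift g x)) = shift g (\<phi>2 (\<psi>1 x))"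
      using a b c 1(6)
    proof eventually_elim
      case (elim x)
      then have "\<psi>1 (shift g x) = T g (\<psi>1 x)" by simp
      then show ?case using elim by simp
    qed
  qed
qed

theorem sofic_entropy_isomorphism_invariant:
  fixes \<mu> :: "('g::{group_add,countable} \<Rightarrow> 'a) measure" and \<nu> :: "('g \<Rightarrow> 'b) measure"
  assumes sof: "sofic_approximation V \<sigma>" and mp: "metric_process X d \<mu>" "metric_process Y e \<nu>"
    and T: "\<And>g. T g \<in> measurable M M" "\<And>g. distr M M (T g) = M"
    and i: "isomorphic_systems M T \<mu> shift" "isomorphic_systems M T \<nu> shift"
  shows "process_sofic_entropy V \<sigma> X d \<mu> = process_sofic_entropy V \<sigma> Y e \<nu>"
proof (rule antisym)
  obtain \<phi> \<psi> where "\<phi> \<in> measurable \<mu> \<nu>" "distr \<mu> \<nu> \<phi> = \<nu>" "\<psi> \<in> measurable \<nu> \<mu>"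
    "AE x in \<mu>. \<psi> (\<phi> x) = x" "\<And>g. AE x in \<mu>. \<phi> (shift g x) = shift g (\<phi> x)"
    using isomorphic_processes_link[OF T i] by blast
  then show "process_sofic_entropy V \<sigma> X d \<mu> \<le> process_sofic_entropy V \<sigma> Y e \<nu>"
    by (rule sofic_entropy_le_of_embedding[OF sof mp])
  obtain \<phi> \<psi> where "\<phi> \<in> measurable \<nu> \<mu>" "distr \<nu> \<mu> \<phi> = \<mu>" "\<psi> \<in> measurable \<mu> \<nu>"
    "AE x in \<nu>. \<psi> (\<phi> x) = x" "\<And>g. AE x in \<nu>. \<phi> (shift g x) = shift g (\<phi> x)"
    using isomorphic_processes_link[OF T i(2,1)] by blast
  then show "process_sofic_entropy V \<sigma> Y e \<nu> \<le> process_sofic_entropy V \<sigma> X d \<mu>"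
    by (rule sofic_entropy_le_of_embedding[OF sof mp(2,1)])
qed

section \<open>Products of systems and of processes\<close>

lemma shift_measurable_Prob:
  assumes "\<mu> \<in> Prob UNIV X d" "Metric_space X d"
  shows "shift g \<in> measurable \<mu> \<mu>"
  using shift_measurable[of g X d] measurable_cong_sets[OF ProbD(2)[OF assms] ProbD(2)[OF assms]] by blast

lemma distr_map_prod:
  assumes "prob_space A" "prob_space B" "f \<in> measurable A A'" "distr A A' f = A'" "h \<in> measurable B B'" "distr B B' h = B'"
  shows "(\<lambda>(x, y). (f x, h y)) \<in> measurable (A \<Otimes>\<^sub>M B) (A' \<Otimes>\<^sub>M B')"
    "distr (A \<Otimes>\<^sub>M B) (A' \<Otimes>\<^sub>M B') (\<lambda>(x, y). (f x, h y)) = A' \<Otimes>\<^sub>M B'"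
proof -
  have "prob_space (distr B B' h)" by (rule prob_space.prob_space_distr[OF assms(2,5)])
  then have "sigma_finite_measure (distr B B' h)" by (simp add: prob_space_imp_sigma_finite)
  from pair_measure_distr[OF assms(3,5) this]
  show "distr (A \<Otimes>\<^sub>M B) (A' \<Otimes>\<^sub>M B') (\<lambda>(x, y). (f x, h y)) = A' \<Otimes>\<^sub>M B'"
    using assms(4,6) by simp
  have "(\<lambda>p. (f (fst p), h (snd p))) \<in> measurable (A \<Otimes>\<^sub>M B) (A' \<Otimes>\<^sub>M B')"
    by (intro measurable_Pair measurable_compose[OF measurable_fst assms(3)] measurable_compose[OF measurable_snd assms(5)])
  then show "(\<lambda>(x, y). (f x, h y)) \<in> measurable (A \<Otimes>\<^sub>M B) (A' \<Otimes>\<^sub>M B')" by (simp add: case_prod_beta')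
qed

lemma distr_pair_snd:
  assumes "prob_space A" "prob_space B"
  shows "distr (A \<Otimes>\<^sub>M B) B snd = B"
proof -
  interpret A: prob_space A by fact
  interpret B: prob_space B by fact
  interpret P: pair_prob_space A B ..
  have "distr (A \<Otimes>\<^sub>M B) B snd = distr (distr (B \<Otimes>\<^sub>M A) (A \<Otimes>\<^sub>M B) (\<lambda>(x, y). (y, x))) B snd"
    using P.distr_pair_swap by simp
  also have "\<dots> = distr (B \<Otimes>\<^sub>M A) B (snd \<circ> (\<lambda>(x, y). (y, x)))"
    by (rule distr_distr[OF measurable_snd measurable_pair_swap'])
  also have "snd \<circ> (\<lambda>(x, y). (y, x)) = (fst :: 'b \<times> 'a \<Rightarrow> 'b)" by auto
  also have "distr (B \<Otimes>\<^sub>M A) B fst = B" by (rule A.distr_pair_fst)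
  finally show ?thesis .
qed

lemma config_fst_measurable:
  assumes "compact_metric X d" "compact_metric Y e"
  shows "(\<lambda>z g. fst (z g)) \<in> measurable (config_algebra UNIV (X \<times> Y) (avg_dist d e)) (config_algebra UNIV X d)"
    and "(\<lambda>z g. snd (z g)) \<in> measurable (config_algebra UNIV (X \<times> Y) (avg_dist d e)) (config_algebra UNIV Y e)"
proof -
  let ?B = "borel_of (metric_top (X \<times> Y) (avg_dist d e))"
  have cont: "f \<in> measurable (borel_of \<tau>) (borel_of \<tau>')" if "continuous_map \<tau> \<tau>' f" for \<tau> :: "'p topology" and \<tau>' :: "'q topology" and f
  proof (rule measurable_borel_of_I)
    show "f \<in> space (borel_of \<tau>) \<rightarrow> topspace \<tau>'" using that by (auto simp: continuous_map_def)
    fix U assume "openin \<tau>' U"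
    then have "openin \<tau> {x \<in> topspace \<tau>. f x \<in> U}" by (rule openin_continuous_map_preimage[OF that])
    moreover have "f -` U \<inter> space (borel_of \<tau>) = {x \<in> topspace \<tau>. f x \<in> U}" by auto
    ultimately show "f -` U \<inter> space (borel_of \<tau>) \<in> sets (borel_of \<tau>)" by (simp add: openin_borel_of)
  qed
  have "(\<lambda>z. \<lambda>g\<in>UNIV. fst (z g)) \<in> measurable (config_algebra UNIV (X \<times> Y) (avg_dist d e)) (config_algebra UNIV X d)"
    unfolding config_algebra_def[of UNIV X]
    by (intro measurable_restrict measurable_compose[OF measurable_config_coord[OF UNIV_I] cont[OF continuous_fst_avg[OF assms]]])
  then show "(\<lambda>z g. fst (z g)) \<in> measurable (config_algebra UNIV (X \<times> Y) (avg_dist d e)) (config_algebra UNIV X d)"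
    by (simp add: restrict_def)
  have "(\<lambda>z. \<lambda>g\<in>UNIV. snd (z g)) \<in> measurable (config_algebra UNIV (X \<times> Y) (avg_dist d e)) (config_algebra UNIV Y e)"
    unfolding config_algebra_def[of UNIV Y]
    by (intro measurable_restrict measurable_compose[OF measurable_config_coord[OF UNIV_I] cont[OF continuous_snd_avg[OF assms]]])
  then show "(\<lambda>z g. snd (z g)) \<in> measurable (config_algebra UNIV (X \<times> Y) (avg_dist d e)) (config_algebra UNIV Y e)"
    by (simp add: restrict_def)
qed

lemma product_metric_process:
  fixes \<mu> :: "('g::{group_add,countable} \<Rightarrow> 'a) measure" and \<nu> :: "('g \<Rightarrow> 'b) measure"
  assumes mpX: "metric_process X d \<mu>" and mpY: "metric_process Y e \<nu>"
  shows "metric_process (X \<times> Y) (avg_dist d e) (product_process X d \<mu> Y e \<nu>)"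
proof -
  note X = metric_processD[OF mpX] and Y = metric_processD[OF mpY]
  note msX = compact_metric_space[OF X(1)] and msY = compact_metric_space[OF Y(1)]
  let ?C = "config_algebra UNIV (X \<times> Y) (avg_dist d e) :: ('g \<Rightarrow> 'a \<times> 'b) measure"
  let ?\<zeta> = "product_process X d \<mu> Y e \<nu>"
  let ?p = "\<lambda>(x :: 'g \<Rightarrow> 'a, y :: 'g \<Rightarrow> 'b). \<lambda>i. (x i, y i)"
  have zP: "?\<zeta> \<in> Prob UNIV (X \<times> Y) (avg_dist d e)" by (rule product_process_Prob[OF X(1) Y(1) X(2) Y(2)])
  have pm: "?p \<in> measurable (\<mu> \<Otimes>\<^sub>M \<nu>) ?C" by (rule pairing_measurable[OF X(1) Y(1) X(2) Y(2)])
  have sz: "sets ?\<zeta> = sets ?C" by (simp add: product_process_def)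
  have "distr ?\<zeta> ?\<zeta> (shift g) = ?\<zeta>" for g
  proof -
    note mp = distr_map_prod[OF ProbD(1)[OF X(2) msX] ProbD(1)[OF Y(2) msY]
        shift_measurable_Prob[OF X(2) msX] X(3)[of g] shift_measurable_Prob[OF Y(2) msY] Y(3)[of g]]
    have "distr ?\<zeta> ?\<zeta> (shift g) = distr ?\<zeta> ?C (shift g)" by (rule distr_cong) (simp_all add: sz)
    also have "\<dots> = distr (\<mu> \<Otimes>\<^sub>M \<nu>) ?C (shift g \<circ> ?p)"
      unfolding product_process_def by (rule distr_distr[OF shift_measurable pm])
    also have "shift g \<circ> ?p = ?p \<circ> (\<lambda>(x, y). (shift g x, shift g y))" by (auto simp: shift_def)
    also have "distr (\<mu> \<Otimes>\<^sub>M \<nu>) ?C (?p \<circ> (\<lambda>(x, y). (shift g x, shift g y))) =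
      distr (distr (\<mu> \<Otimes>\<^sub>M \<nu>) (\<mu> \<Otimes>\<^sub>M \<nu>) (\<lambda>(x, y). (shift g x, shift g y))) ?C ?p"
      by (rule distr_distr[OF pm mp(1), symmetric])
    also have "\<dots> = ?\<zeta>" unfolding mp(2) product_process_def ..
    finally show ?thesis .
  qed
  then show ?thesis
    using compact_avg[OF X(1) Y(1)] zP by (simp add: metric_process_def compact_metric_def)
qed

lemma isomorphic_product:
  fixes \<mu> :: "('g::{group_add,countable} \<Rightarrow> 'a) measure" and \<nu> :: "('g \<Rightarrow> 'b) measure"
  assumes mpX: "metric_process X d \<mu>" and mpY: "metric_process Y e \<nu>"
    and M: "prob_space M" and N: "prob_space N"
    and iX: "isomorphic_systems M T \<mu> shift" and iY: "isomorphic_systems N S \<nu> shift"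
  shows "isomorphic_systems (M \<Otimes>\<^sub>M N) (product_action T S) (product_process X d \<mu> Y e \<nu>) shift"
proof -
  note X = metric_processD[OF mpX] and Y = metric_processD[OF mpY]
  note msX = compact_metric_space[OF X(1)] and msY = compact_metric_space[OF Y(1)]
  let ?C = "config_algebra UNIV (X \<times> Y) (avg_dist d e) :: ('g \<Rightarrow> 'a \<times> 'b) measure"
  let ?\<zeta> = "product_process X d \<mu> Y e \<nu>"
  let ?p = "\<lambda>(x :: 'g \<Rightarrow> 'a, y :: 'g \<Rightarrow> 'b). \<lambda>i. (x i, y i)"
  have pm: "?p \<in> measurable (\<mu> \<Otimes>\<^sub>M \<nu>) ?C" by (rule pairing_measurable[OF X(1) Y(1) X(2) Y(2)])
  have sz: "sets ?\<zeta> = sets ?C" by (simp add: product_process_def)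
  note muP = ProbD(1)[OF X(2) msX] and nuP = ProbD(1)[OF Y(2) msY]
  have s1: "sets \<mu> = sets (config_algebra UNIV X d)" and s2: "sets \<nu> = sets (config_algebra UNIV Y e)"
    using ProbD(2)[OF X(2) msX] ProbD(2)[OF Y(2) msY] by auto
  from iX obtain \<phi>1 \<psi>1 where 1: "\<phi>1 \<in> measurable M \<mu>" "\<psi>1 \<in> measurable \<mu> M" "distr M \<mu> \<phi>1 = \<mu>" "distr \<mu> M \<psi>1 = M"
    "AE x in M. \<psi>1 (\<phi>1 x) = x" "AE y in \<mu>. \<phi>1 (\<psi>1 y) = y" "\<And>g. AE x in M. \<phi>1 (T g x) = shift g (\<phi>1 x)"
    unfolding isomorphic_systems_def by blast
  from iY obtain \<phi>2 \<psi>2 where 2: "\<phi>2 \<in> measurable N \<nu>" "\<psi>2 \<in> measurable \<nu> N" "distr N \<nu> \<phi>2 = \<nu>" "distr \<nu> N \<psi>2 = N"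
    "AE x in N. \<psi>2 (\<phi>2 x) = x" "AE y in \<nu>. \<phi>2 (\<psi>2 y) = y" "\<And>g. AE x in N. \<phi>2 (S g x) = shift g (\<phi>2 x)"
    unfolding isomorphic_systems_def by blast
  note f = distr_map_prod[OF M N 1(1,3) 2(1,3)] and b = distr_map_prod[OF muP nuP 1(2,4) 2(2,4)]
  define \<phi> where "\<phi> = ?p \<circ> (\<lambda>(x, y). (\<phi>1 x, \<phi>2 y))"
  define \<psi> where "\<psi> z = (\<psi>1 (\<lambda>g. fst (z g)), \<psi>2 (\<lambda>g. snd (z g)))" for z
  have q1: "(\<lambda>z g. fst (z g)) \<in> measurable ?\<zeta> \<mu>" and q2: "(\<lambda>z g. snd (z g)) \<in> measurable ?\<zeta> \<nu>"
    using config_fst_measurable[OF X(1) Y(1)] measurable_cong_sets[OF sz s1] measurable_cong_sets[OF sz s2] by blast+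
  have \<phi>C: "\<phi> \<in> measurable (M \<Otimes>\<^sub>M N) ?C" unfolding \<phi>_def by (rule measurable_comp[OF f(1) pm])
  then have \<phi>m: "\<phi> \<in> measurable (M \<Otimes>\<^sub>M N) ?\<zeta>" using measurable_cong_sets[OF refl sz] by blast
  have \<psi>m: "\<psi> \<in> measurable ?\<zeta> (M \<Otimes>\<^sub>M N)"
    unfolding \<psi>_def by (intro measurable_Pair measurable_compose[OF q1 1(2)] measurable_compose[OF q2 2(2)])
  have pmz: "?p \<in> measurable (\<mu> \<Otimes>\<^sub>M \<nu>) ?\<zeta>" using pm measurable_cong_sets[OF refl sz] by blast
  have zd: "?\<zeta> = distr (\<mu> \<Otimes>\<^sub>M \<nu>) ?\<zeta> ?p"
    unfolding product_process_def by (rule distr_cong) simp_all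
  have d1: "distr (M \<Otimes>\<^sub>M N) ?\<zeta> \<phi> = ?\<zeta>"
    unfolding \<phi>_def using distr_distr[OF pmz f(1)] f(2) zd by simp
  have d2: "distr ?\<zeta> (M \<Otimes>\<^sub>M N) \<psi> = M \<Otimes>\<^sub>M N"
  proof -
    have "\<psi> \<circ> ?p = (\<lambda>(x, y). (\<psi>1 x, \<psi>2 y))" by (auto simp: \<psi>_def)
    moreover have "distr ?\<zeta> (M \<Otimes>\<^sub>M N) \<psi> = distr (\<mu> \<Otimes>\<^sub>M \<nu>) (M \<Otimes>\<^sub>M N) (\<psi> \<circ> ?p)"
    proof -
      have "distr (distr (\<mu> \<Otimes>\<^sub>M \<nu>) ?\<zeta> ?p) (M \<Otimes>\<^sub>M N) \<psi> = distr (\<mu> \<Otimes>\<^sub>M \<nu>) (M \<Otimes>\<^sub>M N) (\<psi> \<circ> ?p)" by (rule distr_distr[OF \<psi>m pmz])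
      then show ?thesis using zd by simp
    qed
    ultimately show ?thesis using b(2) by simp
  qed
  interpret PN: prob_space \<nu> by (rule nuP)
  interpret PNN: prob_space N by (rule N)
  have e1: "distr ?\<zeta> \<mu> (\<lambda>z g. fst (z g)) = \<mu>"
  proof -
    have "(\<lambda>z g. fst (z g)) \<circ> ?p = fst" by (auto simp: fun_eq_iff)
    moreover have "distr (distr (\<mu> \<Otimes>\<^sub>M \<nu>) ?\<zeta> ?p) \<mu> (\<lambda>z g. fst (z g)) = distr (\<mu> \<Otimes>\<^sub>M \<nu>) \<mu> ((\<lambda>z g. fst (z g)) \<circ> ?p)" by (rule distr_distr[OF q1 pmz])
    ultimately show ?thesis using zd PN.distr_pair_fst by simp
  qed
  have e2: "distr ?\<zeta> \<nu> (\<lambda>z g. snd (z g)) = \<nu>"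
  proof -
    have "(\<lambda>z g. snd (z g)) \<circ> ?p = snd" by (auto simp: fun_eq_iff)
    moreover have "distr (distr (\<mu> \<Otimes>\<^sub>M \<nu>) ?\<zeta> ?p) \<nu> (\<lambda>z g. snd (z g)) = distr (\<mu> \<Otimes>\<^sub>M \<nu>) \<nu> ((\<lambda>z g. snd (z g)) \<circ> ?p)" by (rule distr_distr[OF q2 pmz])
    ultimately show ?thesis using zd distr_pair_snd[OF muP nuP] by simp
  qed
  note pf = AE_pullback[OF measurable_fst PNN.distr_pair_fst] and ps = AE_pullback[OF measurable_snd distr_pair_snd[OF M N]]
  show ?thesis unfolding isomorphic_systems_def
  proof (rule exI[of _ \<phi>], rule exI[of _ \<psi>], intro conjI allI \<phi>m \<psi>m d1 d2)
    show "AE x in M \<Otimes>\<^sub>M N. \<psi> (\<phi> x) = x"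
      using pf[OF 1(5)] ps[OF 2(5)] by eventually_elim (auto simp: \<psi>_def \<phi>_def)
    show "AE y in ?\<zeta>. \<phi> (\<psi> y) = y"
      using AE_pullback[OF q1 e1 1(6)] AE_pullback[OF q2 e2 2(6)]
      by eventually_elim (auto simp: \<psi>_def \<phi>_def)
    show "AE x in M \<Otimes>\<^sub>M N. \<phi> (product_action T S g x) = shift g (\<phi> x)" for g
      using pf[OF 1(7)[of g]] ps[OF 2(7)[of g]]
      by eventually_elim (auto simp: \<phi>_def product_action_def shift_def split: prod.splits)
  qed
qed

text \<open>The hypotheses of additivity are not symmetric; exchanging the factors gives the case with the roles reversed.\<close>

lemma isomorphic_swap:
  assumes M: "prob_space M" and N: "prob_space N"
    and i: "isomorphic_systems (N \<Otimes>\<^sub>M M) (product_action S T) P R"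
  shows "isomorphic_systems (M \<Otimes>\<^sub>M N) (product_action T S) P R"
proof -
  interpret A: prob_space M by (rule M)
  interpret B: prob_space N by (rule N)
  interpret P: pair_prob_space M N ..
  interpret Q: pair_prob_space N M ..
  let ?s = "\<lambda>(x, y). (y, x)"
  have s1: "distr (M \<Otimes>\<^sub>M N) (N \<Otimes>\<^sub>M M) ?s = N \<Otimes>\<^sub>M M" using Q.distr_pair_swap by simp
  have s2: "distr (N \<Otimes>\<^sub>M M) (M \<Otimes>\<^sub>M N) ?s = M \<Otimes>\<^sub>M N" using P.distr_pair_swap by simp
  from i obtain \<phi> \<psi> where 1: "\<phi> \<in> measurable (N \<Otimes>\<^sub>M M) P" "\<psi> \<in> measurable P (N \<Otimes>\<^sub>M M)" "distr (N \<Otimes>\<^sub>M M) P \<phi> = P" "distr P (N \<Otimes>\<^sub>M M) \<psi> = N \<Otimes>\<^sub>M M"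
    "AE x in N \<Otimes>\<^sub>M M. \<psi> (\<phi> x) = x" "AE y in P. \<phi> (\<psi> y) = y" "\<And>g. AE x in N \<Otimes>\<^sub>M M. \<phi> (product_action S T g x) = R g (\<phi> x)"
    unfolding isomorphic_systems_def by blast
  note pb = AE_pullback[OF measurable_pair_swap' s1]
  show ?thesis unfolding isomorphic_systems_def
  proof (rule exI[of _ "\<phi> \<circ> ?s"], rule exI[of _ "?s \<circ> \<psi>"], intro conjI allI)
    show "\<phi> \<circ> ?s \<in> measurable (M \<Otimes>\<^sub>M N) P" by (rule measurable_comp[OF measurable_pair_swap' 1(1)])
    show "?s \<circ> \<psi> \<in> measurable P (M \<Otimes>\<^sub>M N)" by (rule measurable_comp[OF 1(2) measurable_pair_swap'])
    show "distr (M \<Otimes>\<^sub>M N) P (\<phi> \<circ> ?s) = P" using distr_distr[OF 1(1) measurable_pair_swap'] s1 1(3) by simp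
    show "distr P (M \<Otimes>\<^sub>M N) (?s \<circ> \<psi>) = M \<Otimes>\<^sub>M N" using distr_distr[OF measurable_pair_swap' 1(2)] s2 1(4) by simp
    show "AE x in M \<Otimes>\<^sub>M N. (?s \<circ> \<psi>) ((\<phi> \<circ> ?s) x) = x"
      using pb[OF 1(5)] by eventually_elim auto
    show "AE y in P. (\<phi> \<circ> ?s) ((?s \<circ> \<psi>) y) = y"
      using 1(6) by eventually_elim (auto split: prod.splits)
    show "AE x in M \<Otimes>\<^sub>M N. (\<phi> \<circ> ?s) (product_action T S g x) = R g ((\<phi> \<circ> ?s) x)" for g
      using pb[OF 1(7)[of g]] by eventually_elim (auto simp: product_action_def)
  qed
qed

section \<open>Inner regularity on Polish spaces\<close>

locale polish_prob = Metric_space D d0 + prob_space M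
  for D :: "'a set" and d0 and M :: "'a measure" +
  assumes complete: mcomplete and second: "second_countable mtopology"
    and sets_M: "sets M = sets (borel_of mtopology)"
begin

lemma space_M: "space M = D"
  using sets_eq_imp_space_eq[OF sets_M] by simp

lemma openin_sets: "openin mtopology U \<Longrightarrow> U \<in> sets M"
  by (simp add: sets_M openin_borel_of)

lemma closedin_sets: "closedin mtopology U \<Longrightarrow> U \<in> sets M"
  by (simp add: sets_M closedin_borel_of)

lemma prob_increasing_limit:
  fixes A :: "nat \<Rightarrow> 'a set"
  assumes A: "\<And>n. A n \<in> sets M" and \<epsilon>: "0 < \<epsilon>"
  obtains N where "prob ((\<Union>n. A n) - (\<Union>n\<in>{..N}. A n)) < \<epsilon>"
proof -
  have UN: "(\<Union>n\<in>{..N}. A n) \<in> sets M" for N using A by auto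
  have "(\<lambda>N. prob (\<Union>n\<in>{..N}. A n)) \<longlonglongrightarrow> prob (\<Union>N. \<Union>n\<in>{..N}. A n)"
    by (rule finite_Lim_measure_incseq) (use UN in \<open>auto simp: incseq_def\<close>, fastforce)
  also have "(\<Union>N. \<Union>n\<in>{..N}. A n) = (\<Union>n. A n)" by auto
  finally have "\<forall>\<^sub>F N in sequentially. prob (\<Union>n. A n) - \<epsilon> < prob (\<Union>n\<in>{..N}. A n)"
    using \<epsilon> by (intro order_tendstoD(1)) auto
  then obtain N where N: "prob (\<Union>n. A n) - \<epsilon> < prob (\<Union>n\<in>{..N}. A n)" by (auto simp: eventually_sequentially)
  have "prob ((\<Union>n. A n) - (\<Union>n\<in>{..N}. A n)) = prob (\<Union>n. A n) - prob (\<Union>n\<in>{..N}. A n)"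
    by (rule finite_measure_Diff) (use A UN in auto)
  then show thesis using N by (intro that[of N]) simp
qed

lemma prob_UN_geometric:
  fixes A :: "nat \<Rightarrow> 'a set"
  assumes A: "\<And>n. A n \<in> sets M" and le: "\<And>n. prob (A n) \<le> \<epsilon> * (1/2) ^ Suc n"
  shows "prob (\<Union>n. A n) \<le> \<epsilon>"
proof -
  have s: "(\<lambda>n. \<epsilon> * (1/2) ^ Suc n) sums (\<epsilon> * 1)" by (intro sums_mult power_half_series)
  have sm: "summable (\<lambda>n. prob (A n))"
    by (rule summable_comparison_test'[OF sums_summable[OF s], of 0]) (use le in auto)
  have "prob (\<Union>n. A n) \<le> (\<Sum>n. prob (A n))"
    by (rule finite_measure_subadditive_countably) (use A sm in auto)
  also have "\<dots> \<le> (\<Sum>n. \<epsilon> * (1/2) ^ Suc n)" by (rule suminf_le[OF le sm sums_summable[OF s]])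
  also have "\<dots> = \<epsilon>" using sums_unique[OF s] by simp
  finally show ?thesis .
qed

definition inner_closed :: "'a set \<Rightarrow> bool" where
  "inner_closed A \<longleftrightarrow> A \<in> sets M \<and> (\<forall>\<epsilon>>0. \<exists>C. closedin mtopology C \<and> C \<subseteq> A \<and> prob (A - C) < \<epsilon>)"

lemma inner_closed_closedin: "closedin mtopology C \<Longrightarrow> inner_closed C"
  unfolding inner_closed_def using closedin_sets by (auto intro!: exI[of _ C])

lemma inner_closed_UN:
  fixes A :: "nat \<Rightarrow> 'a set"
  assumes A: "\<And>n. inner_closed (A n)" shows "inner_closed (\<Union>n. A n)"
  unfolding inner_closed_def
proof (intro conjI allI impI)
  have As: "A n \<in> sets M" for n using A by (simp add: inner_closed_def)
  then show "(\<Union>n. A n) \<in> sets M" by auto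
  fix \<epsilon> :: real assume \<epsilon>: "0 < \<epsilon>"
  have "0 < \<epsilon>/2" using \<epsilon> by simp
  from prob_increasing_limit[of A, OF As this] obtain N where N: "prob ((\<Union>n. A n) - (\<Union>n\<in>{..N}. A n)) < \<epsilon>/2" by blast
  define \<eta> where "\<eta> = \<epsilon> / (2 * (real N + 1))"
  have \<eta>: "0 < \<eta>" using \<epsilon> by (simp add: \<eta>_def)
  have "\<forall>n. \<exists>C. closedin mtopology C \<and> C \<subseteq> A n \<and> prob (A n - C) < \<eta>" using A \<eta> by (simp add: inner_closed_def)
  from choice[OF this] obtain C where C: "\<And>n. closedin mtopology (C n)" "\<And>n. C n \<subseteq> A n" "\<And>n. prob (A n - C n) < \<eta>" by blast
  note Cs = closedin_sets[OF C(1)]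
  let ?C = "\<Union>n\<in>{..N}. C n"
  show "\<exists>C. closedin mtopology C \<and> C \<subseteq> (\<Union>n. A n) \<and> prob ((\<Union>n. A n) - C) < \<epsilon>"
  proof (intro exI[of _ ?C] conjI)
    show "closedin mtopology ?C" using C(1) by (intro closedin_Union) auto
    show "?C \<subseteq> (\<Union>n. A n)" using C(2) by blast
    have "prob ((\<Union>n. A n) - ?C) \<le> prob (((\<Union>n. A n) - (\<Union>n\<in>{..N}. A n)) \<union> (\<Union>n\<in>{..N}. A n - C n))"
      by (rule finite_measure_mono) (use As Cs in auto)
    also have "\<dots> \<le> prob ((\<Union>n. A n) - (\<Union>n\<in>{..N}. A n)) + prob (\<Union>n\<in>{..N}. A n - C n)"
      by (rule measure_Un_le) (use As Cs in auto)
    also have "prob (\<Union>n\<in>{..N}. A n - C n) \<le> (\<Sum>n\<in>{..N}. prob (A n - C n))"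
      by (rule finite_measure_subadditive_finite) (use As Cs in auto)
    also have "\<dots> \<le> (\<Sum>n\<in>{..N}. \<eta>)" by (intro sum_mono less_imp_le[OF C(3)])
    also have "\<dots> = \<epsilon>/2" by (simp add: \<eta>_def field_simps)
    finally show "prob ((\<Union>n. A n) - ?C) < \<epsilon>" using N by simp
  qed
qed

lemma inner_closed_INT:
  fixes A :: "nat \<Rightarrow> 'a set"
  assumes A: "\<And>n. inner_closed (A n)" shows "inner_closed (\<Inter>n. A n)"
  unfolding inner_closed_def
proof (intro conjI allI impI)
  have As: "A n \<in> sets M" for n using A by (simp add: inner_closed_def)
  then show IA: "(\<Inter>n. A n) \<in> sets M" by auto
  fix \<epsilon> :: real assume \<epsilon>: "0 < \<epsilon>"
  have "\<forall>n. \<exists>C. closedin mtopology C \<and> C \<subseteq> A n \<and> prob (A n - C) < \<epsilon>/2 * (1/2) ^ Suc n"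
  proof
    fix n
    have "0 < \<epsilon>/2 * (1/2) ^ Suc n" using \<epsilon> by simp
    then show "\<exists>C. closedin mtopology C \<and> C \<subseteq> A n \<and> prob (A n - C) < \<epsilon>/2 * (1/2) ^ Suc n"
      using A[of n] unfolding inner_closed_def by blast
  qed
  from choice[OF this] obtain C where C: "\<And>n. closedin mtopology (C n)" "\<And>n. C n \<subseteq> A n"
    "\<And>n. prob (A n - C n) < \<epsilon>/2 * (1/2) ^ Suc n" by blast
  note Cs = closedin_sets[OF C(1)]
  show "\<exists>C. closedin mtopology C \<and> C \<subseteq> (\<Inter>n. A n) \<and> prob ((\<Inter>n. A n) - C) < \<epsilon>"
  proof (intro exI[of _ "\<Inter>n. C n"] conjI)
    show "closedin mtopology (\<Inter>n. C n)" using C(1) by (intro closedin_Inter) auto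
    show "(\<Inter>n. C n) \<subseteq> (\<Inter>n. A n)" using C(2) by blast
    have "prob ((\<Inter>n. A n) - (\<Inter>n. C n)) \<le> prob (\<Union>n. A n - C n)"
      by (rule finite_measure_mono) (use As Cs in auto)
    also have "\<dots> \<le> \<epsilon>/2" by (rule prob_UN_geometric) (use As Cs less_imp_le[OF C(3)] in auto)
    finally show "prob ((\<Inter>n. A n) - (\<Inter>n. C n)) < \<epsilon>" using \<epsilon> by simp
  qed
qed

text \<open>The property is not visibly closed under complements, so it is proved for a set and its complement at once:
open sets are countable unions of closed ones, and both countable unions and intersections are covered.\<close>

lemma inner_closed_sets:
  assumes "A \<in> sets M" shows "inner_closed A"
proof -
  have "A \<in> sigma_sets D {U. openin mtopology U}" using assms by (simp add: sets_M sets_borel_of)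
  then have "inner_closed A \<and> inner_closed (D - A)"
  proof (induction rule: sigma_sets.induct)
    case (Basic U)
    then have U: "openin mtopology U" by simp
    have "metrizable_space mtopology" by (rule metrizable_space_mtopology)
    then have "fsigma_in mtopology U" using U by (rule open_imp_fsigma_in)
    then obtain \<C> where \<C>: "countable \<C>" "\<C> \<subseteq> Collect (closedin mtopology)" "\<Union>\<C> = U"
      unfolding fsigma_in_def union_of_def by auto
    have "inner_closed U"
    proof (cases "\<C> = {}")
      case True
      then show ?thesis using \<C>(3) inner_closed_closedin[OF closedin_empty] by simp
    next
      case False
      then obtain C :: "nat \<Rightarrow> 'a set" where C: "range C = \<C>" using range_from_nat_into[OF _ \<C>(1)] by blast
      have "inner_closed (\<Union>n. C n)" using C \<C>(2) by (intro inner_closed_UN inner_closed_closedin) auto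
      then show ?thesis using C \<C>(3) by simp
    qed
    moreover have "inner_closed (D - U)" using U by (intro inner_closed_closedin) (auto simp: closedin_def openin_subset openin_diff double_diff dest: openin_subset)
    ultimately show ?case by simp
  next
    case Empty
    show ?case using inner_closed_closedin[OF closedin_empty] inner_closed_closedin[OF closedin_topspace] by simp
  next
    case (Compl A)
    have "D - (D - A) = A" using Compl.hyps sigma_sets_into_sp[of "{U. openin mtopology U}" D A] openin_subset by fastforce
    then show ?case using Compl.IH by simp
  next
    case (Union A)
    have "D - (\<Union>n. A n) = (\<Inter>n. D - A n)" by auto
    then show ?case using inner_closed_UN[of A] inner_closed_INT[of "\<lambda>n. D - A n"] Union.IH by simp
  qed
  then show ?thesis by simp
qed

text \<open>Ulam's theorem: for each radius, finitely many balls around a dense sequence carry almost all of the mass;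
the intersection of such unions is closed and totally bounded.\<close>

lemma tight:
  assumes \<epsilon>: "0 < \<epsilon>" obtains K where "compactin mtopology K" "prob (D - K) \<le> \<epsilon>"
proof -
  have "D \<noteq> {}" using not_empty space_M by simp
  obtain Q where Q: "countable Q" "Q \<subseteq> D" "mtopology closure_of Q = D"
    using second_countable_imp_separable_space[OF second] unfolding separable_space_def by auto
  have "Q \<noteq> {}" using Q(3) \<open>D \<noteq> {}\<close> by auto
  then obtain q :: "nat \<Rightarrow> 'a" where q: "range q = Q" using range_from_nat_into[OF _ Q(1)] by blast
  have qD: "q n \<in> D" for n using q Q(2) by blast
  have cover: "(\<Union>n. mcball (q n) r) = D" if r: "0 < r" for r
  proof
    show "(\<Union>n. mcball (q n) r) \<subseteq> D" by auto
    show "D \<subseteq> (\<Union>n. mcball (q n) r)"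
    proof
      fix x assume x: "x \<in> D"
      then have "x \<in> mtopology closure_of Q" using Q(3) by simp
      then obtain y where "y \<in> Q" "y \<in> mball x r" using r unfolding metric_closure_of by blast
      then obtain n where "q n \<in> mball x r" using q by blast
      then have "x \<in> mcball (q n) r" by (simp add: commute)
      then show "x \<in> (\<Union>n. mcball (q n) r)" by blast
    qed
  qed
  have cb: "mcball (q n) r \<in> sets M" for n r by (rule closedin_sets) simp
  have "\<forall>k. \<exists>N. prob (D - (\<Union>n\<in>{..N}. mcball (q n) (1 / real (Suc k)))) < \<epsilon> * (1/2) ^ Suc k"
  proof
    fix k
    have "0 < \<epsilon> * (1/2) ^ Suc k" using \<epsilon> by simp
    from prob_increasing_limit[of "\<lambda>n. mcball (q n) (1 / real (Suc k))", OF cb this] obtain N where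
      "prob ((\<Union>n. mcball (q n) (1 / real (Suc k))) - (\<Union>n\<in>{..N}. mcball (q n) (1 / real (Suc k)))) < \<epsilon> * (1/2) ^ Suc k" by blast
    moreover have "(\<Union>n. mcball (q n) (1 / real (Suc k))) = D" by (rule cover) simp
    ultimately show "\<exists>N. prob (D - (\<Union>n\<in>{..N}. mcball (q n) (1 / real (Suc k)))) < \<epsilon> * (1/2) ^ Suc k"
      by (intro exI[of _ N]) (simp only:)
  qed
  from choice[OF this] obtain N where N: "\<And>k. prob (D - (\<Union>n\<in>{..N k}. mcball (q n) (1 / real (Suc k)))) < \<epsilon> * (1/2) ^ Suc k" by blast
  define B where "B k = (\<Union>n\<in>{..N k}. mcball (q n) (1 / real (Suc k)))" for k
  have Bc: "closedin mtopology (B k)" for k unfolding B_def by (intro closedin_Union) auto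
  define K where "K = (\<Inter>k. B k)"
  have Kc: "closedin mtopology K" unfolding K_def using Bc by (intro closedin_Inter) auto
  have KD: "K \<subseteq> D" using closedin_subset[OF Kc] by simp
  have tb: "mtotally_bounded K"
    unfolding mtotally_bounded_def
  proof (intro allI impI)
    fix r :: real assume r: "0 < r"
    then have "0 < r/2" by simp
    then obtain k where k: "1 / real (Suc k) < r/2" using nat_approx_posE by blast
    define I where "I = {n\<in>{..N k}. K \<inter> mball (q n) (r/2) \<noteq> {}}"
    have "\<forall>n\<in>I. \<exists>z. z \<in> K \<inter> mball (q n) (r/2)" by (auto simp: I_def)
    from bchoice[OF this] obtain z where z: "\<forall>n\<in>I. z n \<in> K \<inter> mball (q n) (r/2)" ..
    have "K \<subseteq> (\<Union>x\<in>z ` I. mball x r)"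
    proof
      fix x assume x: "x \<in> K"
      then have "x \<in> B k" by (auto simp: K_def)
      then obtain n where n: "n \<le> N k" "x \<in> mcball (q n) (1 / real (Suc k))" by (auto simp: B_def)
      then have xn: "x \<in> D" "d0 (q n) x < r/2" using k by auto
      then have "x \<in> K \<inter> mball (q n) (r/2)" using x qD[of n] by auto
      then have nI: "n \<in> I" using n by (auto simp: I_def)
      have zn: "z n \<in> D" "d0 (q n) (z n) < r/2" using z nI by auto
      have "d0 (z n) x \<le> d0 (z n) (q n) + d0 (q n) x" by (rule triangle[OF zn(1) qD xn(1)])
      then have "x \<in> mball (z n) r" using xn zn commute[of "z n" "q n"] by auto
      then show "x \<in> (\<Union>x\<in>z ` I. mball x r)" using nI by blast
    qed
    then show "\<exists>K'. finite K' \<and> K' \<subseteq> K \<and> K \<subseteq> (\<Union>x\<in>K'. mball x r)"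
      using z by (intro exI[of _ "z ` I"]) (auto simp: I_def)
  qed
  have "compactin mtopology K"
    using tb mtotally_bounded_eq_compact_closure_of[OF complete, of K] closure_of_closedin[OF Kc] by simp
  moreover have "prob (D - K) \<le> \<epsilon>"
  proof -
    have "D - K = (\<Union>k. D - B k)" by (auto simp: K_def)
    moreover have "prob (\<Union>k. D - B k) \<le> \<epsilon>"
    proof (rule prob_UN_geometric)
      show "D - B k \<in> sets M" for k
        using sets.compl_sets[OF closedin_sets[OF Bc[of k]]] by (simp add: space_M)
      show "prob (D - B k) \<le> \<epsilon> * (1/2) ^ Suc k" for k
        using less_imp_le[OF N[of k]] unfolding B_def .
    qed
    ultimately show ?thesis by simp
  qed
  ultimately show thesis by (rule that)
qed

lemma inner_compact:
  assumes A: "A \<in> sets M" and \<epsilon>: "0 < \<epsilon>"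
  obtains K where "compactin mtopology K" "K \<subseteq> A" "prob (A - K) < \<epsilon>"
proof -
  have "inner_closed A" by (rule inner_closed_sets[OF A])
  then obtain C where C: "closedin mtopology C" "C \<subseteq> A" "prob (A - C) < \<epsilon>/2"
    unfolding inner_closed_def using \<epsilon> by (meson half_gt_zero)
  obtain K where K: "compactin mtopology K" "prob (D - K) \<le> \<epsilon>/2" using tight[of "\<epsilon>/2"] \<epsilon> by auto
  have Ks: "K \<in> sets M" using compactin_imp_closedin[OF Hausdorff_space_mtopology K(1)] by (rule closedin_sets)
  note Cs = closedin_sets[OF C(1)]
  have AD: "A \<subseteq> D" using sets.sets_into_space[OF A] space_M by simp
  have Ds: "D \<in> sets M" using sets.top[of M] space_M by simp
  show thesis
  proof (rule that[of "K \<inter> C"])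
    show "compactin mtopology (K \<inter> C)" by (rule compact_Int_closedin[OF K(1) C(1)])
    have "prob (A - K \<inter> C) \<le> prob ((A - C) \<union> (D - K))"
      by (rule finite_measure_mono) (use A Cs Ks Ds AD in auto)
    also have "\<dots> \<le> prob (A - C) + prob (D - K)"
      by (rule measure_Un_le) (use A Cs Ks Ds in auto)
    also have "\<dots> < \<epsilon>" using C K by simp
    finally show "prob (A - K \<inter> C) < \<epsilon>" .
  qed (use C in auto)
qed

text \<open>Remove compact sets greedily, the \<open>n\<close>-th one leaving at most \<open>(1/2) ^ n\<close> of the measure behind.\<close>

lemma disjoint_compacts:
  assumes A: "A \<in> sets M"
  obtains C :: "nat \<Rightarrow> 'a set" where "\<And>n. compactin mtopology (C n)" "\<And>n. C n \<subseteq> A"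
    "\<And>m n. m \<noteq> n \<Longrightarrow> C m \<inter> C n = {}" "prob (A - (\<Union>n. C n)) = 0"
proof -
  define K where "K B n = (SOME K. compactin mtopology K \<and> K \<subseteq> B \<and> prob (B - K) < (1/2) ^ n)" for B and n :: nat
  have K: "compactin mtopology (K B n)" "K B n \<subseteq> B" "prob (B - K B n) < (1/2) ^ n" if B: "B \<in> sets M" for B n
  proof -
    have "(0::real) < (1/2) ^ n" by simp
    from inner_compact[OF B this] have "\<exists>K. compactin mtopology K \<and> K \<subseteq> B \<and> prob (B - K) < (1/2) ^ n" by blast
    from someI_ex[OF this] show "compactin mtopology (K B n)" "K B n \<subseteq> B" "prob (B - K B n) < (1/2) ^ n"
      unfolding K_def by blast+
  qed
  define R where "R = rec_nat A (\<lambda>n r. r - K r n)"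
  have R0: "R 0 = A" and RS: "\<And>n. R (Suc n) = R n - K (R n) n" by (simp_all add: R_def)
  have Ks: "K B n \<in> sets M" if "B \<in> sets M" for B n
    using compactin_imp_closedin[OF Hausdorff_space_mtopology K(1)[OF that]] by (rule closedin_sets)
  have Rs: "R n \<in> sets M" for n by (induction n) (use A Ks in \<open>auto simp: R0 RS\<close>)
  have dec: "R n \<subseteq> R m" if "m \<le> n" for m n
    using that by (induction rule: dec_induct) (auto simp: RS)
  define C where "C n = K (R n) n" for n
  have Rrest: "A - (\<Union>n. C n) \<subseteq> R n" for n
    by (induction n) (auto simp: R0 RS C_def)
  show thesis
  proof (rule that[of C])
    show "compactin mtopology (C n)" for n unfolding C_def by (rule K(1)[OF Rs])
    show "C n \<subseteq> A" for n using K(2)[OF Rs[of n], of n] dec[of 0 n] by (auto simp: C_def R0)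
    have lt: "C m \<inter> C n = {}" if "m < n" for m n
    proof -
      have "C n \<subseteq> R n" unfolding C_def by (rule K(2)[OF Rs])
      also have "R n \<subseteq> R (Suc m)" by (rule dec) (use that in simp)
      finally show ?thesis by (auto simp: RS C_def)
    qed
    show "C m \<inter> C n = {}" if "m \<noteq> n" for m n
      using that lt[of m n] lt[of n m] by (cases "m < n") auto
    have Cs: "C n \<in> sets M" for n unfolding C_def by (rule Ks[OF Rs])
    have le: "prob (A - (\<Union>n. C n)) \<le> (1/2) ^ n" for n
    proof -
      have "prob (A - (\<Union>n. C n)) \<le> prob (R (Suc n))" by (rule finite_measure_mono[OF Rrest Rs])
      then show ?thesis using K(3)[OF Rs[of n], of n] by (simp add: RS)
    qed
    have "(\<lambda>n. (1/2 :: real) ^ n) \<longlonglongrightarrow> 0" by (rule LIMSEQ_realpow_zero) auto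
    then have "prob (A - (\<Union>n. C n)) \<le> 0" by (rule LIMSEQ_le_const) (use le in blast)
    then show "prob (A - (\<Union>n. C n)) = 0" using measure_nonneg[of M] by (simp add: antisym)
  qed
qed

end

section \<open>Compact alphabets for arbitrary systems\<close>

locale compact_pieces = polish_prob +
  fixes p and C :: "nat \<Rightarrow> 'a set"
  assumes p: "p \<in> D" and C: "\<And>n. compactin mtopology (C n)" "\<And>n. C n \<subseteq> D - {p}"
    "\<And>m n. m \<noteq> n \<Longrightarrow> C m \<inter> C n = {}" "prob (D - {p} - (\<Union>n. C n)) = 0"
begin

definition alphabet :: "'a set" where "alphabet = insert p (\<Union>n. C n)"

text \<open>The \<open>n\<close>-th piece is given diameter at most \<open>(1/2) ^ n\<close>, so that the pieces converge to the point \<open>p\<close>, which has weight \<open>0\<close>.\<close>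

definition weight :: "'a \<Rightarrow> real" where
  "weight x = (if \<exists>n. x \<in> C n then (1/2) ^ (THE n. x \<in> C n) else 0)"

definition together :: "'a \<Rightarrow> 'a \<Rightarrow> bool" where
  "together x y \<longleftrightarrow> (\<exists>n. x \<in> C n \<and> y \<in> C n)"

text \<open>Points of different pieces are as far apart as the larger weight; in particular the distance of \<open>x\<close> to \<open>p\<close> is \<open>weight x\<close>.\<close>

definition glued_dist :: "'a \<Rightarrow> 'a \<Rightarrow> real" where
  "glued_dist x y = (if together x y then weight x * min 1 (d0 x y) else max (weight x) (weight y))"

lemma same_piece: "x \<in> C m \<Longrightarrow> x \<in> C n \<Longrightarrow> m = n"
  using C(3)[of m n] by blast

lemma weight_C: assumes "x \<in> C n" shows "weight x = (1/2) ^ n"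
proof -
  have "(THE n. x \<in> C n) = n" using assms same_piece by blast
  then show ?thesis using assms by (auto simp: weight_def)
qed

lemma weight_outside: "(\<And>n. x \<notin> C n) \<Longrightarrow> weight x = 0"
  by (simp add: weight_def)

lemma weight_p: "weight p = 0"
  by (rule weight_outside) (use C(2) in blast)

lemma weight_bounds: "0 \<le> weight x" "weight x \<le> 1"
  by (auto simp: weight_def power_le_one)

lemma weight_pos: "x \<in> alphabet \<Longrightarrow> x \<noteq> p \<Longrightarrow> 0 < weight x"
  by (auto simp: alphabet_def weight_C)

lemma together_weight: "together x y \<Longrightarrow> weight x = weight y"
  by (auto simp: together_def weight_C)

lemma together_sym: "together x y \<longleftrightarrow> together y x"
  by (auto simp: together_def)

lemma together_trans: "together x y \<Longrightarrow> together y z \<Longrightarrow> together x z"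
  unfolding together_def using same_piece by blast

lemma alphabet_D: "x \<in> alphabet \<Longrightarrow> x \<in> D"
  using p C(2) by (auto simp: alphabet_def)

lemma glued_le: "glued_dist x y \<le> max (weight x) (weight y)"
  using weight_bounds[of x] mult_left_mono[of "min 1 (d0 x y)" 1 "weight x"]
  by (auto simp: glued_dist_def)

lemma glued_nonneg: "0 \<le> glued_dist x y"
  using weight_bounds by (auto simp: glued_dist_def le_max_iff_disj)

lemma glued_commute: "glued_dist x y = glued_dist y x"
  using together_sym[of x y] together_weight[of x y] commute[of x y] by (auto simp: glued_dist_def max.commute)

lemma glued_triangle:
  assumes "x \<in> alphabet" "y \<in> alphabet" "z \<in> alphabet"
  shows "glued_dist x z \<le> glued_dist x y + glued_dist y z"
proof (cases "together x y")
  case xy: True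
  show ?thesis
  proof (cases "together y z")
    case yz: True
    have xz: "together x z" by (rule together_trans[OF xy yz])
    have w: "weight y = weight x" using together_weight[OF xy] by simp
    have "d0 x z \<le> d0 x y + d0 y z" using assms by (intro triangle alphabet_D)
    then have "min 1 (d0 x z) \<le> min 1 (d0 x y) + min 1 (d0 y z)" using nonneg[of x y] nonneg[of y z] by linarith
    from mult_left_mono[OF this weight_bounds(1)[of x]] show ?thesis
      using xy yz xz w by (simp add: glued_dist_def distrib_left)
  next
    case yz: False
    then have "\<not> together x z" using xy together_sym together_trans by blast
    then have "glued_dist x z = glued_dist y z" using yz together_weight[OF xy] by (simp add: glued_dist_def)
    then show ?thesis using glued_nonneg[of x y] by simp
  qed
next
  case xy: False
  show ?thesis
  proof (cases "together y z")
    case yz: True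
    then have "\<not> together x z" using xy together_sym together_trans by blast
    then have "glued_dist x z = glued_dist x y" using xy together_weight[OF yz] by (simp add: glued_dist_def)
    then show ?thesis using glued_nonneg[of y z] by simp
  next
    case yz: False
    have "glued_dist x z \<le> max (weight x) (weight z)" by (rule glued_le)
    also have "\<dots> \<le> max (weight x) (weight y) + max (weight y) (weight z)"
      using weight_bounds(1)[of x] weight_bounds(1)[of y] weight_bounds(1)[of z] by linarith
    finally show ?thesis using xy yz by (simp add: glued_dist_def)
  qed
qed

lemma glued_zero:
  assumes "x \<in> alphabet" "y \<in> alphabet"
  shows "glued_dist x y = 0 \<longleftrightarrow> x = y"
proof
  assume 0: "glued_dist x y = 0"
  show "x = y"
  proof (cases "together x y")
    case True
    then have "x \<noteq> p" using C(2) by (auto simp: together_def)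
    then have "0 < weight x" using weight_pos assms by blast
    then have "d0 x y = 0" using 0 True nonneg[of x y] by (auto simp: glued_dist_def min_def split: if_splits)
    then show ?thesis using zero assms alphabet_D by blast
  next
    case False
    then have "max (weight x) (weight y) = 0" using 0 by (simp add: glued_dist_def)
    then have "weight x \<le> 0" "weight y \<le> 0" by (metis max.cobounded1 max.cobounded2)+
    then have "x = p" "y = p" using weight_pos assms by (meson not_le)+
    then show ?thesis by simp
  qed
next
  assume "x = y"
  show "glued_dist x y = 0"
  proof (cases "x = p")
    case True
    have "\<not> together p p" using C(2) by (auto simp: together_def)
    then show ?thesis using True \<open>x = y\<close> weight_p by (simp add: glued_dist_def)
  next
    case False
    then have "together x x" using assms by (auto simp: alphabet_def together_def)
    moreover have "d0 x x = 0" using zero[of x x] alphabet_D assms by blast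
    ultimately show ?thesis using \<open>x = y\<close> by (simp add: glued_dist_def)
  qed
qed

lemma glued_metric: "Metric_space alphabet glued_dist"
  by unfold_locales (simp_all add: glued_nonneg glued_commute glued_zero glued_triangle)

sublocale glued: Metric_space alphabet glued_dist by (rule glued_metric)

text \<open>Inside one piece the new metric is the old one, truncated and scaled.\<close>

lemma piece_compact: "compactin glued.mtopology (C n)"
proof -
  have CA: "C n \<subseteq> alphabet" by (auto simp: alphabet_def)
  have "continuous_map (subtopology mtopology (C n)) glued.mtopology (\<lambda>x. x)"
    unfolding glued.continuous_map_to_metric
  proof (intro ballI allI impI)
    fix x and \<epsilon> :: real assume x: "x \<in> topspace (subtopology mtopology (C n))" and \<epsilon>: "0 < \<epsilon>"
    have xC: "x \<in> C n" "x \<in> D" using x by auto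
    show "\<exists>U. openin (subtopology mtopology (C n)) U \<and> x \<in> U \<and> (\<forall>y\<in>U. y \<in> glued.mball x \<epsilon>)"
    proof (intro exI[of _ "C n \<inter> mball x \<epsilon>"] conjI ballI)
      show "openin (subtopology mtopology (C n)) (C n \<inter> mball x \<epsilon>)" by (simp add: openin_subtopology_Int2)
      show "x \<in> C n \<inter> mball x \<epsilon>" using xC \<epsilon> by simp
      fix y assume y: "y \<in> C n \<inter> mball x \<epsilon>"
      have "together x y" using xC y by (auto simp: together_def)
      then have "glued_dist x y = weight x * min 1 (d0 x y)" by (simp add: glued_dist_def)
      also have "\<dots> \<le> 1 * d0 x y" using weight_bounds[of x] nonneg[of x y] by (intro mult_mono) auto
      also have "\<dots> < \<epsilon>" using y by simp
      finally show "y \<in> glued.mball x \<epsilon>" using xC y CA by auto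
    qed
  qed
  moreover have "compactin (subtopology mtopology (C n)) (C n)" using C(1) by (simp add: compactin_subtopology)
  ultimately have "compactin glued.mtopology ((\<lambda>x. x) ` C n)" by (rule image_compactin[rotated])
  then show ?thesis by simp
qed

text \<open>A neighbourhood of \<open>p\<close> contains all but finitely many pieces, and each of those is compact.\<close>

lemma glued_compact: "compact_metric alphabet glued_dist"
proof -
  have "compact_space glued.mtopology"
    unfolding compact_space_alt
  proof (intro allI impI)
    fix \<U> assume U: "(\<forall>U\<in>\<U>. openin glued.mtopology U) \<and> topspace glued.mtopology \<subseteq> \<Union> \<U>"
    have topA: "alphabet \<subseteq> \<Union>\<U>" using U by simp
    have pA: "p \<in> alphabet" and CA: "\<And>n. C n \<subseteq> alphabet" by (auto simp: alphabet_def)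
    obtain U0 where U0: "U0 \<in> \<U>" "p \<in> U0" using topA pA by blast
    then obtain r where r: "0 < r" "glued.mball p r \<subseteq> U0" using U unfolding glued.openin_mtopology by blast
    obtain N where N: "(1/2 :: real) ^ N < r" using real_arch_pow_inv[OF r(1), of "1/2"] by auto
    have "compactin glued.mtopology (\<Union>n\<in>{..<N}. C n)"
      by (rule compactin_Union) (use piece_compact in auto)
    moreover have "(\<Union>n\<in>{..<N}. C n) \<subseteq> \<Union>\<U>" using topA CA by blast
    ultimately obtain \<F> where F: "finite \<F>" "\<F> \<subseteq> \<U>" "(\<Union>n\<in>{..<N}. C n) \<subseteq> \<Union>\<F>"
      using U unfolding compactin_def by metis
    have "alphabet \<subseteq> \<Union> (insert U0 \<F>)"
    proof
      fix x assume x: "x \<in> alphabet"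
      show "x \<in> \<Union> (insert U0 \<F>)"
      proof (cases "\<exists>n<N. x \<in> C n")
        case True then show ?thesis using F(3) by auto
      next
        case False
        have "glued_dist p x < r"
        proof (cases "x = p")
          case True then show ?thesis using r x glued_zero[of p p] by simp
        next
          case xp: False
          then obtain n where n: "x \<in> C n" using x by (auto simp: alphabet_def)
          then have "N \<le> n" using False not_le by blast
          then have "(1/2 :: real) ^ n \<le> (1/2) ^ N" by (intro power_decreasing) auto
          then have "weight x < r" using weight_C[OF n] N by linarith
          then show ?thesis using glued_le[of p x] weight_p r(1) by simp
        qed
        then have "x \<in> glued.mball p r" using x pA by simp
        then show ?thesis using r(2) by auto
      qed
    qed
    then show "\<exists>\<F>. finite \<F> \<and> \<F> \<subseteq> \<U> \<and> topspace glued.mtopology \<subseteq> \<Union> \<F>"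
      using F U0 by (intro exI[of _ "insert U0 \<F>"]) auto
  qed
  then show ?thesis using glued_metric by (simp add: compact_metric_def)
qed

lemma C_sets: "C n \<in> sets M"
  using compactin_imp_closedin[OF Hausdorff_space_mtopology C(1)] by (rule closedin_sets)

lemma alphabet_sets: "alphabet \<in> sets M"
proof -
  have "{p} \<in> sets M" by (rule closedin_sets) (use p in \<open>simp add: closedin_Hausdorff_sing_eq Hausdorff_space_mtopology\<close>)
  then have "{p} \<union> (\<Union>n. C n) \<in> sets M" using C_sets by blast
  then show ?thesis by (simp add: alphabet_def)
qed

text \<open>The alphabet misses a null set of \<open>D\<close>. Sending that set to \<open>p\<close> gives a map into the alphabet that is defined everywhere, so no
invariant null set has to be removed from the system.\<close>

definition retract :: "'a \<Rightarrow> 'a" where "retract x = (if x \<in> alphabet then x else p)"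

lemma retract_in: "retract x \<in> alphabet"
  by (simp add: retract_def alphabet_def)

lemma AE_retract: "AE x in M. retract x = x"
proof -
  have "prob (D - alphabet) = 0"
  proof -
    have "D - alphabet = D - {p} - (\<Union>n. C n)" by (auto simp: alphabet_def)
    then show ?thesis using C(4) by simp
  qed
  then have "D - alphabet \<in> null_sets M"
    using alphabet_sets space_M sets.top[of M] by (auto simp: null_sets_def emeasure_eq_measure)
  then show ?thesis by (rule AE_I') (auto simp: retract_def space_M)
qed

lemma weight_measurable: "weight \<in> borel_measurable M"
  unfolding borel_measurable_iff_greater
proof
  fix a :: real
  show "{x \<in> space M. a < weight x} \<in> sets M"
  proof (cases "a < 0")
    case True
    then have "{x \<in> space M. a < weight x} = space M" using weight_bounds(1) by (auto intro: less_le_trans)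
    then show ?thesis by simp
  next
    case False
    have "{x \<in> space M. a < weight x} = (\<Union>n\<in>{n. a < (1/2) ^ n}. C n)"
    proof (intro set_eqI iffI)
      fix x assume x: "x \<in> {x \<in> space M. a < weight x}"
      then have "weight x \<noteq> 0" using False by auto
      then obtain n where "x \<in> C n" using weight_outside by blast
      then show "x \<in> (\<Union>n\<in>{n. a < (1/2) ^ n}. C n)" using x weight_C by auto
    next
      fix x assume "x \<in> (\<Union>n\<in>{n. a < (1/2) ^ n}. C n)"
      then show "x \<in> {x \<in> space M. a < weight x}" using weight_C C(2) space_M by auto
    qed
    then show ?thesis using C_sets by auto
  qed
qed

lemma dist_measurable: "z \<in> D \<Longrightarrow> (\<lambda>x. d0 x z) \<in> borel_measurable M"
proof -
  assume z: "z \<in> D"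
  have "continuous_map mtopology euclideanreal (\<lambda>x. d0 x z)"
  proof (rule continuous_map_lipschitz[OF Metric_space_axioms, where L = 1])
    fix x y assume xy: "x \<in> D" "y \<in> D"
    show "\<bar>d0 x z - d0 y z\<bar> \<le> 1 * d0 x y"
      using triangle[OF xy z] triangle[OF xy(2,1) z] commute[of x y] by linarith
  qed
  from continuous_map_measurable_borel_of[OF this] show ?thesis
    by (simp cong: measurable_cong_sets add: sets_M)
qed

lemma retract_measurable: "retract \<in> measurable M (borel_of glued.mtopology)"
proof (rule measurable_into_metric[OF glued_compact])
  show "retract \<in> space M \<rightarrow> alphabet" using retract_in by blast
  fix z assume z: "z \<in> alphabet"
  have wr: "weight (retract x) = weight x" for x
  proof (cases "x \<in> alphabet")
    case False
    then have "weight x = 0" by (intro weight_outside) (auto simp: alphabet_def)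
    then show ?thesis using False weight_p by (simp add: retract_def)
  qed (simp add: retract_def)
  show "(\<lambda>x. glued_dist (retract x) z) \<in> borel_measurable M"
  proof (cases "z = p")
    case True
    have "glued_dist (retract x) z = weight x" for x
    proof -
      have "\<not> together (retract x) p" using C(2) by (auto simp: together_def)
      then show ?thesis using True wr weight_p weight_bounds(1)[of x] by (simp add: glued_dist_def)
    qed
    then show ?thesis using weight_measurable by simp
  next
    case False
    then obtain n where n: "z \<in> C n" using z by (auto simp: alphabet_def)
    have "glued_dist (retract x) z = (if x \<in> C n then weight x * min 1 (d0 x z) else max (weight x) (weight z))" for x
    proof (cases "x \<in> C n")
      case True
      then have "retract x = x" "together x z" using n by (auto simp: retract_def alphabet_def together_def)
      then show ?thesis using True by (simp add: glued_dist_def)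
    next
      case F: False
      have "\<not> together (retract x) z"
      proof
        assume "together (retract x) z"
        then obtain m where m: "retract x \<in> C m" "z \<in> C m" by (auto simp: together_def)
        then have "m = n" using n same_piece by blast
        moreover have "retract x \<noteq> p" using m(1) C(2) by blast
        ultimately show False using m(1) F by (auto simp: retract_def split: if_splits)
      qed
      then show ?thesis using F wr by (simp add: glued_dist_def)
    qed
    moreover have "(\<lambda>x. if x \<in> C n then weight x * min 1 (d0 x z) else max (weight x) (weight z)) \<in> borel_measurable M"
      using weight_measurable dist_measurable[OF alphabet_D[OF z]] C_sets[of n]
      by (intro measurable_If_set borel_measurable_times borel_measurable_min borel_measurable_max borel_measurable_const)
        (auto intro: sets.Int)
    ultimately show ?thesis by simp
  qed
qed

text \<open>Each piece is open in the glued space, with its old topology; together with the measurability of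
\<open>retract\<close> this says that gluing does not change the Borel sets.\<close>

lemma inclusion_measurable: "(\<lambda>x. x) \<in> measurable (borel_of glued.mtopology) M"
proof -
  have "(\<lambda>x. x) \<in> measurable (borel_of glued.mtopology) (borel_of mtopology)"
  proof (rule measurable_borel_of_I)
    show "(\<lambda>x. x) \<in> space (borel_of glued.mtopology) \<rightarrow> topspace mtopology" using alphabet_D by simp
    fix U assume U: "openin mtopology U"
    have piece: "openin glued.mtopology (U \<inter> C n)" for n
      unfolding glued.openin_mtopology
    proof (intro conjI allI impI)
      show "U \<inter> C n \<subseteq> alphabet" by (auto simp: alphabet_def)
      fix x assume x: "x \<in> U \<inter> C n"
      then obtain r where r: "0 < r" "mball x r \<subseteq> U" using U unfolding openin_mtopology by blast
      show "\<exists>r>0. glued.mball x r \<subseteq> U \<inter> C n"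
      proof (intro exI[of _ "(1/2) ^ n * min 1 r"] conjI subsetI)
        show "0 < (1/2) ^ n * min 1 r" using r by simp
        fix y assume y: "y \<in> glued.mball x ((1/2) ^ n * min 1 r)"
        have w: "weight x = (1/2) ^ n" using x weight_C by blast
        have lt: "glued_dist x y < (1/2) ^ n * min 1 r" and yA: "y \<in> alphabet" using y by auto
        have "(1/2 :: real) ^ n * min 1 r \<le> (1/2) ^ n * 1" by (intro mult_left_mono) auto
        then have "glued_dist x y < weight x" using lt w by linarith
        then have t: "together x y" by (auto simp: glued_dist_def split: if_splits)
        then have "y \<in> C n" using x same_piece by (auto simp: together_def)
        have "(1/2) ^ n * min 1 (d0 x y) < (1/2) ^ n * min 1 r" using lt t w by (simp add: glued_dist_def)
        then have "min 1 (d0 x y) < min 1 r" by simp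
        then have "d0 x y < r" by linarith
        moreover have "x \<in> D" using x C(2) by blast
        ultimately have "y \<in> mball x r" using alphabet_D[OF yA] by simp
        then have "y \<in> U" using r(2) by blast
        then show "y \<in> U \<inter> C n" using \<open>y \<in> C n\<close> by simp
      qed
    qed
    have "{p} \<in> sets (borel_of glued.mtopology)"
    proof (rule closedin_borel_of)
      have "p \<in> alphabet" by (simp add: alphabet_def)
      then show "closedin glued.mtopology {p}"
        by (simp add: closedin_Hausdorff_sing_eq glued.Hausdorff_space_mtopology)
    qed
    then have "U \<inter> {p} \<in> sets (borel_of glued.mtopology)" by (cases "p \<in> U") auto
    moreover have "(\<Union>n. U \<inter> C n) \<in> sets (borel_of glued.mtopology)"
      using openin_borel_of[OF piece] by blast
    moreover have "(\<lambda>x. x) -` U \<inter> space (borel_of glued.mtopology) = (U \<inter> {p}) \<union> (\<Union>n. U \<inter> C n)"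
    proof -
      have "U \<inter> alphabet = (U \<inter> {p}) \<union> (\<Union>n. U \<inter> C n)" by (auto simp: alphabet_def)
      then show ?thesis by (simp add: vimage_def)
    qed
    ultimately show "(\<lambda>x. x) -` U \<inter> space (borel_of glued.mtopology) \<in> sets (borel_of glued.mtopology)" by simp
  qed
  then show ?thesis by (simp cong: measurable_cong_sets add: sets_M)
qed

end

text \<open>Transporting an almost sure identity to an image measure needs the set on which it holds to be measurable. Two points of
a compact metric space are equal when their distances to a countable dense set agree.\<close>

lemma equal_set_measurable:
  assumes cm: "compact_metric X d"
    and a: "a \<in> measurable N (borel_of (metric_top X d))" and b: "b \<in> measurable N (borel_of (metric_top X d))"
  shows "{z \<in> space N. a z = b z} \<in> sets N"
proof -
  note ms = compact_metric_space[OF cm]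
  obtain Q where Q: "countable Q" "Q \<subseteq> X" "\<And>x e. x \<in> X \<Longrightarrow> 0 < e \<Longrightarrow> \<exists>q\<in>Q. d x q < e"
    using countable_dense[OF cm] by blast
  have X: "a z \<in> X" "b z \<in> X" if "z \<in> space N" for z
    using measurable_space[OF a that] measurable_space[OF b that] by (simp_all add: topspace_metric_top[OF ms])
  have eq: "a z = b z" if z: "z \<in> space N" and q: "\<forall>q\<in>Q. d (a z) q = d (b z) q" for z
  proof -
    have "d (a z) (b z) \<le> r" if r: "0 < r" for r
    proof -
      from Q(3)[OF X(1)[OF z], of "r/2"] r obtain q where "q \<in> Q" "d (a z) q < r/2" by auto
      moreover have "d (a z) (b z) \<le> d (a z) q + d q (b z)"
        by (rule compact_metric_triangle[OF cm X(1)[OF z] _ X(2)[OF z]]) (use \<open>q \<in> Q\<close> Q(2) in blast)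
      ultimately show ?thesis using bspec[OF q, of q] compact_metric_commute[OF cm, of q "b z"] by simp
    qed
    then have "d (a z) (b z) \<le> 0" by (metis dense not_le)
    then show ?thesis using compact_metric_zero[OF cm X(1)[OF z] X(2)[OF z]] compact_metric_nonneg[OF cm, of "a z" "b z"] by simp
  qed
  have "(\<Union>q\<in>Q. {z \<in> space N. d (a z) q \<noteq> d (b z) q}) \<in> sets N"
  proof (rule sets.countable_UN'[OF Q(1)], rule image_subsetI)
    fix q assume "q \<in> Q"
    then have q: "q \<in> X" using Q(2) by blast
    have [measurable]: "(\<lambda>z. d (a z) q) \<in> borel_measurable N"
      by (rule measurable_compose[OF a continuous_map_measurable_borel_of[OF continuous_map_dist[OF cm q]]])
    have [measurable]: "(\<lambda>z. d (b z) q) \<in> borel_measurable N"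
      by (rule measurable_compose[OF b continuous_map_measurable_borel_of[OF continuous_map_dist[OF cm q]]])
    show "{z \<in> space N. d (a z) q \<noteq> d (b z) q} \<in> sets N" by measurable
  qed
  then have "space N - (\<Union>q\<in>Q. {z \<in> space N. d (a z) q \<noteq> d (b z) q}) \<in> sets N" by blast
  moreover have "space N - (\<Union>q\<in>Q. {z \<in> space N. d (a z) q \<noteq> d (b z) q}) = {z \<in> space N. a z = b z}" using eq by auto
  ultimately show ?thesis by simp
qed

lemma G_systemD:
  assumes "G_system M T"
  shows "prob_space M" "standard_borel M" "T g \<in> measurable M M" "distr M M (T g) = M"
    "x \<in> space M \<Longrightarrow> T 0 x = x" "x \<in> space M \<Longrightarrow> T (g + h) x = T g (T h x)"
  using assms by (auto simp: G_system_def)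

text \<open>The process is the image of \<open>M\<close> under \<open>x \<mapsto> (retract (T h x))\<close>, indexed by \<open>h\<close>, and its zeroth coordinate gives the inverse.\<close>

theorem process_exists:
  fixes M :: "'a measure" and T :: "'g::{group_add,countable} \<Rightarrow> 'a \<Rightarrow> 'a"
  assumes sys: "G_system M T"
  shows "\<exists>X d \<mu>. metric_process X d \<mu> \<and> isomorphic_systems M T (\<mu> :: ('g \<Rightarrow> 'a) measure) shift"
proof -
  note S = G_systemD[OF sys]
  from S(2) obtain \<tau> where \<tau>: "completely_metrizable_space \<tau>" "second_countable \<tau>" "sets M = sets (borel_of \<tau>)"
    unfolding standard_borel_def by blast
  from \<tau>(1) obtain D d0 where D: "Metric_space D d0" "Metric_space.mcomplete D d0" "\<tau> = Metric_space.mtopology D d0"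
    unfolding completely_metrizable_space_def by blast
  interpret prob_space M by (rule S(1))
  interpret A: Metric_space D d0 by (rule D(1))
  interpret P: polish_prob D d0 M
    by unfold_locales (use \<tau> D in auto)
  obtain p where p: "p \<in> D" using not_empty P.space_M by blast
  have "D - {p} \<in> sets M"
    by (rule P.openin_sets) (use p in \<open>auto intro!: openin_diff simp: closedin_Hausdorff_sing_eq A.Hausdorff_space_mtopology openin_topspace[of A.mtopology, simplified]\<close>)
  then obtain C :: "nat \<Rightarrow> 'a set" where C: "\<And>n. compactin A.mtopology (C n)" "\<And>n. C n \<subseteq> D - {p}"
    "\<And>m n. m \<noteq> n \<Longrightarrow> C m \<inter> C n = {}" "prob (D - {p} - (\<Union>n. C n)) = 0"
    using P.disjoint_compacts by blast
  interpret Q: compact_pieces D d0 M p C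
    by unfold_locales (use p C in auto)
  let ?X = Q.alphabet and ?d = Q.glued_dist
  let ?B = "config_algebra UNIV ?X ?d :: ('g \<Rightarrow> 'a) measure"
  define \<phi> where "\<phi> x = (\<lambda>h. Q.retract (T h x))" for x
  define \<mu> where "\<mu> = distr M ?B \<phi>"
  have \<phi>B: "\<phi> \<in> measurable M ?B"
  proof -
    have "(\<lambda>x. \<lambda>h\<in>UNIV. Q.retract (T h x)) \<in> measurable M ?B"
      unfolding config_algebra_def
      by (intro measurable_restrict measurable_compose[OF S(3) Q.retract_measurable])
    then show ?thesis by (simp add: \<phi>_def[abs_def] restrict_def)
  qed
  have s\<mu>: "sets \<mu> = sets ?B" by (simp add: \<mu>_def)
  have \<phi>m: "\<phi> \<in> measurable M \<mu>" using \<phi>B measurable_cong_sets[OF refl s\<mu>] by blast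
  have \<mu>d: "distr M \<mu> \<phi> = \<mu>" unfolding \<mu>_def by (rule distr_cong) simp_all
  have Prob: "\<mu> \<in> Prob UNIV ?X ?d" unfolding Prob_def using prob_space_distr[OF \<phi>B] s\<mu> by (simp add: \<mu>_def)
  have \<phi>shift: "shift g (\<phi> x) = \<phi> (T g x)" if "x \<in> space M" for g x
    using S(6)[OF that] by (simp add: \<phi>_def shift_def)
  have inv: "distr \<mu> \<mu> (shift g) = \<mu>" for g
  proof -
    have "distr \<mu> \<mu> (shift g) = distr \<mu> ?B (shift g)" by (rule distr_cong) (simp_all add: s\<mu>)
    also have "\<dots> = distr M ?B (shift g \<circ> \<phi>)" unfolding \<mu>_def by (rule distr_distr[OF shift_measurable \<phi>B])
    also have "\<dots> = distr M ?B (\<phi> \<circ> T g)" by (rule distr_cong) (simp_all add: \<phi>shift)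
    also have "\<dots> = distr (distr M M (T g)) ?B \<phi>" by (rule distr_distr[OF \<phi>B S(3), symmetric])
    also have "\<dots> = \<mu>" by (simp add: S(4) \<mu>_def)
    finally show ?thesis .
  qed
  have mp: "metric_process ?X ?d \<mu>"
    using Q.glued_compact Prob inv by (simp add: metric_process_def compact_metric_def)
  define \<psi> where "\<psi> z = z 0" for z :: "'g \<Rightarrow> 'a"
  have \<psi>m: "\<psi> \<in> measurable \<mu> M"
  proof -
    have "(\<lambda>z. z 0) \<in> measurable ?B M"
      by (rule measurable_compose[OF measurable_config_coord Q.inclusion_measurable]) simp
    then show ?thesis unfolding \<psi>_def[abs_def] using measurable_cong_sets[OF s\<mu> refl] by blast
  qed
  have \<psi>\<phi>: "\<psi> (\<phi> x) = Q.retract x" if "x \<in> space M" for x using S(5)[OF that] by (simp add: \<psi>_def \<phi>_def)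
  have ae: "AE x in M. \<psi> (\<phi> x) = x"
    using Q.AE_retract by (rule AE_mp) (auto intro!: AE_I2 simp: \<psi>\<phi>)
  have \<psi>d: "distr \<mu> M \<psi> = M"
  proof -
    have "distr (distr M \<mu> \<phi>) M \<psi> = distr M M (\<psi> \<circ> \<phi>)" by (rule distr_distr[OF \<psi>m \<phi>m])
    also have "\<dots> = distr M M (\<lambda>x. x)"
      by (rule distr_cong_AE) (use ae measurable_comp[OF \<phi>m \<psi>m] in auto)
    finally show ?thesis by (simp add: \<mu>d)
  qed
  have ae\<phi>: "AE z in \<mu>. \<phi> (\<psi> z) = z"
  proof -
    have "AE z in \<mu>. \<forall>h. z h = Q.retract (T h (\<psi> z))"
    proof (rule AE_all_countable[THEN iffD2], rule allI)
      fix h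
      have sh: "shift h \<in> measurable \<mu> \<mu>" by (rule shift_measurable_Prob[OF Prob Q.glued_metric])
      let ?P = "\<lambda>z. z h = Q.retract (T h (\<psi> z))"
      have m1: "(\<lambda>z. z h) \<in> measurable \<mu> (borel_of Q.glued.mtopology)"
        using measurable_config_coord[of h UNIV ?X ?d] measurable_cong_sets[OF s\<mu> refl] by blast
      have m2: "(\<lambda>z. Q.retract (T h (\<psi> z))) \<in> measurable \<mu> (borel_of Q.glued.mtopology)"
        by (rule measurable_compose[OF measurable_compose[OF \<psi>m S(3)] Q.retract_measurable])
      have "AE x in M. ?P (\<phi> x)" using ae by (rule AE_mp) (auto intro!: AE_I2 simp: \<phi>_def)
      then have "AE z in distr M \<mu> \<phi>. ?P z"
        by (subst AE_distr_iff[OF \<phi>m equal_set_measurable[OF Q.glued_compact m1 m2]])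
      then show "AE z in \<mu>. ?P z" by (simp only: \<mu>d)
    qed
    then show ?thesis by (rule AE_mp) (auto intro!: AE_I2 simp: \<phi>_def)
  qed
  have equi: "AE x in M. \<phi> (T g x) = shift g (\<phi> x)" for g by (rule AE_I2) (simp add: \<phi>shift)
  have "isomorphic_systems M T \<mu> shift"
    unfolding isomorphic_systems_def using \<phi>m \<psi>m \<mu>d \<psi>d ae ae\<phi> equi by blast
  then show ?thesis using mp by blast
qed

section \<open>Additivity\<close>

lemma process_of_spec:
  fixes T :: "'g::{group_add,countable} \<Rightarrow> 'a \<Rightarrow> 'a"
  assumes ex: "\<exists>X d \<mu>. metric_process X d \<mu> \<and> isomorphic_systems M T (\<mu> :: ('g \<Rightarrow> 'a) measure) shift"
    and P: "process_of M T = (X, d, \<mu>)"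
  shows "metric_process X d \<mu>" "isomorphic_systems M T \<mu> shift"
proof -
  from ex have "\<exists>P. case P of (X, d, \<mu>) \<Rightarrow> metric_process X d \<mu> \<and> isomorphic_systems M T (\<mu> :: ('g \<Rightarrow> 'a) measure) shift"
    by auto
  from someI_ex[OF this] show "metric_process X d \<mu>" "isomorphic_systems M T \<mu> shift"
    using P unfolding process_of_def by auto
qed

text \<open>The lower bound holds for all reals below the two entropies. The cases of \<open>entropy_sum\<close> account for infinite values: with
one entropy \<open>\<infinity>\<close> and the other not \<open>-\<infinity>\<close>, these sums are unbounded.\<close>

theorem product_process_additive:
  fixes \<mu> :: "('g::{group_add,countable} \<Rightarrow> 'a) measure" and \<nu> :: "('g \<Rightarrow> 'b) measure"
  assumes sof: "sofic_approximation V \<sigma>" and mp: "metric_process X d \<mu>" "metric_process Y e \<nu>"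
    and dq: "process_dq_entropy V \<sigma> X d \<mu> = process_sofic_entropy V \<sigma> X d \<mu>"
    and low: "process_lower_sofic_entropy V \<sigma> Y e \<nu> = process_sofic_entropy V \<sigma> Y e \<nu>"
  shows "process_sofic_entropy V \<sigma> (X \<times> Y) (avg_dist d e) (product_process X d \<mu> Y e \<nu>)
    = entropy_sum (process_sofic_entropy V \<sigma> X d \<mu>) (process_sofic_entropy V \<sigma> Y e \<nu>)"
    (is "?h = entropy_sum ?a ?b")
proof (rule antisym)
  note X = metric_processD(1,2)[OF mp(1)] and Y = metric_processD(1,2)[OF mp(2)]
  show "?h \<le> entropy_sum ?a ?b" by (rule sofic_entropy_subadditive[OF sof X(1) Y(1) X(2) Y(2)])
  show "entropy_sum ?a ?b \<le> ?h"
  proof (cases "?a = -\<infinity> \<or> ?b = -\<infinity>")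
    case True
    then show ?thesis by (simp add: entropy_sum_def)
  next
    case False
    have le: "ereal (r + s) \<le> ?h" if "ereal r < ?a" "ereal s < ?b" for r s
      by (rule sofic_entropy_superadditive[OF sof X(1) Y(1) X(2) Y(2)]) (use that dq low in auto)
    have below: "\<exists>s. ereal s < c" if "c \<noteq> -\<infinity>" for c :: ereal
    proof (cases c)
      case (real x) then show ?thesis by (intro exI[of _ "x - 1"]) simp
    next
      case PInf then show ?thesis by (intro exI[of _ 0]) simp
    qed (use that in simp)
    obtain r0 s0 where r0: "ereal r0 < ?a" and s0: "ereal s0 < ?b" using below False by blast
    have "?a + ?b \<le> ?h"
    proof (cases "?a = \<infinity> \<or> ?b = \<infinity>")
      case True
      have "ereal B \<le> ?h" for B
      proof (cases "?a = \<infinity>")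
        case True then show ?thesis using le[of "B - s0" s0] s0 by simp
      next
        case False
        then have "?b = \<infinity>" using \<open>?a = \<infinity> \<or> ?b = \<infinity>\<close> by simp
        then show ?thesis using le[of r0 "B - r0"] r0 by simp
      qed
      then have "?h = \<infinity>" by (rule ereal_top)
      then show ?thesis by simp
    next
      case fin: False
      obtain a b where ab: "?a = ereal a" "?b = ereal b" using False fin by (cases ?a; cases ?b) auto
      have "ereal (a + b) \<le> ?h + ereal \<eta>" if \<eta>: "0 < \<eta>" for \<eta>
      proof -
        have "ereal ((a - \<eta>/2) + (b - \<eta>/2)) \<le> ?h" by (rule le) (use ab \<eta> in auto)
        then have "ereal ((a - \<eta>/2) + (b - \<eta>/2)) + ereal \<eta> \<le> ?h + ereal \<eta>" by (rule add_right_mono)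
        then show ?thesis by (simp add: algebra_simps)
      qed
      then have "ereal (a + b) \<le> ?h" by (rule ereal_le_epsilon2)
      then show ?thesis using ab by simp
    qed
    then show ?thesis using False by (simp add: entropy_sum_def)
  qed
qed

theorem mainTheorem3:
  fixes V :: "nat \<Rightarrow> 'v set"
    and \<sigma> :: "nat \<Rightarrow> 'g::{group_add,countable} \<Rightarrow> 'v \<Rightarrow> 'v"
    and M :: "'a measure" and T :: "'g \<Rightarrow> 'a \<Rightarrow> 'a"
    and N :: "'b measure" and S :: "'g \<Rightarrow> 'b \<Rightarrow> 'b"
  assumes "sofic_approximation V \<sigma>"
    and "G_system M T"
    and "G_system N S"
    and "(dq_entropy V \<sigma> M T = sofic_entropy V \<sigma> M T \<and>
          lower_sofic_entropy V \<sigma> N S = sofic_entropy V \<sigma> N S) \<or>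
         (dq_entropy V \<sigma> N S = sofic_entropy V \<sigma> N S \<and>
          lower_sofic_entropy V \<sigma> M T = sofic_entropy V \<sigma> M T)"
  shows "sofic_entropy V \<sigma> (M \<Otimes>\<^sub>M N) (product_action T S) =
         entropy_sum (sofic_entropy V \<sigma> M T) (sofic_entropy V \<sigma> N S)"
proof -
  note sof = assms(1) and MT = G_systemD[OF assms(2)] and NS = G_systemD[OF assms(3)]
  obtain X d \<mu> where PM: "process_of M T = (X, d, \<mu>)" by (cases "process_of M T")
  obtain Y e \<nu> where PN: "process_of N S = (Y, e, \<nu>)" by (cases "process_of N S")
  note X = process_of_spec[OF process_exists[OF assms(2)] PM]
  note Y = process_of_spec[OF process_exists[OF assms(3)] PN]
  let ?M = "M \<Otimes>\<^sub>M N" and ?T = "product_action T S"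
  have act: "?T g = (\<lambda>(x, y). (T g x, S g y))" for g by (auto simp: product_action_def)
  have T: "?T g \<in> measurable ?M ?M" "distr ?M ?M (?T g) = ?M" for g
    unfolding act using distr_map_prod[OF MT(1) NS(1) MT(3,4) NS(3,4)] by blast+
  have iXY: "isomorphic_systems ?M ?T (product_process X d \<mu> Y e \<nu>) shift"
    by (rule isomorphic_product[OF X(1) Y(1) MT(1) NS(1) X(2) Y(2)])
  have iYX: "isomorphic_systems ?M ?T (product_process Y e \<nu> X d \<mu>) shift"
    by (rule isomorphic_swap[OF MT(1) NS(1) isomorphic_product[OF Y(1) X(1) NS(1) MT(1) Y(2) X(2)]])
  obtain Z D \<zeta> where PZ: "process_of ?M ?T = (Z, D, \<zeta>)" by (cases "process_of ?M ?T")
  have "\<exists>Z D \<zeta>. metric_process Z D \<zeta> \<and> isomorphic_systems ?M ?T (\<zeta> :: ('g \<Rightarrow> 'a \<times> 'b) measure) shift"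
    using product_metric_process[OF X(1) Y(1)] iXY by blast
  note Z = process_of_spec[OF this PZ]
  have sX: "sofic_entropy V \<sigma> M T = process_sofic_entropy V \<sigma> X d \<mu>"
    "dq_entropy V \<sigma> M T = process_dq_entropy V \<sigma> X d \<mu>"
    "lower_sofic_entropy V \<sigma> M T = process_lower_sofic_entropy V \<sigma> X d \<mu>"
    by (simp_all add: sofic_entropy_def dq_entropy_def lower_sofic_entropy_def PM)
  have sY: "sofic_entropy V \<sigma> N S = process_sofic_entropy V \<sigma> Y e \<nu>"
    "dq_entropy V \<sigma> N S = process_dq_entropy V \<sigma> Y e \<nu>"
    "lower_sofic_entropy V \<sigma> N S = process_lower_sofic_entropy V \<sigma> Y e \<nu>"
    by (simp_all add: sofic_entropy_def dq_entropy_def lower_sofic_entropy_def PN)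
  have sZ: "sofic_entropy V \<sigma> ?M ?T = process_sofic_entropy V \<sigma> Z D \<zeta>"
    by (simp add: sofic_entropy_def PZ)
  show ?thesis
    using assms(4)
  proof
    assume h: "dq_entropy V \<sigma> M T = sofic_entropy V \<sigma> M T \<and> lower_sofic_entropy V \<sigma> N S = sofic_entropy V \<sigma> N S"
    have "process_sofic_entropy V \<sigma> Z D \<zeta> = process_sofic_entropy V \<sigma> (X \<times> Y) (avg_dist d e) (product_process X d \<mu> Y e \<nu>)"
      by (rule sofic_entropy_isomorphism_invariant[OF sof Z(1) product_metric_process[OF X(1) Y(1)] T Z(2) iXY])
    also have "\<dots> = entropy_sum (process_sofic_entropy V \<sigma> X d \<mu>) (process_sofic_entropy V \<sigma> Y e \<nu>)"
      by (rule product_process_additive[OF sof X(1) Y(1)]) (use h sX sY in simp_all)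
    finally show ?thesis using sX sY sZ by simp
  next
    assume h: "dq_entropy V \<sigma> N S = sofic_entropy V \<sigma> N S \<and> lower_sofic_entropy V \<sigma> M T = sofic_entropy V \<sigma> M T"
    have "process_sofic_entropy V \<sigma> Z D \<zeta> = process_sofic_entropy V \<sigma> (Y \<times> X) (avg_dist e d) (product_process Y e \<nu> X d \<mu>)"
      by (rule sofic_entropy_isomorphism_invariant[OF sof Z(1) product_metric_process[OF Y(1) X(1)] T Z(2) iYX])
    also have "\<dots> = entropy_sum (process_sofic_entropy V \<sigma> Y e \<nu>) (process_sofic_entropy V \<sigma> X d \<mu>)"
      by (rule product_process_additive[OF sof Y(1) X(1)]) (use h sX sY in simp_all)
    finally show ?thesis using sX sY sZ by (simp add: entropy_sum_def add.commute)
  qed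
qed

end
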